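(* Let $d \geq 2$ and let $\mu = (\mu^{ij}_{\alpha\beta})_{\alpha,\beta,i,j=1}^d$ be coefficients satisfying the ellipticity and boundedness assumption with constants $\mu_\bullet, \mu^\bullet > 0$ (see context). For all $\nu \in (0,2)$ there exists a constant $C > 0$, depending only on $\mu_\bullet$, $\mu^\bullet$, $d$, and $\nu$, such that for all $x_0 \in \mathbb{R}^d$, $r > 0$, $k_0 \in \mathbb{N}$ with $k_0 \geq 2$, $t > 0$, and $f \in L^2_\sigma(\mathbb{R}^d)$ with $\operatorname{supp}(f) \subset \overline{B(x_0, 2^{k_0} r)} \setminus B(x_0, 2^{k_0-1} r)$ it holds $$\| e^{-tA} f \|_{L^2(B(x_0,r))} + t \| A e^{-tA} f \|_{L^2(B(x_0,r))} \leq C \Big( 1 + \frac{2^{2k_0} r^2}{t} \Big)^{-\frac{\nu}{4}} \| f \|_{L^2(B(x_0, 2^{k_0} r)\setminus B(x_0, 2^{k_0-1} r))}.$$ Moreover, for all such $x_0, r, k_0, t$ and all $F \in L^2(\mathbb{R}^d; \mathbb{C}^{d\times d})$ with $\operatorname{supp}(F) \subset \overline{B(x_0, 2^{k_0} r)} \setminus B(x_0, 2^{k_0-1} r)$ it holds $$t^{\frac12} \| e^{-tA} \mathbb{P} \operatorname{div}(F) \|_{L^2(B(x_0,r))} \leq C \Big( 1 + \frac{2^{2k_0} r^2}{t} \Big)^{-\frac{\nu}{4}} \| F \|_{L^2(B(x_0, 2^{k_0} r)\setminus B(x_0, 2^{k_0-1} r))}.$$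
   Context: **Coefficient assumption.** $\mu^{ij}_{\alpha\beta} \in L^\infty(\mathbb{R}^d;\mathbb{C})$ for all $1 \le \alpha,\beta,i,j \le d$, and for constants $\mu_\bullet, \mu^\bullet > 0$ $$\operatorname{Re} \sum_{\alpha,\beta,i,j=1}^d \int_{\mathbb{R}^d} \mu^{ij}_{\alpha\beta} \, \partial_\beta u_j \, \overline{\partial_\alpha u_i} \, dx \geq \mu_\bullet \| \nabla u \|_{L^2}^2 \quad (u \in H^1(\mathbb{R}^d;\mathbb{C}^d)), \qquad \max_{i,j,\alpha,\beta} \| \mu^{ij}_{\alpha\beta} \|_{L^\infty} \leq \mu^\bullet.$$ **Spaces.** $L^2_\sigma(\mathbb{R}^d) = \{ f \in L^2(\mathbb{R}^d;\mathbb{C}^d) : \operatorname{div}(f) = 0 \}$ (in the sense of distributions) and $H^1_\sigma(\mathbb{R}^d) = \{ f \in H^1(\mathbb{R}^d;\mathbb{C}^d) : \operatorname{div}(f)=0\}$. $\mathbb{P}$ is the Helmholtz projection, i.e. the orthogonal projection of $L^2(\mathbb{R}^d;\mathbb{C}^d)$ onto $L^2_\sigma(\mathbb{R}^d)$. $B(x_0,r)$ is the ball with center $x_0$ and radius $r$. **The generalized Stokes operator.** Let $\mathfrak{a}(u,v) = \sum_{\alpha,\beta,i,j=1}^d \int_{\mathbb{R}^d} \mu^{ij}_{\alpha\beta}\, \partial_\beta u_j\, \overline{\partial_\alpha v_i} \, dx$ for $u,v \in H^1_\sigma(\mathbb{R}^d)$. The operator $A$ on $L^2_\sigma(\mathbb{R}^d)$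 has domain $\mathcal{D}(A)$ consisting of all $u \in H^1_\sigma(\mathbb{R}^d)$ for which there is $f \in L^2_\sigma(\mathbb{R}^d)$ with $\mathfrak{a}(u,v) = \int_{\mathbb{R}^d} f\cdot \overline{v}\, dx$ for all $v \in H^1_\sigma(\mathbb{R}^d)$; in this case $Au := f$. **Resolvent and semigroup.** For $\omega\in(0,\pi)$ let $S_\omega = \{ z \in \mathbb{C}\setminus\{0\} : |\arg z| < \omega\}$. By Lax–Milgram there is $\omega \in (\pi/2,\pi)$, depending only on $d,\mu_\bullet,\mu^\bullet$, such that for all $\lambda \in S_\omega$, $f \in L^2_\sigma(\mathbb{R}^d)$, $F \in L^2(\mathbb{R}^d;\mathbb{C}^{d\times d})$ there is a unique $u \in H^1_\sigma(\mathbb{R}^d)$ with $$\lambda \int_{\mathbb{R}^d} u\cdot\overline{v}\,dx + \mathfrak{a}(u,v) = \int_{\mathbb{R}^d} f\cdot\overline{v}\,dx - \sum_{\alpha,\beta=1}^d \int_{\mathbb{R}^d} F_{\alpha\beta}\,\overline{\partial_\alpha v_\beta}\,dx \quad (v \in H^1_\sigma(\mathbb{R}^d));$$ one writes $u = (\lambda+A)^{-1}(f + \mathbb{P}\operatorname{div}(F))$. The operator $-A$ generates a bounded analytic semigroup $(e^{-tA})_{t\ge 0}$ on $L^2_\sigma(\mathbb{R}^d)$, with $e^{-tA} = \frac{1}{2\pi i}\int_{\gamma_t} e^{t\lambda}(\lambda+A)^{-1}\,d\lambda$ for $t>0$, where $\gamma_t$ runs counterclockwise through $\partial(B(0,t^{-1})\cup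 S_\vartheta)$ for some $\vartheta\in(\pi/2,\omega)$. Correspondingly, $e^{-tA}\mathbb{P}\operatorname{div}(F) := \frac{1}{2\pi i}\int_{\gamma_t} e^{t\lambda}(\lambda+A)^{-1}\mathbb{P}\operatorname{div}(F)\,d\lambda$ for $t>0$.
   Formalization: The contour γ_t defining e^{-tA} and e^{-tA}P div is taken with its arc of radius 1/t through the positive real axis (rays at angles ±ϑ), since the boundary of B(0,1/t) ∪ S_ϑ as written passes through −1/t, where (λ+A)^{-1} need not exist. *)

theory Defs
  imports "HOL-Analysis.Analysis"
begin

section \<open>The Hilbert space of square-integrable functions\<close>

definition square_integrable :: "('a::euclidean_space \<Rightarrow> 'b::euclidean_space) \<Rightarrow> bool" where
  "square_integrable f \<longleftrightarrow>
     f \<in> borel_measurable lebesgue \<and> integrable lebesgue (\<lambda>x. (norm (f x))\<^sup>2)"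

lemma square_integrable_zero: "square_integrable (\<lambda>x. 0)"
  by (simp add: square_integrable_def)

lemma square_integrable_bound:
  assumes "square_integrable f" "g \<in> borel_measurable lebesgue" "\<And>x. norm (g x) \<le> c * norm (f x)"
  shows "square_integrable g"
  unfolding square_integrable_def
proof
  have "integrable lebesgue (\<lambda>x. c\<^sup>2 * (norm (f x))\<^sup>2)"
    using assms(1) by (simp add: square_integrable_def)
  then show "integrable lebesgue (\<lambda>x. (norm (g x))\<^sup>2)"
  proof (rule Bochner_Integration.integrable_bound)
    show "(\<lambda>x. (norm (g x))\<^sup>2) \<in> borel_measurable lebesgue"
      using assms(2) by measurable
    have "(norm (g x))\<^sup>2 \<le> c\<^sup>2 * (norm (f x))\<^sup>2" for x
      using power_mono[OF assms(3)[of x], of 2] by (simp add: power_mult_distrib)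
    then show "AE x in lebesgue. norm ((norm (g x))\<^sup>2) \<le> norm (c\<^sup>2 * (norm (f x))\<^sup>2)"
      by simp
  qed
qed (use assms(2) in simp)

lemma square_integrable_add:
  assumes "square_integrable f" "square_integrable g"
  shows "square_integrable (\<lambda>x. f x + g x)"
  unfolding square_integrable_def
proof
  have meas: "f \<in> borel_measurable lebesgue" "g \<in> borel_measurable lebesgue"
    using assms by (auto simp: square_integrable_def)
  then show m: "(\<lambda>x. f x + g x) \<in> borel_measurable lebesgue"
    by measurable
  have "integrable lebesgue (\<lambda>x. 2 * (norm (f x))\<^sup>2 + 2 * (norm (g x))\<^sup>2)"
    using assms by (simp add: square_integrable_def)
  then show "integrable lebesgue (\<lambda>x. (norm (f x + g x))\<^sup>2)"
  proof (rule Bochner_Integration.integrable_bound)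
    show "(\<lambda>x. (norm (f x + g x))\<^sup>2) \<in> borel_measurable lebesgue"
      using m by measurable
    have "(norm (f x + g x))\<^sup>2 \<le> 2 * (norm (f x))\<^sup>2 + 2 * (norm (g x))\<^sup>2" for x
    proof -
      have "(norm (f x + g x))\<^sup>2 \<le> (norm (f x) + norm (g x))\<^sup>2"
        by (intro power_mono norm_triangle_ineq) auto
      also have "\<dots> \<le> 2 * (norm (f x))\<^sup>2 + 2 * (norm (g x))\<^sup>2"
        using sum_squares_bound[of "norm (f x)" "norm (g x)"]
        by (simp add: power2_sum)
      finally show ?thesis .
    qed
    then show "AE x in lebesgue. norm ((norm (f x + g x))\<^sup>2)
        \<le> norm (2 * (norm (f x))\<^sup>2 + 2 * (norm (g x))\<^sup>2)"
      by simp
  qed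
qed

lemma square_integrable_scaleR:
  "square_integrable f \<Longrightarrow> square_integrable (\<lambda>x. c *\<^sub>R f x)"
  by (rule square_integrable_bound[where c = "\<bar>c\<bar>"]) (auto simp: square_integrable_def)

lemma square_integrable_uminus: "square_integrable f \<Longrightarrow> square_integrable (\<lambda>x. - f x)"
  using square_integrable_scaleR[of f "-1"] by simp

lemma square_integrable_inner:
  assumes "square_integrable f" "square_integrable g"
  shows "integrable lebesgue (\<lambda>x. f x \<bullet> g x)"
proof (rule Bochner_Integration.integrable_bound)
  show "integrable lebesgue (\<lambda>x. (norm (f x))\<^sup>2 + (norm (g x))\<^sup>2)"
    using assms by (simp add: square_integrable_def)
  have "f \<in> borel_measurable lebesgue" "g \<in> borel_measurable lebesgue"
    using assms by (auto simp: square_integrable_def)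
  then show "(\<lambda>x. f x \<bullet> g x) \<in> borel_measurable lebesgue"
    by measurable
  have "\<bar>f x \<bullet> g x\<bar> \<le> (norm (f x))\<^sup>2 + (norm (g x))\<^sup>2" for x
  proof -
    have "\<bar>f x \<bullet> g x\<bar> \<le> norm (f x) * norm (g x)"
      by (rule Cauchy_Schwarz_ineq2)
    also have "\<dots> \<le> (norm (f x))\<^sup>2 + (norm (g x))\<^sup>2"
    proof -
      have "0 \<le> norm (f x) * norm (g x)" by simp
      then show ?thesis
        using sum_squares_bound[of "norm (f x)" "norm (g x)"] by linarith
    qed
    finally show ?thesis .
  qed
  then show "AE x in lebesgue. norm (f x \<bullet> g x) \<le> norm ((norm (f x))\<^sup>2 + (norm (g x))\<^sup>2)"
    by simp
qed

lemma square_integrable_smult: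
  fixes f :: "'a::euclidean_space \<Rightarrow> complex ^ 'n"
  assumes "square_integrable f"
  shows "square_integrable (\<lambda>x. c *s f x)"
proof (rule square_integrable_bound[where c = "cmod c"])
  have eq: "norm (c *s v) = cmod c * norm v" for v :: "complex ^ 'n"
    by (simp add: norm_vec_def norm_mult L2_set_right_distrib)
  then show "\<And>x. norm (c *s f x) \<le> cmod c * norm (f x)" by simp
  have "linear ((*s) c :: complex ^ 'n \<Rightarrow> complex ^ 'n)"
    by (rule linearI) (simp_all add: vec_eq_iff algebra_simps)
  then have "(*s) c \<in> borel_measurable (borel :: (complex ^ 'n) measure)"
    by (intro borel_measurable_continuous_onI linear_continuous_on)
       (simp add: linear_conv_bounded_linear)
  then show "(\<lambda>x. c *s f x) \<in> borel_measurable lebesgue"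
    by (rule measurable_compose[rotated]) (use assms in \<open>simp add: square_integrable_def\<close>)
qed fact

definition L2_rel :: "('a::euclidean_space \<Rightarrow> 'b::euclidean_space) \<Rightarrow> ('a \<Rightarrow> 'b) \<Rightarrow> bool" where
  "L2_rel f g \<longleftrightarrow> square_integrable f \<and> square_integrable g \<and> (AE x in lebesgue. f x = g x)"

quotient_type (overloaded) ('a, 'b) L2 = "'a::euclidean_space \<Rightarrow> 'b::euclidean_space" / partial: L2_rel
  morphisms L2_fun L2_class
proof (rule part_equivpI)
  show "\<exists>f :: 'a \<Rightarrow> 'b. L2_rel f f"
    using square_integrable_zero by (auto simp: L2_rel_def)
  show "symp (L2_rel :: ('a \<Rightarrow> 'b) \<Rightarrow> _)"
    unfolding L2_rel_def symp_def by (simp add: eq_commute)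
  show "transp (L2_rel :: ('a \<Rightarrow> 'b) \<Rightarrow> _)"
  proof (rule transpI)
    fix f g h :: "'a \<Rightarrow> 'b"
    assume "L2_rel f g" "L2_rel g h"
    moreover from this have "AE x in lebesgue. f x = g x" "AE x in lebesgue. g x = h x"
      by (simp_all add: L2_rel_def)
    then have "AE x in lebesgue. f x = h x"
      by eventually_elim simp
    ultimately show "L2_rel f h"
      by (simp add: L2_rel_def)
  qed
qed

instantiation L2 :: (euclidean_space, euclidean_space) real_inner
begin

lift_definition zero_L2 :: "('a, 'b) L2" is "\<lambda>x. 0"
  by (simp add: L2_rel_def square_integrable_zero)

lift_definition plus_L2 :: "('a, 'b) L2 \<Rightarrow> ('a, 'b) L2 \<Rightarrow> ('a, 'b) L2" is "\<lambda>f g x. f x + g x"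
  unfolding L2_rel_def by (auto intro: square_integrable_add)

lift_definition uminus_L2 :: "('a, 'b) L2 \<Rightarrow> ('a, 'b) L2" is "\<lambda>f x. - f x"
  unfolding L2_rel_def by (auto intro: square_integrable_uminus)

lift_definition scaleR_L2 :: "real \<Rightarrow> ('a, 'b) L2 \<Rightarrow> ('a, 'b) L2" is "\<lambda>c f x. c *\<^sub>R f x"
  unfolding L2_rel_def by (auto intro: square_integrable_scaleR)

lift_definition inner_L2 :: "('a, 'b) L2 \<Rightarrow> ('a, 'b) L2 \<Rightarrow> real"
  is "\<lambda>f g. \<integral>x. f x \<bullet> g x \<partial>lebesgue"
proof -
  fix f f' g g' :: "'a \<Rightarrow> 'b"
  assume a: "L2_rel f f'" "L2_rel g g'"
  then have "AE x in lebesgue. f x \<bullet> g x = f' x \<bullet> g' x"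
    unfolding L2_rel_def by auto
  moreover have "(\<lambda>x. f x \<bullet> g x) \<in> borel_measurable lebesgue"
    "(\<lambda>x. f' x \<bullet> g' x) \<in> borel_measurable lebesgue"
    using a unfolding L2_rel_def
    by (blast intro: borel_measurable_integrable square_integrable_inner)+
  ultimately show "(\<integral>x. f x \<bullet> g x \<partial>lebesgue) = (\<integral>x. f' x \<bullet> g' x \<partial>lebesgue)"
    by (intro integral_cong_AE)
qed

definition minus_L2 :: "('a, 'b) L2 \<Rightarrow> ('a, 'b) L2 \<Rightarrow> ('a, 'b) L2" where
  "minus_L2 f g = f + - g"

definition norm_L2 :: "('a, 'b) L2 \<Rightarrow> real" where
  "norm_L2 f = sqrt (inner f f)"

definition sgn_L2 :: "('a, 'b) L2 \<Rightarrow> ('a, 'b) L2" where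
  "sgn_L2 f = inverse (norm f) *\<^sub>R f"

definition dist_L2 :: "('a, 'b) L2 \<Rightarrow> ('a, 'b) L2 \<Rightarrow> real" where
  "dist_L2 f g = norm (f - g)"

definition uniformity_L2 :: "(('a, 'b) L2 \<times> ('a, 'b) L2) filter" where
  "uniformity_L2 = (INF e\<in>{0<..}. principal {(f, g). dist f g < e})"

definition open_L2 :: "('a, 'b) L2 set \<Rightarrow> bool" where
  "open_L2 U \<longleftrightarrow> (\<forall>f\<in>U. eventually (\<lambda>(f', g). f' = f \<longrightarrow> g \<in> U) uniformity)"

instance
proof
  fix f g h :: "('a, 'b) L2" and a b :: real
  show "f + g + h = f + (g + h)"
    by transfer (simp add: L2_rel_def add.assoc square_integrable_add)
  show "f + g = g + f"
    by transfer (simp add: L2_rel_def add.commute square_integrable_add)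
  show "0 + f = f"
    by transfer (simp add: L2_rel_def)
  show "- f + f = 0"
    by transfer (simp add: L2_rel_def square_integrable_zero)
  show "f - g = f + - g"
    by (simp add: minus_L2_def)
  show "a *\<^sub>R (f + g) = a *\<^sub>R f + a *\<^sub>R g"
    by transfer (simp add: L2_rel_def scaleR_add_right square_integrable_add square_integrable_scaleR)
  show "(a + b) *\<^sub>R f = a *\<^sub>R f + b *\<^sub>R f"
    by transfer (simp add: L2_rel_def scaleR_add_left square_integrable_add square_integrable_scaleR)
  show "a *\<^sub>R b *\<^sub>R f = (a * b) *\<^sub>R f"
    by transfer (simp add: L2_rel_def square_integrable_scaleR)
  show "1 *\<^sub>R f = f"
    by transfer (simp add: L2_rel_def)
  show "sgn f = inverse (norm f) *\<^sub>R f" by (rule sgn_L2_def)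
  show "dist f g = norm (f - g)" by (rule dist_L2_def)
  show "(uniformity :: (('a, 'b) L2 \<times> ('a, 'b) L2) filter)
      = (INF e\<in>{0<..}. principal {(x, y). dist x y < e})"
    by (rule uniformity_L2_def)
  show "open U \<longleftrightarrow> (\<forall>x\<in>U. eventually (\<lambda>(x', y). x' = x \<longrightarrow> y \<in> U) uniformity)"
    for U :: "('a, 'b) L2 set"
    by (rule open_L2_def)
  show "inner f g = inner g f"
    by transfer (simp add: inner_commute)
  show "inner (f + g) h = inner f h + inner g h"
    by transfer (simp add: L2_rel_def inner_add_left square_integrable_inner)
  show "inner (a *\<^sub>R f) g = a * inner f g"
    by transfer simp
  show "0 \<le> inner f f"
    by transfer simp
  show "inner f f = 0 \<longleftrightarrow> f = 0"
  proof (transfer, goal_cases)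
    case (1 f)
    then have "integrable lebesgue (\<lambda>x. f x \<bullet> f x)"
      by (simp add: L2_rel_def square_integrable_inner)
    then have "(\<integral>x. f x \<bullet> f x \<partial>lebesgue) = 0 \<longleftrightarrow> (AE x in lebesgue. f x \<bullet> f x = 0)"
      by (rule integral_nonneg_eq_0_iff_AE) simp
    with 1 show ?case
      by (simp add: L2_rel_def square_integrable_zero)
  qed
  show "norm f = sqrt (inner f f)" by (rule norm_L2_def)
qed

end

text \<open>Multiplication by complex scalars; the type class above only provides real ones.\<close>

lift_definition L2_scaleC ::
  "complex \<Rightarrow> ('a::euclidean_space, complex ^ 'n) L2 \<Rightarrow> ('a, complex ^ 'n) L2" (infixr "*\<^sub>C" 75)
  is "\<lambda>c f x. c *s f x"
  unfolding L2_rel_def by (auto intro: square_integrable_smult)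

definition L2_norm_on :: "'a::euclidean_space set \<Rightarrow> ('a, 'b::euclidean_space) L2 \<Rightarrow> real" where
  "L2_norm_on S u = sqrt (set_lebesgue_integral lebesgue S (\<lambda>x. (norm (L2_fun u x))\<^sup>2))"

text \<open>The essential support, i.e. the complement of the largest open set on which the function
  vanishes almost everywhere.\<close>

definition L2_supp :: "('a::euclidean_space, 'b::euclidean_space) L2 \<Rightarrow> 'a set" where
  "L2_supp u = {x. \<forall>e>0. \<not> (AE y in lebesgue. y \<in> ball x e \<longrightarrow> L2_fun u y = 0)}"

type_synonym 'n vfield = "(real ^ 'n, complex ^ 'n) L2"
type_synonym 'n mfield = "(real ^ 'n, complex ^ 'n ^ 'n) L2"

section \<open>Test functions, weak derivatives, solenoidal fields\<close>

definition partial_deriv :: "'n::finite \<Rightarrow> (real ^ 'n \<Rightarrow> complex) \<Rightarrow> real ^ 'n \<Rightarrow> complex" where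
  "partial_deriv i \<phi> x = frechet_derivative \<phi> (at x) (axis i 1)"

fun C_k :: "nat \<Rightarrow> (real ^ 'n \<Rightarrow> complex) \<Rightarrow> bool" where
  "C_k 0 \<phi> \<longleftrightarrow> continuous_on UNIV \<phi>"
| "C_k (Suc k) \<phi> \<longleftrightarrow> (\<forall>x. \<phi> differentiable at x) \<and> (\<forall>i. C_k k (partial_deriv i \<phi>))"

definition test_function :: "(real ^ 'n \<Rightarrow> complex) \<Rightarrow> bool" where
  "test_function \<phi> \<longleftrightarrow> (\<forall>k. C_k k \<phi>) \<and> (\<exists>K. compact K \<and> (\<forall>x. x \<notin> K \<longrightarrow> \<phi> x = 0))"

definition has_weak_deriv :: "'n::finite \<Rightarrow> 'n vfield \<Rightarrow> 'n vfield \<Rightarrow> bool" where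
  "has_weak_deriv \<beta> u g \<longleftrightarrow>
     (\<forall>\<phi>. test_function \<phi> \<longrightarrow>
        (\<integral>x. partial_deriv \<beta> \<phi> x *s L2_fun u x \<partial>lebesgue)
          = - (\<integral>x. \<phi> x *s L2_fun g x \<partial>lebesgue))"

definition H1 :: "'n::finite vfield set" where
  "H1 = {u. \<forall>\<beta>. \<exists>g. has_weak_deriv \<beta> u g}"

definition weak_deriv :: "'n::finite \<Rightarrow> 'n vfield \<Rightarrow> 'n vfield" where
  "weak_deriv \<beta> u = (THE g. has_weak_deriv \<beta> u g)"

text \<open>The \<open>\<alpha>\<close>-th partial derivative of the \<open>i\<close>-th component.\<close>

abbreviation weak_grad :: "'n::finite \<Rightarrow> 'n \<Rightarrow> 'n vfield \<Rightarrow> real ^ 'n \<Rightarrow> complex" where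
  "weak_grad \<alpha> i u x \<equiv> L2_fun (weak_deriv \<alpha> u) x $ i"

definition div_free :: "'n::finite vfield \<Rightarrow> bool" where
  "div_free u \<longleftrightarrow>
     (\<forall>\<phi>. test_function \<phi> \<longrightarrow>
        (\<integral>x. (\<Sum>i\<in>UNIV. L2_fun u x $ i * partial_deriv i \<phi> x) \<partial>lebesgue) = 0)"

definition L2_sigma :: "'n::finite vfield set" where
  "L2_sigma = {u. div_free u}"

definition H1_sigma :: "'n::finite vfield set" where
  "H1_sigma = {u \<in> H1. div_free u}"

section \<open>The generalized Stokes operator\<close>

text \<open>\<open>\<mu> \<alpha> \<beta> i j\<close> stands for the coefficient with lower indices \<open>\<alpha>\<close>, \<open>\<beta>\<close> and upper
  indices \<open>i\<close>, \<open>j\<close>.\<close>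

type_synonym 'n coeffs = "'n \<Rightarrow> 'n \<Rightarrow> 'n \<Rightarrow> 'n \<Rightarrow> real ^ 'n \<Rightarrow> complex"

definition stokes_form :: "'n::finite coeffs \<Rightarrow> 'n vfield \<Rightarrow> 'n vfield \<Rightarrow> complex" where
  "stokes_form \<mu> u v =
     (\<Sum>\<alpha>\<in>UNIV. \<Sum>\<beta>\<in>UNIV. \<Sum>i\<in>UNIV. \<Sum>j\<in>UNIV.
        \<integral>x. \<mu> \<alpha> \<beta> i j x * weak_grad \<beta> j u x * cnj (weak_grad \<alpha> i v x) \<partial>lebesgue)"

definition admissible_coeffs :: "real \<Rightarrow> real \<Rightarrow> 'n::finite coeffs \<Rightarrow> bool" where
  "admissible_coeffs mlo mhi \<mu> \<longleftrightarrow>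
     (\<forall>\<alpha> \<beta> i j. \<mu> \<alpha> \<beta> i j \<in> borel_measurable lebesgue \<and>
        (AE x in lebesgue. cmod (\<mu> \<alpha> \<beta> i j x) \<le> mhi)) \<and>
     (\<forall>u\<in>H1. Re (stokes_form \<mu> u u) \<ge> mlo * (\<Sum>\<beta>\<in>UNIV. (norm (weak_deriv \<beta> u))\<^sup>2))"

definition L2_cinner :: "'n::finite vfield \<Rightarrow> 'n vfield \<Rightarrow> complex" where
  "L2_cinner u v = (\<integral>x. (\<Sum>i\<in>UNIV. L2_fun u x $ i * cnj (L2_fun v x $ i)) \<partial>lebesgue)"

definition stokes_rel :: "'n::finite coeffs \<Rightarrow> 'n vfield \<Rightarrow> 'n vfield \<Rightarrow> bool" where
  "stokes_rel \<mu> u f \<longleftrightarrow>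
     u \<in> H1_sigma \<and> f \<in> L2_sigma \<and> (\<forall>v\<in>H1_sigma. stokes_form \<mu> u v = L2_cinner f v)"

definition stokes_domain :: "'n::finite coeffs \<Rightarrow> 'n vfield set" where
  "stokes_domain \<mu> = {u. \<exists>f. stokes_rel \<mu> u f}"

text \<open>Unspecified unless \<open>u \<in> stokes_domain \<mu>\<close>.\<close>

definition stokes_op :: "'n::finite coeffs \<Rightarrow> 'n vfield \<Rightarrow> 'n vfield" where
  "stokes_op \<mu> u = (THE f. stokes_rel \<mu> u f)"

section \<open>Resolvent and semigroup\<close>

definition open_sector :: "real \<Rightarrow> complex set" where
  "open_sector \<omega> = {z. z \<noteq> 0 \<and> \<bar>Arg z\<bar> < \<omega>}"

definition resolvent_solution ::
  "'n::finite coeffs \<Rightarrow> complex \<Rightarrow> 'n vfield \<Rightarrow> 'n mfield \<Rightarrow> 'n vfield \<Rightarrow> bool" where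
  "resolvent_solution \<mu> l f F u \<longleftrightarrow>
     u \<in> H1_sigma \<and>
     (\<forall>v\<in>H1_sigma.
        l * L2_cinner u v + stokes_form \<mu> u v
          = L2_cinner f v
            - (\<Sum>\<alpha>\<in>UNIV. \<Sum>\<beta>\<in>UNIV.
                 \<integral>x. L2_fun F x $ \<alpha> $ \<beta> * cnj (weak_grad \<alpha> \<beta> v x) \<partial>lebesgue))"

text \<open>\<open>stokes_resolvent \<mu> l f F\<close> is \<open>(l + A)\<^sup>-\<^sup>1 (f + \<P> div F)\<close>.\<close>

definition stokes_resolvent ::
  "'n::finite coeffs \<Rightarrow> complex \<Rightarrow> 'n vfield \<Rightarrow> 'n mfield \<Rightarrow> 'n vfield" where
  "stokes_resolvent \<mu> l f F = (THE u. resolvent_solution \<mu> l f F u)"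

definition resolvent_sector :: "'n::finite coeffs \<Rightarrow> real \<Rightarrow> bool" where
  "resolvent_sector \<mu> \<omega> \<longleftrightarrow>
     (\<forall>l\<in>open_sector \<omega>. \<forall>f\<in>L2_sigma. \<forall>F. \<exists>!u. resolvent_solution \<mu> l f F u)"

text \<open>The integral of \<open>G\<close> along the contour which comes from infinity along the ray of angle
  \<open>-\<theta>\<close> up to the circle of radius \<open>1/t\<close>, follows this circle counterclockwise through \<open>1/t\<close> to
  angle \<open>\<theta>\<close>, and goes back to infinity along the ray of angle \<open>\<theta>\<close>. This is the positively
  oriented boundary of the union of the disc with the complement of the sector of half-angle
  \<open>\<theta>\<close>: it stays in the sector where the resolvent exists and winds counterclockwise around the
  spectrum of \<open>-A\<close>. The three terms are the outgoing ray, the arc and the incoming ray,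
  parametrized by arc length, angle and (reversed) arc length; the integrals are vector-valued
  gauge integrals in the Hilbert space of square-integrable fields, which for the continuous,
  absolutely integrable integrands used below coincide with Bochner integrals.\<close>

definition contour_integral_L2 :: "real \<Rightarrow> real \<Rightarrow> (complex \<Rightarrow> 'n::finite vfield) \<Rightarrow> 'n vfield" where
  "contour_integral_L2 \<theta> t G =
       integral {1 / t..} (\<lambda>s. cis \<theta> *\<^sub>C G (of_real s * cis \<theta>))
     + integral {- \<theta>..\<theta>} (\<lambda>\<phi>. (\<i> * cis \<phi> / of_real t) *\<^sub>C G (cis \<phi> / of_real t))
     - integral {1 / t..} (\<lambda>s. cis (- \<theta>) *\<^sub>C G (of_real s * cis (- \<theta>)))"

definition stokes_semigroup ::
  "'n::finite coeffs \<Rightarrow> real \<Rightarrow> real \<Rightarrow> 'n vfield \<Rightarrow> 'n vfield" where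
  "stokes_semigroup \<mu> \<theta> t f =
     (1 / (2 * of_real pi * \<i>)) *\<^sub>C
       contour_integral_L2 \<theta> t (\<lambda>l. exp (of_real t * l) *\<^sub>C stokes_resolvent \<mu> l f 0)"

text \<open>The operator \<open>exp (-t A) \<P> div\<close>.\<close>

definition stokes_semigroup_div ::
  "'n::finite coeffs \<Rightarrow> real \<Rightarrow> real \<Rightarrow> 'n mfield \<Rightarrow> 'n vfield" where
  "stokes_semigroup_div \<mu> \<theta> t F =
     (1 / (2 * of_real pi * \<i>)) *\<^sub>C
       contour_integral_L2 \<theta> t (\<lambda>l. exp (of_real t * l) *\<^sub>C stokes_resolvent \<mu> l 0 F)"

end

theory Submission
  imports Defs "HOL-Computational_Algebra.Polynomial"
begin

text \<open>
  For \<open>u = (\<lambda> + A)\<^sup>-\<^sup>1 (f + \<P> div F)\<close> with data supported away from a ball, the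
  equation is tested with the Helmholtz projection of \<open>\<eta>\<^sup>2 u\<close>, where \<open>\<eta>\<close> is a cutoff at the scale
  \<open>R = 2^k0 r\<close>. Since \<open>u\<close> is solenoidal, the discarded gradient part \<open>g\<close> satisfies
  \<open>\<parallel>\<nabla>g\<parallel> = \<parallel>div (\<eta>\<^sup>2 u)\<parallel> \<le> C/R \<parallel>\<eta> u\<parallel>\<close>, so that no information on the pressure beyond the global
  energy estimate is needed, and \<open>\<parallel>\<eta> u\<parallel>\<close> gains the factor \<open>(R \<bar>\<lambda>\<bar>^(1/2))^(-1)\<close>, which corresponds to
  \<open>\<nu> = 2\<close>. The Helmholtz projection commutes with translations, hence preserves \<open>H\<^sup>1\<close>; this also
  yields the density of \<open>H\<^sup>1\<^sub>\<sigma>\<close> in \<open>L\<^sup>2\<^sub>\<sigma>\<close>.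
  On the rays of the contour the integrals of \<open>exp (t\<lambda>) u\<^sub>\<lambda>\<close> are integrated by parts twice; the
  \<open>\<lambda>\<close>-derivatives of the resolvent are again resolvents and obey the same localised estimates, which
  makes the constants independent of the angle of the contour.
\<close>

text \<open>The fields form a real Hilbert space with an extra scaling \<open>*\<^sub>C\<close>.
  Complex identities are replaced by their real parts; testing also with
  \<open>\<i> *\<^sub>C v\<close> recovers the rest. For \<lambda> beyond the imaginary axis the
  real part of the equation tested with \<open>u\<close> is not coercive; tested with
  \<open>(1 \<plusminus> \<i> \<kappa>) u\<close> it is, if \<kappa> is so small that the form keeps
  half of its ellipticity. Weak derivatives are handled as L2 limits of difference quotients. This
  turns translation invariance into H1 regularity and exchanges mixed derivatives without smoothing.
  On the contour \<bar>\<lambda>\<bar> \<ge> 1/t, so the gain is at most \<open>sqrt t / R\<close>.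
  For \<open>R^2 < t\<close> it is useless and the plain energy estimate takes over; both cases
  share one argument with an abstract operator \<open>T\<close>. \<open>stokes_op\<close> is a
  definite description, so the value \<open>S\<close> of the semigroup must be placed in the domain.
  Integrating \<open>u = (1 + A)^(-1) (u + (f - \<lambda> u))\<close> along the contour gives
  \<open>S = (1 + A)^(-1) (S + g)\<close>, with \<open>g\<close> the integral of
  \<open>f - \<lambda> u\<close>; hence \<open>A S = g\<close>. No contour is deformed.\<close>

lemma norm_le_of_square_le:
  fixes a b :: real
  assumes "a * a \<le> b * a" "0 \<le> a" "0 \<le> b"
  shows "a \<le> b"
  using assms by (cases "a = 0") auto

lemma norm_diff_scaleR_square:
  fixes x y :: "'a::real_inner"
  shows "(norm (x - r *\<^sub>R y))\<^sup>2 = (norm x)\<^sup>2 - 2 * r * inner x y + r\<^sup>2 * (norm y)\<^sup>2"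
  unfolding power2_norm_eq_inner
  by (simp add: inner_diff_left inner_diff_right inner_commute power2_eq_square algebra_simps)

section \<open>Orthogonal projections and the Lax-Milgram lemma\<close>

lemma nearest_point_exists:
  fixes V :: "'a::{real_inner, complete_space} set"
  assumes V: "subspace V" "closed V"
  shows "\<exists>p\<in>V. \<forall>v\<in>V. norm (x - p) \<le> norm (x - v)"
proof -
  define d where "d = (INF v\<in>V. (norm (x - v))\<^sup>2)"
  have ne: "V \<noteq> {}" using V(1) subspace_0 by blast
  have bdd: "bdd_below ((\<lambda>v. (norm (x - v))\<^sup>2) ` V)"
    by (rule bdd_belowI[of _ 0]) auto
  have dle: "d \<le> (norm (x - v))\<^sup>2" if "v \<in> V" for v
    unfolding d_def by (rule cINF_lower[OF bdd that])
  have "\<exists>v\<in>V. (norm (x - v))\<^sup>2 < d + 1 / Suc n" for n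
    using cInf_lessD[of "(\<lambda>v. (norm (x - v))\<^sup>2) ` V" "d + 1 / Suc n"] ne
    by (auto simp: d_def)
  then obtain s where s: "\<And>n. s n \<in> V" "\<And>n. (norm (x - s n))\<^sup>2 < d + 1 / Suc n"
    by metis
  \<comment> \<open>Parallelogram law: the midpoint of two members of \<open>V\<close> lies in
    \<open>V\<close>, so its squared distance to \<open>x\<close> is at least
    \<open>d\<close>.\<close>
  have para: "(norm (s m - s n))\<^sup>2 \<le> 2 / Suc m + 2 / Suc n" for m n
  proof -
    have "(1/2) *\<^sub>R (s m + s n) \<in> V"
      using V(1) s(1) by (simp add: subspace_add subspace_scale)
    then have "d \<le> (norm (x - (1/2) *\<^sub>R (s m + s n)))\<^sup>2" by (rule dle)
    moreover have "(norm (s m - s n))\<^sup>2 + 4 * (norm (x - (1/2) *\<^sub>R (s m + s n)))\<^sup>2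
        = 2 * (norm (x - s m))\<^sup>2 + 2 * (norm (x - s n))\<^sup>2"
      by (simp add: power2_norm_eq_inner inner_diff_left inner_diff_right inner_add_left inner_add_right
          inner_commute algebra_simps)
    ultimately show ?thesis using s(2)[of m] s(2)[of n] by (smt (verit) add_divide_distrib)
  qed
  have "Cauchy s"
  proof (rule metric_CauchyI)
    fix e :: real assume e: "e > 0"
    obtain N :: nat where N: "4 / e\<^sup>2 < real N" using reals_Archimedean2 by blast
    have "dist (s m) (s n) < e" if "m \<ge> N" "n \<ge> N" for m n
    proof -
      have "real N > 0" using N e by (meson dual_order.strict_trans less_divide_eq_numeral1(1) divide_pos_pos zero_less_numeral zero_less_power)
      have "2 / Suc m \<le> 2 / real N" "2 / Suc n \<le> 2 / real N"
        using that \<open>real N > 0\<close> by (auto intro!: divide_left_mono)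
      then have "(norm (s m - s n))\<^sup>2 \<le> 4 / real N" using para[of m n] by simp
      also have "\<dots> < e\<^sup>2" using N e \<open>real N > 0\<close> by (simp add: field_simps)
      finally show ?thesis using e by (simp add: dist_norm power_less_imp_less_base)
    qed
    then show "\<exists>M. \<forall>m\<ge>M. \<forall>n\<ge>M. dist (s m) (s n) < e" by blast
  qed
  then obtain p where p: "s \<longlonglongrightarrow> p" using Cauchy_convergent convergent_def by blast
  then have "p \<in> V" using V(2) s(1) closed_sequentially by blast
  moreover have "(norm (x - p))\<^sup>2 \<le> d"
  proof (rule LIMSEQ_le)
    show "(\<lambda>n. (norm (x - s n))\<^sup>2) \<longlonglongrightarrow> (norm (x - p))\<^sup>2" by (intro tendsto_intros p)
    show "(\<lambda>n. d + 1 / Suc n) \<longlonglongrightarrow> d"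
      using tendsto_add[OF tendsto_const[of d] LIMSEQ_inverse_real_of_nat] by (simp add: inverse_eq_divide)
    show "\<exists>N. \<forall>n\<ge>N. (norm (x - s n))\<^sup>2 \<le> d + 1 / Suc n" using s(2) less_imp_le by blast
  qed
  ultimately show ?thesis using dle
    by (meson norm_ge_zero order_trans power2_le_imp_le)
qed

definition orth_proj :: "'a::real_inner set \<Rightarrow> 'a \<Rightarrow> 'a" where
  "orth_proj V x = (THE p. p \<in> V \<and> (\<forall>v\<in>V. inner (x - p) v = 0))"

lemma orth_proj_unique:
  assumes V: "subspace V" and p: "p \<in> V" "\<And>v. v \<in> V \<Longrightarrow> inner (x - p) v = 0"
  shows "orth_proj V x = p"
  unfolding orth_proj_def
proof (rule the_equality)
  show "p \<in> V \<and> (\<forall>v\<in>V. inner (x - p) v = 0)" using p by blast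
  fix q assume q: "q \<in> V \<and> (\<forall>v\<in>V. inner (x - q) v = 0)"
  then have "q - p \<in> V" using V p by (simp add: subspace_diff)
  then have "inner (x - p) (q - p) = 0" "inner (x - q) (q - p) = 0" using p q by auto
  then have "inner (q - p) (q - p) = 0" by (simp add: inner_diff_left)
  then show "q = p" by simp
qed

lemma orth_proj:
  fixes V :: "'a::{real_inner, complete_space} set"
  assumes V: "subspace V" "closed V"
  shows orth_proj_in: "orth_proj V x \<in> V"
    and orth_proj_orth: "\<And>v. v \<in> V \<Longrightarrow> inner (x - orth_proj V x) v = 0"
proof -
  obtain p where p: "p \<in> V" "\<And>v. v \<in> V \<Longrightarrow> norm (x - p) \<le> norm (x - v)"
    using nearest_point_exists[OF V] by blast
  have "inner (x - p) v = 0" if v: "v \<in> V" for v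
  proof (cases "v = 0")
    case False
    \<comment> \<open>The minimiser of the quadratic in \<open>s\<close>: moving by it lowers the
      squared distance by \<open>(inner (x - p) v)^2 / inner v v\<close>, which minimality of
      \<open>p\<close> forces to be zero.\<close>
    define s where "s = inner (x - p) v / inner v v"
    have "p + s *\<^sub>R v \<in> V" using V p v by (simp add: subspace_add subspace_scale)
    then have "(norm (x - p))\<^sup>2 \<le> (norm (x - p - s *\<^sub>R v))\<^sup>2"
      using p(2) by (metis diff_diff_eq norm_ge_zero power_mono)
    also have "\<dots> = (norm (x - p))\<^sup>2 - 2 * s * inner (x - p) v + s\<^sup>2 * inner v v"
      by (simp add: norm_diff_scaleR_square power2_norm_eq_inner[of v])
    also have "\<dots> = (norm (x - p))\<^sup>2 - (inner (x - p) v)\<^sup>2 / inner v v"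
      using False by (simp add: s_def power2_eq_square field_simps)
    finally have "(inner (x - p) v)\<^sup>2 / inner v v \<le> 0" by simp
    moreover have "inner v v > 0" using False by simp
    ultimately show ?thesis by (simp add: divide_le_0_iff)
  qed simp
  then have "orth_proj V x = p" using orth_proj_unique[OF V(1) p(1)] by blast
  with p show "orth_proj V x \<in> V" "\<And>v. v \<in> V \<Longrightarrow> inner (x - orth_proj V x) v = 0"
    using \<open>\<And>v. v \<in> V \<Longrightarrow> inner (x - p) v = 0\<close> by auto
qed

context
  fixes V :: "'a::{real_inner, complete_space} set"
  assumes V: "subspace V" "closed V"
begin

lemma orth_proj_inner: "v \<in> V \<Longrightarrow> inner (orth_proj V x) v = inner x v"
  using orth_proj_orth[OF V, of v x] by (simp add: inner_diff_left)

lemma orth_proj_id: "x \<in> V \<Longrightarrow> orth_proj V x = x"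
  by (rule orth_proj_unique) (use V in auto)

lemma orth_proj_linear: "linear (orth_proj V)"
proof (rule linearI)
  show "orth_proj V (x + y) = orth_proj V x + orth_proj V y" for x y
    by (rule orth_proj_unique[OF V(1)])
       (auto simp: V subspace_add orth_proj_in orth_proj_inner inner_diff_left inner_add_left)
  show "orth_proj V (c *\<^sub>R x) = c *\<^sub>R orth_proj V x" for c x
    by (rule orth_proj_unique[OF V(1)])
       (auto simp: V subspace_scale orth_proj_in orth_proj_inner inner_diff_left)
qed

lemma orth_proj_norm_le: "norm (orth_proj V x) \<le> norm x"
proof (rule norm_le_of_square_le)
  have "norm (orth_proj V x) * norm (orth_proj V x) = inner x (orth_proj V x)"
    by (metis orth_proj_in[OF V] orth_proj_inner power2_norm_eq_inner power2_eq_square)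
  also have "\<dots> \<le> norm x * norm (orth_proj V x)" by (rule norm_cauchy_schwarz)
  finally show "norm (orth_proj V x) * norm (orth_proj V x) \<le> norm x * norm (orth_proj V x)" .
qed auto

lemma orth_proj_bounded_linear: "bounded_linear (orth_proj V)"
  by (intro bounded_linear_intro[where K = 1])
     (auto simp: linear_add[OF orth_proj_linear] linear_scale[OF orth_proj_linear] orth_proj_norm_le)

text \<open>Applied to the closure of the span of the test fields, this turns a uniqueness statement
  into density.\<close>

lemma orth_complement_trivial_imp_all:
  assumes "\<And>x. (\<And>v. v \<in> V \<Longrightarrow> inner x v = 0) \<Longrightarrow> x = 0"
  shows "x \<in> V"
proof -
  have "x - orth_proj V x = 0"
    by (rule assms) (simp add: orth_proj_orth[OF V])
  then show ?thesis using orth_proj_in[OF V, of x] by simp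
qed

text \<open>The solution is the fixed point of \<open>x - r *\<^sub>R orth_proj V (T x - y)\<close>,
  a contraction of \<open>V\<close>. \<open>T\<close> acts on the ambient space but is coercive on
  \<open>V\<close> only: this is the situation of a graph inside a product space, to which the lemma
  is applied.\<close>

lemma lax_milgram:
  assumes T: "bounded_linear T" and c: "c > 0"
    and coer: "\<And>x. x \<in> V \<Longrightarrow> c * (norm x)\<^sup>2 \<le> inner (T x) x"
  shows "\<exists>!x. x \<in> V \<and> (\<forall>v\<in>V. inner (T x) v = inner y v)"
proof -
  interpret T: bounded_linear T by fact
  obtain M where M: "M > 0" "\<And>x. norm (T x) \<le> norm x * M" using T.pos_bounded by blast
  \<comment> \<open>Minimises the squared contraction factor
    \<open>1 - 2 * r * c + r^2 * M^2\<close>; the minimum is \<open>1 - c^2 / M^2\<close>.\<close>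
  define r where "r = c / M\<^sup>2"
  have r: "r > 0" using c M by (simp add: r_def)
  \<comment> \<open>\<open>M\<close> is just some bound of \<open>T\<close>. If \<open>V\<close> is
    trivial, \<open>c\<close> may exceed it, and the \<open>max 0\<close> keeps \<open>q\<close>
    nonnegative.\<close>
  define q where "q = sqrt (max 0 (1 - c\<^sup>2 / M\<^sup>2))"
  have q: "0 \<le> q" "q < 1" using c M by (auto simp: q_def max_def)
  define f where "f x = x - r *\<^sub>R orth_proj V (T x - y)" for x
  have fV: "f x \<in> V" if "x \<in> V" for x
    using that V orth_proj_in[OF V] by (simp add: f_def subspace_diff subspace_scale)
  have contr: "dist (f x) (f x') \<le> q * dist x x'" if "x \<in> V" "x' \<in> V" for x x'
  proof -
    define z where "z = x - x'"
    have z: "z \<in> V" using that V by (simp add: z_def subspace_diff)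
    have "f x - f x' = z - r *\<^sub>R (orth_proj V (T x - y) - orth_proj V (T x' - y))"
      by (simp add: f_def z_def algebra_simps)
    also have "orth_proj V (T x - y) - orth_proj V (T x' - y) = orth_proj V (T z)"
      by (simp add: linear_diff[OF orth_proj_linear, symmetric] z_def T.diff)
    finally have fz: "f x - f x' = z - r *\<^sub>R orth_proj V (T z)" .
    have nT: "(norm (orth_proj V (T z)))\<^sup>2 \<le> M\<^sup>2 * (norm z)\<^sup>2"
    proof -
      have "norm (orth_proj V (T z)) \<le> M * norm z"
        using orth_proj_norm_le[of "T z"] M(2)[of z] by (simp add: mult.commute)
      then show ?thesis by (metis norm_ge_zero power_mono power_mult_distrib)
    qed
    have "(norm (f x - f x'))\<^sup>2 = (norm z)\<^sup>2 - 2 * r * inner (T z) z + r\<^sup>2 * (norm (orth_proj V (T z)))\<^sup>2"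
      unfolding fz using orth_proj_inner[OF z, of "T z"]
      by (simp add: norm_diff_scaleR_square inner_commute)
    also have "\<dots> \<le> (norm z)\<^sup>2 - 2 * r * (c * (norm z)\<^sup>2) + r\<^sup>2 * (M\<^sup>2 * (norm z)\<^sup>2)"
      using coer[OF z] nT r by (intro add_mono diff_mono mult_left_mono) auto
    also have "\<dots> = (1 - c\<^sup>2 / M\<^sup>2) * (norm z)\<^sup>2"
      using M by (simp add: r_def field_simps power2_eq_square)
    also have "\<dots> \<le> (q * norm z)\<^sup>2"
      by (auto simp: q_def power_mult_distrib intro!: mult_right_mono)
    finally have "norm (f x - f x') \<le> q * norm z"
      by (rule power2_le_imp_le) (use q in simp)
    then show ?thesis by (simp only: dist_norm z_def)
  qed
  have "\<exists>!x\<in>V. f x = x"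
    by (rule Banach_fix) (use V q fV contr subspace_0[OF V(1)] in \<open>auto simp: complete_eq_closed\<close>)
  moreover have "f x = x \<longleftrightarrow> (\<forall>v\<in>V. inner (T x) v = inner y v)" for x
  proof
    assume "f x = x"
    then have "orth_proj V (T x - y) = 0" using r by (simp add: f_def)
    then show "\<forall>v\<in>V. inner (T x) v = inner y v"
      using orth_proj_inner[of _ "T x - y"] by (auto simp: inner_diff_left)
  next
    assume "\<forall>v\<in>V. inner (T x) v = inner y v"
    then have "orth_proj V (T x - y) = 0"
      by (intro orth_proj_unique[OF V(1) subspace_0[OF V(1)]]) (auto simp: inner_diff_left)
    then show "f x = x" by (simp add: f_def)
  qed
  ultimately show ?thesis by auto
qed

end

section \<open>The space of square-integrable functions\<close>

lemma square_integrable_L2_fun [simp, intro]: "square_integrable (L2_fun u)"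
  using Quotient_rep_reflp[OF Quotient_L2, of u] by (simp add: L2_rel_def)

lemma L2_class_L2_fun [simp]: "L2_class (L2_fun u) = u"
  using Quotient_abs_rep[OF Quotient_L2] .

lemma borel_measurable_L2_fun [measurable, simp]: "L2_fun u \<in> borel_measurable lebesgue"
  using square_integrable_L2_fun[of u] by (simp add: square_integrable_def)

lemma L2_class_eq_iff:
  assumes "square_integrable f" "square_integrable g"
  shows "L2_class f = L2_class g \<longleftrightarrow> (AE x in lebesgue. f x = g x)"
  using Quotient_rel[OF Quotient_L2, of f g] assms by (simp add: L2_rel_def)

lemma L2_fun_class:
  assumes "square_integrable f"
  shows "AE x in lebesgue. L2_fun (L2_class f) x = f x"
  using Quotient_rep_abs[OF Quotient_L2, of f] assms by (simp add: L2_rel_def)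

lemma L2_eqI: "AE x in lebesgue. L2_fun u x = L2_fun v x \<Longrightarrow> u = v"
  using L2_class_eq_iff[of "L2_fun u" "L2_fun v"] by simp

lemma L2_fun_add: "AE x in lebesgue. L2_fun (u + v) x = L2_fun u x + L2_fun v x"
proof -
  have "u + v = L2_class (\<lambda>x. L2_fun u x + L2_fun v x)"
    using plus_L2.abs_eq[of "L2_fun u" "L2_fun v"] by (simp add: L2_rel_def)
  then show ?thesis by (simp add: L2_fun_class square_integrable_add)
qed

lemma L2_fun_scaleR: "AE x in lebesgue. L2_fun (c *\<^sub>R u) x = c *\<^sub>R L2_fun u x"
proof -
  have "c *\<^sub>R u = L2_class (\<lambda>x. c *\<^sub>R L2_fun u x)"
    using scaleR_L2.abs_eq[of "L2_fun u" c] by (simp add: L2_rel_def)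
  then show ?thesis by (simp add: L2_fun_class square_integrable_scaleR)
qed

lemma L2_fun_scaleC: "AE x in lebesgue. L2_fun (c *\<^sub>C u) x = c *s L2_fun u x"
proof -
  have "c *\<^sub>C u = L2_class (\<lambda>x. c *s L2_fun u x)"
    using L2_scaleC.abs_eq[of "L2_fun u" c] by (simp add: L2_rel_def)
  then show ?thesis by (simp add: L2_fun_class square_integrable_smult)
qed

lemma L2_fun_zero: "AE x in lebesgue. L2_fun 0 x = 0"
  unfolding zero_L2_def by (rule L2_fun_class) (rule square_integrable_zero)

lemma L2_fun_uminus: "AE x in lebesgue. L2_fun (- u) x = - L2_fun u x"
  using L2_fun_scaleR[of "-1" u] by simp

lemma L2_fun_diff: "AE x in lebesgue. L2_fun (u - v) x = L2_fun u x - L2_fun v x"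
  using L2_fun_add[of u "- v"] L2_fun_uminus[of v] by eventually_elim simp

lemma inner_L2_eq: "inner u v = (\<integral>x. L2_fun u x \<bullet> L2_fun v x \<partial>lebesgue)"
  using inner_L2.abs_eq[of "L2_fun u" "L2_fun v"] by (simp add: L2_rel_def)

lemma integrable_norm_L2: "integrable lebesgue (\<lambda>x. (norm (L2_fun u x))\<^sup>2)"
  using square_integrable_L2_fun[of u] by (simp add: square_integrable_def)

lemma norm_L2_square: "(norm u)\<^sup>2 = (\<integral>x. (norm (L2_fun u x))\<^sup>2 \<partial>lebesgue)"
  by (simp add: power2_norm_eq_inner inner_L2_eq)

lemma inner_L2_class:
  assumes "square_integrable f"
  shows "inner u (L2_class f) = (\<integral>x. L2_fun u x \<bullet> f x \<partial>lebesgue)"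
  unfolding inner_L2_eq
proof (rule integral_cong_AE)
  have [measurable]: "f \<in> borel_measurable lebesgue" using assms by (simp add: square_integrable_def)
  show "(\<lambda>x. L2_fun u x \<bullet> L2_fun (L2_class f) x) \<in> borel_measurable lebesgue"
    "(\<lambda>x. L2_fun u x \<bullet> f x) \<in> borel_measurable lebesgue" by measurable
  show "AE x in lebesgue. L2_fun u x \<bullet> L2_fun (L2_class f) x = L2_fun u x \<bullet> f x"
    using L2_fun_class[OF assms] by eventually_elim simp
qed

lemma norm_L2_class:
  assumes "square_integrable f"
  shows "(norm (L2_class f))\<^sup>2 = (\<integral>x. (norm (f x))\<^sup>2 \<partial>lebesgue)"
  unfolding norm_L2_square
proof (rule integral_cong_AE)
  have [measurable]: "f \<in> borel_measurable lebesgue" using assms by (simp add: square_integrable_def)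
  show "(\<lambda>x. (norm (L2_fun (L2_class f) x))\<^sup>2) \<in> borel_measurable lebesgue"
    "(\<lambda>x. (norm (f x))\<^sup>2) \<in> borel_measurable lebesgue" by measurable
  show "AE x in lebesgue. (norm (L2_fun (L2_class f) x))\<^sup>2 = (norm (f x))\<^sup>2"
    using L2_fun_class[OF assms] by eventually_elim simp
qed

subsection \<open>Completeness\<close>

text \<open>Lebesgue measure is infinite, so square-integrable functions need not be integrable.
  Multiplied by such a weight they are, by Cauchy-Schwarz, and a strictly positive factor does not
  disturb pointwise convergence. This makes the subsequence theorem for L1 available.\<close>

lemma positive_square_integrable_weight:
  obtains w :: "'a::euclidean_space \<Rightarrow> real"
  where "square_integrable w" "\<And>x. w x > 0"
proof -
  obtain w :: "'a \<Rightarrow> real" where w: "w \<in> borel_measurable lborel" "\<And>x. w x > 0" "\<And>x. w x \<le> 1"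
    "integrable lborel w"
    using sigma_finite_measure.obtain_positive_integrable_function[OF sigma_finite_lborel] by blast
  have "integrable lebesgue w" using w integrable_completion by blast
  then have "integrable lebesgue (\<lambda>x. (norm (w x))\<^sup>2)"
  proof (rule Bochner_Integration.integrable_bound)
    show "(\<lambda>x. (norm (w x))\<^sup>2) \<in> borel_measurable lebesgue"
      using \<open>integrable lebesgue w\<close> by measurable
    have "(w x)\<^sup>2 \<le> w x" for x
      using w(2)[of x] w(3)[of x] by (simp add: power2_eq_square mult_le_cancel_left1)
    then show "AE x in lebesgue. norm ((norm (w x))\<^sup>2) \<le> norm (w x)"
      using w(2) by (simp add: less_imp_le)
  qed
  then have "square_integrable w"
    using \<open>integrable lebesgue w\<close> by (auto simp: square_integrable_def)
  with w(2) that show thesis by blast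
qed

lemma L2_Cauchy_AE_subseq:
  fixes s :: "nat \<Rightarrow> ('a::euclidean_space, 'b::euclidean_space) L2"
  assumes "Cauchy s"
  obtains r where "strict_mono r" "AE x in lebesgue. Cauchy (\<lambda>i. L2_fun (s (r i)) x)"
proof -
  obtain w :: "'a \<Rightarrow> real" where w: "square_integrable w" "\<And>x. w x > 0"
    using positive_square_integrable_weight by blast
  have wm [measurable]: "w \<in> borel_measurable lebesgue" using w(1) by (simp add: square_integrable_def)
  define W where "W = L2_class w"
  have si_norm: "square_integrable (\<lambda>x. norm (L2_fun u x))" for u :: "('a,'b) L2"
    using square_integrable_L2_fun[of u] by (auto simp: square_integrable_def)
  have int: "integrable lebesgue (\<lambda>x. w x * norm (L2_fun u x))" for u :: "('a,'b) L2"
    using square_integrable_inner[OF w(1) si_norm[of u]] by simp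
  have bound: "(\<integral>x. w x * norm (L2_fun u x) \<partial>lebesgue) \<le> norm W * norm u" for u :: "('a,'b) L2"
  proof -
    have "(\<integral>x. w x * norm (L2_fun u x) \<partial>lebesgue) = inner W (L2_class (\<lambda>x. norm (L2_fun u x)))"
      unfolding inner_L2_class[OF si_norm] W_def
      by (rule integral_cong_AE) (use L2_fun_class[OF w(1)] in auto)
    also have "\<dots> \<le> norm W * norm (L2_class (\<lambda>x. norm (L2_fun u x)))" by (rule norm_cauchy_schwarz)
    also have "(norm (L2_class (\<lambda>x. norm (L2_fun u x))))\<^sup>2 = (norm u)\<^sup>2"
      by (simp add: norm_L2_class[OF si_norm] norm_L2_square[of u])
    then have "norm (L2_class (\<lambda>x. norm (L2_fun u x))) = norm u"
      by (meson norm_ge_zero power2_eq_iff_nonneg)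
    finally show ?thesis .
  qed
  have "\<exists>r. strict_mono r \<and> (AE x in lebesgue. Cauchy (\<lambda>i. w x *\<^sub>R L2_fun (s (r i)) x))"
  proof (rule cauchy_L1_AE_cauchy_subseq[of lebesgue "\<lambda>n x. w x *\<^sub>R L2_fun (s n) x"])
    show "integrable lebesgue (\<lambda>x. w x *\<^sub>R L2_fun (s n) x)" for n
    proof (rule Bochner_Integration.integrable_bound[OF int[of "s n"]])
      show "AE x in lebesgue. norm (w x *\<^sub>R L2_fun (s n) x) \<le> norm (w x * norm (L2_fun (s n) x))"
        by (simp add: w(2) less_imp_le)
    qed measurable
    fix e :: real assume e: "e > 0"
    define d where "d = e / (norm W + 1)"
    have "d > 0" using e by (simp add: d_def add_nonneg_pos)
    then obtain N where N: "\<And>m n. m \<ge> N \<Longrightarrow> n \<ge> N \<Longrightarrow> norm (s m - s n) < d"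
      using assms unfolding Cauchy_iff by blast
    have "(LINT x|lebesgue. norm (w x *\<^sub>R L2_fun (s i) x - w x *\<^sub>R L2_fun (s j) x)) < e"
      if "i \<ge> N" "j \<ge> N" for i j
    proof -
      have "(LINT x|lebesgue. norm (w x *\<^sub>R L2_fun (s i) x - w x *\<^sub>R L2_fun (s j) x))
          = (\<integral>x. w x * norm (L2_fun (s i - s j) x) \<partial>lebesgue)"
      proof (rule integral_cong_AE)
        show "AE x in lebesgue. norm (w x *\<^sub>R L2_fun (s i) x - w x *\<^sub>R L2_fun (s j) x) = w x * norm (L2_fun (s i - s j) x)"
          using L2_fun_diff[of "s i" "s j"]
          by eventually_elim (simp add: scaleR_diff_right[symmetric] w(2) less_imp_le)
      qed measurable
      also have "\<dots> \<le> norm W * norm (s i - s j)" by (rule bound)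
      also have "\<dots> \<le> norm W * d" using N[OF that] by (intro mult_left_mono) auto
      also have "\<dots> < e" using e norm_ge_zero[of W] by (simp add: d_def pos_divide_less_eq add_nonneg_pos)
      finally show ?thesis .
    qed
    then show "\<exists>N. \<forall>i\<ge>N. \<forall>j\<ge>N. (LINT x|lebesgue. norm (w x *\<^sub>R L2_fun (s i) x - w x *\<^sub>R L2_fun (s j) x)) < e"
      by blast
  qed blast
  then obtain r where r: "strict_mono r" "AE x in lebesgue. Cauchy (\<lambda>i. w x *\<^sub>R L2_fun (s (r i)) x)"
    by blast
  have "AE x in lebesgue. Cauchy (\<lambda>i. L2_fun (s (r i)) x)"
    using r(2)
  proof eventually_elim
    case (elim x)
    then have "Cauchy (\<lambda>i. (1 / w x) *\<^sub>R (w x *\<^sub>R L2_fun (s (r i)) x))"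
      by (rule bounded_linear.Cauchy[OF bounded_linear_scaleR_right])
    moreover have "w x \<noteq> 0" using w(2)[of x] by simp
    ultimately show ?case by simp
  qed
  with r(1) that show thesis by blast
qed

text \<open>Fatou's lemma for the squared norms gives membership in L2 and the norm bound at once.
  Applied to the differences \<open>s (r i) - s m\<close> it upgrades almost everywhere convergence
  of a subsequence to norm convergence of the whole Cauchy sequence.\<close>

lemma L2_Fatou:
  fixes s :: "nat \<Rightarrow> ('a::euclidean_space, 'b::euclidean_space) L2"
  assumes U [measurable]: "U \<in> borel_measurable lebesgue"
    and lim: "AE x in lebesgue. (\<lambda>i. L2_fun (s i) x) \<longlonglongrightarrow> U x"
    and bound: "\<forall>\<^sub>F i in sequentially. norm (s i) \<le> e"
  shows "square_integrable U" "norm (L2_class U) \<le> e"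
proof -
  obtain i0 where "norm (s i0) \<le> e"
    using eventually_happens'[OF sequentially_bot bound] by blast
  then have e: "e \<ge> 0" using norm_ge_zero[of "s i0"] by linarith
  have eq: "(\<integral>\<^sup>+x. ennreal ((norm (L2_fun (s i) x))\<^sup>2) \<partial>lebesgue) = ennreal ((norm (s i))\<^sup>2)" for i
    unfolding norm_L2_square by (rule nn_integral_eq_integral[OF integrable_norm_L2]) simp
  have "(\<integral>\<^sup>+x. ennreal ((norm (U x))\<^sup>2) \<partial>lebesgue)
      = (\<integral>\<^sup>+x. liminf (\<lambda>i. ennreal ((norm (L2_fun (s i) x))\<^sup>2)) \<partial>lebesgue)"
  proof (rule nn_integral_cong_AE)
    show "AE x in lebesgue. ennreal ((norm (U x))\<^sup>2) = liminf (\<lambda>i. ennreal ((norm (L2_fun (s i) x))\<^sup>2))"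
      using lim
    proof eventually_elim
      case (elim x)
      have "(\<lambda>i. ennreal ((norm (L2_fun (s i) x))\<^sup>2)) \<longlonglongrightarrow> ennreal ((norm (U x))\<^sup>2)"
        by (intro tendsto_intros elim)
      then show ?case using lim_imp_Liminf[OF sequentially_bot] by metis
    qed
  qed
  also have "\<dots> \<le> liminf (\<lambda>i. \<integral>\<^sup>+x. ennreal ((norm (L2_fun (s i) x))\<^sup>2) \<partial>lebesgue)"
    by (rule nn_integral_liminf) measurable
  also have "\<dots> \<le> ennreal (e\<^sup>2)"
    unfolding eq
  proof (rule Liminf_le)
    show "\<forall>\<^sub>F i in sequentially. ennreal ((norm (s i))\<^sup>2) \<le> ennreal (e\<^sup>2)"
      using bound by eventually_elim (simp add: ennreal_leI power_mono)
  qed simp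
  finally have le: "(\<integral>\<^sup>+x. ennreal ((norm (U x))\<^sup>2) \<partial>lebesgue) \<le> ennreal (e\<^sup>2)" .
  have int: "integrable lebesgue (\<lambda>x. (norm (U x))\<^sup>2)"
    by (rule integrableI_nonneg) (use le in \<open>auto simp: le_less_trans[OF _ ennreal_less_top]\<close>)
  then show si: "square_integrable U" by (simp add: square_integrable_def)
  have "(norm (L2_class U))\<^sup>2 \<le> e\<^sup>2"
    unfolding norm_L2_class[OF si]
    using le nn_integral_eq_integral[OF int] e by (simp add: ennreal_le_iff)
  then show "norm (L2_class U) \<le> e" using e by (rule power2_le_imp_le)
qed

instance L2 :: (euclidean_space, euclidean_space) banach
proof
  fix s :: "nat \<Rightarrow> ('a, 'b) L2"
  assume C: "Cauchy s"
  obtain r where r: "strict_mono r" "AE x in lebesgue. Cauchy (\<lambda>i. L2_fun (s (r i)) x)"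
    using L2_Cauchy_AE_subseq[OF C] by blast
  define U where "U x = lim (\<lambda>i. L2_fun (s (r i)) x)" for x
  have [measurable]: "U \<in> borel_measurable lebesgue" unfolding U_def by measurable
  have lim: "AE x in lebesgue. (\<lambda>i. L2_fun (s (r i)) x) \<longlonglongrightarrow> U x"
    using r(2) by eventually_elim (simp add: U_def Cauchy_convergent_iff convergent_LIMSEQ_iff)
  have close: "square_integrable (\<lambda>x. U x - L2_fun (s m) x) \<and> norm (L2_class (\<lambda>x. U x - L2_fun (s m) x)) \<le> e"
    if N: "\<And>m n. m \<ge> N \<Longrightarrow> n \<ge> N \<Longrightarrow> norm (s m - s n) < e" and m: "m \<ge> N" for m N e
  proof -
    have l: "AE x in lebesgue. (\<lambda>i. L2_fun (s (r i) - s m) x) \<longlonglongrightarrow> U x - L2_fun (s m) x"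
    proof -
      have "AE x in lebesgue. \<forall>i. L2_fun (s (r i) - s m) x = L2_fun (s (r i)) x - L2_fun (s m) x"
        unfolding AE_all_countable using L2_fun_diff by blast
      with lim show ?thesis by eventually_elim (auto intro!: tendsto_intros)
    qed
    have b: "\<forall>\<^sub>F i in sequentially. norm (s (r i) - s m) \<le> e"
      using eventually_ge_at_top[of N]
    proof eventually_elim
      case (elim i)
      then have "r i \<ge> N" using seq_suble[OF r(1), of i] by simp
      then show ?case using N[of "r i" m] m by simp
    qed
    show ?thesis using L2_Fatou[OF _ l b] by simp
  qed
  obtain N where N: "\<And>m n. m \<ge> N \<Longrightarrow> n \<ge> N \<Longrightarrow> norm (s m - s n) < 1"
    using C unfolding Cauchy_iff by (meson zero_less_one)
  have "square_integrable (\<lambda>x. (U x - L2_fun (s N) x) + L2_fun (s N) x)"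
    using close[OF N order_refl] square_integrable_add by blast
  then have U: "square_integrable U" by simp
  have "s \<longlonglongrightarrow> L2_class U"
  proof (rule LIMSEQ_I)
    fix e :: real assume e: "e > 0"
    then obtain N where N: "\<And>m n. m \<ge> N \<Longrightarrow> n \<ge> N \<Longrightarrow> norm (s m - s n) < e / 2"
      using C unfolding Cauchy_iff by (meson half_gt_zero)
    have "norm (s m - L2_class U) < e" if "m \<ge> N" for m
    proof -
      have c: "square_integrable (\<lambda>x. U x - L2_fun (s m) x)" "norm (L2_class (\<lambda>x. U x - L2_fun (s m) x)) \<le> e / 2"
        using close[OF N that] by auto
      have "L2_class U - s m = L2_class (\<lambda>x. U x - L2_fun (s m) x)"
        by (rule L2_eqI)
          (use L2_fun_diff[of "L2_class U" "s m"] L2_fun_class[OF U] L2_fun_class[OF c(1)] in eventually_elim, simp)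
      then show ?thesis using c(2) e by (simp add: norm_minus_commute)
    qed
    then show "\<exists>no. \<forall>n\<ge>no. norm (s n - L2_class U) < e" by blast
  qed
  then show "convergent s" by (auto simp: convergent_def)
qed

subsection \<open>Complex scalars\<close>

text \<open>The inner product of \<open>complex ^ 'n\<close> is the real part of the Hermitian one,
  so the adjoint of a complex scalar is its conjugate.\<close>

lemma inner_smult_vec:
  fixes x y :: "complex ^ 'n"
  shows "inner (c *s x) y = inner x (cnj c *s y)"
  by (simp add: inner_vec_def inner_complex_def algebra_simps)

lemma norm_smult_vec:
  fixes x :: "complex ^ 'n"
  shows "norm (c *s x) = cmod c * norm x"
  by (simp add: norm_vec_def norm_mult L2_set_right_distrib)

lemma scaleR_smult_vec:
  fixes x :: "complex ^ 'n"
  shows "r *\<^sub>R x = of_real r *s x"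
  by (simp add: vec_eq_iff) (simp add: scaleR_conv_of_real)

lemma L2_scaleC_add_right: "c *\<^sub>C (u + v) = c *\<^sub>C u + c *\<^sub>C v"
  by (rule L2_eqI)
    (use L2_fun_scaleC[of c "u + v"] L2_fun_scaleC[of c u] L2_fun_scaleC[of c v]
      L2_fun_add[of u v] L2_fun_add[of "c *\<^sub>C u" "c *\<^sub>C v"]
     in \<open>eventually_elim, simp add: vec_eq_iff algebra_simps\<close>)

lemma L2_scaleC_add_left: "(c + d) *\<^sub>C u = c *\<^sub>C u + d *\<^sub>C u"
  by (rule L2_eqI)
    (use L2_fun_scaleC[of "c + d" "u"] L2_fun_scaleC[of c u] L2_fun_scaleC[of d u]
      L2_fun_add[of "c *\<^sub>C u" "d *\<^sub>C u"]
     in \<open>eventually_elim, simp add: vec_eq_iff algebra_simps\<close>)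

lemma L2_scaleC_scaleC [simp]: "c *\<^sub>C d *\<^sub>C u = (c * d) *\<^sub>C u"
  by (rule L2_eqI)
    (use L2_fun_scaleC[of "c * d" "u"] L2_fun_scaleC[of c "d *\<^sub>C u"] L2_fun_scaleC[of d u]
     in \<open>eventually_elim, simp add: vec_eq_iff algebra_simps\<close>)

lemma L2_scaleC_of_real: "of_real r *\<^sub>C u = r *\<^sub>R u"
  by (rule L2_eqI)
    (use L2_fun_scaleC[of "of_real r" "u"] L2_fun_scaleR[of r "u"]
     in \<open>eventually_elim, simp add: scaleR_smult_vec\<close>)

lemma L2_scaleC_one [simp]: "1 *\<^sub>C u = u"
  using L2_scaleC_of_real[of 1 u] by simp

lemma L2_scaleC_scaleR: "c *\<^sub>C (r *\<^sub>R u) = r *\<^sub>R (c *\<^sub>C u)"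
  by (simp add: L2_scaleC_of_real[symmetric] mult.commute)

lemma L2_scaleC_zero_left [simp]: "0 *\<^sub>C u = 0"
  using L2_scaleC_of_real[of 0 u] by simp

lemma L2_scaleC_minus_one [simp]: "(-1) *\<^sub>C u = - u"
  using L2_scaleC_of_real[of "-1" u] by simp

lemma inner_scaleC_left: "inner (c *\<^sub>C u) v = inner u (cnj c *\<^sub>C v)"
  unfolding inner_L2_eq
proof (rule integral_cong_AE)
  show "AE x in lebesgue. L2_fun (c *\<^sub>C u) x \<bullet> L2_fun v x = L2_fun u x \<bullet> L2_fun (cnj c *\<^sub>C v) x"
    using L2_fun_scaleC[of c u] L2_fun_scaleC[of "cnj c" v]
    by eventually_elim (simp add: inner_smult_vec)
qed measurable

lemma norm_scaleC [simp]: "norm (c *\<^sub>C u) = cmod c * norm u"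
proof -
  have "(norm (c *\<^sub>C u))\<^sup>2 = inner u ((cnj c * c) *\<^sub>C u)"
    by (simp add: power2_norm_eq_inner inner_scaleC_left)
  also have "cnj c * c = of_real ((cmod c)\<^sup>2)" by (metis complex_norm_square mult.commute)
  also have "inner u (of_real ((cmod c)\<^sup>2) *\<^sub>C u) = (cmod c * norm u)\<^sup>2"
    unfolding L2_scaleC_of_real by (simp add: power2_norm_eq_inner power_mult_distrib)
  finally show ?thesis by (meson norm_ge_zero power2_eq_iff_nonneg mult_nonneg_nonneg)
qed

lemma bounded_bilinear_scaleC: "bounded_bilinear ((*\<^sub>C) :: complex \<Rightarrow> ('a::euclidean_space, complex ^ 'n) L2 \<Rightarrow> _)"
proof
  show "\<exists>K. \<forall>a b. norm (a *\<^sub>C (b :: ('a, complex ^ 'n) L2)) \<le> norm a * norm b * K"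
    by (rule exI[of _ 1]) simp
qed (simp_all add: L2_scaleC_add_left L2_scaleC_add_right L2_scaleC_scaleR scaleR_conv_of_real mult.commute
    flip: L2_scaleC_of_real)

lemmas bounded_linear_scaleC = bounded_bilinear.bounded_linear_right[OF bounded_bilinear_scaleC]
lemmas L2_scaleC_diff_right = bounded_bilinear.diff_right[OF bounded_bilinear_scaleC]
lemmas L2_scaleC_diff_left = bounded_bilinear.diff_left[OF bounded_bilinear_scaleC]
lemmas L2_scaleC_minus_right = bounded_bilinear.minus_right[OF bounded_bilinear_scaleC]
lemmas L2_scaleC_minus_left = bounded_bilinear.minus_left[OF bounded_bilinear_scaleC]
lemmas L2_scaleC_zero_right [simp] = bounded_bilinear.zero_right[OF bounded_bilinear_scaleC]

section \<open>Test functions\<close>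

lemma partial_deriv_eq:
  "(\<phi> has_derivative D) (at x) \<Longrightarrow> partial_deriv i \<phi> x = D (axis i 1)"
  unfolding partial_deriv_def by (metis frechet_derivative_at)

lemma has_derivative_frechet: "\<phi> differentiable at x \<Longrightarrow> (\<phi> has_derivative frechet_derivative \<phi> (at x)) (at x)"
  by (simp add: frechet_derivative_works)

lemma partial_deriv_add:
  assumes "\<phi> differentiable at x" "\<psi> differentiable at x"
  shows "partial_deriv i (\<lambda>x. \<phi> x + \<psi> x) x = partial_deriv i \<phi> x + partial_deriv i \<psi> x"
  using partial_deriv_eq[OF has_derivative_add[OF has_derivative_frechet[OF assms(1)] has_derivative_frechet[OF assms(2)]], of i]
  by (simp only: partial_deriv_def)

lemma partial_deriv_mult:
  assumes "\<phi> differentiable at x" "\<psi> differentiable at x"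
  shows "partial_deriv i (\<lambda>x. \<phi> x * \<psi> x) x = \<phi> x * partial_deriv i \<psi> x + partial_deriv i \<phi> x * \<psi> x"
  using partial_deriv_eq[OF has_derivative_mult[OF has_derivative_frechet[OF assms(1)] has_derivative_frechet[OF assms(2)]], of i]
  by (simp only: partial_deriv_def)

lemma partial_deriv_cnj:
  assumes "\<phi> differentiable at x"
  shows "partial_deriv i (\<lambda>x. cnj (\<phi> x)) x = cnj (partial_deriv i \<phi> x)"
  using partial_deriv_eq[OF has_derivative_cnj[OF has_derivative_frechet[OF assms]], of i]
  by (simp only: partial_deriv_def)

lemma differentiable_cnj: "\<phi> differentiable at x \<Longrightarrow> (\<lambda>x. cnj (\<phi> x)) differentiable at x"
  unfolding differentiable_def using has_derivative_cnj by blast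

lemma C_k_continuous: "C_k k \<phi> \<Longrightarrow> continuous_on UNIV \<phi>"
  by (cases k) (auto simp: continuous_at_imp_continuous_on differentiable_imp_continuous_within)

lemma C_k_SucD: "C_k (Suc k) \<phi> \<Longrightarrow> C_k k \<phi>"
proof (induction k arbitrary: \<phi>)
  case 0
  from C_k_continuous[OF this] show ?case by simp
next
  case (Suc k)
  then have "\<forall>i. C_k (Suc k) (partial_deriv i \<phi>)" "\<forall>x. \<phi> differentiable at x"
    using Suc.prems by simp_all
  then show ?case using Suc.IH by simp
qed

lemma C_k_const: "C_k k (\<lambda>x. c)"
proof (induction k arbitrary: c)
  case (Suc k)
  have "partial_deriv i (\<lambda>x :: real ^ 'a. c) = (\<lambda>x. 0)" for i :: 'a
    by (rule ext) (simp add: partial_deriv_eq[OF has_derivative_const])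
  then show ?case using Suc by simp
qed simp

lemma C_k_add: "C_k k \<phi> \<Longrightarrow> C_k k \<psi> \<Longrightarrow> C_k k (\<lambda>x. \<phi> x + \<psi> x)"
proof (induction k arbitrary: \<phi> \<psi>)
  case (Suc k)
  then have "partial_deriv i (\<lambda>x. \<phi> x + \<psi> x) = (\<lambda>x. partial_deriv i \<phi> x + partial_deriv i \<psi> x)" for i
    by (auto intro!: ext partial_deriv_add)
  with Suc show ?case by simp
qed (simp add: continuous_on_add)

lemma C_k_mult: "C_k k \<phi> \<Longrightarrow> C_k k \<psi> \<Longrightarrow> C_k k (\<lambda>x. \<phi> x * \<psi> x)"
proof (induction k arbitrary: \<phi> \<psi>)
  case (Suc k)
  then have "partial_deriv i (\<lambda>x. \<phi> x * \<psi> x)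
      = (\<lambda>x. \<phi> x * partial_deriv i \<psi> x + partial_deriv i \<phi> x * \<psi> x)" for i
    by (auto intro!: ext partial_deriv_mult)
  with Suc show ?case by (simp add: C_k_add C_k_SucD)
qed (simp add: continuous_on_mult)

lemma C_k_cnj: "C_k k \<phi> \<Longrightarrow> C_k k (\<lambda>x. cnj (\<phi> x))"
proof (induction k arbitrary: \<phi>)
  case (Suc k)
  then have "partial_deriv i (\<lambda>x. cnj (\<phi> x)) = (\<lambda>x. cnj (partial_deriv i \<phi> x))" for i
    by (auto intro!: ext partial_deriv_cnj)
  with Suc show ?case by (simp add: differentiable_cnj)
qed (simp add: continuous_on_cnj)

lemma C_k_linear:
  assumes "bounded_linear l"
  shows "C_k k l"
proof (cases k)
  case 0
  then show ?thesis using linear_continuous_on[OF assms] by simp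
next
  case (Suc m)
  have "partial_deriv i l = (\<lambda>x. l (axis i 1))" for i
    by (rule ext) (rule partial_deriv_eq[OF bounded_linear_imp_has_derivative[OF assms]])
  then show ?thesis
    using Suc bounded_linear_imp_differentiable[OF assms] by (simp add: C_k_const)
qed

lemma C_k_coord: "C_k k (\<lambda>x. of_real (x $ i))"
  by (rule C_k_linear) (intro bounded_linear_compose[OF bounded_linear_of_real] bounded_linear_vec_nth)

lemma C_k_prod: "finite S \<Longrightarrow> (\<And>i. i \<in> S \<Longrightarrow> C_k k (f i)) \<Longrightarrow> C_k k (\<lambda>x. \<Prod>i\<in>S. f i x)"
  by (induction S rule: finite_induct) (auto intro: C_k_const C_k_mult)

lemma C_k_sum: "finite S \<Longrightarrow> (\<And>i. i \<in> S \<Longrightarrow> C_k k (f i)) \<Longrightarrow> C_k k (\<lambda>x. \<Sum>i\<in>S. f i x)"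
  by (induction S rule: finite_induct) (auto intro: C_k_const C_k_add)

lemma differentiable_of_real_iff:
  "(\<lambda>x. complex_of_real (q x)) differentiable at x \<longleftrightarrow> q differentiable at x"
proof
  assume "(\<lambda>x. complex_of_real (q x)) differentiable at x"
  then obtain D where "((\<lambda>x. complex_of_real (q x)) has_derivative D) (at x)"
    unfolding differentiable_def by blast
  from has_derivative_Re[OF this] show "q differentiable at x"
    unfolding differentiable_def by auto
next
  assume "q differentiable at x"
  then show "(\<lambda>x. complex_of_real (q x)) differentiable at x"
    unfolding differentiable_def using has_derivative_of_real by blast
qed

lemma real_chain_has_derivative:
  assumes D: "(h has_real_derivative h') (at (q x))" and q: "q differentiable at x"
  shows "((\<lambda>x. complex_of_real (h (q x))) has_derivative
      (\<lambda>v. of_real (h' * frechet_derivative q (at x) v))) (at x)"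
proof (rule has_derivative_of_real)
  have "(q has_derivative frechet_derivative q (at x)) (at x)" using q by (simp add: frechet_derivative_works)
  from has_derivative_compose[OF this D[unfolded has_field_derivative_def]]
  show "((\<lambda>x. h (q x)) has_derivative (\<lambda>v. h' * frechet_derivative q (at x) v)) (at x)" .
qed

lemma partial_deriv_of_real:
  assumes "q differentiable at x"
  shows "partial_deriv i (\<lambda>x. complex_of_real (q x)) x = of_real (frechet_derivative q (at x) (axis i 1))"
  by (rule partial_deriv_eq, rule has_derivative_of_real) (use assms in \<open>simp add: frechet_derivative_works\<close>)

text \<open>The whole tower \<open>D\<close> of derivatives is given and \<open>n\<close> stays
  arbitrary in the induction on \<open>k\<close>, so the plain chain and product rules suffice and
  no formula for higher derivatives of a composition is needed.\<close>

lemma C_k_compose: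
  assumes D: "\<And>n s. (D n has_real_derivative D (Suc n) s) (at s)"
    and q: "\<And>k. C_k k (\<lambda>x. complex_of_real (q x))"
  shows "C_k k (\<lambda>x. complex_of_real (D n (q x)))"
proof (induction k arbitrary: n)
  case 0
  have "continuous_on UNIV q" using C_k_continuous[OF q] continuous_on_Re by fastforce
  moreover have "continuous_on UNIV (D n)"
    using D DERIV_isCont by (blast intro: continuous_at_imp_continuous_on)
  ultimately show ?case
    by (simp add: continuous_on_of_real continuous_on_compose2)
next
  case (Suc k)
  have dq: "q differentiable at x" for x
    using q[of "Suc 0"] by (simp add: differentiable_of_real_iff)
  have der: "((\<lambda>x. complex_of_real (D n (q x))) has_derivative
      (\<lambda>v. of_real (D (Suc n) (q x) * frechet_derivative q (at x) v))) (at x)" for x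
    by (rule real_chain_has_derivative[OF D dq])
  have "partial_deriv i (\<lambda>x. complex_of_real (D n (q x)))
      = (\<lambda>x. of_real (D (Suc n) (q x)) * partial_deriv i (\<lambda>x. complex_of_real (q x)) x)" for i
    by (rule ext) (simp add: partial_deriv_eq[OF der] partial_deriv_of_real[OF dq])
  moreover have "C_k k (partial_deriv i (\<lambda>x. complex_of_real (q x)))" for i
    using q[of "Suc k"] by simp
  moreover have "\<forall>x. (\<lambda>x. complex_of_real (D n (q x))) differentiable at x"
    using der unfolding differentiable_def by blast
  ultimately show ?case using Suc by (simp add: C_k_mult)
qed

subsection \<open>The flat exponential\<close>

text \<open>The polynomial \<open>p\<close> in \<open>p (1/s) exp (-1/s)\<close>, the \<open>n\<close>-th derivative of \<open>exp (-1/s)\<close> for \<open>s > 0\<close>.\<close>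

fun flat_exp_poly :: "nat \<Rightarrow> real poly" where
  "flat_exp_poly 0 = 1"
| "flat_exp_poly (Suc n) = [:0, 0, 1:] * (flat_exp_poly n - pderiv (flat_exp_poly n))"

definition flat_exp_deriv :: "nat \<Rightarrow> real \<Rightarrow> real" where
  "flat_exp_deriv n s = (if s > 0 then poly (flat_exp_poly n) (1 / s) * exp (- (1 / s)) else 0)"

abbreviation flat_exp :: "real \<Rightarrow> real" where "flat_exp \<equiv> flat_exp_deriv 0"

lemma poly_times_exp_minus_tendsto_0:
  fixes p :: "real poly"
  shows "((\<lambda>y. poly p y * exp (- y)) \<longlongrightarrow> 0) at_top"
proof -
  have "((\<lambda>y. \<Sum>i\<le>degree p. coeff p i * (y ^ i / exp y)) \<longlongrightarrow> (\<Sum>i\<le>degree p. coeff p i * 0)) at_top"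
    by (intro tendsto_intros tendsto_power_div_exp_0)
  then show ?thesis
    by (simp add: poly_altdef exp_minus field_simps sum_distrib_left sum_divide_distrib sum_distrib_right)
qed

lemma flat_exp_has_derivative:
  "(flat_exp_deriv n has_real_derivative flat_exp_deriv (Suc n) s) (at s)"
proof -
  consider "s > 0" | "s < 0" | "s = 0" by linarith
  then show ?thesis
  proof cases
    case 1
    let ?p = "flat_exp_poly n"
    have "((\<lambda>s. poly ?p (1 / s) * exp (- (1 / s))) has_real_derivative
        (poly (pderiv ?p) (1 / s) * (- (1 / s\<^sup>2)) * exp (- (1 / s))
         + poly ?p (1 / s) * (exp (- (1 / s)) * (1 / s\<^sup>2)))) (at s)"
      using 1 by (auto intro!: derivative_eq_intros DERIV_chain2[OF poly_DERIV] simp: power2_eq_square field_simps)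
    moreover have "poly (pderiv ?p) (1 / s) * (- (1 / s\<^sup>2)) * exp (- (1 / s))
         + poly ?p (1 / s) * (exp (- (1 / s)) * (1 / s\<^sup>2)) = flat_exp_deriv (Suc n) s"
      using 1 by (simp add: flat_exp_deriv_def power2_eq_square algebra_simps diff_divide_distrib)
    ultimately have "((\<lambda>s. poly ?p (1 / s) * exp (- (1 / s))) has_real_derivative flat_exp_deriv (Suc n) s) (at s)"
      by simp
    then show ?thesis
      by (rule has_field_derivative_transform_within_open[of _ _ _ "{0<..}"])
         (use 1 in \<open>auto simp: flat_exp_deriv_def\<close>)
  next
    case 2
    have "((\<lambda>s. 0) has_real_derivative flat_exp_deriv (Suc n) s) (at s)"
      using 2 by (simp add: flat_exp_deriv_def)
    then show ?thesis
      by (rule has_field_derivative_transform_within_open[of _ _ _ "{..<0}"])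
         (use 2 in \<open>auto simp: flat_exp_deriv_def\<close>)
  next
    case 3
    \<comment> \<open>With \<open>y = 1 / h\<close>, dividing by \<open>h\<close> multiplies by
      \<open>y\<close>, which is what \<open>pCons 0\<close> does to the polynomial.\<close>
    have "((\<lambda>h. poly (pCons 0 (flat_exp_poly n)) (1 / h) * exp (- (1 / h))) \<longlongrightarrow> 0) (at_right 0)"
      using filterlim_compose[OF poly_times_exp_minus_tendsto_0[of "pCons 0 (flat_exp_poly n)"] filterlim_inverse_at_top_right]
      by (simp add: inverse_eq_divide)
    then have r: "((\<lambda>h. flat_exp_deriv n h / h) \<longlongrightarrow> 0) (at_right 0)"
    proof (rule Lim_transform_eventually)
      show "\<forall>\<^sub>F h in at_right 0. poly (pCons 0 (flat_exp_poly n)) (1 / h) * exp (- (1 / h)) = flat_exp_deriv n h / h"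
        by (rule eventually_at_rightI[of 0 1]) (auto simp: flat_exp_deriv_def)
    qed
    have l: "((\<lambda>h. flat_exp_deriv n h / h) \<longlongrightarrow> 0) (at_left 0)"
    proof (rule Lim_transform_eventually[OF tendsto_const])
      show "\<forall>\<^sub>F h in at_left 0. 0 = flat_exp_deriv n h / h"
        by (rule eventually_at_leftI[of "-1" 0]) (auto simp: flat_exp_deriv_def)
    qed
    have "((\<lambda>h. flat_exp_deriv n h / h) \<longlongrightarrow> 0) (at 0)"
      using l r by (simp add: filterlim_at_split)
    then show ?thesis
      unfolding DERIV_def 3 by (simp add: flat_exp_deriv_def)
  qed
qed

lemma flat_exp_pos_iff: "flat_exp s > 0 \<longleftrightarrow> s > 0"
  and flat_exp_nonneg: "flat_exp s \<ge> 0"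
  and flat_exp_le_1: "flat_exp s \<le> 1"
  and flat_exp_zero: "s \<le> 0 \<Longrightarrow> flat_exp s = 0"
  by (auto simp: flat_exp_deriv_def)

lemma flat_exp_mono: "s \<le> t \<Longrightarrow> flat_exp s \<le> flat_exp t"
proof (cases "s > 0")
  case True
  assume "s \<le> t"
  then have "1 / t \<le> 1 / s" using True by (intro divide_left_mono) auto
  then show ?thesis using True \<open>s \<le> t\<close> by (simp add: flat_exp_deriv_def)
qed (simp add: flat_exp_nonneg flat_exp_zero)

text \<open>For \<open>s > 0\<close> the derivative is \<open>y^2 * exp (- y)\<close> with
  \<open>y = 1 / s\<close>. The crude constant 2 is one of the two factors in the slope
  \<open>4 / \<sigma>\<close> of the cutoff function.\<close>

lemma flat_exp_deriv_bound: "\<bar>flat_exp_deriv (Suc 0) s\<bar> \<le> 2"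
proof (cases "s > 0")
  case True
  define y where "y = 1 / s"
  have y: "y > 0" using True by (simp add: y_def)
  then have "1 + y + y\<^sup>2 / 2 \<le> exp y" by (intro exp_lower_Taylor_quadratic) simp
  then have "y\<^sup>2 \<le> 2 * exp y" using y by linarith
  then have "y\<^sup>2 * exp (- y) \<le> 2" by (simp add: exp_minus field_simps)
  moreover have "flat_exp_deriv (Suc 0) s = y\<^sup>2 * exp (- y)"
    using True by (simp add: flat_exp_deriv_def y_def power2_eq_square)
  ultimately show ?thesis by simp
qed (simp add: flat_exp_deriv_def)

text \<open>If \<open>q\<close> is positive exactly on an open set and zero elsewhere,
  \<open>flat_exp (m * q x)\<close> tends to the indicator of that set; this supplies smooth
  approximations of box indicators.\<close>

lemma flat_exp_scaled_tendsto:
  assumes "s > 0"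
  shows "(\<lambda>m. flat_exp (real m * s)) \<longlonglongrightarrow> 1"
proof -
  have "(\<lambda>m. exp (- (1 / s * (1 / real m)))) \<longlonglongrightarrow> exp (- (1 / s * 0))"
    by (intro tendsto_intros lim_1_over_n)
  then have l: "(\<lambda>m. exp (- (1 / s * (1 / real m)))) \<longlonglongrightarrow> 1" by simp
  have "\<forall>\<^sub>F m in sequentially. exp (- (1 / s * (1 / real m))) = flat_exp (real m * s)"
    using eventually_gt_at_top[of 0]
    by eventually_elim (use assms in \<open>simp add: flat_exp_deriv_def field_simps\<close>)
  with l show ?thesis by (rule Lim_transform_eventually)
qed

lemma C_k_flat_exp:
  "(\<And>k. C_k k (\<lambda>x. complex_of_real (q x))) \<Longrightarrow> C_k k (\<lambda>x. complex_of_real (flat_exp (q x)))"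
  by (rule C_k_compose[where D = flat_exp_deriv, OF flat_exp_has_derivative])

subsection \<open>Algebra of test functions\<close>

lemma test_functionI:
  "(\<And>k. C_k k \<phi>) \<Longrightarrow> compact K \<Longrightarrow> (\<And>x. x \<notin> K \<Longrightarrow> \<phi> x = 0) \<Longrightarrow> test_function \<phi>"
  by (auto simp: test_function_def)

lemma test_function_C_k: "test_function \<phi> \<Longrightarrow> C_k k \<phi>"
  by (simp add: test_function_def)

lemma test_function_continuous: "test_function \<phi> \<Longrightarrow> continuous_on UNIV \<phi>"
  using test_function_C_k C_k_continuous by blast

lemma test_function_differentiable: "test_function \<phi> \<Longrightarrow> \<phi> differentiable at x"
  using test_function_C_k[of \<phi> "Suc 0"] by simp

lemma test_function_mult:
  assumes "\<And>k. C_k k \<phi>" "test_function \<psi>"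
  shows "test_function (\<lambda>x. \<phi> x * \<psi> x)"
  using assms C_k_mult unfolding test_function_def by (metis mult_zero_right)

lemma test_function_cnj: "test_function \<phi> \<Longrightarrow> test_function (\<lambda>x. cnj (\<phi> x))"
  using C_k_cnj unfolding test_function_def by (metis complex_cnj_zero)

lemma test_function_partial_deriv:
  assumes "test_function \<phi>"
  shows "test_function (partial_deriv i \<phi>)"
proof -
  obtain K where K: "compact K" "\<And>x. x \<notin> K \<Longrightarrow> \<phi> x = 0"
    using assms by (auto simp: test_function_def)
  have "partial_deriv i \<phi> x = 0" if "x \<notin> K" for x
  proof -
    have "(\<phi> has_derivative (\<lambda>h. 0)) (at x)"
    proof (rule has_derivative_transform_within_open[OF has_derivative_const])
      show "open (- K)" using K(1) compact_imp_closed by blast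
    qed (use that K in auto)
    then show ?thesis by (simp add: partial_deriv_eq)
  qed
  moreover have "C_k k (partial_deriv i \<phi>)" for k
    using test_function_C_k[OF assms, of "Suc k"] by simp
  ultimately show ?thesis using K(1) by (intro test_functionI)
qed

lemma test_function_bounded:
  assumes "test_function \<phi>"
  obtains B where "B > 0" "\<And>x. cmod (\<phi> x) \<le> B"
proof -
  obtain K where K: "compact K" "\<And>x. x \<notin> K \<Longrightarrow> \<phi> x = 0"
    using assms by (auto simp: test_function_def)
  have "compact (\<phi> ` K)"
    using K(1) test_function_continuous[OF assms] continuous_on_subset compact_continuous_image by blast
  then obtain B where "B > 0" "\<forall>y\<in>\<phi> ` K. norm y \<le> B"
    using compact_imp_bounded bounded_pos by blast
  then have "cmod (\<phi> x) \<le> B" for x using K(2)[of x] by (cases "x \<in> K") auto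
  with \<open>B > 0\<close> that show thesis by blast
qed

text \<open>The product \<open>q\<close> is smooth and positive exactly on the open box. The outer
  \<open>flat_exp\<close> with the factor \<open>r\<close> is there for the limit
  \<open>r \<longlonglongrightarrow> \<infinity>\<close>, in which these test functions approach the
  indicator of the box while staying below 1.\<close>

lemma test_function_box:
  fixes a b :: "real ^ 'n"
  defines "q \<equiv> \<lambda>x. \<Prod>i\<in>UNIV. flat_exp (x $ i - a $ i) * flat_exp (b $ i - x $ i)"
  shows "test_function (\<lambda>x. of_real (flat_exp (r * q x)))" "q x \<ge> 0" "q x > 0 \<longleftrightarrow> x \<in> box a b"
proof -
  have l1: "C_k k (\<lambda>x :: real ^ 'n. complex_of_real (x $ i - c))" for k i c
    using C_k_add[OF C_k_coord[of k i] C_k_const[of k "- of_real c"]] by simp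
  have l2: "C_k k (\<lambda>x :: real ^ 'n. complex_of_real (c - x $ i))" for k i c
    using C_k_add[OF C_k_const[of k "of_real c"] C_k_mult[OF C_k_const[of k "-1"] C_k_coord[of k i]]] by simp
  have Cq: "C_k k (\<lambda>x. complex_of_real (q x))" for k
    unfolding q_def of_real_prod of_real_mult
    by (intro C_k_prod C_k_mult C_k_flat_exp l1 l2 finite)
  have Crq: "C_k k (\<lambda>x. complex_of_real (r * q x))" for k
    unfolding of_real_mult by (intro C_k_mult C_k_const Cq)
  show nn: "q x \<ge> 0" for x unfolding q_def by (intro prod_nonneg mult_nonneg_nonneg ballI flat_exp_nonneg)
  show pos: "q x > 0 \<longleftrightarrow> x \<in> box a b" for x
  proof
    assume "q x > 0"
    then have "q x \<noteq> 0" by simp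
    then have "\<forall>i. flat_exp (x $ i - a $ i) \<noteq> 0 \<and> flat_exp (b $ i - x $ i) \<noteq> 0"
      by (simp add: q_def)
    then have "\<forall>i. flat_exp (x $ i - a $ i) > 0 \<and> flat_exp (b $ i - x $ i) > 0"
      using flat_exp_nonneg by (simp add: order.strict_iff_order)
    then show "x \<in> box a b" by (simp add: flat_exp_pos_iff mem_box_cart)
  next
    assume "x \<in> box a b"
    then show "q x > 0" unfolding q_def
      by (intro prod_pos) (simp add: flat_exp_pos_iff mem_box_cart)
  qed
  show "test_function (\<lambda>x. of_real (flat_exp (r * q x)))"
  proof (rule test_functionI[OF C_k_flat_exp[OF Crq] compact_cbox[of a b]])
    fix x assume "x \<notin> cbox a b"
    then have "q x = 0" using pos[of x] nn[of x] box_subset_cbox[of a b] by force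
    then show "complex_of_real (flat_exp (r * q x)) = 0" by (simp add: flat_exp_zero)
  qed
qed

section \<open>Operators on square-integrable functions\<close>

subsection \<open>Pointwise linear operators\<close>

text \<open>Linearity and the bound are asked almost everywhere because the coefficients are only
  essentially bounded. Measurability is phrased as preservation of measurable functions, so that no
  measurable structure on a space of linear maps is involved. Coefficients, cutoffs, component maps
  and matrix rows are all instances.\<close>

definition bounded_multiplier ::
  "real \<Rightarrow> ('a::euclidean_space \<Rightarrow> 'b::euclidean_space \<Rightarrow> 'c::euclidean_space) \<Rightarrow> bool" where
  "bounded_multiplier K A \<longleftrightarrow> 0 \<le> K \<and>
     (\<forall>f\<in>borel_measurable lebesgue. (\<lambda>x. A x (f x)) \<in> borel_measurable lebesgue) \<and>
     (AE x in lebesgue. linear (A x) \<and> (\<forall>v. norm (A x v) \<le> K * norm v))"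

definition L2_mult ::
  "('a::euclidean_space \<Rightarrow> 'b::euclidean_space \<Rightarrow> 'c::euclidean_space) \<Rightarrow> ('a, 'b) L2 \<Rightarrow> ('a, 'c) L2" where
  "L2_mult A u = L2_class (\<lambda>x. A x (L2_fun u x))"

lemma square_integrable_bound_AE:
  assumes f: "square_integrable f" and g [measurable]: "g \<in> borel_measurable lebesgue"
    and le: "AE x in lebesgue. norm (g x) \<le> K * norm (f x)"
  shows "square_integrable g"
proof -
  have "integrable lebesgue (\<lambda>x. K\<^sup>2 * (norm (f x))\<^sup>2)"
    using f by (simp add: square_integrable_def)
  then have "integrable lebesgue (\<lambda>x. (norm (g x))\<^sup>2)"
  proof (rule Bochner_Integration.integrable_bound)
    show "AE x in lebesgue. norm ((norm (g x))\<^sup>2) \<le> norm (K\<^sup>2 * (norm (f x))\<^sup>2)"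
      using le
    proof eventually_elim
      case (elim x)
      then have "(norm (g x))\<^sup>2 \<le> (K * norm (f x))\<^sup>2" by (intro power_mono) auto
      then show ?case by (simp add: power_mult_distrib)
    qed
  qed measurable
  then show ?thesis by (simp add: square_integrable_def)
qed

lemma norm_L2_le_AE:
  assumes "AE x in lebesgue. norm (L2_fun v x) \<le> K * norm (L2_fun u x)" "0 \<le> K"
  shows "norm v \<le> K * norm u"
proof -
  have "(norm v)\<^sup>2 \<le> (\<integral>x. K\<^sup>2 * (norm (L2_fun u x))\<^sup>2 \<partial>lebesgue)"
    unfolding norm_L2_square
  proof (rule integral_mono_AE)
    show "AE x in lebesgue. (norm (L2_fun v x))\<^sup>2 \<le> K\<^sup>2 * (norm (L2_fun u x))\<^sup>2"
      using assms(1)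
    proof eventually_elim
      case (elim x)
      then have "(norm (L2_fun v x))\<^sup>2 \<le> (K * norm (L2_fun u x))\<^sup>2" by (intro power_mono) auto
      then show ?case by (simp add: power_mult_distrib)
    qed
  qed (auto simp: integrable_norm_L2)
  also have "\<dots> = (K * norm u)\<^sup>2" by (simp add: norm_L2_square power_mult_distrib)
  finally show ?thesis
    by (rule power2_le_imp_le) (use assms(2) in simp)
qed

context
  fixes A :: "'a::euclidean_space \<Rightarrow> 'b::euclidean_space \<Rightarrow> 'c::euclidean_space" and K :: real
  assumes A: "bounded_multiplier K A"
begin

lemma square_integrable_mult: "square_integrable (\<lambda>x. A x (L2_fun u x))"
  by (rule square_integrable_bound_AE[OF square_integrable_L2_fun[of u], where K = K])
     (use A in \<open>auto simp: bounded_multiplier_def\<close>)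

lemma L2_fun_mult: "AE x in lebesgue. L2_fun (L2_mult A u) x = A x (L2_fun u x)"
  unfolding L2_mult_def by (rule L2_fun_class) (rule square_integrable_mult)

lemma norm_L2_mult_le: "norm (L2_mult A u) \<le> K * norm u"
proof (rule norm_L2_le_AE)
  have "AE x in lebesgue. linear (A x) \<and> (\<forall>v. norm (A x v) \<le> K * norm v)"
    using A by (simp add: bounded_multiplier_def)
  then show "AE x in lebesgue. norm (L2_fun (L2_mult A u) x) \<le> K * norm (L2_fun u x)"
    using L2_fun_mult[of u] by eventually_elim simp
qed (use A in \<open>simp add: bounded_multiplier_def\<close>)

lemma bounded_linear_L2_mult: "bounded_linear (L2_mult A)"
proof (rule bounded_linear_intro)
  have lin: "AE x in lebesgue. linear (A x)"
    using A by (auto simp: bounded_multiplier_def)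
  show "L2_mult A (u + v) = L2_mult A u + L2_mult A v" for u v
    by (rule L2_eqI)
      (use lin L2_fun_mult[of "u + v"] L2_fun_mult[of u] L2_fun_mult[of v] L2_fun_add[of u v]
        L2_fun_add[of "L2_mult A u" "L2_mult A v"]
       in \<open>eventually_elim, simp add: linear_add\<close>)
  show "L2_mult A (c *\<^sub>R u) = c *\<^sub>R L2_mult A u" for c u
    by (rule L2_eqI)
      (use lin L2_fun_mult[of "c *\<^sub>R u"] L2_fun_mult[of u] L2_fun_scaleR[of c u]
        L2_fun_scaleR[of c "L2_mult A u"]
       in \<open>eventually_elim, simp add: linear_scale\<close>)
  show "norm (L2_mult A u) \<le> norm u * K" for u
    using norm_L2_mult_le[of u] by (simp add: mult.commute)
qed

end

lemma bounded_multiplier_const: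
  fixes l :: "'b::euclidean_space \<Rightarrow> 'c::euclidean_space"
  assumes l: "linear l" and le: "\<And>v. norm (l v) \<le> K * norm v" and "K \<ge> 0"
  shows "bounded_multiplier K (\<lambda>x :: 'a::euclidean_space. l)"
proof -
  have "l \<in> borel_measurable borel"
    using l by (intro borel_measurable_continuous_onI linear_continuous_on) (simp add: linear_conv_bounded_linear)
  then have "(\<lambda>x. l (f x)) \<in> borel_measurable lebesgue" if "f \<in> borel_measurable lebesgue" for f :: "'a \<Rightarrow> 'b"
    using that by (rule measurable_compose[rotated])
  then show ?thesis using assms by (simp add: bounded_multiplier_def)
qed

lemma borel_measurable_smult_vec [measurable]:
  fixes f :: "'a \<Rightarrow> complex ^ 'n"
  assumes m: "m \<in> borel_measurable M" and f: "f \<in> borel_measurable M"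
  shows "(\<lambda>x. m x *s f x) \<in> borel_measurable M"
proof (rule borel_measurable_continuous_Pair[OF m f])
  show "continuous_on UNIV (\<lambda>x. fst x *s snd x :: complex ^ 'n)"
    unfolding vector_scalar_mult_def by (intro continuous_intros)
qed

lemma linear_smult_vec: "linear ((*s) c :: complex ^ 'n \<Rightarrow> complex ^ 'n)"
  by (rule linearI) (simp_all add: vec_eq_iff algebra_simps)

definition L2_smult :: "('a::euclidean_space \<Rightarrow> complex) \<Rightarrow> ('a, complex ^ 'n) L2 \<Rightarrow> ('a, complex ^ 'n) L2" where
  "L2_smult m = L2_mult (\<lambda>x. (*s) (m x))"

lemma bounded_multiplier_smult:
  assumes "m \<in> borel_measurable lebesgue" "AE x in lebesgue. cmod (m x) \<le> K" "K \<ge> 0"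
  shows "bounded_multiplier K (\<lambda>x. (*s) (m x) :: complex ^ 'n \<Rightarrow> _)"
proof -
  have "AE x in lebesgue. linear ((*s) (m x) :: complex ^ 'n \<Rightarrow> complex ^ 'n)
      \<and> (\<forall>v :: complex ^ 'n. norm (m x *s v) \<le> K * norm v)"
    using assms(2)
    by eventually_elim (auto simp: linear_smult_vec norm_smult_vec intro: mult_right_mono)
  then show ?thesis using assms(1,3) by (simp add: bounded_multiplier_def borel_measurable_smult_vec)
qed

context
  fixes m :: "'a::euclidean_space \<Rightarrow> complex" and K :: real
  assumes m: "m \<in> borel_measurable lebesgue" "AE x in lebesgue. cmod (m x) \<le> K" "K \<ge> 0"
begin

lemma L2_fun_smult: "AE x in lebesgue. L2_fun (L2_smult m u) x = m x *s L2_fun u x"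
  unfolding L2_smult_def by (rule L2_fun_mult[OF bounded_multiplier_smult[OF m]])

lemma bounded_linear_L2_smult: "bounded_linear (L2_smult m :: ('a, complex ^ 'n) L2 \<Rightarrow> _)"
  unfolding L2_smult_def by (rule bounded_linear_L2_mult[OF bounded_multiplier_smult[OF m]])

lemma norm_L2_smult_le: "norm (L2_smult m u) \<le> K * norm u"
  unfolding L2_smult_def by (rule norm_L2_mult_le[OF bounded_multiplier_smult[OF m]])

lemma L2_smult_scaleC: "L2_smult m (c *\<^sub>C u) = c *\<^sub>C L2_smult m u"
  by (rule L2_eqI)
    (use L2_fun_smult[of "c *\<^sub>C u"] L2_fun_smult[of u] L2_fun_scaleC[of c u]
      L2_fun_scaleC[of c "L2_smult m u"]
     in \<open>eventually_elim, simp add: vec_eq_iff mult_ac\<close>)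

end

text \<open>A matrix unit: component \<open>j\<close> is moved to slot \<open>i\<close>, all other
  slots are zero. Scalar components thus remain vector fields, the only objects for which weak
  derivatives are defined.\<close>

definition L2_comp :: "'m::finite \<Rightarrow> 'n::finite \<Rightarrow> ('a::euclidean_space, complex ^ 'n) L2 \<Rightarrow> ('a, complex ^ 'm) L2" where
  "L2_comp i j = L2_mult (\<lambda>x v. axis i (v $ j))"

lemma norm_axis_vec: "norm (axis i z :: complex ^ 'n) = norm z"
  by (simp add: norm_eq_sqrt_inner inner_axis_axis)

lemma bounded_multiplier_comp:
  "bounded_multiplier 1 (\<lambda>x v. axis i (v $ j) :: complex ^ 'm)"
proof (rule bounded_multiplier_const)
  show "linear (\<lambda>v. axis i (v $ j) :: complex ^ 'm)"
    by (rule linearI) (simp_all add: vec_eq_iff axis_def)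
qed (simp_all add: norm_axis_vec component_le_norm_cart Finite_Cartesian_Product.norm_nth_le)

lemmas L2_fun_comp = L2_fun_mult[OF bounded_multiplier_comp, folded L2_comp_def]
lemmas bounded_linear_L2_comp = bounded_linear_L2_mult[OF bounded_multiplier_comp, folded L2_comp_def]
lemmas norm_L2_comp_le = norm_L2_mult_le[OF bounded_multiplier_comp, folded L2_comp_def, simplified]

lemma L2_comp_scaleC: "L2_comp i j (c *\<^sub>C u) = c *\<^sub>C L2_comp i j u"
  by (rule L2_eqI)
    (use L2_fun_comp[of i j "c *\<^sub>C u"] L2_fun_comp[of i j u] L2_fun_scaleC[of c u]
      L2_fun_scaleC[of c "L2_comp i j u"]
     in \<open>eventually_elim, simp add: vec_eq_iff axis_def\<close>)

lemma square_integrable_norm_L2: "square_integrable (\<lambda>x. norm (L2_fun w x))"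
  using square_integrable_L2_fun[of w] by (auto simp: square_integrable_def)

lemma integrable_norm_norm_L2:
  "integrable lebesgue (\<lambda>x. norm (L2_fun u x) * norm (L2_fun v x))"
  using square_integrable_inner[OF square_integrable_norm_L2[of u] square_integrable_norm_L2[of v]]
  by simp

lemma integrable_L2_product:
  fixes h :: "'a::euclidean_space \<Rightarrow> 'b::{banach, second_countable_topology}"
  assumes "h \<in> borel_measurable lebesgue"
    and "AE x in lebesgue. norm (h x) \<le> K * (norm (L2_fun u x) * norm (L2_fun v x))"
  shows "integrable lebesgue h"
proof (rule Bochner_Integration.integrable_bound[OF _ assms(1)])
  show "integrable lebesgue (\<lambda>x. K * (norm (L2_fun u x) * norm (L2_fun v x)))"
    using integrable_norm_norm_L2[of u v] by simp
  show "AE x in lebesgue. norm (h x) \<le> norm (K * (norm (L2_fun u x) * norm (L2_fun v x)))"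
    using assms(2) by eventually_elim simp
qed

lemma borel_measurable_vec_nth [measurable (raw)]:
  fixes f :: "'a \<Rightarrow> 'b::euclidean_space ^ 'n"
  assumes "f \<in> borel_measurable M"
  shows "(\<lambda>x. f x $ i) \<in> borel_measurable M"
proof -
  have "(\<lambda>v :: 'b ^ 'n. v $ i) \<in> borel_measurable borel"
    by (intro borel_measurable_continuous_onI continuous_intros)
  then show ?thesis using assms by (rule measurable_compose[rotated])
qed

lemma inner_L2_comp_comp:
  "inner (L2_comp i j u) (L2_comp i k v) = (\<integral>x. inner (L2_fun u x $ j) (L2_fun v x $ k) \<partial>lebesgue)"
  unfolding inner_L2_eq
proof (rule integral_cong_AE)
  show "AE x in lebesgue. inner (L2_fun (L2_comp i j u) x) (L2_fun (L2_comp i k v) x)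
      = inner (L2_fun u x $ j) (L2_fun v x $ k)"
    using L2_fun_comp[of i j u] L2_fun_comp[of i k v]
    by eventually_elim (simp add: inner_axis_axis)
qed measurable

lemma integrable_L2_components_cnj:
  fixes u :: "('a::euclidean_space, complex ^ 'n) L2" and v :: "('a, complex ^ 'm) L2"
  shows "integrable lebesgue (\<lambda>x. L2_fun u x $ j * cnj (L2_fun v x $ k))"
proof (rule integrable_L2_product[where K = 1])
  have "(\<lambda>x. cnj (L2_fun v x $ k)) \<in> borel_measurable lebesgue"
    by (rule measurable_compose[OF borel_measurable_vec_nth[OF borel_measurable_L2_fun]])
       (intro borel_measurable_continuous_onI continuous_intros)
  then show "(\<lambda>x. L2_fun u x $ j * cnj (L2_fun v x $ k)) \<in> borel_measurable lebesgue"
    by measurable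
  show "AE x in lebesgue. norm (L2_fun u x $ j * cnj (L2_fun v x $ k))
      \<le> 1 * (norm (L2_fun u x) * norm (L2_fun v x))"
    by (simp add: norm_mult mult_mono Finite_Cartesian_Product.norm_nth_le)
qed

lemma inner_eq_Re_mult_cnj: "inner z w = Re (z * cnj w)" for z w :: complex
  by (simp add: inner_complex_def)

lemma integrable_L2_components:
  fixes u :: "('a::euclidean_space, complex ^ 'n) L2" and v :: "('a, complex ^ 'm) L2"
  shows "integrable lebesgue (\<lambda>x. inner (L2_fun u x $ j) (L2_fun v x $ k))"
  unfolding inner_eq_Re_mult_cnj by (rule integrable_Re) (rule integrable_L2_components_cnj)

lemma inner_L2_sum_comp: "inner u v = (\<Sum>j\<in>UNIV. inner (L2_comp i j u) (L2_comp i j v))"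
  unfolding inner_L2_comp_comp unfolding inner_L2_eq inner_vec_def
  by (rule Bochner_Integration.integral_sum) (rule integrable_L2_components)

section \<open>Test fields and weak derivatives\<close>

lemma borel_measurable_lebesgue_continuous:
  fixes f :: "'a::euclidean_space \<Rightarrow> 'b::topological_space"
  assumes "continuous_on UNIV f"
  shows "f \<in> borel_measurable lebesgue"
  using borel_measurable_continuous_onI[OF assms] by (simp add: measurable_completion)

lemma square_integrable_compact_support:
  fixes f :: "'a::euclidean_space \<Rightarrow> 'b::euclidean_space"
  assumes f: "continuous_on UNIV f" and K: "compact K" "\<And>x. x \<notin> K \<Longrightarrow> f x = 0"
  shows "square_integrable f"
proof -
  have m: "f \<in> borel_measurable borel" using f by (rule borel_measurable_continuous_onI)
  have "integrable lborel (\<lambda>x. indicator K x *\<^sub>R (norm (f x))\<^sup>2)"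
    by (intro borel_integrable_compact K(1) continuous_intros continuous_on_subset[OF f]) auto
  also have "(\<lambda>x. indicator K x *\<^sub>R (norm (f x))\<^sup>2) = (\<lambda>x. (norm (f x))\<^sup>2)"
    using K(2) by (intro ext) (metis (no_types, lifting) indicator_simps norm_zero power2_eq_square mult_zero_right scaleR_one scaleR_zero_right)
  finally have "integrable lebesgue (\<lambda>x. (norm (f x))\<^sup>2)"
    using m by (subst integrable_completion) auto
  then show ?thesis
    using borel_measurable_lebesgue_continuous[OF f] by (simp add: square_integrable_def)
qed

definition test_field :: "(real ^ 'n \<Rightarrow> complex) \<Rightarrow> complex ^ 'n \<Rightarrow> 'n::finite vfield" where
  "test_field \<phi> c = L2_class (\<lambda>x. \<phi> x *s c)"

definition grad_field :: "(real ^ 'n \<Rightarrow> complex) \<Rightarrow> 'n::finite vfield" where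
  "grad_field \<phi> = L2_class (\<lambda>x. \<chi> i. partial_deriv i \<phi> x)"

lemma square_integrable_test_field:
  assumes "test_function \<phi>"
  shows "square_integrable (\<lambda>x. \<phi> x *s c)"
proof -
  obtain K where K: "compact K" "\<And>x. x \<notin> K \<Longrightarrow> \<phi> x = 0"
    using assms by (auto simp: test_function_def)
  have "continuous_on UNIV (\<lambda>x. \<phi> x *s c)"
    unfolding vector_scalar_mult_def
    by (intro continuous_intros test_function_continuous[OF assms])
  then show ?thesis
    by (rule square_integrable_compact_support[OF _ K(1)]) (simp add: K(2) vec_eq_iff)
qed

lemma square_integrable_grad_field:
  assumes "test_function \<phi>"
  shows "square_integrable (\<lambda>x. \<chi> i. partial_deriv i \<phi> x)"
proof -
  have t: "test_function (partial_deriv i \<phi>)" for i using test_function_partial_deriv[OF assms] .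
  have "\<exists>K. compact K \<and> (\<forall>x. x \<notin> K \<longrightarrow> partial_deriv i \<phi> x = 0)" for i
    using t by (auto simp: test_function_def)
  then obtain K where K: "\<And>i. compact (K i)" "\<And>i x. x \<notin> K i \<Longrightarrow> partial_deriv i \<phi> x = 0"
    by metis
  have "continuous_on UNIV (\<lambda>x. \<chi> i. partial_deriv i \<phi> x)"
    by (intro continuous_intros test_function_continuous t)
  then show ?thesis
    by (rule square_integrable_compact_support[where K = "\<Union>i. K i"]) (auto simp: K vec_eq_iff intro!: compact_UN)
qed

lemma L2_fun_test_field: "test_function \<phi> \<Longrightarrow> AE x in lebesgue. L2_fun (test_field \<phi> c) x = \<phi> x *s c"
  unfolding test_field_def by (rule L2_fun_class) (rule square_integrable_test_field)

lemma L2_fun_grad_field: "test_function \<phi> \<Longrightarrow> AE x in lebesgue. L2_fun (grad_field \<phi>) x = (\<chi> i. partial_deriv i \<phi> x)"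
  unfolding grad_field_def by (rule L2_fun_class) (rule square_integrable_grad_field)

lemma test_function_add:
  assumes "test_function \<phi>" "test_function \<psi>"
  shows "test_function (\<lambda>x. \<phi> x + \<psi> x)"
proof -
  obtain K L where KL: "compact K" "\<And>x. x \<notin> K \<Longrightarrow> \<phi> x = 0" "compact L" "\<And>x. x \<notin> L \<Longrightarrow> \<psi> x = 0"
    using assms by (auto simp: test_function_def)
  show ?thesis
  proof (rule test_functionI[where K = "K \<union> L"])
    show "C_k k (\<lambda>x. \<phi> x + \<psi> x)" for k by (rule C_k_add) (rule test_function_C_k, fact)+
  qed (use KL in auto)
qed

lemma test_field_add:
  assumes "test_function \<phi>" "test_function \<psi>"
  shows "test_field (\<lambda>x. \<phi> x + \<psi> x) c = test_field \<phi> c + test_field \<psi> c"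
  by (rule L2_eqI)
    (use L2_fun_test_field[OF test_function_add[OF assms], of c] L2_fun_test_field[OF assms(1), of c]
      L2_fun_test_field[OF assms(2), of c] L2_fun_add[of "test_field \<phi> c" "test_field \<psi> c"]
     in \<open>eventually_elim, simp add: vec_eq_iff algebra_simps\<close>)

lemma test_function_smult: "test_function \<phi> \<Longrightarrow> test_function (\<lambda>x. a * \<phi> x)"
  by (rule test_function_mult[OF C_k_const])

lemma test_field_scaleC:
  assumes "test_function \<phi>"
  shows "a *\<^sub>C test_field \<phi> c = test_field \<phi> (a *s c)"
  by (rule L2_eqI)
    (use L2_fun_test_field[OF assms, of c] L2_fun_test_field[OF assms, of "a *s c"]
      L2_fun_scaleC[of a "test_field \<phi> c"]
     in \<open>eventually_elim, simp add: vec_eq_iff algebra_simps\<close>)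

subsection \<open>The fundamental lemma of the calculus of variations\<close>

text \<open>\<open>ennreal\<close> truncates at zero, so the two densities are the positive and the
  negative part of \<open>h\<close>. The measures agree on boxes, hence everywhere; on
  \<open>{x. h x > 0}\<close> the second one vanishes, therefore the first one does.\<close>

lemma AE_nonpos_if_box_integrals_zero:
  fixes h :: "'a::euclidean_space \<Rightarrow> real"
  assumes [measurable]: "h \<in> borel_measurable borel"
    and int: "\<And>a b. integrable lborel (\<lambda>x. indicator (box a b) x * h x)"
    and zero: "\<And>a b. (\<integral>x. indicator (box a b) x * h x \<partial>lborel) = 0"
  shows "AE x in lborel. h x \<le> 0"
proof -
  let ?M = "density lborel (\<lambda>x. ennreal (h x))" and ?N = "density lborel (\<lambda>x. ennreal (- h x))"
  have ind: "ennreal (indicator S x * y) = ennreal y * indicator S x" for S and x :: 'a and y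
    by (auto simp: indicator_def)
  have ind': "ennreal (- (indicator S x * y)) = ennreal (- y) * indicator S x" for S and x :: 'a and y
    by (auto simp: indicator_def)
  have M: "emeasure ?M (box a b) = (\<integral>\<^sup>+x. ennreal (indicator (box a b) x * h x) \<partial>lborel)" for a b
    by (subst emeasure_density) (auto simp: ind)
  have N: "emeasure ?N (box a b) = (\<integral>\<^sup>+x. ennreal (- (indicator (box a b) x * h x)) \<partial>lborel)" for a b
    by (subst emeasure_density) (auto simp: ind')
  have fin: "emeasure ?M (box a b) \<noteq> \<infinity>" "emeasure ?N (box a b) \<noteq> \<infinity>" for a b
    using int[of a b] unfolding M N real_integrable_def by auto
  have eq: "emeasure ?M (box a b) = emeasure ?N (box a b)" for a b
  proof -
    have "enn2real (emeasure ?M (box a b)) = enn2real (emeasure ?N (box a b))"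
      using real_lebesgue_integral_def[OF int[of a b]] zero[of a b] unfolding M N by simp
    then show ?thesis using fin[of a b]
      by (metis ennreal_enn2real_if infinity_ennreal_def)
  qed
  have "?M = ?N"
  proof (rule measure_eqI_generator_eq)
    let ?E = "range (\<lambda>(a, b). box a b::'a set)"
    show "Int_stable ?E" by (auto simp: Int_stable_def box_Int_box)
    show "?E \<subseteq> Pow UNIV" "sets ?M = sigma_sets UNIV ?E" "sets ?N = sigma_sets UNIV ?E"
      by (simp_all add: borel_eq_box)
    let ?A = "\<lambda>n::nat. box (- (real n *\<^sub>R One)) (real n *\<^sub>R One) :: 'a set"
    show "range ?A \<subseteq> ?E" "(\<Union>i. ?A i) = UNIV" unfolding UN_box_eq_UNIV by auto
    show "emeasure ?M (?A i) \<noteq> \<infinity>" for i using fin by blast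
    show "emeasure ?M X = emeasure ?N X" if "X \<in> ?E" for X using that eq by auto
  qed
  moreover have "emeasure ?N {x. h x > 0} = 0"
    by (subst emeasure_density) (auto simp: nn_integral_0_iff_AE indicator_def ennreal_neg intro!: AE_I2)
  ultimately have "emeasure ?M {x. h x > 0} = 0" by simp
  then have "(\<integral>\<^sup>+x. ennreal (h x) * indicator {x. h x > 0} x \<partial>lborel) = 0"
    by (subst (asm) emeasure_density) auto
  then have "AE x in lborel. ennreal (h x) * indicator {x. h x > 0} x = 0"
    by (subst (asm) nn_integral_0_iff_AE) auto
  then show ?thesis by eventually_elim (auto simp: indicator_def ennreal_eq_0_iff split: if_splits)
qed

lemma AE_zero_if_box_integrals_zero:
  fixes h :: "'a::euclidean_space \<Rightarrow> real"
  assumes h: "h \<in> borel_measurable lebesgue"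
    and int: "\<And>a b. integrable lebesgue (\<lambda>x. indicator (box a b) x * h x)"
    and zero: "\<And>a b. (\<integral>x. indicator (box a b) x * h x \<partial>lebesgue) = 0"
  shows "AE x in lebesgue. h x = 0"
proof -
  \<comment> \<open>Boxes generate the Borel sets only, so the measure-theoretic uniqueness argument
    is run for a Borel representative of \<open>h\<close>.\<close>
  obtain k where k [measurable]: "k \<in> borel_measurable lborel" and ae: "AE x in lborel. h x = k x"
    using completion_ex_borel_measurable_real[OF h] by blast
  have kb [measurable]: "k \<in> borel_measurable borel" using k by simp
  have ae': "AE x in lebesgue. h x = k x" using ae by (rule AE_completion)
  have kl: "k \<in> borel_measurable lebesgue" using k by (rule measurable_completion)
  have kint: "integrable lborel (\<lambda>x. indicator (box a b) x * k x)" for a b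
  proof -
    have "integrable lebesgue (\<lambda>x. indicator (box a b) x * k x)"
    proof (rule integrable_cong_AE_imp[OF int[of a b]])
      show "(\<lambda>x. indicator (box a b) x * k x) \<in> borel_measurable lebesgue"
        by (intro borel_measurable_times kl borel_measurable_indicator) auto
      show "AE x in lebesgue. indicator (box a b) x * h x = indicator (box a b) x * k x"
        using ae' by eventually_elim simp
    qed
    then show ?thesis by (subst (asm) integrable_completion) auto
  qed
  have kzero: "(\<integral>x. indicator (box a b) x * k x \<partial>lborel) = 0" for a b
  proof -
    have "(\<integral>x. indicator (box a b) x * k x \<partial>lborel) = (\<integral>x. indicator (box a b) x * k x \<partial>lebesgue)"
      by (subst integral_completion) auto
    also have "\<dots> = (\<integral>x. indicator (box a b) x * h x \<partial>lebesgue)"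
    proof (rule integral_cong_AE)
      show "(\<lambda>x. indicator (box a b) x * k x) \<in> borel_measurable lebesgue"
        "(\<lambda>x. indicator (box a b) x * h x) \<in> borel_measurable lebesgue"
        by (auto intro!: borel_measurable_times borel_measurable_indicator h kl)
      show "AE x in lebesgue. indicator (box a b) x * k x = indicator (box a b) x * h x"
        using ae' by eventually_elim simp
    qed
    finally show ?thesis using zero by simp
  qed
  have "AE x in lborel. k x \<le> 0"
    by (rule AE_nonpos_if_box_integrals_zero[OF kb kint kzero])
  moreover have "AE x in lborel. - k x \<le> 0"
    by (rule AE_nonpos_if_box_integrals_zero) (use kint kzero in auto)
  ultimately have "AE x in lborel. h x = 0"
    using ae by eventually_elim simp
  then show ?thesis by (rule AE_completion)
qed

text \<open>The fundamental lemma behind every later identification of fields: uniqueness of weak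
  derivatives, vanishing divergence, symmetry of the gradient. Test functions tending to the
  indicator of a box, dominated by that of the closed box, give vanishing box integrals for each
  real component \<open>inner (L2_fun g x) c\<close>.\<close>

lemma test_fields_total:
  assumes g: "\<And>\<phi> c. test_function \<phi> \<Longrightarrow> inner g (test_field \<phi> c) = 0"
  shows "g = 0"
proof -
  have comp: "AE x in lebesgue. inner (L2_fun g x) c = 0" for c
  proof (rule AE_zero_if_box_integrals_zero)
    fix a b :: "real ^ 'a"
    have si: "square_integrable (\<lambda>x. indicator S x *\<^sub>R (v :: 'b::euclidean_space))"
      if "S = box a b \<or> S = cbox a b" for v S
    proof -
      have "integrable lebesgue (\<lambda>x. indicator S x * (norm v)\<^sup>2)"
        by (rule integrable_mult_left, rule integrable_real_indicator)
           (use that in \<open>auto simp: emeasure_lborel_box_eq emeasure_lborel_cbox_eq\<close>)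
      moreover have "(\<lambda>x. (norm (indicator S x *\<^sub>R v))\<^sup>2) = (\<lambda>x. indicator S x * (norm v)\<^sup>2)"
        by (auto simp: indicator_def)
      moreover have "(\<lambda>x. indicator S x *\<^sub>R v) \<in> borel_measurable lebesgue"
        using that by (intro borel_measurable_scaleR borel_measurable_indicator) auto
      ultimately show ?thesis by (simp add: square_integrable_def)
    qed
    have "integrable lebesgue (\<lambda>x. inner (L2_fun g x) (indicator (box a b) x *\<^sub>R c))"
      by (rule square_integrable_inner) (auto intro: si)
    then show "integrable lebesgue (\<lambda>x. indicator (box a b) x * inner (L2_fun g x) c)"
      by simp
    define q where "q x = (\<Prod>i\<in>UNIV. flat_exp (x $ i - a $ i) * flat_exp (b $ i - x $ i))" for x
    define \<phi> where "\<phi> m x = complex_of_real (flat_exp (real m * q x))" for m :: nat and x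
    have \<phi>: "test_function (\<phi> m)" for m unfolding \<phi>_def q_def by (rule test_function_box)
    have qpos: "q x > 0 \<longleftrightarrow> x \<in> box a b" and qnn: "q x \<ge> 0" for x
      unfolding q_def by (rule test_function_box)+
    have lim: "(\<lambda>m. inner (L2_fun g x) (\<phi> m x *s c)) \<longlonglongrightarrow> indicator (box a b) x * inner (L2_fun g x) c" for x
    proof (cases "x \<in> box a b")
      case True
      then have "(\<lambda>m. flat_exp (real m * q x) * inner (L2_fun g x) c) \<longlonglongrightarrow> 1 * inner (L2_fun g x) c"
        by (intro tendsto_intros flat_exp_scaled_tendsto) (simp add: qpos)
      then show ?thesis using True by (simp add: \<phi>_def scaleR_smult_vec[symmetric])
    next
      case False
      then have "q x = 0" using qpos[of x] qnn[of x] by linarith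
      then have "\<phi> m x = 0" for m by (simp add: \<phi>_def flat_exp_zero)
      then show ?thesis using False by simp
    qed
    have "(\<lambda>m. \<integral>x. inner (L2_fun g x) (\<phi> m x *s c) \<partial>lebesgue)
        \<longlonglongrightarrow> (\<integral>x. indicator (box a b) x * inner (L2_fun g x) c \<partial>lebesgue)"
    proof (rule integral_dominated_convergence)
      show "integrable lebesgue (\<lambda>x. norm (L2_fun g x) * (indicator (cbox a b) x * norm c))"
        using square_integrable_inner[OF square_integrable_norm_L2[of g] si[of "cbox a b" "norm c"]] by simp
      show "AE x in lebesgue. (\<lambda>m. inner (L2_fun g x) (\<phi> m x *s c)) \<longlonglongrightarrow> indicator (box a b) x * inner (L2_fun g x) c"
        using lim by simp
      show "AE x in lebesgue. norm (inner (L2_fun g x) (\<phi> m x *s c)) \<le> norm (L2_fun g x) * (indicator (cbox a b) x * norm c)" for m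
      proof (rule AE_I2)
        fix x
        have "cmod (\<phi> m x) \<le> indicator (cbox a b) x"
        proof (cases "x \<in> cbox a b")
          case False
          then have "q x = 0" using qpos[of x] qnn[of x] box_subset_cbox[of a b] by force
          then show ?thesis by (simp add: \<phi>_def flat_exp_zero)
        qed (simp add: \<phi>_def flat_exp_nonneg flat_exp_le_1)
        then have "norm (\<phi> m x *s c) \<le> indicator (cbox a b) x * norm c"
          unfolding norm_smult_vec by (intro mult_right_mono) auto
        then have "norm (L2_fun g x) * norm (\<phi> m x *s c) \<le> norm (L2_fun g x) * (indicator (cbox a b) x * norm c)"
          by (rule mult_left_mono) simp
        then show "norm (inner (L2_fun g x) (\<phi> m x *s c)) \<le> norm (L2_fun g x) * (indicator (cbox a b) x * norm c)"
          using Cauchy_Schwarz_ineq2[of "L2_fun g x" "\<phi> m x *s c"] by (simp only: real_norm_def)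
      qed
      have "\<phi> m \<in> borel_measurable lebesgue" for m
        using test_function_continuous[OF \<phi>] by (rule borel_measurable_lebesgue_continuous)
      then show "(\<lambda>x. inner (L2_fun g x) (\<phi> m x *s c)) \<in> borel_measurable lebesgue" for m
        by (intro borel_measurable_inner borel_measurable_smult_vec) auto
      show "(\<lambda>x. indicator (box a b) x * inner (L2_fun g x) c) \<in> borel_measurable lebesgue"
        by (intro borel_measurable_times borel_measurable_indicator borel_measurable_inner) auto
    qed
    moreover have "(\<integral>x. inner (L2_fun g x) (\<phi> m x *s c) \<partial>lebesgue) = 0" for m
      using g[OF \<phi>[of m], of c] unfolding test_field_def
      by (simp add: inner_L2_class[OF square_integrable_test_field[OF \<phi>]])
    ultimately show "(\<integral>x. indicator (box a b) x * inner (L2_fun g x) c \<partial>lebesgue) = 0"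
      by (simp add: LIMSEQ_const_iff)
  qed (intro borel_measurable_inner, auto)
  have "AE x in lebesgue. \<forall>c\<in>Basis. inner (L2_fun g x) c = 0"
    using comp by (subst AE_ball_countable) (auto intro: countable_finite)
  then have "AE x in lebesgue. L2_fun g x = 0"
    by eventually_elim (simp add: euclidean_all_zero_iff)
  then have "AE x in lebesgue. L2_fun g x = L2_fun 0 x"
    using L2_fun_zero by eventually_elim simp
  then show ?thesis by (rule L2_eqI)
qed

subsection \<open>Weak derivatives and divergence through the real inner product\<close>

text \<open>The imaginary part of the Hermitian product is again a real product, against
  \<open>\<i> *\<^sub>C v\<close>. Hence an identity between Hermitian products for all
  \<open>v\<close> in a complex subspace is equivalent to its real part for all such
  \<open>v\<close>.\<close>

lemma L2_cinner_eq: "L2_cinner u v = Complex (inner u v) (inner u (\<i> *\<^sub>C v))"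
proof -
  have int: "integrable lebesgue (\<lambda>x. \<Sum>i\<in>UNIV. L2_fun u x $ i * cnj (L2_fun v x $ i))"
    by (intro Bochner_Integration.integrable_sum integrable_L2_components_cnj)
  have "Re (L2_cinner u v) = (\<integral>x. Re (\<Sum>i\<in>UNIV. L2_fun u x $ i * cnj (L2_fun v x $ i)) \<partial>lebesgue)"
    unfolding L2_cinner_def by (rule integral_Re[OF int, symmetric])
  also have "\<dots> = inner u v"
    unfolding inner_L2_eq inner_vec_def by (simp add: inner_eq_Re_mult_cnj)
  finally have Re: "Re (L2_cinner u v) = inner u v" .
  have "Im (L2_cinner u v) = (\<integral>x. Im (\<Sum>i\<in>UNIV. L2_fun u x $ i * cnj (L2_fun v x $ i)) \<partial>lebesgue)"
    unfolding L2_cinner_def by (rule integral_Im[OF int, symmetric])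
  also have "\<dots> = (\<integral>x. inner (L2_fun u x) (L2_fun (\<i> *\<^sub>C v) x) \<partial>lebesgue)"
  proof (rule integral_cong_AE)
    show "(\<lambda>x. Im (\<Sum>i\<in>UNIV. L2_fun u x $ i * cnj (L2_fun v x $ i))) \<in> borel_measurable lebesgue"
      using integrable_Im[OF int] by (rule borel_measurable_integrable)
    show "AE x in lebesgue. Im (\<Sum>i\<in>UNIV. L2_fun u x $ i * cnj (L2_fun v x $ i))
        = inner (L2_fun u x) (L2_fun (\<i> *\<^sub>C v) x)"
      using L2_fun_scaleC[of \<i> v]
      by eventually_elim (simp add: inner_vec_def inner_complex_def algebra_simps)
  qed measurable
  finally have "Im (L2_cinner u v) = inner u (\<i> *\<^sub>C v)" by (simp add: inner_L2_eq)
  with Re show ?thesis by (simp add: complex_eq_iff)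
qed

lemma inner_test_field:
  assumes "test_function \<phi>"
  shows "inner u (test_field \<phi> c) = inner (\<integral>x. cnj (\<phi> x) *s L2_fun u x \<partial>lebesgue) c"
proof -
  have m: "(\<lambda>x. cnj (\<phi> x)) \<in> borel_measurable lebesgue"
    by (intro borel_measurable_lebesgue_continuous continuous_on_cnj test_function_continuous assms)
  have "integrable lebesgue (\<lambda>x. cnj (\<phi> x) *s L2_fun u x)"
  proof (rule integrable_L2_product[where K = 1])
    show "(\<lambda>x. cnj (\<phi> x) *s L2_fun u x) \<in> borel_measurable lebesgue"
      using m by (intro borel_measurable_smult_vec) auto
    \<comment> \<open>\<open>axis undefined 1\<close> is merely some unit vector; it makes \<phi>
      into a field with pointwise norm \<open>cmod (\<phi> x)\<close>, which serves as
      majorant.\<close>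
    show "AE x in lebesgue. norm (cnj (\<phi> x) *s L2_fun u x)
        \<le> 1 * (norm (L2_fun u x) * norm (L2_fun (test_field \<phi> (axis undefined 1)) x))"
      using L2_fun_test_field[OF assms, of "axis undefined 1"]
      by eventually_elim (simp add: norm_smult_vec norm_axis_vec)
  qed
  then have "(\<integral>x. inner (cnj (\<phi> x) *s L2_fun u x) c \<partial>lebesgue) = inner (\<integral>x. cnj (\<phi> x) *s L2_fun u x \<partial>lebesgue) c"
    by (intro integral_inner_left) auto
  moreover have "inner u (test_field \<phi> c) = (\<integral>x. inner (cnj (\<phi> x) *s L2_fun u x) c \<partial>lebesgue)"
    unfolding test_field_def inner_L2_class[OF square_integrable_test_field[OF assms]]
    by (simp add: inner_smult_vec)
  ultimately show ?thesis by simp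
qed

lemma partial_deriv_test_cnj:
  "test_function \<phi> \<Longrightarrow> partial_deriv i (\<lambda>x. cnj (\<phi> x)) = (\<lambda>x. cnj (partial_deriv i \<phi> x))"
  by (rule ext) (rule partial_deriv_cnj[OF test_function_differentiable])

text \<open>The vector-valued integrals are compared by pairing with all constant vectors
  \<open>c\<close>. The conjugate that the real inner product puts on \<phi> is harmless because
  test functions are closed under conjugation.\<close>

lemma has_weak_deriv_iff:
  fixes u g :: "'n::finite vfield"
  shows "has_weak_deriv \<beta> u g \<longleftrightarrow> (\<forall>\<phi> c. test_function \<phi> \<longrightarrow>
     inner u (test_field (partial_deriv \<beta> \<phi>) c) = - inner g (test_field \<phi> c))"
proof
  assume w: "has_weak_deriv \<beta> u g"
  show "\<forall>\<phi> c. test_function \<phi> \<longrightarrow>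
     inner u (test_field (partial_deriv \<beta> \<phi>) c) = - inner g (test_field \<phi> c)"
  proof (intro allI impI)
    fix \<phi> :: "real ^ 'n \<Rightarrow> complex" and c :: "complex ^ 'n" assume t: "test_function \<phi>"
    have "(\<integral>x. cnj (partial_deriv \<beta> \<phi> x) *s L2_fun u x \<partial>lebesgue) = - (\<integral>x. cnj (\<phi> x) *s L2_fun g x \<partial>lebesgue)"
      using w test_function_cnj[OF t] unfolding has_weak_deriv_def
      by (auto simp: partial_deriv_test_cnj[OF t] dest: spec[of _ "\<lambda>x. cnj (\<phi> x)"])
    then show "inner u (test_field (partial_deriv \<beta> \<phi>) c) = - inner g (test_field \<phi> c)"
      by (simp add: inner_test_field t test_function_partial_deriv)
  qed
next
  assume R: "\<forall>\<phi> c. test_function \<phi> \<longrightarrow>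
     inner u (test_field (partial_deriv \<beta> \<phi>) c) = - inner g (test_field \<phi> c)"
  show "has_weak_deriv \<beta> u g"
    unfolding has_weak_deriv_def
  proof (intro allI impI)
    fix \<phi> :: "real ^ 'n \<Rightarrow> complex" assume t: "test_function \<phi>"
    have "inner (\<integral>x. partial_deriv \<beta> \<phi> x *s L2_fun u x \<partial>lebesgue) c
        = inner (- (\<integral>x. \<phi> x *s L2_fun g x \<partial>lebesgue)) c" for c
      using R[rule_format, OF test_function_cnj[OF t], of c] test_function_cnj[OF t]
        test_function_partial_deriv[OF test_function_cnj[OF t]]
      by (simp add: inner_test_field partial_deriv_test_cnj[OF t])
    then show "(\<integral>x. partial_deriv \<beta> \<phi> x *s L2_fun u x \<partial>lebesgue) = - (\<integral>x. \<phi> x *s L2_fun g x \<partial>lebesgue)"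
      by (rule vector_eq_rdot[THEN iffD1, OF allI])
  qed
qed

lemma L2_cinner_grad_field:
  assumes "test_function \<phi>"
  shows "L2_cinner u (grad_field \<phi>)
    = (\<integral>x. (\<Sum>i\<in>UNIV. L2_fun u x $ i * partial_deriv i (\<lambda>x. cnj (\<phi> x)) x) \<partial>lebesgue)"
  unfolding L2_cinner_def
proof (rule integral_cong_AE)
  show "(\<lambda>x. \<Sum>i\<in>UNIV. L2_fun u x $ i * cnj (L2_fun (grad_field \<phi>) x $ i)) \<in> borel_measurable lebesgue"
    by (intro borel_measurable_integrable Bochner_Integration.integrable_sum integrable_L2_components_cnj)
  have "partial_deriv i (\<lambda>x. cnj (\<phi> x)) \<in> borel_measurable lebesgue" for i
    by (intro borel_measurable_lebesgue_continuous test_function_continuous test_function_partial_deriv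
        test_function_cnj assms)
  then show "(\<lambda>x. \<Sum>i\<in>UNIV. L2_fun u x $ i * partial_deriv i (\<lambda>x. cnj (\<phi> x)) x) \<in> borel_measurable lebesgue"
    by (intro borel_measurable_sum borel_measurable_times) auto
  show "AE x in lebesgue. (\<Sum>i\<in>UNIV. L2_fun u x $ i * cnj (L2_fun (grad_field \<phi>) x $ i))
      = (\<Sum>i\<in>UNIV. L2_fun u x $ i * partial_deriv i (\<lambda>x. cnj (\<phi> x)) x)"
    using L2_fun_grad_field[OF assms] by eventually_elim (simp add: partial_deriv_test_cnj[OF assms])
qed

lemma grad_field_scaleC:
  assumes "test_function \<phi>"
  shows "a *\<^sub>C grad_field \<phi> = grad_field (\<lambda>x. a * \<phi> x)"
proof (rule L2_eqI)
  have "partial_deriv i (\<lambda>x. a * \<phi> x) x = a * partial_deriv i \<phi> x" for i x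
    using partial_deriv_mult[of "\<lambda>x. a" x \<phi> i] test_function_differentiable[OF assms]
    by (simp add: partial_deriv_eq[OF has_derivative_const])
  note pd = this
  show "AE x in lebesgue. L2_fun (a *\<^sub>C grad_field \<phi>) x = L2_fun (grad_field (\<lambda>x. a * \<phi> x)) x"
    using L2_fun_scaleC[of a "grad_field \<phi>"] L2_fun_grad_field[OF assms]
      L2_fun_grad_field[OF test_function_smult[OF assms], of a]
    by eventually_elim (simp add: vec_eq_iff pd)
qed

text \<open>Solenoidal fields as the real orthogonal complement of gradients; this is what makes
  \<open>L2_sigma\<close> a closed subspace. For the direction from right to left, the test function
  \<open>\<i> * \<phi>\<close> supplies the imaginary part.\<close>

lemma div_free_iff: "div_free u \<longleftrightarrow> (\<forall>\<phi>. test_function \<phi> \<longrightarrow> inner u (grad_field \<phi>) = 0)"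
proof
  assume d: "div_free u"
  show "\<forall>\<phi>. test_function \<phi> \<longrightarrow> inner u (grad_field \<phi>) = 0"
  proof (intro allI impI)
    fix \<phi> :: "real ^ 'a \<Rightarrow> complex" assume t: "test_function \<phi>"
    then have "L2_cinner u (grad_field \<phi>) = 0"
      using d test_function_cnj[OF t] by (simp add: L2_cinner_grad_field div_free_def)
    then show "inner u (grad_field \<phi>) = 0" by (simp add: L2_cinner_eq complex_eq_iff)
  qed
next
  assume R: "\<forall>\<phi>. test_function \<phi> \<longrightarrow> inner u (grad_field \<phi>) = 0"
  show "div_free u"
    unfolding div_free_def
  proof (intro allI impI)
    fix \<phi> :: "real ^ 'a \<Rightarrow> complex" assume "test_function \<phi>"
    then have t: "test_function (\<lambda>x. cnj (\<phi> x))" by (rule test_function_cnj)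
    have "L2_cinner u (grad_field (\<lambda>x. cnj (\<phi> x))) = 0"
      using R t test_function_smult[OF t, of \<i>]
      by (simp add: L2_cinner_eq grad_field_scaleC complex_eq_iff)
    then show "(\<integral>x. (\<Sum>i\<in>UNIV. L2_fun u x $ i * partial_deriv i \<phi> x) \<partial>lebesgue) = 0"
      by (simp add: L2_cinner_grad_field[OF t])
  qed
qed

lemma L2_sigma_iff: "u \<in> L2_sigma \<longleftrightarrow> (\<forall>\<phi>. test_function \<phi> \<longrightarrow> inner u (grad_field \<phi>) = 0)"
  by (simp add: L2_sigma_def div_free_iff)

lemma subspace_L2_sigma: "subspace L2_sigma"
  by (rule subspaceI) (auto simp: L2_sigma_iff inner_add_left)

lemma closed_L2_sigma: "closed (L2_sigma :: 'n::finite vfield set)"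
proof -
  have eq: "(L2_sigma :: 'n vfield set) = (\<Inter>\<phi>\<in>Collect test_function. {u. inner u (grad_field \<phi>) = 0})"
    by (auto simp: L2_sigma_iff)
  show ?thesis
    unfolding eq by (intro closed_INT ballI closed_Collect_eq continuous_intros)
qed

lemma scaleC_L2_sigma: "u \<in> L2_sigma \<Longrightarrow> c *\<^sub>C u \<in> L2_sigma"
  using test_function_smult by (auto simp: L2_sigma_iff inner_scaleC_left grad_field_scaleC)

lemma H1_sigma_eq: "H1_sigma = H1 \<inter> L2_sigma"
  by (auto simp: H1_sigma_def L2_sigma_def)

lemma has_weak_deriv_unique:
  assumes "has_weak_deriv \<beta> u g" "has_weak_deriv \<beta> u h"
  shows "g = h"
proof -
  have "g - h = 0"
    by (rule test_fields_total) (use assms in \<open>simp add: has_weak_deriv_iff inner_diff_left\<close>)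
  then show ?thesis by simp
qed

lemma weak_deriv_eq: "has_weak_deriv \<beta> u g \<Longrightarrow> weak_deriv \<beta> u = g"
  unfolding weak_deriv_def using has_weak_deriv_unique by blast

lemma H1_has_weak_deriv: "u \<in> H1 \<Longrightarrow> has_weak_deriv \<beta> u (weak_deriv \<beta> u)"
  unfolding H1_def using weak_deriv_eq by blast

lemma H1I: "(\<And>\<beta>. has_weak_deriv \<beta> u (g \<beta>)) \<Longrightarrow> u \<in> H1"
  unfolding H1_def by blast

lemma has_weak_deriv_zero: "has_weak_deriv \<beta> 0 0"
  by (simp add: has_weak_deriv_iff)

lemma has_weak_deriv_add:
  "has_weak_deriv \<beta> u g \<Longrightarrow> has_weak_deriv \<beta> v h \<Longrightarrow> has_weak_deriv \<beta> (u + v) (g + h)"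
  by (simp add: has_weak_deriv_iff inner_add_left)

lemma has_weak_deriv_scaleR: "has_weak_deriv \<beta> u g \<Longrightarrow> has_weak_deriv \<beta> (r *\<^sub>R u) (r *\<^sub>R g)"
  by (simp add: has_weak_deriv_iff)

lemma has_weak_deriv_scaleC: "has_weak_deriv \<beta> u g \<Longrightarrow> has_weak_deriv \<beta> (c *\<^sub>C u) (c *\<^sub>C g)"
  by (simp add: has_weak_deriv_iff inner_scaleC_left test_field_scaleC test_function_partial_deriv)

text \<open>Closedness of weak differentiation, used to see that the graph of the gradient is
  closed.\<close>

lemma has_weak_deriv_limit:
  fixes U G :: "'n::finite vfield"
  assumes "\<And>n. has_weak_deriv \<beta> (u n) (g n)" "u \<longlonglongrightarrow> U" "g \<longlonglongrightarrow> G"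
  shows "has_weak_deriv \<beta> U G"
  unfolding has_weak_deriv_iff
proof (intro allI impI)
  fix \<phi> :: "real ^ 'n \<Rightarrow> complex" and c :: "complex ^ 'n" assume "test_function \<phi>"
  then have "inner (u n) (test_field (partial_deriv \<beta> \<phi>) c) = - inner (g n) (test_field \<phi> c)" for n
    using assms(1) by (simp add: has_weak_deriv_iff)
  moreover have "(\<lambda>n. inner (u n) (test_field (partial_deriv \<beta> \<phi>) c)) \<longlonglongrightarrow> inner U (test_field (partial_deriv \<beta> \<phi>) c)"
    "(\<lambda>n. - inner (g n) (test_field \<phi> c)) \<longlonglongrightarrow> - inner G (test_field \<phi> c)"
    by (intro tendsto_intros assms)+
  ultimately show "inner U (test_field (partial_deriv \<beta> \<phi>) c) = - inner G (test_field \<phi> c)"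
    using LIMSEQ_unique by auto
qed

lemma H1_closure:
  fixes u v :: "'n::finite vfield"
  shows H1_zero: "(0 :: 'n vfield) \<in> H1"
    and H1_add: "u \<in> H1 \<Longrightarrow> v \<in> H1 \<Longrightarrow> u + v \<in> H1"
    and H1_scaleR: "u \<in> H1 \<Longrightarrow> r *\<^sub>R u \<in> H1"
    and H1_scaleC: "u \<in> H1 \<Longrightarrow> c *\<^sub>C u \<in> H1"
    and H1_diff: "u \<in> H1 \<Longrightarrow> v \<in> H1 \<Longrightarrow> u - v \<in> H1"
proof -
  show "(0 :: 'n vfield) \<in> H1" using has_weak_deriv_zero by (auto simp: H1_def)
  show add: "u + v \<in> H1" if "u \<in> H1" "v \<in> H1" for u v :: "'n vfield"
    using that has_weak_deriv_add unfolding H1_def by blast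
  show sc: "r *\<^sub>R u \<in> H1" if "u \<in> H1" for r and u :: "'n vfield"
    using that has_weak_deriv_scaleR unfolding H1_def by blast
  show "c *\<^sub>C u \<in> H1" if "u \<in> H1" for c and u :: "'n vfield"
    using that has_weak_deriv_scaleC unfolding H1_def by blast
  show "u - v \<in> H1" if "u \<in> H1" "v \<in> H1" for u v :: "'n vfield"
    using add[OF that(1) sc[OF that(2), of "-1"]] by simp
qed

lemma weak_deriv_zero: "weak_deriv \<beta> 0 = 0"
  by (rule weak_deriv_eq[OF has_weak_deriv_zero])

lemma weak_deriv_add: "u \<in> H1 \<Longrightarrow> v \<in> H1 \<Longrightarrow> weak_deriv \<beta> (u + v) = weak_deriv \<beta> u + weak_deriv \<beta> v"
  by (intro weak_deriv_eq has_weak_deriv_add H1_has_weak_deriv)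

lemma weak_deriv_scaleR: "u \<in> H1 \<Longrightarrow> weak_deriv \<beta> (r *\<^sub>R u) = r *\<^sub>R weak_deriv \<beta> u"
  by (intro weak_deriv_eq has_weak_deriv_scaleR H1_has_weak_deriv)

lemma weak_deriv_scaleC: "u \<in> H1 \<Longrightarrow> weak_deriv \<beta> (c *\<^sub>C u) = c *\<^sub>C weak_deriv \<beta> u"
  by (intro weak_deriv_eq has_weak_deriv_scaleC H1_has_weak_deriv)

lemma weak_deriv_diff: "u \<in> H1 \<Longrightarrow> v \<in> H1 \<Longrightarrow> weak_deriv \<beta> (u - v) = weak_deriv \<beta> u - weak_deriv \<beta> v"
  using weak_deriv_add[of u "-1 *\<^sub>R v" \<beta>] weak_deriv_scaleR[of v \<beta> "-1"] H1_scaleR[of v "-1"] by simp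

section \<open>Translations and difference quotients\<close>

definition L2_shift :: "'a \<Rightarrow> ('a::euclidean_space, 'b::euclidean_space) L2 \<Rightarrow> ('a, 'b) L2" where
  "L2_shift a u = L2_class (\<lambda>x. L2_fun u (x + a))"

lemma
  fixes a :: "'a::euclidean_space"
  shows distr_lebesgue_shift: "distr lebesgue lebesgue (\<lambda>x. x + a) = lebesgue"
    and measurable_shift: "(\<lambda>x. x + a) \<in> measurable lebesgue lebesgue"
proof -
  have eq: "(\<lambda>x. a + (\<Sum>j\<in>Basis. (1 * (x \<bullet> j)) *\<^sub>R j)) = (\<lambda>x. x + a)"
    by (rule ext) (simp add: euclidean_representation)
  show "distr lebesgue lebesgue (\<lambda>x. x + a) = lebesgue"
    using lebesgue_affine_euclidean[of "\<lambda>_. 1" a] unfolding eq by (simp add: density_1)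
  show "(\<lambda>x. x + a) \<in> measurable lebesgue lebesgue"
    using lebesgue_affine_measurable[of "\<lambda>_. 1" a] unfolding eq by simp
qed

lemma AE_shift: "AE x in lebesgue. P x \<Longrightarrow> AE x in lebesgue. P (x + a)"
  using AE_distrD[OF measurable_shift[of a], of P] unfolding distr_lebesgue_shift .

lemma integral_shift:
  fixes f :: "'a::euclidean_space \<Rightarrow> 'b::{banach, second_countable_topology}"
  assumes "f \<in> borel_measurable lebesgue"
  shows "(\<integral>x. f (x + a) \<partial>lebesgue) = (\<integral>x. f x \<partial>lebesgue)"
  using integral_distr[OF measurable_shift[of a] assms] by (simp add: distr_lebesgue_shift)

lemma square_integrable_shift:
  assumes "square_integrable f"
  shows "square_integrable (\<lambda>x. f (x + a))"
proof -
  have "integrable (distr lebesgue lebesgue (\<lambda>x. x + a)) (\<lambda>x. (norm (f x))\<^sup>2)"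
    using assms by (simp add: distr_lebesgue_shift square_integrable_def)
  then have "integrable lebesgue (\<lambda>x. (norm (f (x + a)))\<^sup>2)"
    by (rule integrable_distr[OF measurable_shift])
  moreover have "(\<lambda>x. f (x + a)) \<in> borel_measurable lebesgue"
    using measurable_compose[OF measurable_shift[of a]] assms by (auto simp: square_integrable_def)
  ultimately show ?thesis by (simp add: square_integrable_def)
qed

lemma L2_fun_shift: "AE x in lebesgue. L2_fun (L2_shift a u) x = L2_fun u (x + a)"
  unfolding L2_shift_def by (rule L2_fun_class) (rule square_integrable_shift, simp)

lemma L2_shift_class:
  assumes "square_integrable f"
  shows "L2_shift a (L2_class f) = L2_class (\<lambda>x. f (x + a))"
  unfolding L2_shift_def
  by (subst L2_class_eq_iff)
     (auto intro: square_integrable_shift assms AE_shift[OF L2_fun_class[OF assms]])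

lemma inner_shift_shift: "inner (L2_shift a u) (L2_shift a v) = inner u v"
proof -
  have "inner (L2_shift a u) (L2_shift a v) = (\<integral>x. inner (L2_fun u (x + a)) (L2_fun v (x + a)) \<partial>lebesgue)"
    unfolding inner_L2_eq
  proof (rule integral_cong_AE)
    show "AE x in lebesgue. inner (L2_fun (L2_shift a u) x) (L2_fun (L2_shift a v) x) = inner (L2_fun u (x + a)) (L2_fun v (x + a))"
      using L2_fun_shift[of a u] L2_fun_shift[of a v] by eventually_elim simp
    show "(\<lambda>x. inner (L2_fun u (x + a)) (L2_fun v (x + a))) \<in> borel_measurable lebesgue"
      by (intro borel_measurable_inner measurable_compose[OF measurable_shift borel_measurable_L2_fun])
  qed measurable
  also have "\<dots> = inner u v"
    unfolding inner_L2_eq by (rule integral_shift) measurable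
  finally show ?thesis .
qed

lemma L2_shift_shift: "L2_shift a (L2_shift b u) = L2_shift (a + b) u"
  by (rule L2_eqI)
    (use L2_fun_shift[of a "L2_shift b u"] AE_shift[OF L2_fun_shift[of b u], of a] L2_fun_shift[of "a + b" u]
     in \<open>eventually_elim, simp add: add_ac\<close>)

lemma L2_shift_0 [simp]: "L2_shift 0 u = u"
  unfolding L2_shift_def by simp

lemma inner_shift_left: "inner (L2_shift a u) v = inner u (L2_shift (- a) v)"
  using inner_shift_shift[of a u "L2_shift (- a) v"] by (simp add: L2_shift_shift)

lemma norm_shift [simp]: "norm (L2_shift a u) = norm u"
  by (simp add: norm_eq_sqrt_inner inner_shift_shift)

lemma L2_shift_add: "L2_shift a (u + v) = L2_shift a u + L2_shift a v"
  by (rule L2_eqI)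
    (use L2_fun_shift[of a u] L2_fun_shift[of a v] L2_fun_shift[of a "u + v"]
      L2_fun_add[of "L2_shift a u" "L2_shift a v"] AE_shift[OF L2_fun_add[of u v], of a]
     in \<open>eventually_elim, simp\<close>)

lemma L2_shift_scaleR: "L2_shift a (r *\<^sub>R u) = r *\<^sub>R L2_shift a u"
  by (rule L2_eqI)
    (use L2_fun_shift[of a u] L2_fun_shift[of a "r *\<^sub>R u"]
      L2_fun_scaleR[of r "L2_shift a u"] AE_shift[OF L2_fun_scaleR[of r u], of a]
     in \<open>eventually_elim, simp\<close>)

lemma bounded_linear_shift: "bounded_linear (L2_shift a)"
  by (rule bounded_linear_intro[where K = 1]) (simp_all add: L2_shift_add L2_shift_scaleR)

lemma L2_shift_diff: "L2_shift a (u - v) = L2_shift a u - L2_shift a v"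
  by (rule linear_diff[OF bounded_linear.linear[OF bounded_linear_shift]])

lemma L2_shift_comp: "L2_comp i j (L2_shift a u) = L2_shift a (L2_comp i j u)"
  by (rule L2_eqI)
    (use L2_fun_comp[of i j "L2_shift a u"] L2_fun_shift[of a u] L2_fun_shift[of a "L2_comp i j u"]
      AE_shift[OF L2_fun_comp[of i j u], of a]
     in \<open>eventually_elim, simp\<close>)

lemma has_derivative_shift:
  assumes "(\<phi> has_derivative D) (at (x + a))"
  shows "((\<lambda>x. \<phi> (x + a)) has_derivative D) (at x)"
proof -
  have "((\<lambda>x. x + a) has_derivative (\<lambda>h. h)) (at x)"
    by (auto intro!: derivative_eq_intros)
  from has_derivative_compose[OF this assms] show ?thesis .
qed

lemma partial_deriv_shift:
  assumes "\<And>x. \<phi> differentiable at x"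
  shows "partial_deriv i (\<lambda>x. \<phi> (x + a)) = (\<lambda>x. partial_deriv i \<phi> (x + a))"
  using partial_deriv_eq[OF has_derivative_shift[OF has_derivative_frechet[OF assms]]]
  by (intro ext) (simp add: partial_deriv_def)

lemma C_k_shift: "C_k k \<phi> \<Longrightarrow> C_k k (\<lambda>x. \<phi> (x + a))"
proof (induction k arbitrary: \<phi>)
  case 0
  then show ?case
    using continuous_on_compose2[of UNIV \<phi> UNIV "\<lambda>x. x + a"] by (simp add: continuous_on_add)
next
  case (Suc k)
  then have d: "\<And>x. \<phi> differentiable at x" by simp
  have "(\<lambda>x. \<phi> (x + a)) differentiable at x" for x
    using has_derivative_shift[OF has_derivative_frechet[OF d]] unfolding differentiable_def by blast
  with Suc show ?case by (simp add: partial_deriv_shift[OF d])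
qed

lemma test_function_shift:
  assumes "test_function \<phi>"
  shows "test_function (\<lambda>x. \<phi> (x + a))"
proof -
  obtain K where K: "compact K" "\<And>x. x \<notin> K \<Longrightarrow> \<phi> x = 0"
    using assms by (auto simp: test_function_def)
  show ?thesis
  proof (rule test_functionI[where K = "(+) (- a) ` K"])
    show "C_k k (\<lambda>x. \<phi> (x + a))" for k by (rule C_k_shift) (rule test_function_C_k, fact)
    show "compact ((+) (- a) ` K)" using K(1) by (rule compact_translation)
    show "\<phi> (x + a) = 0" if "x \<notin> (+) (- a) ` K" for x
    proof (rule K(2))
      show "x + a \<notin> K" using that by (force simp: image_iff)
    qed
  qed
qed

lemma partial_deriv_test_shift:
  "test_function \<phi> \<Longrightarrow> partial_deriv i (\<lambda>x. \<phi> (x + a)) = (\<lambda>x. partial_deriv i \<phi> (x + a))"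
  by (rule partial_deriv_shift) (rule test_function_differentiable)

lemma L2_shift_test_field: "test_function \<phi> \<Longrightarrow> L2_shift a (test_field \<phi> c) = test_field (\<lambda>x. \<phi> (x + a)) c"
  unfolding test_field_def by (rule L2_shift_class) (rule square_integrable_test_field)

lemma L2_shift_grad_field: "test_function \<phi> \<Longrightarrow> L2_shift a (grad_field \<phi>) = grad_field (\<lambda>x. \<phi> (x + a))"
  unfolding grad_field_def
  by (subst L2_shift_class) (auto simp: square_integrable_grad_field partial_deriv_test_shift)

lemma L2_shift_L2_sigma: "u \<in> L2_sigma \<Longrightarrow> L2_shift a u \<in> L2_sigma"
  by (simp add: L2_sigma_iff inner_shift_left L2_shift_grad_field test_function_shift del: add_uminus_conv_diff)

subsection \<open>Difference quotients\<close>

definition diff_quot :: "'n::finite \<Rightarrow> real \<Rightarrow> 'n vfield \<Rightarrow> 'n vfield" where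
  "diff_quot i h u = (1 / h) *\<^sub>R (L2_shift (h *\<^sub>R axis i 1) u - u)"

text \<open>Integration by parts in discrete form, exact for every step \<open>h\<close> because
  translations are isometries.\<close>

lemma inner_diff_quot_left: "inner (diff_quot i h u) v = - inner u (diff_quot i (- h) v)"
  by (simp add: diff_quot_def inner_diff_left inner_diff_right inner_shift_left divide_simps)

lemma diff_quot_commute: "diff_quot i h (diff_quot j k u) = diff_quot j k (diff_quot i h u)"
  by (simp add: diff_quot_def L2_shift_scaleR L2_shift_diff L2_shift_shift algebra_simps)

text \<open>Two discrete integrations by parts and the commutation of translations: the precursor of
  the exchange of mixed derivatives, valid without any second derivative.\<close>

lemma inner_diff_quot_diff_quot:
  "inner (diff_quot i h u) (diff_quot j k v) = inner (diff_quot j (- k) u) (diff_quot i (- h) v)"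
proof -
  have "inner (diff_quot i h u) (diff_quot j k v) = - inner u (diff_quot i (- h) (diff_quot j k v))"
    by (rule inner_diff_quot_left)
  also have "\<dots> = - inner u (diff_quot j k (diff_quot i (- h) v))"
    by (simp only: diff_quot_commute)
  also have "\<dots> = inner (diff_quot j (- k) u) (diff_quot i (- h) v)"
    by (simp add: inner_diff_quot_left)
  finally show ?thesis .
qed

lemma diff_quot_comp: "L2_comp i j (diff_quot k h u) = diff_quot k h (L2_comp i j u)"
  by (simp add: diff_quot_def L2_shift_comp
      linear_diff[OF bounded_linear.linear[OF bounded_linear_L2_comp]]
      linear_scale[OF bounded_linear.linear[OF bounded_linear_L2_comp]])

lemma test_function_directional:
  fixes \<phi> :: "real ^ 'n::finite \<Rightarrow> complex"
  assumes "test_function \<phi>"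
  shows "((\<lambda>s. \<phi> (x + s *\<^sub>R axis i 1)) has_vector_derivative partial_deriv i \<phi> (x + s *\<^sub>R axis i 1)) (at s)"
proof -
  let ?y = "x + s *\<^sub>R axis i 1 :: real ^ 'n"
  have D: "(\<phi> has_derivative frechet_derivative \<phi> (at ?y)) (at ?y)"
    by (rule has_derivative_frechet[OF test_function_differentiable[OF assms]])
  have "((\<lambda>s. x + s *\<^sub>R axis i 1 :: real ^ 'n) has_derivative (\<lambda>h. h *\<^sub>R axis i 1)) (at s)"
    by (auto intro!: derivative_eq_intros)
  from has_derivative_compose[OF this D]
  have "((\<lambda>s. \<phi> (x + s *\<^sub>R axis i 1)) has_derivative (\<lambda>h. frechet_derivative \<phi> (at ?y) (h *\<^sub>R axis i 1))) (at s)" .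
  moreover have "frechet_derivative \<phi> (at ?y) (h *\<^sub>R axis i 1) = h *\<^sub>R partial_deriv i \<phi> ?y" for h
    using linear_scale[OF has_derivative_linear[OF D]] by (simp add: partial_deriv_def)
  ultimately show ?thesis by (simp add: has_vector_derivative_def)
qed

lemma test_function_second_order:
  fixes \<phi> :: "real ^ 'n::finite \<Rightarrow> complex"
  assumes t: "test_function \<phi>"
  obtains B where "B \<ge> 0" "\<And>x h. norm (\<phi> (x + h *\<^sub>R axis i 1) - \<phi> x - h *\<^sub>R partial_deriv i \<phi> x) \<le> B * \<bar>h\<bar>\<^sup>2"
proof -
  let ?d = "partial_deriv i \<phi>"
  obtain B where B: "B > 0" "\<And>x. cmod (partial_deriv i ?d x) \<le> B"
    using test_function_bounded[OF test_function_partial_deriv[OF test_function_partial_deriv[OF t]]] by blast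
  have first: "norm (\<psi> (x + h *\<^sub>R axis i 1) - \<psi> x) \<le> C * \<bar>h\<bar>"
    if "test_function \<psi>" "\<And>s. \<bar>s\<bar> \<le> \<bar>h\<bar> \<Longrightarrow> cmod (partial_deriv i \<psi> (x + s *\<^sub>R axis i 1)) \<le> C" for \<psi> C h x
  proof -
    have "norm (\<psi> (x + h *\<^sub>R axis i 1) - \<psi> (x + 0 *\<^sub>R axis i 1)) \<le> C * norm (h - 0)"
    proof (rule differentiable_bound[where S = "{- \<bar>h\<bar>..\<bar>h\<bar>}" and f = "\<lambda>s. \<psi> (x + s *\<^sub>R axis i 1)"])
      show "((\<lambda>s. \<psi> (x + s *\<^sub>R axis i 1)) has_derivative (\<lambda>k. k *\<^sub>R partial_deriv i \<psi> (x + s *\<^sub>R axis i 1)))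
          (at s within {- \<bar>h\<bar>..\<bar>h\<bar>})" for s
        using test_function_directional[OF that(1), of x i s] unfolding has_vector_derivative_def
        by (rule has_derivative_at_withinI)
      show "onorm (\<lambda>k. k *\<^sub>R partial_deriv i \<psi> (x + s *\<^sub>R axis i 1)) \<le> C" if "s \<in> {- \<bar>h\<bar>..\<bar>h\<bar>}" for s
      proof (rule onorm_le)
        have "\<bar>s\<bar> \<le> \<bar>h\<bar>" using that by auto
        then show "norm (k *\<^sub>R partial_deriv i \<psi> (x + s *\<^sub>R axis i 1)) \<le> C * norm k" for k
          using \<open>\<And>s. \<bar>s\<bar> \<le> \<bar>h\<bar> \<Longrightarrow> cmod (partial_deriv i \<psi> (x + s *\<^sub>R axis i 1)) \<le> C\<close>[of s]
          by (auto simp: mult.commute[of C] intro: mult_left_mono)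
      qed
    qed auto
    then show ?thesis by simp
  qed
  have "norm (\<phi> (x + h *\<^sub>R axis i 1) - \<phi> x - h *\<^sub>R ?d x) \<le> B * \<bar>h\<bar>\<^sup>2" for x h
  proof -
    let ?f = "\<lambda>s. \<phi> (x + s *\<^sub>R axis i 1) - s *\<^sub>R ?d x"
    have "norm (?f h - ?f 0) \<le> (B * \<bar>h\<bar>) * norm (h - 0)"
    proof (rule differentiable_bound[where S = "{- \<bar>h\<bar>..\<bar>h\<bar>}" and f = ?f])
      show "(?f has_derivative (\<lambda>k. k *\<^sub>R (?d (x + s *\<^sub>R axis i 1) - ?d x))) (at s within {- \<bar>h\<bar>..\<bar>h\<bar>})" for s
      proof -
        have "(?f has_vector_derivative (?d (x + s *\<^sub>R axis i 1) - ?d x)) (at s)"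
          by (rule has_vector_derivative_diff[OF test_function_directional[OF t]])
             (auto intro!: derivative_eq_intros simp: has_vector_derivative_def)
        then show ?thesis unfolding has_vector_derivative_def by (rule has_derivative_at_withinI)
      qed
      show "onorm (\<lambda>k. k *\<^sub>R (?d (x + s *\<^sub>R axis i 1) - ?d x)) \<le> B * \<bar>h\<bar>" if "s \<in> {- \<bar>h\<bar>..\<bar>h\<bar>}" for s
      proof (rule onorm_le)
        have "norm (?d (x + s *\<^sub>R axis i 1) - ?d x) \<le> B * \<bar>s\<bar>"
          by (rule first[OF test_function_partial_deriv[OF t]]) (rule B(2))
        also have "\<dots> \<le> B * \<bar>h\<bar>" using that B(1) by (intro mult_left_mono) auto
        finally show "norm (k *\<^sub>R (?d (x + s *\<^sub>R axis i 1) - ?d x)) \<le> B * \<bar>h\<bar> * norm k" for k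
          by (simp add: mult.commute mult_left_mono)
      qed
    qed auto
    then show ?thesis by (simp add: power2_eq_square algebra_simps)
  qed
  with B(1) that[of B] show thesis by auto
qed

text \<open>The second-order Taylor error is uniform in \<open>x\<close>, and for
  \<open>\<bar>h\<bar> \<le> 1\<close> all functions involved are supported in one fixed box. So the
  L2 error is at most a multiple of \<bar>h\<bar> times the norm of the indicator of that
  box.\<close>

lemma diff_quot_test_field:
  fixes \<phi> :: "real ^ 'n::finite \<Rightarrow> complex"
  assumes t: "test_function \<phi>"
  shows "((\<lambda>h. diff_quot i h (test_field \<phi> c)) \<longlongrightarrow> test_field (partial_deriv i \<phi>) c) (at 0)"
proof -
  obtain B where B: "B \<ge> 0" "\<And>x h. norm (\<phi> (x + h *\<^sub>R axis i 1) - \<phi> x - h *\<^sub>R partial_deriv i \<phi> x) \<le> B * \<bar>h\<bar>\<^sup>2"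
    using test_function_second_order[OF t] by blast
  obtain K where K: "compact K" "\<And>x. x \<notin> K \<Longrightarrow> \<phi> x = 0"
    using t by (auto simp: test_function_def)
  obtain L where L: "compact L" "\<And>x. x \<notin> L \<Longrightarrow> partial_deriv i \<phi> x = 0"
    using test_function_partial_deriv[OF t, of i] by (auto simp: test_function_def)
  have "bounded (K \<union> L \<union> {x + y |x y. x \<in> K \<and> y \<in> cball 0 1})"
    using compact_imp_bounded[OF K(1)] compact_imp_bounded[OF L(1)]
      compact_imp_bounded[OF compact_sums[OF K(1) compact_cball[of 0 1]]] by simp
  then obtain b where ab: "K \<union> L \<union> {x + y |x y. x \<in> K \<and> y \<in> cball 0 1} \<subseteq> cbox (- b) b"
    using bounded_subset_cbox_symmetric by blast
  define a where "a = - b"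
  note ab = ab[folded a_def]
  define w where "w = (L2_class (\<lambda>x. indicator (cbox a b) x) :: (real ^ 'n, real) L2)"
  have ind: "integrable lebesgue (indicator (cbox a b) :: real ^ 'n \<Rightarrow> real)"
    by (rule integrable_real_indicator) (auto simp: emeasure_lborel_cbox_eq)
  have si: "square_integrable (\<lambda>x :: real ^ 'n. indicator (cbox a b) x :: real)"
  proof -
    have "(\<lambda>x. (norm (indicator (cbox a b) x :: real))\<^sup>2) = (indicator (cbox a b) :: real ^ 'n \<Rightarrow> real)"
      by (rule ext) (simp add: indicator_def)
    with ind show ?thesis
      unfolding square_integrable_def by (simp add: borel_measurable_integrable)
  qed
  have est: "norm (diff_quot i h (test_field \<phi> c) - test_field (partial_deriv i \<phi>) c) \<le> (B * norm c * \<bar>h\<bar>) * norm w"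
    if h: "h \<noteq> 0" "\<bar>h\<bar> \<le> 1" for h
  proof (rule norm_L2_le_AE)
    let ?a = "h *\<^sub>R axis i 1 :: real ^ 'n"
    let ?F = "test_field \<phi> c" and ?G = "test_field (partial_deriv i \<phi>) c"
    have ae: "AE x in lebesgue. L2_fun (diff_quot i h ?F - ?G) x
        = (1 / h) *\<^sub>R (\<phi> (x + ?a) *s c - \<phi> x *s c) - partial_deriv i \<phi> x *s c"
      using L2_fun_diff[of "diff_quot i h ?F" ?G] L2_fun_test_field[OF t, of c]
        L2_fun_test_field[OF test_function_partial_deriv[OF t], of i c]
        L2_fun_diff[of "L2_shift ?a ?F" ?F] L2_fun_scaleR[of "1 / h" "L2_shift ?a ?F - ?F"]
        L2_fun_shift[of ?a ?F] AE_shift[OF L2_fun_test_field[OF t, of c], of ?a]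
      by eventually_elim (simp add: diff_quot_def)
    show "AE x in lebesgue. norm (L2_fun (diff_quot i h ?F - ?G) x) \<le> (B * norm c * \<bar>h\<bar>) * norm (L2_fun w x)"
      using ae L2_fun_class[OF si]
    proof eventually_elim
      case (elim x)
      let ?z = "\<phi> (x + ?a) - \<phi> x - h *\<^sub>R partial_deriv i \<phi> x"
      have eq: "L2_fun (diff_quot i h ?F - ?G) x = (1 / h) *\<^sub>R (?z *s c)"
        unfolding elim(1) scaleR_smult_vec using h(1)
        by (simp add: vec_eq_iff scaleR_conv_of_real field_simps)
      show ?case
      proof (cases "x \<in> cbox a b")
        case True
        have "norm ((1 / h) *\<^sub>R (?z *s c)) = norm ?z * norm c / \<bar>h\<bar>"
          unfolding norm_scaleR norm_smult_vec by simp
        also have "\<dots> \<le> (B * \<bar>h\<bar>\<^sup>2) * norm c / \<bar>h\<bar>"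
          by (intro divide_right_mono mult_right_mono B(2)) auto
        also have "\<dots> = B * norm c * \<bar>h\<bar>" using h(1)
          by (simp add: power2_eq_square field_simps del: abs_mult_self_eq)
        finally show ?thesis using True elim(2) unfolding eq w_def by simp
      next
        case False
        then have "x \<notin> K" "x \<notin> L" using ab by auto
        moreover have "x + ?a \<notin> K"
        proof
          assume "x + ?a \<in> K"
          moreover have "- ?a \<in> cball 0 1" using h(2) by (simp add: norm_axis_1)
          ultimately have "\<exists>y z. x = y + z \<and> y \<in> K \<and> z \<in> cball 0 1"
            by (intro exI[of _ "x + ?a"] exI[of _ "- ?a"]) simp
          then have "x \<in> {x + y |x y. x \<in> K \<and> y \<in> cball 0 1}" by simp
          then show False using False ab by blast
        qed
        ultimately have "?z = 0" using K(2) L(2) by simp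
        then show ?thesis unfolding eq using B(1) by simp
      qed
    qed
  qed (use B(1) in auto)
  have "((\<lambda>h. (B * norm c * \<bar>h\<bar>) * norm w) \<longlongrightarrow> (B * norm c * \<bar>0\<bar>) * norm w) (at 0)"
    by (intro tendsto_intros)
  then have "((\<lambda>h. (B * norm c * \<bar>h\<bar>) * norm w) \<longlongrightarrow> 0) (at 0)" by simp
  then have "((\<lambda>h. diff_quot i h (test_field \<phi> c) - test_field (partial_deriv i \<phi>) c) \<longlongrightarrow> 0) (at 0)"
  proof (rule Lim_null_comparison[rotated])
    show "\<forall>\<^sub>F h in at 0. norm (diff_quot i h (test_field \<phi> c) - test_field (partial_deriv i \<phi>) c) \<le> (B * norm c * \<bar>h\<bar>) * norm w"
      unfolding eventually_at by (rule exI[of _ 1]) (auto intro!: est)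
  qed
  then show ?thesis by (simp add: LIM_zero_iff)
qed

section \<open>Density of test fields and strong convergence of difference quotients\<close>

definition test_span :: "'n::finite vfield set" where
  "test_span = span {test_field \<phi> c |\<phi> c. test_function \<phi>}"

lemma closure_subspace_real:
  fixes S :: "'a::real_normed_vector set"
  assumes S: "subspace S"
  shows "subspace (closure S)"
proof (rule subspaceI)
  show "0 \<in> closure S" using S subspace_0 closure_subset by blast
  show "x + y \<in> closure S" if xy: "x \<in> closure S" "y \<in> closure S" for x y
  proof -
    obtain a where a: "\<And>n. a n \<in> S" "a \<longlonglongrightarrow> x"
      using xy(1) unfolding closure_sequential by blast
    obtain b where b: "\<And>n. b n \<in> S" "b \<longlonglongrightarrow> y"
      using xy(2) unfolding closure_sequential by blast
    from a b have "\<And>n. a n + b n \<in> S" "(\<lambda>n. a n + b n) \<longlonglongrightarrow> x + y"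
      using S by (auto intro: subspace_add tendsto_add)
    then show ?thesis unfolding closure_sequential by (intro exI[of _ "\<lambda>n. a n + b n"]) simp
  qed
  show "c *\<^sub>R x \<in> closure S" if xy: "x \<in> closure S" for c x
  proof -
    obtain a where "\<And>n. a n \<in> S" "a \<longlonglongrightarrow> x"
      using xy unfolding closure_sequential by blast
    then have "\<And>n. c *\<^sub>R a n \<in> S" "(\<lambda>n. c *\<^sub>R a n) \<longlonglongrightarrow> c *\<^sub>R x"
      using S by (auto intro: subspace_scale tendsto_intros)
    then show ?thesis unfolding closure_sequential by (intro exI[of _ "\<lambda>n. c *\<^sub>R a n"]) simp
  qed
qed

lemma test_span_dense:
  fixes x :: "'n::finite vfield"
  assumes "e > 0"
  obtains w where "w \<in> test_span" "norm (x - w) < e"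
proof -
  have "x \<in> closure test_span"
  proof (rule orth_complement_trivial_imp_all)
    show "subspace (closure (test_span :: 'n vfield set))"
      unfolding test_span_def by (intro closure_subspace_real subspace_span)
    fix y :: "'n vfield" assume y: "\<And>v. v \<in> closure test_span \<Longrightarrow> inner y v = 0"
    have "test_field \<phi> c \<in> closure test_span" if "test_function \<phi>" for \<phi> and c :: "complex ^ 'n"
    proof -
      have "test_field \<phi> c \<in> test_span"
        unfolding test_span_def by (rule span_base) (use that in blast)
      then show ?thesis using closure_subset by blast
    qed
    with y show "y = 0" by (intro test_fields_total) blast
  qed simp
  then obtain w where "w \<in> test_span" "dist w x < e"
    using assms unfolding closure_approachable by blast
  then show thesis using that by (simp add: dist_norm norm_minus_commute)
qed

lemma filterlim_uminus_at_0: "filterlim uminus (at (0::real)) (at 0)"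
proof (rule filterlim_atI)
  have "((\<lambda>x::real. - x) \<longlongrightarrow> - 0) (at 0)" by (intro tendsto_intros)
  then show "(uminus \<longlongrightarrow> (0::real)) (at 0)" by simp
  show "\<forall>\<^sub>F x in at (0::real). - x \<noteq> 0" by (auto simp: eventually_at_filter)
qed

text \<open>Moving the translation to the test field reduces this to
  \<open>diff_quot_test_field\<close>. The derivative is needed at every \<open>s\<close>, not only
  at 0, since a mean value inequality along \<open>s\<close> follows.\<close>

lemma inner_shift_has_derivative:
  assumes w: "has_weak_deriv i u g" and v: "v \<in> test_span"
  shows "((\<lambda>s. inner (L2_shift (s *\<^sub>R axis i 1) u) v) has_real_derivative
    inner (L2_shift (s *\<^sub>R axis i 1) g) v) (at s)"
  using v unfolding test_span_def
proof (induction v rule: span_induct_alt)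
  case base
  then show ?case by simp
next
  case (step r x y)
  then obtain \<phi> c where x: "x = test_field \<phi> c" and t: "test_function \<phi>" by blast
  let ?e = "axis i 1 :: real ^ 'a"
  let ?\<psi> = "\<lambda>x. \<phi> (x + - (s *\<^sub>R ?e))"
  have t': "test_function ?\<psi>" by (rule test_function_shift[OF t])
  have sh: "L2_shift (- (s *\<^sub>R ?e)) x = test_field ?\<psi> c"
    unfolding x by (rule L2_shift_test_field[OF t])
  have quot: "(inner (L2_shift ((s + h) *\<^sub>R ?e) u) x - inner (L2_shift (s *\<^sub>R ?e) u) x) / h
      = - inner u (diff_quot i (- h) (test_field ?\<psi> c))" for h
  proof -
    have "inner (L2_shift ((s + h) *\<^sub>R ?e) u) x = inner (L2_shift (s *\<^sub>R ?e) (L2_shift (h *\<^sub>R ?e) u)) x"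
      by (simp add: L2_shift_shift scaleR_add_left)
    then have "(inner (L2_shift ((s + h) *\<^sub>R ?e) u) x - inner (L2_shift (s *\<^sub>R ?e) u) x) / h
        = inner (diff_quot i h u) (L2_shift (- (s *\<^sub>R ?e)) x)"
      by (simp add: diff_quot_def inner_shift_left[of "s *\<^sub>R ?e"] inner_diff_left)
    then show ?thesis by (simp only: sh inner_diff_quot_left)
  qed
  have "((\<lambda>h. - inner u (diff_quot i (- h) (test_field ?\<psi> c))) \<longlongrightarrow> - inner u (test_field (partial_deriv i ?\<psi>) c)) (at 0)"
    by (intro tendsto_intros filterlim_compose[OF diff_quot_test_field[OF t'] filterlim_uminus_at_0])
  moreover have "- inner u (test_field (partial_deriv i ?\<psi>) c) = inner (L2_shift (s *\<^sub>R ?e) g) x"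
    using w t' by (simp only: has_weak_deriv_iff inner_shift_left sh)
  ultimately have "((\<lambda>s. inner (L2_shift (s *\<^sub>R ?e) u) x) has_real_derivative
      inner (L2_shift (s *\<^sub>R ?e) g) x) (at s)"
    unfolding DERIV_def quot by simp
  then show ?case
    using step.IH by (auto simp: inner_add_right intro!: derivative_eq_intros)
qed

text \<open>Mean value inequality for the scalar function
  \<open>s \<mapsto> inner (L2_shift (s *\<^sub>R axis i 1) u) v\<close>, whose derivative is
  bounded by \<open>norm g * norm v\<close> as translates of \<open>g\<close> keep their norm;
  density of the test fields then removes \<open>v\<close>.\<close>

lemma norm_diff_quot_le:
  fixes u g :: "'n::finite vfield"
  assumes w: "has_weak_deriv i u g" and h: "h \<noteq> 0"
  shows "norm (diff_quot i h u) \<le> norm g"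
proof -
  let ?e = "axis i 1 :: real ^ 'n" and ?D = "diff_quot i h u"
  have le: "inner ?D v \<le> norm g * norm v" if v: "v \<in> test_span" for v
  proof -
    have "norm (inner (L2_shift (h *\<^sub>R ?e) u) v - inner (L2_shift (0 *\<^sub>R ?e) u) v) \<le> (norm g * norm v) * norm (h - 0)"
    proof (rule field_differentiable_bound[OF convex_UNIV])
      show "((\<lambda>s. inner (L2_shift (s *\<^sub>R ?e) u) v) has_field_derivative inner (L2_shift (s *\<^sub>R ?e) g) v) (at s within UNIV)" for s
        using inner_shift_has_derivative[OF w v, of s] by simp
      show "norm (inner (L2_shift (s *\<^sub>R ?e) g) v) \<le> norm g * norm v" for s
        using Cauchy_Schwarz_ineq2[of "L2_shift (s *\<^sub>R ?e) g" v] by simp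
    qed auto
    then have "\<bar>inner (L2_shift (h *\<^sub>R ?e) u - u) v\<bar> \<le> norm g * norm v * \<bar>h\<bar>"
      by (simp add: inner_diff_left)
    moreover have "inner ?D v \<le> \<bar>inner (L2_shift (h *\<^sub>R ?e) u - u) v\<bar> / \<bar>h\<bar>"
    proof -
      have "inner ?D v = inner (L2_shift (h *\<^sub>R ?e) u - u) v / h" by (simp add: diff_quot_def)
      also have "\<dots> \<le> \<bar>inner (L2_shift (h *\<^sub>R ?e) u - u) v / h\<bar>" by (rule abs_ge_self)
      finally show ?thesis by (simp only: abs_divide)
    qed
    moreover have "\<bar>inner (L2_shift (h *\<^sub>R ?e) u - u) v\<bar> / \<bar>h\<bar> \<le> norm g * norm v"
      using calculation(1) h by (simp add: divide_le_eq)
    ultimately show ?thesis by linarith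
  qed
  have "norm ?D * norm ?D \<le> norm g * norm ?D"
  proof (rule field_le_epsilon)
    fix e :: real assume e: "e > 0"
    define d where "d = e / (norm ?D + norm g + 1)"
    have pos: "norm ?D + norm g + 1 > 0" by (simp add: add_nonneg_pos)
    then have d: "d > 0" using e by (simp add: d_def)
    obtain v where v: "v \<in> test_span" "norm (?D - v) < d" using test_span_dense[OF d] by blast
    have "norm ?D * norm ?D = inner ?D v + inner ?D (?D - v)"
      by (simp add: inner_diff_right power2_norm_eq_inner[symmetric] power2_eq_square)
    also have "\<dots> \<le> norm g * norm v + norm ?D * norm (?D - v)"
      by (intro add_mono le[OF v(1)] norm_cauchy_schwarz)
    also have "norm v \<le> norm ?D + norm (?D - v)"
      using norm_triangle_ineq4[of ?D "?D - v"] by simp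
    then have "norm g * norm v + norm ?D * norm (?D - v) \<le> norm g * norm ?D + (norm g + norm ?D) * norm (?D - v)"
      using mult_left_mono[of "norm v" "norm ?D + norm (?D - v)" "norm g"] by (simp add: algebra_simps)
    also have "\<dots> \<le> norm g * norm ?D + (norm g + norm ?D + 1) * d"
    proof -
      have "(norm g + norm ?D) * norm (?D - v) \<le> (norm g + norm ?D) * d"
        using v(2) by (intro mult_left_mono) auto
      then show ?thesis using d by (simp add: algebra_simps)
    qed
    also have "(norm g + norm ?D + 1) * d = e" using pos by (simp add: d_def add_ac)
    finally show "norm ?D * norm ?D \<le> norm g * norm ?D + e" .
  qed
  then show ?thesis by (rule norm_le_of_square_le) auto
qed

text \<open>Weak convergence together with \<open>norm_diff_quot_le\<close> forces norm convergence.\<close>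

lemma diff_quot_tendsto:
  fixes u g :: "'n::finite vfield"
  assumes w: "has_weak_deriv i u g"
  shows "((\<lambda>h. diff_quot i h u) \<longlongrightarrow> g) (at 0)"
proof (rule tendstoI)
  fix e :: real assume e: "e > 0"
  \<comment> \<open>Three errors of size at most \<open>(norm g + 1) * d\<close> enter the expansion
    of the square below; this choice leaves \<open>e^2 / 2\<close>.\<close>
  define d where "d = e\<^sup>2 / (8 * (norm g + 1))"
  have pos: "norm g + 1 > 0" by (simp add: add_nonneg_pos)
  then have d: "d > 0" using e by (simp add: d_def)
  obtain v where v: "v \<in> test_span" "norm (g - v) < d" using test_span_dense[OF d] by blast
  have "((\<lambda>h. inner (diff_quot i h u) v) \<longlongrightarrow> inner g v) (at 0)"
    using inner_shift_has_derivative[OF w v(1), of 0] unfolding DERIV_def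
    by (simp add: diff_quot_def inner_diff_left)
  then have "\<forall>\<^sub>F h in at 0. inner g v - d < inner (diff_quot i h u) v"
    using d by (intro order_tendstoD(1)) auto
  moreover have "\<forall>\<^sub>F h in at (0::real). h \<noteq> 0" by (simp add: eventually_at_filter)
  ultimately show "\<forall>\<^sub>F h in at 0. dist (diff_quot i h u) g < e"
  proof eventually_elim
    case (elim h)
    let ?D = "diff_quot i h u"
    have n: "norm ?D \<le> norm g" by (rule norm_diff_quot_le[OF w elim(2)])
    have g: "inner g v \<ge> (norm g)\<^sup>2 - norm g * d"
    proof -
      have "inner g (g - v) \<le> norm g * norm (g - v)" by (rule norm_cauchy_schwarz)
      also have "\<dots> \<le> norm g * d" using v(2) by (intro mult_left_mono) auto
      finally show ?thesis by (simp add: inner_diff_right power2_norm_eq_inner)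
    qed
    have D: "inner ?D g \<ge> inner ?D v - norm g * d"
    proof -
      have "- inner ?D (g - v) \<le> norm ?D * norm (g - v)"
        using Cauchy_Schwarz_ineq2[of ?D "g - v"] by linarith
      also have "\<dots> \<le> norm g * d" using v(2) n by (intro mult_mono) auto
      finally show ?thesis by (simp add: inner_diff_right)
    qed
    have "(norm (?D - g))\<^sup>2 = (norm ?D)\<^sup>2 - 2 * inner ?D g + (norm g)\<^sup>2"
      using norm_diff_scaleR_square[of ?D 1 g] by simp
    also have "\<dots> \<le> 2 * (norm g)\<^sup>2 - 2 * inner ?D g"
      using power_mono[OF n, of 2] by simp
    also have "\<dots> < 4 * (norm g + 1) * d"
      using g D elim(1) d by (simp add: algebra_simps)
    also have "\<dots> = e\<^sup>2 / 2"
    proof -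
      have "4 * a * (b / (8 * a)) = b / 2" if "a > 0" for a b :: real
        using that by (simp add: field_simps)
      from this[OF pos] show ?thesis unfolding d_def .
    qed
    also have "\<dots> \<le> e\<^sup>2" by simp
    finally show ?case using e by (simp add: dist_norm power_less_imp_less_base)
  qed
qed

text \<open>In this form weak differentiability passes through every bounded linear operator that
  commutes with translations, in particular through component maps and the Helmholtz
  projection.\<close>

lemma has_weak_deriv_iff_diff_quot:
  fixes u g :: "'n::finite vfield"
  shows "has_weak_deriv i u g \<longleftrightarrow> ((\<lambda>h. diff_quot i h u) \<longlongrightarrow> g) (at 0)"
proof
  assume lim: "((\<lambda>h. diff_quot i h u) \<longlongrightarrow> g) (at 0)"
  show "has_weak_deriv i u g"
    unfolding has_weak_deriv_iff
  proof (intro allI impI)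
    fix \<phi> :: "real ^ 'n \<Rightarrow> complex" and c assume t: "test_function \<phi>"
    have "((\<lambda>h. inner (diff_quot i h u) (test_field \<phi> c)) \<longlongrightarrow> inner g (test_field \<phi> c)) (at 0)"
      by (intro tendsto_intros lim)
    moreover have "((\<lambda>h. inner (diff_quot i h u) (test_field \<phi> c)) \<longlongrightarrow> - inner u (test_field (partial_deriv i \<phi>) c)) (at 0)"
      unfolding inner_diff_quot_left
      by (intro tendsto_intros filterlim_compose[OF diff_quot_test_field[OF t] filterlim_uminus_at_0])
    ultimately have "inner g (test_field \<phi> c) = - inner u (test_field (partial_deriv i \<phi>) c)"
      by (rule tendsto_unique[OF at_neq_bot])
    then show "inner u (test_field (partial_deriv i \<phi>) c) = - inner g (test_field \<phi> c)" by simp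
  qed
qed (rule diff_quot_tendsto)

lemma has_weak_deriv_test_field:
  "test_function \<phi> \<Longrightarrow> has_weak_deriv i (test_field \<phi> c) (test_field (partial_deriv i \<phi>) c)"
  unfolding has_weak_deriv_iff_diff_quot by (rule diff_quot_test_field)

lemma test_field_H1: "test_function \<phi> \<Longrightarrow> test_field \<phi> c \<in> H1"
  by (rule H1I) (rule has_weak_deriv_test_field)

lemma has_weak_deriv_comp:
  assumes "has_weak_deriv i u g"
  shows "has_weak_deriv i (L2_comp k j u) (L2_comp k j g)"
  using bounded_linear.tendsto[OF bounded_linear_L2_comp[of k j] assms[unfolded has_weak_deriv_iff_diff_quot]]
  unfolding has_weak_deriv_iff_diff_quot by (simp add: diff_quot_comp)

text \<open>For smooth fields these are two integrations by parts; difference quotients commute, so no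
  approximation is needed.\<close>

lemma inner_weak_deriv_swap:
  assumes "has_weak_deriv i a ai" "has_weak_deriv j a aj" "has_weak_deriv i b bi" "has_weak_deriv j b bj"
  shows "inner ai bj = inner aj bi"
proof -
  have "((\<lambda>h. inner (diff_quot i h a) (diff_quot j h b)) \<longlongrightarrow> inner ai bj) (at 0)"
    by (intro tendsto_intros diff_quot_tendsto assms)
  moreover have "((\<lambda>h. inner (diff_quot i h a) (diff_quot j h b)) \<longlongrightarrow> inner aj bi) (at 0)"
    unfolding inner_diff_quot_diff_quot[of i _ a j]
    by (intro tendsto_intros filterlim_compose[OF diff_quot_tendsto filterlim_uminus_at_0] assms)
  ultimately show ?thesis by (rule tendsto_unique[OF at_neq_bot])
qed

section \<open>The Helmholtz projection\<close>

definition helmholtz :: "'n::finite vfield \<Rightarrow> 'n vfield" where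
  "helmholtz = orth_proj L2_sigma"

lemmas helmholtz_in = orth_proj_in[OF subspace_L2_sigma closed_L2_sigma, folded helmholtz_def]
lemmas helmholtz_orth = orth_proj_orth[OF subspace_L2_sigma closed_L2_sigma, folded helmholtz_def]
lemmas helmholtz_inner = orth_proj_inner[OF subspace_L2_sigma closed_L2_sigma, folded helmholtz_def]
lemmas helmholtz_id = orth_proj_id[OF subspace_L2_sigma closed_L2_sigma, folded helmholtz_def]
lemmas bounded_linear_helmholtz =
  orth_proj_bounded_linear[OF subspace_L2_sigma closed_L2_sigma, folded helmholtz_def]
lemma helmholtz_shift: "helmholtz (L2_shift a u) = L2_shift a (helmholtz u)"
  unfolding helmholtz_def
proof (rule orth_proj_unique[OF subspace_L2_sigma], fold helmholtz_def)
  show "L2_shift a (helmholtz u) \<in> L2_sigma" by (intro L2_shift_L2_sigma helmholtz_in)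
  show "inner (L2_shift a u - L2_shift a (helmholtz u)) v = 0" if "v \<in> L2_sigma" for v
    using helmholtz_orth[OF L2_shift_L2_sigma[OF that, of "- a"], of u]
    by (simp add: L2_shift_diff[symmetric] inner_shift_left)
qed

lemma helmholtz_scaleC: "helmholtz (c *\<^sub>C u) = c *\<^sub>C helmholtz u"
  unfolding helmholtz_def
proof (rule orth_proj_unique[OF subspace_L2_sigma], fold helmholtz_def)
  show "c *\<^sub>C helmholtz u \<in> L2_sigma" by (intro scaleC_L2_sigma helmholtz_in)
  show "inner (c *\<^sub>C u - c *\<^sub>C helmholtz u) v = 0" if "v \<in> L2_sigma" for v
    using helmholtz_orth[OF scaleC_L2_sigma[OF that, of "cnj c"], of u]
    by (simp add: L2_scaleC_diff_right[symmetric] inner_scaleC_left)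
qed

lemma has_weak_deriv_helmholtz:
  assumes "has_weak_deriv i u g"
  shows "has_weak_deriv i (helmholtz u) (helmholtz g)"
proof -
  interpret bounded_linear helmholtz by (rule bounded_linear_helmholtz)
  have "diff_quot i h (helmholtz u) = helmholtz (diff_quot i h u)" for h
    by (simp add: diff_quot_def helmholtz_shift diff scaleR)
  then show ?thesis
    using tendsto[OF assms[unfolded has_weak_deriv_iff_diff_quot]]
    by (simp add: has_weak_deriv_iff_diff_quot)
qed

lemma helmholtz_H1_sigma:
  assumes "u \<in> H1"
  shows "helmholtz u \<in> H1_sigma"
  unfolding H1_sigma_eq
proof
  show "helmholtz u \<in> H1"
    by (rule H1I) (rule has_weak_deriv_helmholtz[OF H1_has_weak_deriv[OF assms]])
qed (rule helmholtz_in)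

text \<open>Makes \<open>stokes_op\<close> single-valued. A solenoidal \<open>h\<close> does not
  distinguish a test field from its projection, and the latter belongs to
  \<open>H1_sigma\<close>.\<close>

lemma H1_sigma_total:
  fixes h :: "'n::finite vfield"
  assumes h: "h \<in> L2_sigma" and orth: "\<And>v. v \<in> H1_sigma \<Longrightarrow> inner h v = 0"
  shows "h = 0"
proof (rule test_fields_total)
  fix \<phi> :: "real ^ 'n \<Rightarrow> complex" and c assume t: "test_function \<phi>"
  have "inner h (test_field \<phi> c) = inner h (helmholtz (test_field \<phi> c))"
    using helmholtz_inner[OF h, of "test_field \<phi> c"] by (simp add: inner_commute)
  also have "\<dots> = 0" by (intro orth helmholtz_H1_sigma test_field_H1 t)
  finally show "inner h (test_field \<phi> c) = 0" .
qed

lemma inner_L2_comp_adjoint: "inner (L2_comp k j u) v = inner u (L2_comp j k v)"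
  unfolding inner_L2_eq
proof (rule integral_cong_AE)
  show "AE x in lebesgue. inner (L2_fun (L2_comp k j u) x) (L2_fun v x) = inner (L2_fun u x) (L2_fun (L2_comp j k v) x)"
    using L2_fun_comp[of k j u] L2_fun_comp[of j k v]
    by eventually_elim (simp add: inner_axis inner_axis')
qed measurable

lemma L2_comp_test_field:
  assumes "test_function \<phi>"
  shows "L2_comp j k (test_field \<phi> c) = test_field \<phi> (axis j (c $ k))"
  by (rule L2_eqI)
    (use L2_fun_comp[of j k "test_field \<phi> c"] L2_fun_test_field[OF assms, of c]
      L2_fun_test_field[OF assms, of "axis j (c $ k)"]
     in \<open>eventually_elim, simp add: vec_eq_iff axis_def\<close>)

lemma L2_comp_grad_field:
  assumes "test_function \<phi>"
  shows "L2_comp k j (grad_field \<phi>) = test_field (partial_deriv j \<phi>) (axis k 1)"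
  by (rule L2_eqI)
    (use L2_fun_comp[of k j "grad_field \<phi>"] L2_fun_grad_field[OF assms]
      L2_fun_test_field[OF test_function_partial_deriv[OF assms], of j "axis k 1"]
     in \<open>eventually_elim, simp add: vec_eq_iff axis_def\<close>)

text \<open>The scalar divergence, stored in slot \<open>k\<close> of a field so that the calculus
  of vector fields applies; the choice of \<open>k\<close> is immaterial.\<close>

definition weak_div :: "'n::finite \<Rightarrow> 'n vfield \<Rightarrow> 'n vfield" where
  "weak_div k u = (\<Sum>i\<in>UNIV. L2_comp k i (weak_deriv i u))"

text \<open>After integration by parts the test field becomes the gradient of a test function,
  scaled by \<open>c $ k\<close>, the one component of \<open>c\<close> that slot \<open>k\<close>
  sees; such gradients are orthogonal to \<open>u\<close>.\<close>

lemma weak_div_H1_sigma: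
  fixes u :: "'n::finite vfield"
  assumes u: "u \<in> H1_sigma"
  shows "weak_div k u = 0"
proof (rule test_fields_total)
  fix \<phi> :: "real ^ 'n \<Rightarrow> complex" and c :: "complex ^ 'n" assume t: "test_function \<phi>"
  note td = test_function_partial_deriv[OF t]
  have "inner (L2_comp k i (weak_deriv i u)) (test_field \<phi> c)
      = - inner (L2_comp k i u) (L2_comp k i (c $ k *\<^sub>C grad_field \<phi>))" for i
  proof -
    have "has_weak_deriv i (L2_comp k i u) (L2_comp k i (weak_deriv i u))"
      using u by (intro has_weak_deriv_comp H1_has_weak_deriv) (simp add: H1_sigma_eq)
    then have "inner (L2_comp k i (weak_deriv i u)) (test_field \<phi> c)
        = - inner (L2_comp k i u) (test_field (partial_deriv i \<phi>) c)"
      using t by (simp add: has_weak_deriv_iff)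
    also have "inner (L2_comp k i u) (test_field (partial_deriv i \<phi>) c)
        = inner u (test_field (partial_deriv i \<phi>) (axis i (c $ k)))"
      by (simp add: inner_L2_comp_adjoint L2_comp_test_field td)
    also have "\<dots> = inner (L2_comp k i u) (L2_comp k i (c $ k *\<^sub>C grad_field \<phi>))"
    proof -
      have "L2_comp k i (c $ k *\<^sub>C grad_field \<phi>) = test_field (partial_deriv i \<phi>) (c $ k *s axis k 1)"
        by (simp add: L2_comp_scaleC L2_comp_grad_field t test_field_scaleC td)
      then show ?thesis
        by (simp add: inner_L2_comp_adjoint L2_comp_test_field td)
    qed
    finally show ?thesis .
  qed
  then have "inner (weak_div k u) (test_field \<phi> c)
      = - (\<Sum>i\<in>UNIV. inner (L2_comp k i u) (L2_comp k i (c $ k *\<^sub>C grad_field \<phi>)))"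
    by (simp add: weak_div_def inner_sum_left sum_negf)
  also have "\<dots> = - inner u (c $ k *\<^sub>C grad_field \<phi>)"
    by (simp add: inner_L2_sum_comp[of u _ k])
  also have "\<dots> = 0"
    using u t by (simp add: grad_field_scaleC H1_sigma_eq L2_sigma_iff test_function_smult)
  finally show "inner (weak_div k u) (test_field \<phi> c) = 0" .
qed

text \<open>The field with \<partial>_i \<phi> in slot \<open>j\<close> and -\<partial>_j \<phi> in
  slot \<open>i\<close> is solenoidal because mixed derivatives can be exchanged. Orthogonality of
  \<open>g\<close> to it is the claimed symmetry in weak form.\<close>

lemma curl_free:
  fixes g :: "'n::finite vfield" and k :: 'n
  assumes g: "g \<in> H1" and orth: "\<And>v. v \<in> L2_sigma \<Longrightarrow> inner g v = 0"
  shows "L2_comp k j (weak_deriv i g) = L2_comp k i (weak_deriv j g)"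
proof -
  have "L2_comp k j (weak_deriv i g) - L2_comp k i (weak_deriv j g) = 0"
  proof (rule test_fields_total)
    fix \<phi> :: "real ^ 'n \<Rightarrow> complex" and c :: "complex ^ 'n" assume t: "test_function \<phi>"
    note td = test_function_partial_deriv[OF t]
    have 1: "inner (L2_comp k j (weak_deriv i g)) (test_field \<phi> c)
        = - inner g (test_field (partial_deriv i \<phi>) (axis j (c $ k)))" for i j
    proof -
      have "has_weak_deriv i (L2_comp k j g) (L2_comp k j (weak_deriv i g))"
        by (intro has_weak_deriv_comp H1_has_weak_deriv g)
      then have "inner (L2_comp k j (weak_deriv i g)) (test_field \<phi> c)
          = - inner (L2_comp k j g) (test_field (partial_deriv i \<phi>) c)"
        using t by (simp add: has_weak_deriv_iff)
      then show ?thesis by (simp add: inner_L2_comp_adjoint L2_comp_test_field td)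
    qed
    let ?T = "\<lambda>i j. test_field (partial_deriv i \<phi>) (axis j (c $ k))"
    have "?T i j - ?T j i \<in> L2_sigma"
      unfolding L2_sigma_iff
    proof (intro allI impI)
      fix \<psi> :: "real ^ 'n \<Rightarrow> complex" assume s: "test_function \<psi>"
      have 2: "inner (?T i j) (grad_field \<psi>)
          = inner (test_field (partial_deriv i \<phi>) (axis k (c $ k))) (test_field (partial_deriv j \<psi>) (axis k 1))" for i j
      proof -
        have "?T i j = L2_comp j k (test_field (partial_deriv i \<phi>) (axis k (c $ k)))"
          by (simp add: L2_comp_test_field td)
        then show ?thesis by (simp add: inner_L2_comp_adjoint L2_comp_grad_field s)
      qed
      have "inner (test_field (partial_deriv i \<phi>) (axis k (c $ k))) (test_field (partial_deriv j \<psi>) (axis k 1))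
          = inner (test_field (partial_deriv j \<phi>) (axis k (c $ k))) (test_field (partial_deriv i \<psi>) (axis k 1))"
        by (rule inner_weak_deriv_swap[OF has_weak_deriv_test_field[OF t] has_weak_deriv_test_field[OF t]
              has_weak_deriv_test_field[OF s] has_weak_deriv_test_field[OF s]])
      then show "inner (?T i j - ?T j i) (grad_field \<psi>) = 0"
        by (simp add: inner_diff_left 2)
    qed
    from orth[OF this] show "inner (L2_comp k j (weak_deriv i g) - L2_comp k i (weak_deriv j g)) (test_field \<phi> c) = 0"
      by (simp add: inner_diff_left inner_diff_right 1)
  qed
  then show ?thesis by simp
qed

text \<open>For \<open>g = w - helmholtz w\<close> one has \<partial>_i g_j = \<partial>_j g_i.
  Replacing one factor of \<bar>\<nabla>g\<bar>^2 by its transpose and exchanging derivatives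
  between the two factors leaves \<bar>div g\<bar>^2, and div g = div w. This exact identity is what
  takes the place of a pressure estimate.\<close>

lemma helmholtz_complement_grad:
  fixes w :: "'n::finite vfield"
  assumes w: "w \<in> H1"
  shows "(\<Sum>i\<in>UNIV. (norm (weak_deriv i (w - helmholtz w)))\<^sup>2) = (norm (weak_div k w))\<^sup>2"
proof -
  define g where "g = w - helmholtz w"
  have hw: "helmholtz w \<in> H1" "helmholtz w \<in> H1_sigma" using helmholtz_H1_sigma[OF w] by (auto simp: H1_sigma_eq)
  have g: "g \<in> H1" using w hw by (simp add: g_def H1_diff)
  have orth: "inner g v = 0" if "v \<in> L2_sigma" for v
    unfolding g_def by (rule helmholtz_orth[OF that])
  have d: "has_weak_deriv i (L2_comp k j g) (L2_comp k j (weak_deriv i g))" for i j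
    by (intro has_weak_deriv_comp H1_has_weak_deriv g)
  have "(\<Sum>i\<in>UNIV. (norm (weak_deriv i g))\<^sup>2)
      = (\<Sum>i\<in>UNIV. \<Sum>j\<in>UNIV. inner (L2_comp k j (weak_deriv i g)) (L2_comp k j (weak_deriv i g)))"
    unfolding power2_norm_eq_inner by (intro sum.cong[OF refl] inner_L2_sum_comp)
  also have "\<dots> = (\<Sum>i\<in>UNIV. \<Sum>j\<in>UNIV. inner (L2_comp k j (weak_deriv i g)) (L2_comp k i (weak_deriv j g)))"
    by (intro sum.cong[OF refl] arg_cong2[where f = inner, OF refl] curl_free[OF g orth])
  also have "\<dots> = (\<Sum>i\<in>UNIV. \<Sum>j\<in>UNIV. inner (L2_comp k j (weak_deriv j g)) (L2_comp k i (weak_deriv i g)))"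
    by (intro sum.cong[OF refl] inner_weak_deriv_swap[OF d d d d])
  also have "\<dots> = (norm (weak_div k g))\<^sup>2"
    unfolding power2_norm_eq_inner weak_div_def inner_sum_right unfolding inner_sum_left by (rule refl)
  also have "weak_div k g = weak_div k w - weak_div k (helmholtz w)"
  proof -
    have "L2_comp k i (weak_deriv i (w - helmholtz w))
        = L2_comp k i (weak_deriv i w) - L2_comp k i (weak_deriv i (helmholtz w))" for i
      using linear_diff[OF bounded_linear.linear[OF bounded_linear_L2_comp]] weak_deriv_diff[OF w hw(1)] by metis
    then show ?thesis unfolding weak_div_def g_def by (simp add: sum_subtractf)
  qed
  also have "weak_div k (helmholtz w) = 0" by (rule weak_div_H1_sigma[OF hw(2)])
  finally show ?thesis by (simp add: g_def)
qed

section \<open>The form and the resolvent\<close>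

text \<open>A tuple of fields indexed by the direction of differentiation; the product inner product
  of \<open>'n vfield ^ 'n\<close> then gives the full gradient norm without further
  definitions.\<close>

definition grad :: "'n::finite vfield \<Rightarrow> 'n vfield ^ 'n" where
  "grad u = (\<chi> \<alpha>. weak_deriv \<alpha> u)"

definition vscaleC :: "complex \<Rightarrow> 'n::finite vfield ^ 'n \<Rightarrow> 'n vfield ^ 'n" where
  "vscaleC c G = (\<chi> \<alpha>. c *\<^sub>C G $ \<alpha>)"

lemma grad_zero: "grad 0 = 0"
  by (simp add: grad_def vec_eq_iff weak_deriv_zero)

lemma grad_add: "u \<in> H1 \<Longrightarrow> v \<in> H1 \<Longrightarrow> grad (u + v) = grad u + grad v"
  by (simp add: grad_def vec_eq_iff weak_deriv_add)

lemma grad_diff: "u \<in> H1 \<Longrightarrow> v \<in> H1 \<Longrightarrow> grad (u - v) = grad u - grad v"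
  by (simp add: grad_def vec_eq_iff weak_deriv_diff)

lemma grad_scaleR: "u \<in> H1 \<Longrightarrow> grad (r *\<^sub>R u) = r *\<^sub>R grad u"
  by (simp add: grad_def vec_eq_iff weak_deriv_scaleR)

lemma grad_scaleC: "u \<in> H1 \<Longrightarrow> grad (c *\<^sub>C u) = vscaleC c (grad u)"
  by (simp add: grad_def vscaleC_def vec_eq_iff weak_deriv_scaleC)

lemma norm_vec_square: "(norm (G :: 'b::real_inner ^ 'n))\<^sup>2 = (\<Sum>\<alpha>\<in>UNIV. (norm (G $ \<alpha>))\<^sup>2)"
  by (simp add: power2_norm_eq_inner inner_vec_def)

lemma norm_vec_le_sum: "norm (G :: 'b::real_inner ^ 'n) \<le> (\<Sum>\<alpha>\<in>UNIV. norm (G $ \<alpha>))"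
  unfolding norm_vec_def by (rule L2_set_le_sum) simp

lemma norm_vec_le_card:
  fixes K :: real
  assumes "\<And>\<alpha>. norm (G $ \<alpha>) \<le> K"
  shows "norm (G :: 'b::real_inner ^ 'n::finite) \<le> CARD('n) * K"
  using norm_vec_le_sum[of G] sum_bounded_above[of UNIV "\<lambda>\<alpha>. norm (G $ \<alpha>)" K] assms by simp

lemma vscaleC_add: "vscaleC c (G + H) = vscaleC c G + vscaleC c H"
  by (simp add: vscaleC_def vec_eq_iff L2_scaleC_add_right)

lemma vscaleC_diff: "vscaleC c (G - H) = vscaleC c G - vscaleC c H"
  by (simp add: vscaleC_def vec_eq_iff L2_scaleC_diff_right)

lemma vscaleC_scaleR: "vscaleC c (r *\<^sub>R G) = r *\<^sub>R vscaleC c G"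
  by (simp add: vscaleC_def vec_eq_iff L2_scaleC_scaleR)

lemma norm_vscaleC [simp]: "norm (vscaleC c G) = cmod c * norm G"
  by (simp add: norm_vec_def vscaleC_def L2_set_right_distrib)

lemma bounded_linear_vscaleC: "bounded_linear (vscaleC c)"
  by (rule bounded_linear_intro[where K = "cmod c"]) (simp_all add: vscaleC_add vscaleC_scaleR)

lemma inner_vscaleC_left: "inner (vscaleC c G) H = inner G (vscaleC (cnj c) H)"
  by (simp add: inner_vec_def vscaleC_def inner_scaleC_left)

lemma inner_scaleC_Re_Im: "inner u (c *\<^sub>C v) = Re c * inner u v + Im c * inner u (\<i> *\<^sub>C v)"
proof -
  have c: "c = of_real (Re c) + of_real (Im c) * \<i>" by (simp add: complex_eq_iff)
  have "c *\<^sub>C v = Re c *\<^sub>R v + Im c *\<^sub>R (\<i> *\<^sub>C v)"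
    unfolding L2_scaleC_of_real[symmetric] L2_scaleC_scaleC L2_scaleC_add_left[symmetric]
    by (rule arg_cong[OF c])
  then show ?thesis by (simp add: inner_add_right)
qed

lemma inner_vscaleC_Re_Im: "inner G (vscaleC c H) = Re c * inner G H + Im c * inner G (vscaleC \<i> H)"
  by (simp add: inner_vec_def vscaleC_def inner_scaleC_Re_Im[of _ c] sum.distrib sum_distrib_left)

lemma scaleC_self_inner: "inner (l *\<^sub>C u) (z *\<^sub>C u) = Re (l * cnj z) * (norm u)\<^sup>2"
proof -
  have i0: "inner u (\<i> *\<^sub>C u) = 0"
    using inner_scaleC_left[of \<i> u u] by (simp add: L2_scaleC_minus_left inner_commute)
  have "inner (l *\<^sub>C u) (z *\<^sub>C u) = inner u ((cnj l * z) *\<^sub>C u)" by (simp add: inner_scaleC_left)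
  also have "\<dots> = Re (cnj l * z) * (norm u)\<^sup>2"
    by (simp add: inner_scaleC_Re_Im[of _ "cnj l * z"] i0 power2_norm_eq_inner)
  finally show ?thesis by simp
qed

subsection \<open>The coefficient operator\<close>

text \<open>The coefficient tensor as one bounded operator on gradient tuples; row \<alpha> of the
  result is the flux that is paired with the \<alpha>-th derivative of the test field.\<close>

definition stokes_mult :: "'n::finite coeffs \<Rightarrow> 'n vfield ^ 'n \<Rightarrow> 'n vfield ^ 'n" where
  "stokes_mult \<mu> G = (\<chi> \<alpha>. \<Sum>\<beta>\<in>UNIV. \<Sum>i\<in>UNIV. \<Sum>j\<in>UNIV. L2_smult (\<mu> \<alpha> \<beta> i j) (L2_comp i j (G $ \<beta>)))"

definition mat_rows :: "'n::finite mfield \<Rightarrow> 'n vfield ^ 'n" where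
  "mat_rows F = (\<chi> \<alpha>. L2_mult (\<lambda>x A. A $ \<alpha>) F)"

lemma bounded_multiplier_nth: "bounded_multiplier 1 (\<lambda>x (A :: complex ^ 'n ^ 'n). A $ \<alpha>)"
  by (rule bounded_multiplier_const)
     (auto intro: linearI simp: Finite_Cartesian_Product.norm_nth_le)

lemma L2_fun_mat_rows: "AE x in lebesgue. L2_fun (mat_rows F $ \<alpha>) x = L2_fun F x $ \<alpha>"
  unfolding mat_rows_def using L2_fun_mult[OF bounded_multiplier_nth, of \<alpha> F] by simp

lemma norm_mat_rows_le: "norm (mat_rows F :: 'n::finite vfield ^ 'n) \<le> CARD('n) * norm F"
proof (rule norm_vec_le_card)
  show "norm (mat_rows F $ \<alpha>) \<le> norm F" for \<alpha>
    using norm_L2_mult_le[OF bounded_multiplier_nth, of \<alpha> F] by (simp add: mat_rows_def)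
qed

definition vcinner :: "'n::finite vfield ^ 'n \<Rightarrow> 'n vfield ^ 'n \<Rightarrow> complex" where
  "vcinner G H = (\<Sum>\<alpha>\<in>UNIV. L2_cinner (G $ \<alpha>) (H $ \<alpha>))"

lemma vcinner_eq: "vcinner G H = Complex (inner G H) (inner G (vscaleC \<i> H))"
  by (simp add: complex_eq_iff vcinner_def L2_cinner_eq inner_vec_def vscaleC_def)

lemma L2_cinner_sum_left: "L2_cinner (\<Sum>i\<in>S. f i) v = (\<Sum>i\<in>S. L2_cinner (f i) v)"
  by (simp add: complex_eq_iff L2_cinner_eq inner_sum_left)

lemma L2_cinner_scaleC: "L2_cinner (l *\<^sub>C u) v = l * L2_cinner u v"
  by (simp add: complex_eq_iff L2_cinner_eq inner_scaleC_left
      inner_scaleC_Re_Im[of _ "cnj l"] inner_scaleC_Re_Im[of _ "cnj l * \<i>"])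

lemma mat_rows_vcinner:
  "(\<Sum>\<alpha>\<in>UNIV. \<Sum>\<beta>\<in>UNIV. \<integral>x. L2_fun F x $ \<alpha> $ \<beta> * cnj (weak_grad \<alpha> \<beta> v x) \<partial>lebesgue)
    = vcinner (mat_rows F) (grad v)"
proof -
  have "L2_cinner (mat_rows F $ \<alpha>) (weak_deriv \<alpha> v)
      = (\<Sum>\<beta>\<in>UNIV. \<integral>x. L2_fun F x $ \<alpha> $ \<beta> * cnj (weak_grad \<alpha> \<beta> v x) \<partial>lebesgue)" for \<alpha>
  proof -
    have "L2_cinner (mat_rows F $ \<alpha>) (weak_deriv \<alpha> v)
        = (\<Sum>\<beta>\<in>UNIV. \<integral>x. L2_fun (mat_rows F $ \<alpha>) x $ \<beta> * cnj (weak_grad \<alpha> \<beta> v x) \<partial>lebesgue)"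
      unfolding L2_cinner_def by (rule Bochner_Integration.integral_sum) (rule integrable_L2_components_cnj)
    also have "\<dots> = (\<Sum>\<beta>\<in>UNIV. \<integral>x. L2_fun F x $ \<alpha> $ \<beta> * cnj (weak_grad \<alpha> \<beta> v x) \<partial>lebesgue)"
    proof (intro sum.cong[OF refl] integral_cong_AE)
      fix \<beta>
      show meas: "(\<lambda>x. L2_fun (mat_rows F $ \<alpha>) x $ \<beta> * cnj (weak_grad \<alpha> \<beta> v x)) \<in> borel_measurable lebesgue"
        by (intro borel_measurable_integrable integrable_L2_components_cnj)
      have "(\<lambda>x. cnj (weak_grad \<alpha> \<beta> v x)) \<in> borel_measurable lebesgue"
        by (rule measurable_compose[OF borel_measurable_vec_nth[OF borel_measurable_L2_fun]])
           (intro borel_measurable_continuous_onI continuous_intros)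
      then show "(\<lambda>x. L2_fun F x $ \<alpha> $ \<beta> * cnj (weak_grad \<alpha> \<beta> v x)) \<in> borel_measurable lebesgue"
        by (intro borel_measurable_times borel_measurable_vec_nth borel_measurable_L2_fun)
      show "AE x in lebesgue. L2_fun (mat_rows F $ \<alpha>) x $ \<beta> * cnj (weak_grad \<alpha> \<beta> v x)
          = L2_fun F x $ \<alpha> $ \<beta> * cnj (weak_grad \<alpha> \<beta> v x)"
        using L2_fun_mat_rows[of F \<alpha>] by eventually_elim simp
    qed
    finally show ?thesis .
  qed
  then show ?thesis by (simp add: vcinner_def grad_def)
qed

locale stokes_coeffs =
  fixes \<mu> :: "'n::finite coeffs" and mlo mhi :: real
  assumes adm: "admissible_coeffs mlo mhi \<mu>" and mlo: "mlo > 0" and mhi: "mhi > 0"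
begin

text \<open>A crude operator bound for \<open>stokes_mult\<close>: three dimension factors come from
  the sums over \<beta>, \<open>i\<close>, \<open>j\<close>, the fourth from passing from rows to
  the tuple.\<close>

definition bnd :: real where "bnd = mhi * CARD('n) ^ 4"

lemma bnd_pos: "bnd > 0"
  using mhi by (simp add: bnd_def)

lemma coeff_props: "\<mu> \<alpha> \<beta> i j \<in> borel_measurable lebesgue" "AE x in lebesgue. cmod (\<mu> \<alpha> \<beta> i j x) \<le> mhi" "mhi \<ge> 0"
  using adm mhi by (auto simp: admissible_coeffs_def)

lemma stokes_mult_scaleC: "stokes_mult \<mu> (vscaleC c G) = vscaleC c (stokes_mult \<mu> G)"
  by (simp add: stokes_mult_def vscaleC_def vec_eq_iff L2_comp_scaleC L2_smult_scaleC[OF coeff_props]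
      linear_sum[OF bounded_linear.linear[OF bounded_linear_scaleC]])

lemma norm_stokes_mult_le: "norm (stokes_mult \<mu> G) \<le> bnd * norm G"
proof -
  have "norm (stokes_mult \<mu> G $ \<alpha>) \<le> (\<Sum>\<beta>\<in>(UNIV :: 'n set). \<Sum>i\<in>(UNIV :: 'n set). \<Sum>j\<in>(UNIV :: 'n set). mhi * norm G)" for \<alpha>
  proof -
    have "norm (L2_smult (\<mu> \<alpha> \<beta> i j) (L2_comp i j (G $ \<beta>))) \<le> mhi * norm G" for \<beta> i j
    proof -
      have "norm (L2_smult (\<mu> \<alpha> \<beta> i j) (L2_comp i j (G $ \<beta>))) \<le> mhi * norm (L2_comp i j (G $ \<beta>))"
        by (rule norm_L2_smult_le[OF coeff_props])
      also have "norm (L2_comp i j (G $ \<beta>)) \<le> norm G"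
        using norm_L2_comp_le[of i j "G $ \<beta>"] Finite_Cartesian_Product.norm_nth_le[of G \<beta>] by linarith
      finally show ?thesis using mhi by (simp add: mult_left_mono)
    qed
    then show ?thesis
      unfolding stokes_mult_def vec_lambda_beta by (intro sum_norm_le)
  qed
  then have "norm (stokes_mult \<mu> G) \<le> CARD('n) * (\<Sum>\<beta>\<in>(UNIV :: 'n set). \<Sum>i\<in>(UNIV :: 'n set). \<Sum>j\<in>(UNIV :: 'n set). mhi * norm G)"
    by (rule norm_vec_le_card)
  also have "\<dots> = bnd * norm G" by (simp add: bnd_def power4_eq_xxxx)
  finally show ?thesis .
qed

lemma bounded_linear_stokes_mult: "bounded_linear (stokes_mult \<mu>)"
proof (rule bounded_linear_intro)
  note sm = bounded_linear.linear[OF bounded_linear_L2_smult[OF coeff_props]]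
  note cp = bounded_linear.linear[OF bounded_linear_L2_comp]
  show "stokes_mult \<mu> (G + H) = stokes_mult \<mu> G + stokes_mult \<mu> H" for G H
    by (simp add: stokes_mult_def vec_eq_iff linear_add[OF sm] linear_add[OF cp] sum.distrib)
  show "stokes_mult \<mu> (r *\<^sub>R G) = r *\<^sub>R stokes_mult \<mu> G" for r G
    by (simp add: stokes_mult_def vec_eq_iff linear_scale[OF sm] linear_scale[OF cp] scaleR_sum_right)
  show "norm (stokes_mult \<mu> G) \<le> norm G * bnd" for G
    using norm_stokes_mult_le[of G] by (simp add: mult.commute)
qed

lemma stokes_form_eq: "stokes_form \<mu> u v = vcinner (stokes_mult \<mu> (grad u)) (grad v)"
proof -
  have coeff: "(\<integral>x. \<mu> \<alpha> \<beta> i j x * weak_grad \<beta> j u x * cnj (weak_grad \<alpha> i v x) \<partial>lebesgue)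
      = L2_cinner (L2_smult (\<mu> \<alpha> \<beta> i j) (L2_comp i j (weak_deriv \<beta> u))) (weak_deriv \<alpha> v)" for \<alpha> \<beta> i j
    unfolding L2_cinner_def
  proof (rule integral_cong_AE)
    have c: "(\<lambda>x. cnj (weak_grad \<alpha> i v x)) \<in> borel_measurable lebesgue"
      by (rule measurable_compose[OF borel_measurable_vec_nth[OF borel_measurable_L2_fun]])
         (intro borel_measurable_continuous_onI continuous_intros)
    show "(\<lambda>x. \<mu> \<alpha> \<beta> i j x * weak_grad \<beta> j u x * cnj (weak_grad \<alpha> i v x)) \<in> borel_measurable lebesgue"
      by (intro borel_measurable_times borel_measurable_vec_nth borel_measurable_L2_fun c coeff_props)
    show "(\<lambda>x. \<Sum>k\<in>UNIV. L2_fun (L2_smult (\<mu> \<alpha> \<beta> i j) (L2_comp i j (weak_deriv \<beta> u))) x $ k * cnj (weak_grad \<alpha> k v x))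
        \<in> borel_measurable lebesgue"
      by (intro borel_measurable_integrable Bochner_Integration.integrable_sum integrable_L2_components_cnj)
    show "AE x in lebesgue. \<mu> \<alpha> \<beta> i j x * weak_grad \<beta> j u x * cnj (weak_grad \<alpha> i v x)
        = (\<Sum>k\<in>UNIV. L2_fun (L2_smult (\<mu> \<alpha> \<beta> i j) (L2_comp i j (weak_deriv \<beta> u))) x $ k * cnj (weak_grad \<alpha> k v x))"
      using L2_fun_smult[OF coeff_props, of \<alpha> \<beta> i j "L2_comp i j (weak_deriv \<beta> u)"] L2_fun_comp[of i j "weak_deriv \<beta> u"]
      by eventually_elim (simp add: axis_def if_distrib[of "\<lambda>z. _ * z"] if_distrib[of "\<lambda>z. z * _"] sum.delta cong: if_cong)
  qed
  show ?thesis
    unfolding stokes_form_def coeff vcinner_def stokes_mult_def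
    by (simp add: L2_cinner_sum_left grad_def)
qed

lemma form_lower_bound: "u \<in> H1 \<Longrightarrow> mlo * (norm (grad u))\<^sup>2 \<le> inner (stokes_mult \<mu> (grad u)) (grad u)"
  using adm by (auto simp: admissible_coeffs_def stokes_form_eq vcinner_eq norm_vec_square grad_def)

text \<open>Real form of the weak equation; its imaginary part is the same equation for
  \<open>\<i> *\<^sub>C v\<close>, which again lies in \<open>H1_sigma\<close>.\<close>

lemma resolvent_solution_iff:
  "resolvent_solution \<mu> l f F u \<longleftrightarrow> u \<in> H1_sigma \<and>
    (\<forall>v\<in>H1_sigma. inner (l *\<^sub>C u) v + inner (stokes_mult \<mu> (grad u)) (grad v)
      = inner f v - inner (mat_rows F) (grad v))"
proof -
  have eq: "l * L2_cinner u v + stokes_form \<mu> u v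
      = L2_cinner f v - (\<Sum>\<alpha>\<in>UNIV. \<Sum>\<beta>\<in>UNIV. \<integral>x. L2_fun F x $ \<alpha> $ \<beta> * cnj (weak_grad \<alpha> \<beta> v x) \<partial>lebesgue)
    \<longleftrightarrow> (inner (l *\<^sub>C u) v + inner (stokes_mult \<mu> (grad u)) (grad v) = inner f v - inner (mat_rows F) (grad v)
      \<and> inner (l *\<^sub>C u) (\<i> *\<^sub>C v) + inner (stokes_mult \<mu> (grad u)) (grad (\<i> *\<^sub>C v))
         = inner f (\<i> *\<^sub>C v) - inner (mat_rows F) (grad (\<i> *\<^sub>C v)))"
    if "v \<in> H1_sigma" for v
    using that unfolding L2_cinner_scaleC[symmetric] stokes_form_eq mat_rows_vcinner
    by (simp add: vcinner_eq L2_cinner_eq complex_eq_iff grad_scaleC H1_sigma_eq)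
  have iv: "\<i> *\<^sub>C v \<in> H1_sigma" if "v \<in> H1_sigma" for v
    using that by (simp add: H1_sigma_eq H1_scaleC scaleC_L2_sigma)
  show ?thesis unfolding resolvent_solution_def using eq iv by blast
qed

lemma stokes_rel_iff:
  "stokes_rel \<mu> u f \<longleftrightarrow> u \<in> H1_sigma \<and> f \<in> L2_sigma \<and>
    (\<forall>v\<in>H1_sigma. inner (stokes_mult \<mu> (grad u)) (grad v) = inner f v)"
proof -
  have eq: "stokes_form \<mu> u v = L2_cinner f v
    \<longleftrightarrow> (inner (stokes_mult \<mu> (grad u)) (grad v) = inner f v
      \<and> inner (stokes_mult \<mu> (grad u)) (grad (\<i> *\<^sub>C v)) = inner f (\<i> *\<^sub>C v))"
    if "v \<in> H1_sigma" for v
    using that unfolding stokes_form_eq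
    by (simp add: vcinner_eq L2_cinner_eq complex_eq_iff grad_scaleC H1_sigma_eq)
  have iv: "\<i> *\<^sub>C v \<in> H1_sigma" if "v \<in> H1_sigma" for v
    using that by (simp add: H1_sigma_eq H1_scaleC scaleC_L2_sigma)
  show ?thesis unfolding stokes_rel_def using eq iv by blast
qed

lemma stokes_op_eq: "stokes_rel \<mu> u f \<Longrightarrow> stokes_op \<mu> u = f"
  unfolding stokes_op_def
proof (rule the_equality)
  fix g assume f: "stokes_rel \<mu> u f" and g: "stokes_rel \<mu> u g"
  have "g - f = 0"
  proof (rule H1_sigma_total)
    show "g - f \<in> L2_sigma" using f g by (auto simp: stokes_rel_iff intro: subspace_diff[OF subspace_L2_sigma])
    show "inner (g - f) v = 0" if "v \<in> H1_sigma" for v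
      using f g that by (simp add: stokes_rel_iff inner_diff_left)
  qed
  then show "g = f" by simp
qed

end

subsection \<open>Rotated coercivity in a sector\<close>

text \<open>An algebraic substitute for the sector: for one of the rotations
  \<open>1 \<plusminus> \<i> \<kappa>\<close> the term \<open>l *\<^sub>C u\<close> paired with
  \<open>z *\<^sub>C u\<close> is at least \<open>c * cmod l * (norm u)^2\<close>. The two signs
  serve the upper and the lower half plane.\<close>

definition sectorial :: "real \<Rightarrow> real \<Rightarrow> complex \<Rightarrow> bool" where
  "sectorial \<kappa> c l \<longleftrightarrow> l \<noteq> 0 \<and> (\<exists>z\<in>{Complex 1 \<kappa>, Complex 1 (- \<kappa>)}. c * cmod l \<le> Re (l * cnj z))"

lemma open_sector_sectorial:
  assumes \<kappa>: "\<kappa> > 0"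
  obtains \<omega> c where "pi / 2 < \<omega>" "\<omega> < pi" "c > 0" "\<And>l. l \<in> open_sector \<omega> \<Longrightarrow> sectorial \<kappa> c l"
proof -
  \<comment> \<open>At an angle \<psi> past the imaginary axis the quantity to bound is
    \<open>\<kappa> * cos \<psi> - sin \<psi>\<close>. The choice
    \<open>tan \<epsilon> = \<kappa> / 2\<close> leaves at least half of
    \<open>\<kappa> * cos \<epsilon>\<close>.\<close>
  define \<epsilon> where "\<epsilon> = arctan (\<kappa> / 2)"
  have e: "0 < \<epsilon>" "\<epsilon> < pi / 2" using \<kappa> arctan_ubound[of "\<kappa> / 2"] by (auto simp: \<epsilon>_def)
  have cose: "cos \<epsilon> > 0" using e by (intro cos_gt_zero) auto
  have sine: "sin \<epsilon> = \<kappa> / 2 * cos \<epsilon>"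
    using tan_arctan[of "\<kappa> / 2"] cose by (simp add: \<epsilon>_def[symmetric] tan_def field_simps)
  define c where "c = min 1 \<kappa> * cos \<epsilon> / 2"
  have c: "c > 0" using \<kappa> cose by (simp add: c_def)
  have ang: "c \<le> cos \<phi> + \<kappa> * \<bar>sin \<phi>\<bar>" if phi: "\<bar>\<phi>\<bar> < pi / 2 + \<epsilon>" for \<phi>
  proof (cases "\<bar>\<phi>\<bar> \<le> pi / 2")
    case True
    then have cp: "cos \<phi> \<ge> 0" by (intro cos_ge_zero) auto
    have "1 = (cos \<phi>)\<^sup>2 + \<bar>sin \<phi>\<bar>\<^sup>2" by simp
    also have "\<dots> \<le> cos \<phi> + \<bar>sin \<phi>\<bar>"
      using cp abs_sin_le_one[of \<phi>] cos_le_one[of \<phi>]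
      by (intro add_mono) (auto simp: power2_eq_square mult_left_le_one_le simp del: power2_abs abs_mult_self_eq)
    finally have "min 1 \<kappa> * 1 \<le> min 1 \<kappa> * (cos \<phi> + \<bar>sin \<phi>\<bar>)" using \<kappa> by (intro mult_left_mono) auto
    also have "\<dots> \<le> 1 * cos \<phi> + \<kappa> * \<bar>sin \<phi>\<bar>"
      unfolding distrib_left using cp by (intro add_mono mult_right_mono) auto
    finally have "min 1 \<kappa> \<le> cos \<phi> + \<kappa> * \<bar>sin \<phi>\<bar>" by simp
    moreover have "c \<le> min 1 \<kappa>" using \<kappa> cos_le_one[of \<epsilon>] cose
      mult_left_mono[of "cos \<epsilon>" 1 "min 1 \<kappa>"] by (simp add: c_def)
    ultimately show ?thesis by (rule order_trans[rotated])
  next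
    case False
    define \<psi> where "\<psi> = \<bar>\<phi>\<bar> - pi / 2"
    have psi: "0 < \<psi>" "\<psi> < \<epsilon>" using False phi by (auto simp: \<psi>_def)
    have cosphi: "cos \<phi> = - sin \<psi>"
    proof -
      have "cos \<phi> = cos \<bar>\<phi>\<bar>" by (simp add: abs_if)
      also have "\<bar>\<phi>\<bar> = \<psi> + pi / 2" by (simp add: \<psi>_def)
      finally show ?thesis by (simp add: cos_add)
    qed
    have sinphi: "\<bar>sin \<phi>\<bar> = cos \<psi>"
    proof -
      have "\<bar>sin \<phi>\<bar> = \<bar>sin \<bar>\<phi>\<bar>\<bar>" by (simp add: abs_if)
      also have "\<bar>\<phi>\<bar> = \<psi> + pi / 2" by (simp add: \<psi>_def)
      also have "sin (\<psi> + pi / 2) = cos \<psi>" by (simp add: sin_add)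
      also have "\<bar>cos \<psi>\<bar> = cos \<psi>" using cos_gt_zero[of \<psi>] psi e by simp
      finally show ?thesis .
    qed
    have "cos \<epsilon> \<le> cos \<psi>" using psi e by (intro cos_monotone_0_pi_le) auto
    then have "\<kappa> * cos \<epsilon> \<le> \<kappa> * cos \<psi>" using \<kappa> by (intro mult_left_mono) auto
    moreover have "sin \<psi> \<le> sin \<epsilon>" using psi e by (intro sin_monotone_2pi_le) auto
    ultimately have "\<kappa> * cos \<epsilon> - sin \<epsilon> \<le> cos \<phi> + \<kappa> * \<bar>sin \<phi>\<bar>"
      unfolding cosphi sinphi by linarith
    moreover have "\<kappa> * cos \<epsilon> - sin \<epsilon> = \<kappa> * cos \<epsilon> / 2" by (simp add: sine)
    moreover have "c \<le> \<kappa> * cos \<epsilon> / 2" unfolding c_def using cose by (intro divide_right_mono mult_right_mono) auto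
    ultimately show ?thesis by simp
  qed
  have sec: "sectorial \<kappa> c l" if l: "l \<in> open_sector (pi / 2 + \<epsilon>)" for l
  proof -
    define \<phi> where "\<phi> = Arg l"
    have l0: "l \<noteq> 0" and phi: "\<bar>\<phi>\<bar> < pi / 2 + \<epsilon>" using l by (auto simp: open_sector_def \<phi>_def)
    have "l = rcis (cmod l) \<phi>" by (simp add: \<phi>_def rcis_cmod_Arg)
    then have ReIm: "Re l = cmod l * cos \<phi>" "Im l = cmod l * sin \<phi>"
      by (metis Re_rcis, metis Im_rcis)
    define z where "z = (if sin \<phi> \<ge> 0 then Complex 1 \<kappa> else Complex 1 (- \<kappa>))"
    have "Re (l * cnj z) = cmod l * (cos \<phi> + \<kappa> * \<bar>sin \<phi>\<bar>)"
      by (simp add: z_def ReIm algebra_simps)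
    then have "c * cmod l \<le> Re (l * cnj z)"
      using ang[OF phi] mult_left_mono[of c "cos \<phi> + \<kappa> * \<bar>sin \<phi>\<bar>" "cmod l"] by (simp add: mult.commute)
    moreover have "z \<in> {Complex 1 \<kappa>, Complex 1 (- \<kappa>)}" by (simp add: z_def)
    ultimately show ?thesis using l0 unfolding sectorial_def by blast
  qed
  show thesis by (rule that[OF _ _ c sec]) (use e in auto)
qed

subsection \<open>Existence, uniqueness and energy estimate\<close>

text \<open>Beyond the claimed bound \<open>N\<close> exceeds \<open>X\<close>, so the term
  \<open>b * X^2\<close> is absorbed by \<open>b * X * N\<close>, and one factor \<open>N\<close>
  cancels.\<close>

lemma quadratic_bound:
  fixes N b X Y c :: real
  assumes "c > 0" "0 \<le> N" "0 \<le> X" "0 \<le> b" "c * N\<^sup>2 \<le> b * X * N + b * X\<^sup>2"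
  shows "N \<le> (2 * b / c + 1) * X"
proof (rule ccontr)
  assume "\<not> N \<le> (2 * b / c + 1) * X"
  then have N: "N > (2 * b / c + 1) * X" by simp
  have "(2 * b / c + 1) * X \<ge> 1 * X" using assms by (intro mult_right_mono) auto
  then have "N > X" using N by simp
  then have "b * X\<^sup>2 \<le> b * X * N" using assms by (simp add: power2_eq_square mult_left_mono mult.assoc)
  then have "c * N * N \<le> (2 * b * X) * N" using assms(5) by (simp add: power2_eq_square algebra_simps)
  then have "c * N \<le> 2 * b * X" using \<open>N > X\<close> assms(3) by (simp add: mult_le_cancel_right)
  then have "N \<le> 2 * b / c * X" using assms(1) by (simp add: field_simps)
  also have "\<dots> \<le> (2 * b / c + 1) * X" using assms(3) by (simp add: distrib_right)
  finally show False using N by simp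
qed

lemma H1_sigma_closure:
  fixes u v :: "'n::finite vfield"
  shows H1_sigma_scaleC: "u \<in> H1_sigma \<Longrightarrow> c *\<^sub>C u \<in> H1_sigma"
    and H1_sigma_H1: "u \<in> H1_sigma \<Longrightarrow> u \<in> H1"
    and H1_sigma_L2_sigma: "u \<in> H1_sigma \<Longrightarrow> u \<in> L2_sigma"
    and H1_sigma_add: "u \<in> H1_sigma \<Longrightarrow> v \<in> H1_sigma \<Longrightarrow> u + v \<in> H1_sigma"
    and H1_sigma_scaleR: "u \<in> H1_sigma \<Longrightarrow> r *\<^sub>R u \<in> H1_sigma"
    and H1_sigma_diff: "u \<in> H1_sigma \<Longrightarrow> v \<in> H1_sigma \<Longrightarrow> u - v \<in> H1_sigma"
  by (auto simp: H1_sigma_eq H1_scaleC scaleC_L2_sigma H1_add H1_scaleR H1_diff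
      intro: subspace_add[OF subspace_L2_sigma] subspace_scale[OF subspace_L2_sigma]
        subspace_diff[OF subspace_L2_sigma])

text \<open>Lax-Milgram is applied to this closed subspace of a product Hilbert space. The graph
  norm is the norm of H1, and completeness of H1 becomes closedness of the graph.\<close>

definition H1_sigma_graph :: "('n::finite vfield \<times> ('n vfield ^ 'n)) set" where
  "H1_sigma_graph = (\<lambda>u. (u, grad u)) ` H1_sigma"

lemma subspace_H1_sigma_graph: "subspace H1_sigma_graph"
proof (rule subspaceI)
  have "0 \<in> H1_sigma" by (simp add: H1_sigma_eq H1_zero subspace_0[OF subspace_L2_sigma])
  then show "0 \<in> H1_sigma_graph"
    unfolding H1_sigma_graph_def using grad_zero by (force simp: zero_prod_def)
qed (auto simp: H1_sigma_graph_def grad_add grad_scaleR H1_sigma_H1 H1_sigma_add H1_sigma_scaleR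
      intro!: image_eqI)

lemma closed_H1_sigma_graph: "closed (H1_sigma_graph :: ('n::finite vfield \<times> ('n vfield ^ 'n)) set)"
  unfolding closed_sequential_limits
proof (intro allI impI, elim conjE)
  fix x and y :: "'n vfield \<times> ('n vfield ^ 'n)"
  assume x: "\<forall>n. x n \<in> H1_sigma_graph" and lim: "x \<longlonglongrightarrow> y"
  have u: "fst (x n) \<in> H1_sigma" "snd (x n) = grad (fst (x n))" for n
    using x[rule_format, of n] by (auto simp: H1_sigma_graph_def)
  have l1: "(\<lambda>n. fst (x n)) \<longlonglongrightarrow> fst y" and l2: "(\<lambda>n. snd (x n)) \<longlonglongrightarrow> snd y"
    by (intro tendsto_intros lim)+
  have w: "has_weak_deriv \<beta> (fst y) (snd y $ \<beta>)" for \<beta>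
  proof (rule has_weak_deriv_limit[OF _ l1])
    show "has_weak_deriv \<beta> (fst (x n)) (snd (x n) $ \<beta>)" for n
      using H1_has_weak_deriv[OF H1_sigma_H1[OF u(1)], of \<beta> n] by (simp add: u(2) grad_def)
    show "(\<lambda>n. snd (x n) $ \<beta>) \<longlonglongrightarrow> snd y $ \<beta>" by (intro tendsto_intros l2)
  qed
  have "fst y \<in> L2_sigma"
    using closed_sequentially[OF closed_L2_sigma _ l1] u(1) H1_sigma_L2_sigma by blast
  then have "fst y \<in> H1_sigma" using H1I[OF w] by (simp add: H1_sigma_eq)
  moreover have "grad (fst y) = snd y" using weak_deriv_eq[OF w] by (simp add: grad_def vec_eq_iff)
  ultimately show "y \<in> H1_sigma_graph"
    unfolding H1_sigma_graph_def by (intro image_eqI[of y _ "fst y"]) (simp_all add: prod_eq_iff)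
qed

text \<open>The skew part that a rotation by \<open>1 \<plusminus> \<i> \<kappa>\<close> adds to the
  form is at most \<open>\<kappa> * bnd * (norm (grad u))^2\<close>. The value of \<kappa> makes
  this half of the ellipticity.\<close>

locale stokes_sector = stokes_coeffs \<mu> mlo mhi for \<mu> :: "'n::finite coeffs" and mlo mhi +
  fixes c \<kappa> :: real
  assumes c: "c > 0" and \<kappa>_def: "\<kappa> = mlo / (2 * bnd)"
begin

definition c0 :: real where "c0 = min c (mlo / 2)"

definition Z :: real where "Z = 1 + \<kappa>"

abbreviation "sec \<equiv> sectorial \<kappa> c"

lemma \<kappa>_pos: "\<kappa> > 0"
  using mlo bnd_pos by (simp add: \<kappa>_def)

lemma c0_pos: "c0 > 0"
  using c mlo by (simp add: c0_def)

lemma Z_pos: "Z > 0"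
  using \<kappa>_pos by (simp add: Z_def)

lemma rotation_norm: "z \<in> {Complex 1 \<kappa>, Complex 1 (- \<kappa>)} \<Longrightarrow> cmod z \<le> Z"
  using cmod_le[of z] \<kappa>_pos by (auto simp: Z_def)

lemma rotated_form_lower_bound:
  assumes z: "z \<in> {Complex 1 \<kappa>, Complex 1 (- \<kappa>)}" and u: "u \<in> H1"
  shows "mlo / 2 * (norm (grad u))\<^sup>2 \<le> inner (stokes_mult \<mu> (grad u)) (vscaleC z (grad u))"
proof -
  let ?G = "grad u"
  have "\<bar>Im z * inner (stokes_mult \<mu> ?G) (vscaleC \<i> ?G)\<bar> \<le> \<kappa> * ((bnd * norm ?G) * norm ?G)"
  proof -
    have "\<bar>inner (stokes_mult \<mu> ?G) (vscaleC \<i> ?G)\<bar> \<le> norm (stokes_mult \<mu> ?G) * norm ?G"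
      using Cauchy_Schwarz_ineq2[of "stokes_mult \<mu> ?G" "vscaleC \<i> ?G"] by simp
    also have "\<dots> \<le> (bnd * norm ?G) * norm ?G" by (intro mult_right_mono norm_stokes_mult_le) simp
    finally have "\<kappa> * \<bar>inner (stokes_mult \<mu> ?G) (vscaleC \<i> ?G)\<bar> \<le> \<kappa> * ((bnd * norm ?G) * norm ?G)"
      using \<kappa>_pos by (intro mult_left_mono) auto
    moreover have "\<bar>Im z\<bar> = \<kappa>" using z \<kappa>_pos by auto
    ultimately show ?thesis by (simp add: abs_mult)
  qed
  also have "\<kappa> * ((bnd * norm ?G) * norm ?G) = mlo / 2 * (norm ?G)\<^sup>2"
    using bnd_pos by (simp add: \<kappa>_def power2_eq_square)
  finally have "\<bar>Im z * inner (stokes_mult \<mu> ?G) (vscaleC \<i> ?G)\<bar> \<le> mlo / 2 * (norm ?G)\<^sup>2" .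
  moreover have "inner (stokes_mult \<mu> ?G) (vscaleC z ?G)
      = inner (stokes_mult \<mu> ?G) ?G + Im z * inner (stokes_mult \<mu> ?G) (vscaleC \<i> ?G)"
    using z by (auto simp: inner_vscaleC_Re_Im[of _ z])
  ultimately show ?thesis using form_lower_bound[OF u] by (simp add: abs_le_iff)
qed

text \<open>Formulated on all of \<open>H1\<close>: the localised estimate applies it to the cut-off
  field, which is no longer solenoidal. Here it matters that the ellipticity assumption refers to
  \<open>H1\<close> and not to \<open>H1_sigma\<close>.\<close>

lemma energy_lower_bound:
  assumes z: "z \<in> {Complex 1 \<kappa>, Complex 1 (- \<kappa>)}" and lz: "c * cmod l \<le> Re (l * cnj z)" and u: "u \<in> H1"
  shows "c0 * (cmod l * (norm u)\<^sup>2 + (norm (grad u))\<^sup>2)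
    \<le> inner (l *\<^sub>C u) (z *\<^sub>C u) + inner (stokes_mult \<mu> (grad u)) (vscaleC z (grad u))"
proof -
  have "c0 * (cmod l * (norm u)\<^sup>2) \<le> c * (cmod l * (norm u)\<^sup>2)"
    by (rule mult_right_mono) (auto simp: c0_def)
  also have "\<dots> = (c * cmod l) * (norm u)\<^sup>2" by simp
  also have "\<dots> \<le> inner (l *\<^sub>C u) (z *\<^sub>C u)"
    unfolding scaleC_self_inner by (rule mult_right_mono[OF lz]) simp
  finally have 1: "c0 * (cmod l * (norm u)\<^sup>2) \<le> inner (l *\<^sub>C u) (z *\<^sub>C u)" .
  have "c0 * (norm (grad u))\<^sup>2 \<le> mlo / 2 * (norm (grad u))\<^sup>2"
    by (rule mult_right_mono) (auto simp: c0_def)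
  also note rotated_form_lower_bound[OF z u]
  finally show ?thesis using 1 by (simp add: distrib_left)
qed

text \<open>Multiplication by \<open>z\<close> is a bijection of \<open>H1_sigma\<close>, so the
  rotated equation is equivalent to the original one and becomes coercive when tested with
  \<open>u\<close>.\<close>

lemma resolvent_solution_rotated:
  assumes z: "z \<noteq> 0"
  shows "resolvent_solution \<mu> l f F u \<longleftrightarrow> u \<in> H1_sigma \<and>
    (\<forall>v\<in>H1_sigma. inner (l *\<^sub>C u) (z *\<^sub>C v) + inner (stokes_mult \<mu> (grad u)) (vscaleC z (grad v))
      = inner f (z *\<^sub>C v) - inner (mat_rows F) (vscaleC z (grad v)))"
proof -
  let ?P = "\<lambda>v. inner (l *\<^sub>C u) v + inner (stokes_mult \<mu> (grad u)) (grad v) = inner f v - inner (mat_rows F) (grad v)"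
  have "(\<forall>v\<in>H1_sigma. ?P v) \<longleftrightarrow> (\<forall>v\<in>H1_sigma. ?P (z *\<^sub>C v))"
  proof
    assume R: "\<forall>v\<in>H1_sigma. ?P (z *\<^sub>C v)"
    show "\<forall>v\<in>H1_sigma. ?P v"
    proof
      fix v :: "'n vfield" assume "v \<in> H1_sigma"
      then have "(1 / z) *\<^sub>C v \<in> H1_sigma" by (rule H1_sigma_scaleC)
      from R[rule_format, OF this] show "?P v" using z by simp
    qed
  qed (use H1_sigma_scaleC in blast)
  then show ?thesis unfolding resolvent_solution_iff
    by (auto simp: grad_scaleC H1_sigma_H1)
qed

lemma resolvent_unique_solution:
  assumes l: "sec l"
  shows "\<exists>!u. resolvent_solution \<mu> l f F u"
proof -
  obtain z where z: "z \<in> {Complex 1 \<kappa>, Complex 1 (- \<kappa>)}" and lz: "c * cmod l \<le> Re (l * cnj z)" and l0: "l \<noteq> 0"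
    using l unfolding sectorial_def by blast
  have z0: "z \<noteq> 0" using z by (auto simp: complex_eq_iff)
  \<comment> \<open>A scalar crosses the real inner product as its conjugate. With
    \<open>cnj z\<close> placed here, the form of \<open>T\<close> on the graph is the left side of
    the rotated equation.\<close>
  define T where "T x = ((cnj z * l) *\<^sub>C fst x, vscaleC (cnj z) (stokes_mult \<mu> (snd x)))" for x :: "'n vfield \<times> ('n vfield ^ 'n)"
  define y where "y = (cnj z *\<^sub>C f, - vscaleC (cnj z) (mat_rows F))"
  have T: "bounded_linear T"
    unfolding T_def
    by (intro bounded_linear_Pair bounded_linear_compose[OF bounded_linear_scaleC]
        bounded_linear_compose[OF bounded_linear_vscaleC] bounded_linear_compose[OF bounded_linear_stokes_mult]
        bounded_linear_fst bounded_linear_snd)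
  have Tin: "inner (T (u, grad u)) (v, grad v) = inner (l *\<^sub>C u) (z *\<^sub>C v) + inner (stokes_mult \<mu> (grad u)) (vscaleC z (grad v))" for u v
    by (simp add: T_def inner_scaleC_left inner_vscaleC_left mult.commute)
  have yin: "inner y (v, grad v) = inner f (z *\<^sub>C v) - inner (mat_rows F) (vscaleC z (grad v))" for v
    by (simp add: y_def inner_scaleC_left inner_vscaleC_left)
  \<comment> \<open>This coercivity constant degenerates as \<open>l\<close> tends to 0. It serves
    existence and uniqueness only; bounds uniform in \<open>l\<close> come from
    \<open>resolvent_energy\<close>.\<close>
  define m where "m = c0 * min (cmod l) 1"
  have "\<exists>!x. x \<in> H1_sigma_graph \<and> (\<forall>v\<in>H1_sigma_graph. inner (T x) v = inner y v)"
  proof (rule lax_milgram[OF subspace_H1_sigma_graph closed_H1_sigma_graph T])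
    show "m > 0" using c0_pos l0 by (simp add: m_def)
    fix x :: "'n vfield \<times> ('n vfield ^ 'n)" assume "x \<in> H1_sigma_graph"
    then obtain u where u: "u \<in> H1_sigma" "x = (u, grad u)" by (auto simp: H1_sigma_graph_def)
    have "m * (norm x)\<^sup>2 = c0 * (min (cmod l) 1 * (norm u)\<^sup>2 + min (cmod l) 1 * (norm (grad u))\<^sup>2)"
      by (simp add: u(2) m_def norm_Pair algebra_simps)
    also have "\<dots> \<le> c0 * (cmod l * (norm u)\<^sup>2 + 1 * (norm (grad u))\<^sup>2)"
      using c0_pos by (intro mult_left_mono add_mono mult_right_mono) auto
    also have "\<dots> \<le> inner (T x) x"
      unfolding u(2) Tin using energy_lower_bound[OF z lz H1_sigma_H1[OF u(1)]] by simp
    finally show "m * (norm x)\<^sup>2 \<le> inner (T x) x" .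
  qed
  then obtain x where x: "x \<in> H1_sigma_graph" "\<forall>v\<in>H1_sigma_graph. inner (T x) v = inner y v"
    and uniq: "\<And>x'. x' \<in> H1_sigma_graph \<Longrightarrow> \<forall>v\<in>H1_sigma_graph. inner (T x') v = inner y v \<Longrightarrow> x' = x"
    by blast
  have sol: "resolvent_solution \<mu> l f F u \<longleftrightarrow> u \<in> H1_sigma \<and> (\<forall>v\<in>H1_sigma_graph. inner (T (u, grad u)) v = inner y v)" for u
    unfolding resolvent_solution_rotated[OF z0] H1_sigma_graph_def by (simp add: Tin yin)
  obtain u where u: "u \<in> H1_sigma" "x = (u, grad u)" using x(1) by (auto simp: H1_sigma_graph_def)
  show ?thesis
  proof (rule ex1I[of _ u])
    show "resolvent_solution \<mu> l f F u" unfolding sol using u x(2) by simp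
    show "u' = u" if "resolvent_solution \<mu> l f F u'" for u'
      using uniq[of "(u', grad u')"] that u(2) unfolding sol by (simp add: H1_sigma_graph_def)
  qed
qed

definition K1 :: real where "K1 = Z / c0"

lemma K1_pos: "K1 > 0"
  using Z_pos c0_pos by (simp add: K1_def)

text \<open>In the weighted energy norm \<open>N\<close> the data act with norm at most
  \<open>Z * A\<close>, so one factor \<open>N\<close> cancels. The weights in \<open>A\<close> and
  on the left make the constant independent of \<open>l\<close>.\<close>

lemma resolvent_energy:
  assumes l: "sec l" and sol: "resolvent_solution \<mu> l f F u"
  defines "A \<equiv> norm f / sqrt (cmod l) + norm (mat_rows F)"
  shows "sqrt (cmod l) * norm u \<le> K1 * A" "norm (grad u) \<le> K1 * A"
proof -
  obtain z where z: "z \<in> {Complex 1 \<kappa>, Complex 1 (- \<kappa>)}" and lz: "c * cmod l \<le> Re (l * cnj z)" and l0: "l \<noteq> 0"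
    using l unfolding sectorial_def by blast
  have z0: "z \<noteq> 0" using z by (auto simp: complex_eq_iff)
  have u: "u \<in> H1_sigma" using sol by (simp add: resolvent_solution_iff)
  define s where "s = sqrt (cmod l)"
  have s: "s > 0" "s\<^sup>2 = cmod l" using l0 by (auto simp: s_def)
  define N where "N = sqrt (cmod l * (norm u)\<^sup>2 + (norm (grad u))\<^sup>2)"
  have N2: "N\<^sup>2 = cmod l * (norm u)\<^sup>2 + (norm (grad u))\<^sup>2" by (simp add: N_def)
  have N0: "N \<ge> 0" by (simp add: N_def)
  have Nu: "s * norm u \<le> N"
    by (rule power2_le_imp_le[OF _ N0]) (simp add: N2 power_mult_distrib s)
  have Ng: "norm (grad u) \<le> N"
    by (rule power2_le_imp_le[OF _ N0]) (simp add: N2)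
  have "c0 * N\<^sup>2 \<le> inner f (z *\<^sub>C u) - inner (mat_rows F) (vscaleC z (grad u))"
    using energy_lower_bound[OF z lz H1_sigma_H1[OF u]] sol[unfolded resolvent_solution_rotated[OF z0]] u
    by (simp add: N2)
  also have "\<dots> \<le> norm f * (Z * norm u) + norm (mat_rows F) * (Z * norm (grad u))"
  proof -
    have "inner f (z *\<^sub>C u) \<le> norm f * (cmod z * norm u)"
      using norm_cauchy_schwarz[of f "z *\<^sub>C u"] by simp
    also have "\<dots> \<le> norm f * (Z * norm u)" by (intro mult_left_mono mult_right_mono rotation_norm z) auto
    finally have 1: "inner f (z *\<^sub>C u) \<le> norm f * (Z * norm u)" .
    have "- inner (mat_rows F) (vscaleC z (grad u)) \<le> norm (mat_rows F) * (cmod z * norm (grad u))"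
      using Cauchy_Schwarz_ineq2[of "mat_rows F" "vscaleC z (grad u)"] by simp
    also have "\<dots> \<le> norm (mat_rows F) * (Z * norm (grad u))" by (intro mult_left_mono mult_right_mono rotation_norm z) auto
    finally show ?thesis using 1 by simp
  qed
  also have "\<dots> = Z * (norm f / s * (s * norm u) + norm (mat_rows F) * norm (grad u))"
    using s by (simp add: algebra_simps)
  also have "\<dots> \<le> Z * (norm f / s * N + norm (mat_rows F) * N)"
    using Nu Ng s Z_pos by (intro mult_left_mono add_mono) auto
  also have "\<dots> = Z * A * N" by (simp add: A_def s_def algebra_simps)
  finally have "c0 * N * N \<le> Z * A * N" by (simp add: power2_eq_square mult.assoc)
  then have "N \<le> K1 * A"
  proof (cases "N = 0")
    case True
    have "A \<ge> 0" by (simp add: A_def)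
    then show ?thesis using True K1_pos by simp
  next
    case False
    assume "c0 * N * N \<le> Z * A * N"
    then have "c0 * N \<le> Z * A" using False N0 by (simp add: mult_le_cancel_right)
    then show ?thesis using c0_pos by (simp add: K1_def field_simps)
  qed
  then show "sqrt (cmod l) * norm u \<le> K1 * A" "norm (grad u) \<le> K1 * A"
    using Nu Ng by (auto simp: s_def)
qed

end

section \<open>Localised resolvent estimates\<close>

lemma L2_smult_adjoint:
  assumes m: "m \<in> borel_measurable lebesgue" "AE x in lebesgue. cmod (m x) \<le> K" "K \<ge> 0"
  shows "inner (L2_smult m u) v = inner u (L2_smult (\<lambda>x. cnj (m x)) v)"
  unfolding inner_L2_eq
proof (rule integral_cong_AE)
  have m': "(\<lambda>x. cnj (m x)) \<in> borel_measurable lebesgue"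
    by (rule measurable_compose[OF m(1)]) (intro borel_measurable_continuous_onI continuous_intros)
  have b': "AE x in lebesgue. cmod (cnj (m x)) \<le> K" using m(2) by simp
  show "AE x in lebesgue. inner (L2_fun (L2_smult m u) x) (L2_fun v x)
      = inner (L2_fun u x) (L2_fun (L2_smult (\<lambda>x. cnj (m x)) v) x)"
    using L2_fun_smult[OF m, of u] L2_fun_smult[OF m' b' m(3), of v]
    by eventually_elim (simp add: inner_smult_vec)
qed measurable

lemma L2_smult_commute:
  assumes m: "m \<in> borel_measurable lebesgue" "AE x in lebesgue. cmod (m x) \<le> K" "K \<ge> 0"
    and n: "n \<in> borel_measurable lebesgue" "AE x in lebesgue. cmod (n x) \<le> L" "L \<ge> 0"
  shows "L2_smult m (L2_smult n u) = L2_smult n (L2_smult m u)"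
  by (rule L2_eqI)
    (use L2_fun_smult[OF m, of u] L2_fun_smult[OF n, of u] L2_fun_smult[OF m, of "L2_smult n u"]
      L2_fun_smult[OF n, of "L2_smult m u"]
     in \<open>eventually_elim, simp add: vec_eq_iff mult_ac\<close>)

lemma L2_comp_smult:
  assumes m: "m \<in> borel_measurable lebesgue" "AE x in lebesgue. cmod (m x) \<le> K" "K \<ge> 0"
  shows "L2_comp i j (L2_smult m u) = L2_smult m (L2_comp i j u)"
  by (rule L2_eqI)
    (use L2_fun_smult[OF m, of u] L2_fun_smult[OF m, of "L2_comp i j u"] L2_fun_comp[of i j u]
      L2_fun_comp[of i j "L2_smult m u"]
     in \<open>eventually_elim, simp add: vec_eq_iff axis_def\<close>)

lemma test_function_multiplier:
  assumes "test_function \<eta>"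
  obtains B where "\<eta> \<in> borel_measurable lebesgue" "AE x in lebesgue. cmod (\<eta> x) \<le> B" "B \<ge> 0"
proof -
  obtain B where "B > 0" "\<And>x. cmod (\<eta> x) \<le> B" using test_function_bounded[OF assms] by blast
  then show thesis
    using that[of B] borel_measurable_lebesgue_continuous[OF test_function_continuous[OF assms]] by auto
qed

lemma L2_smult_test_field:
  assumes \<eta>: "test_function \<eta>" and \<phi>: "test_function \<phi>"
  shows "L2_smult \<eta> (test_field \<phi> c) = test_field (\<lambda>x. \<eta> x * \<phi> x) c"
proof -
  obtain B where m: "\<eta> \<in> borel_measurable lebesgue" "AE x in lebesgue. cmod (\<eta> x) \<le> B" "B \<ge> 0"
    using test_function_multiplier[OF \<eta>] by blast
  have t: "test_function (\<lambda>x. \<eta> x * \<phi> x)"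
    by (rule test_function_mult[OF test_function_C_k[OF \<eta>] \<phi>])
  show ?thesis
    by (rule L2_eqI)
      (use L2_fun_smult[OF m, of "test_field \<phi> c"] L2_fun_test_field[OF \<phi>, of c] L2_fun_test_field[OF t, of c]
       in \<open>eventually_elim, simp add: vec_eq_iff\<close>)
qed

text \<open>Multipliers move to the test field as conjugates, where the classical product rule
  applies; only test functions are differentiated.\<close>

lemma has_weak_deriv_smult:
  fixes u g :: "'n::finite vfield"
  assumes \<eta>: "test_function \<eta>" and w: "has_weak_deriv i u g"
  shows "has_weak_deriv i (L2_smult \<eta> u) (L2_smult \<eta> g + L2_smult (partial_deriv i \<eta>) u)"
  unfolding has_weak_deriv_iff
proof (intro allI impI)
  fix \<phi> :: "real ^ 'n \<Rightarrow> complex" and c assume \<phi>: "test_function \<phi>"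
  let ?\<eta> = "\<lambda>x. cnj (\<eta> x)"
  have c\<eta>: "test_function ?\<eta>" by (rule test_function_cnj[OF \<eta>])
  note d\<eta> = test_function_partial_deriv[OF \<eta>, of i] and d\<phi> = test_function_partial_deriv[OF \<phi>, of i]
    and dc\<eta> = test_function_partial_deriv[OF c\<eta>, of i]
  have adj: "inner (L2_smult \<psi> u) v = inner u (L2_smult (\<lambda>x. cnj (\<psi> x)) v)" if t: "test_function \<psi>" for \<psi> and u v :: "'n vfield"
  proof -
    obtain B where m: "\<psi> \<in> borel_measurable lebesgue" "AE x in lebesgue. cmod (\<psi> x) \<le> B" "B \<ge> 0"
      using test_function_multiplier[OF t] by blast
    show ?thesis by (rule L2_smult_adjoint[OF m])
  qed
  have t1: "test_function (\<lambda>x. ?\<eta> x * \<phi> x)" by (rule test_function_mult[OF test_function_C_k[OF c\<eta>] \<phi>])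
  have t2: "test_function (\<lambda>x. ?\<eta> x * partial_deriv i \<phi> x)" by (rule test_function_mult[OF test_function_C_k[OF c\<eta>] d\<phi>])
  have t3: "test_function (\<lambda>x. partial_deriv i ?\<eta> x * \<phi> x)" by (rule test_function_mult[OF test_function_C_k[OF dc\<eta>] \<phi>])
  have pd: "partial_deriv i (\<lambda>x. ?\<eta> x * \<phi> x) = (\<lambda>x. ?\<eta> x * partial_deriv i \<phi> x + partial_deriv i ?\<eta> x * \<phi> x)"
    by (rule ext) (rule partial_deriv_mult[OF test_function_differentiable[OF c\<eta>] test_function_differentiable[OF \<phi>]])
  have "inner (L2_smult \<eta> u) (test_field (partial_deriv i \<phi>) c) = inner u (test_field (\<lambda>x. ?\<eta> x * partial_deriv i \<phi> x) c)"
    by (simp add: adj[OF \<eta>] L2_smult_test_field[OF c\<eta> d\<phi>])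
  also have "\<dots> = inner u (test_field (partial_deriv i (\<lambda>x. ?\<eta> x * \<phi> x)) c) - inner u (test_field (\<lambda>x. partial_deriv i ?\<eta> x * \<phi> x) c)"
    unfolding pd by (simp add: test_field_add[OF t2 t3] inner_add_right)
  also have "inner u (test_field (partial_deriv i (\<lambda>x. ?\<eta> x * \<phi> x)) c) = - inner g (test_field (\<lambda>x. ?\<eta> x * \<phi> x) c)"
    using w t1 by (simp add: has_weak_deriv_iff)
  also have "test_field (\<lambda>x. ?\<eta> x * \<phi> x) c = L2_smult ?\<eta> (test_field \<phi> c)"
    by (rule L2_smult_test_field[OF c\<eta> \<phi>, symmetric])
  also have "test_field (\<lambda>x. partial_deriv i ?\<eta> x * \<phi> x) c = L2_smult (\<lambda>x. cnj (partial_deriv i \<eta> x)) (test_field \<phi> c)"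
    using L2_smult_test_field[OF dc\<eta> \<phi>, of c] by (simp add: partial_deriv_test_cnj[OF \<eta>])
  finally show "inner (L2_smult \<eta> u) (test_field (partial_deriv i \<phi>) c)
      = - inner (L2_smult \<eta> g + L2_smult (partial_deriv i \<eta>) u) (test_field \<phi> c)"
    by (simp add: adj[OF \<eta>] adj[OF d\<eta>] inner_add_left)
qed

section \<open>Cutoff functions as operators on fields\<close>

locale cutoff =
  fixes h :: "real ^ 'n::finite \<Rightarrow> real" and L :: real
  assumes test: "test_function (\<lambda>x. of_real (h x))"
    and h_le: "\<And>x. \<bar>h x\<bar> \<le> 1"
    and dh_le: "\<And>i x. cmod (partial_deriv i (\<lambda>x. of_real (h x)) x) \<le> L"
begin

definition eta :: "'n vfield \<Rightarrow> 'n vfield" where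
  "eta = L2_smult (\<lambda>x. of_real (h x))"

definition deta :: "'n \<Rightarrow> 'n vfield \<Rightarrow> 'n vfield" where
  "deta i = L2_smult (partial_deriv i (\<lambda>x. of_real (h x)))"

definition veta :: "'n vfield ^ 'n \<Rightarrow> 'n vfield ^ 'n" where
  "veta G = (\<chi> \<alpha>. eta (G $ \<alpha>))"

definition vdeta :: "'n vfield \<Rightarrow> 'n vfield ^ 'n" where
  "vdeta u = (\<chi> \<alpha>. deta \<alpha> u)"

definition D :: real where "D = CARD('n) * L"

lemma L_nonneg: "L \<ge> 0"
  using dh_le[of undefined undefined] norm_ge_zero order_trans by blast

lemma D_nonneg: "D \<ge> 0"
  using L_nonneg by (simp add: D_def)

lemma h_props: "(\<lambda>x. complex_of_real (h x)) \<in> borel_measurable lebesgue"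
  "AE x in lebesgue. cmod (complex_of_real (h x)) \<le> 1" "(1::real) \<ge> 0"
  using borel_measurable_lebesgue_continuous[OF test_function_continuous[OF test]] h_le by auto

lemma dh_props: "partial_deriv i (\<lambda>x. complex_of_real (h x)) \<in> borel_measurable lebesgue"
  "AE x in lebesgue. cmod (partial_deriv i (\<lambda>x. complex_of_real (h x)) x) \<le> L" "L \<ge> 0"
  using borel_measurable_lebesgue_continuous[OF test_function_continuous[OF test_function_partial_deriv[OF test]]]
    dh_le L_nonneg by auto

lemma bounded_linear_eta: "bounded_linear eta"
  unfolding eta_def by (rule bounded_linear_L2_smult[OF h_props])

lemmas linear_eta = bounded_linear.linear[OF bounded_linear_eta]

lemma eta_scaleC: "eta (a *\<^sub>C u) = a *\<^sub>C eta u"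
  unfolding eta_def by (rule L2_smult_scaleC[OF h_props])

lemma eta_comp: "L2_comp i j (eta u) = eta (L2_comp i j u)"
  unfolding eta_def by (rule L2_comp_smult[OF h_props])

lemma norm_deta_le: "norm (deta i u) \<le> L * norm u"
  using norm_L2_smult_le[OF dh_props] by (simp add: deta_def)

lemma norm_vdeta_le: "norm (vdeta u) \<le> D * norm u"
  using norm_vec_le_card[of "vdeta u" "L * norm u"] norm_deta_le by (simp add: vdeta_def D_def)

lemma inner_eta: "inner (eta u) v = inner u (eta v)"
  using L2_smult_adjoint[OF h_props] by (simp add: eta_def)

lemma inner_veta: "inner (veta G) H = inner G (veta H)"
  by (simp add: inner_vec_def veta_def inner_eta)

lemma veta_vscaleC: "veta (vscaleC z G) = vscaleC z (veta G)"
  by (simp add: veta_def vscaleC_def vec_eq_iff eta_scaleC)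

lemma eta_deta: "eta (deta i u) = deta i (eta u)"
  unfolding eta_def deta_def by (rule L2_smult_commute[OF h_props dh_props])

lemma eta_H1:
  assumes "u \<in> H1"
  shows "eta u \<in> H1" "grad (eta u) = veta (grad u) + vdeta u"
proof -
  have w: "has_weak_deriv i (eta u) (eta (weak_deriv i u) + deta i u)" for i
    unfolding eta_def deta_def by (rule has_weak_deriv_smult[OF test H1_has_weak_deriv[OF assms]])
  then show "eta u \<in> H1" by (rule H1I)
  show "grad (eta u) = veta (grad u) + vdeta u"
    using weak_deriv_eq[OF w] by (simp add: grad_def veta_def vdeta_def vec_eq_iff)
qed

lemma weak_div_eta:
  assumes "u \<in> H1"
  shows "weak_div k (eta u) = eta (weak_div k u) + (\<Sum>i\<in>UNIV. L2_comp k i (deta i u))"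
proof -
  note lc = bounded_linear.linear[OF bounded_linear_L2_comp]
  have "weak_deriv i (eta u) = eta (weak_deriv i u) + deta i u" for i
    using eta_H1(2)[OF assms] by (simp add: grad_def veta_def vdeta_def vec_eq_iff)
  then show ?thesis
    by (simp add: weak_div_def linear_add[OF lc] eta_comp sum.distrib linear_sum[OF linear_eta])
qed

text \<open>Since div u = 0, only derivatives of the cutoff survive: div (\<eta>^2 u) = 2 \<eta>
  \<nabla>\<eta> \<cdot> u. Squaring the cutoff leaves one factor \<eta> on \<open>u\<close>, so the
  bound involves \<open>norm (eta u)\<close>, which the left side of the energy inequality can
  absorb.\<close>

lemma norm_weak_div_eta_eta:
  assumes u: "u \<in> H1_sigma"
  shows "norm (weak_div k (eta (eta u))) \<le> 2 * D * norm (eta u)"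
proof -
  have u1: "u \<in> H1" by (rule H1_sigma_H1[OF u])
  let ?S = "\<lambda>w. \<Sum>i\<in>UNIV. L2_comp k i (deta i w)"
  have "weak_div k (eta (eta u)) = eta (weak_div k (eta u)) + ?S (eta u)"
    by (rule weak_div_eta[OF eta_H1(1)[OF u1]])
  also have "weak_div k (eta u) = ?S u"
    by (simp add: weak_div_eta[OF u1] weak_div_H1_sigma[OF u] linear_0[OF linear_eta])
  also have "eta (?S u) = ?S (eta u)"
    by (simp add: linear_sum[OF linear_eta] eta_comp[symmetric] eta_deta)
  finally have eq: "weak_div k (eta (eta u)) = 2 *\<^sub>R ?S (eta u)" by (simp add: scaleR_2)
  have "norm (?S (eta u)) \<le> (\<Sum>i\<in>(UNIV :: 'n set). L * norm (eta u))"
  proof (rule sum_norm_le)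
    show "norm (L2_comp k i (deta i (eta u))) \<le> L * norm (eta u)" for i
      using norm_L2_comp_le[of k i "deta i (eta u)"] norm_deta_le[of i "eta u"] by linarith
  qed
  then show ?thesis unfolding eq by (simp add: D_def)
qed

end

section \<open>The energy inequality for the cut-off resolvent\<close>

locale stokes_cutoff = stokes_sector \<mu> mlo mhi c \<kappa> + cutoff h L
  for \<mu> :: "'n::finite coeffs" and mlo mhi c \<kappa> :: real and h :: "real ^ 'n \<Rightarrow> real" and L :: real
begin

lemma stokes_mult_veta: "stokes_mult \<mu> (veta G) = veta (stokes_mult \<mu> G)"
proof -
  have "L2_smult (\<mu> \<alpha> \<beta> i j) (eta w) = eta (L2_smult (\<mu> \<alpha> \<beta> i j) w)" for \<alpha> \<beta> i j w
    unfolding eta_def by (rule L2_smult_commute[OF coeff_props h_props])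
  then show ?thesis
    by (simp add: stokes_mult_def veta_def vec_eq_iff eta_comp linear_sum[OF linear_eta])
qed

lemma form_rotated_bound:
  assumes "z \<in> {Complex 1 \<kappa>, Complex 1 (- \<kappa>)}"
  shows "\<bar>inner (stokes_mult \<mu> A) (vscaleC z B)\<bar> \<le> Z * bnd * (norm A * norm B)"
proof -
  have "\<bar>inner (stokes_mult \<mu> A) (vscaleC z B)\<bar> \<le> norm (stokes_mult \<mu> A) * (cmod z * norm B)"
    using Cauchy_Schwarz_ineq2[of "stokes_mult \<mu> A" "vscaleC z B"] by simp
  also have "\<dots> \<le> (bnd * norm A) * (Z * norm B)"
    using Z_pos bnd_pos by (intro mult_mono norm_stokes_mult_le rotation_norm assms mult_nonneg_nonneg) auto
  finally show ?thesis by (simp add: mult_ac)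
qed

text \<open>Testing the equation with the Helmholtz projection of \<open>\<eta>\<^sup>2 u\<close>: the gradient part \<open>g\<close>
  that is removed plays the role of the pressure.\<close>

lemma localised_energy:
  assumes z: "z \<in> {Complex 1 \<kappa>, Complex 1 (- \<kappa>)}" and lz: "c * cmod l \<le> Re (l * cnj z)"
    and f: "f \<in> L2_sigma" and F: "veta (mat_rows F) = 0"
    and sol: "resolvent_solution \<mu> l f F u"
  shows "c0 * (cmod l * (norm (eta u))\<^sup>2 + (norm (grad (eta u)))\<^sup>2)
    \<le> Z * bnd * (2 * (norm (grad (eta u)) * (D * norm u)) + (D * norm u)\<^sup>2 + norm (grad u) * (2 * D * norm (eta u)))
      + Z * norm (eta f) * norm (eta u) + Z * norm (mat_rows F) * (2 * D * norm (eta u))"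
proof -
  have z0: "z \<noteq> 0" using z by (auto simp: complex_eq_iff)
  have u: "u \<in> H1_sigma" using sol by (simp add: resolvent_solution_iff)
  have u1: "u \<in> H1" and us: "u \<in> L2_sigma" using u by (simp_all add: H1_sigma_closure)
  define w where "w = eta u"
  define W where "W = grad w"
  define E where "E = vdeta u"
  define x where "x = eta w"
  define v where "v = helmholtz x"
  define g where "g = x - v"
  define M where "M = stokes_mult \<mu>"
  have w1: "w \<in> H1" unfolding w_def by (rule eta_H1(1)[OF u1])
  have x1: "x \<in> H1" unfolding x_def by (rule eta_H1(1)[OF w1])
  have vs: "v \<in> H1_sigma" unfolding v_def by (rule helmholtz_H1_sigma[OF x1])
  have v1: "v \<in> H1" by (rule H1_sigma_H1[OF vs])
  have G: "veta (grad u) = W - E"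
    using eta_H1(2)[OF u1] by (simp add: W_def E_def w_def)
  have gx: "grad x = veta (W + E)"
  proof -
    have "vdeta w = veta E" by (simp add: vdeta_def veta_def E_def w_def eta_deta vec_eq_iff)
    then show ?thesis
      using eta_H1(2)[OF w1] by (simp add: x_def W_def veta_def vec_eq_iff linear_add[OF linear_eta])
  qed
  have gv: "grad v = veta (W + E) - grad g"
    using grad_diff[OF x1 v1] gx by (simp add: g_def)
  \<comment> \<open>Against a solenoidal \<open>y\<close> the projection is invisible. So
    \<open>l *\<^sub>C u\<close> and \<open>f\<close> meet \<eta>^2 u itself, and only the gradient
    terms notice the correction \<open>g\<close>.\<close>
  have proj: "inner y (z *\<^sub>C v) = inner (eta y) (z *\<^sub>C w)" if "y \<in> L2_sigma" for y
  proof -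
    have "inner y (z *\<^sub>C v) = inner y (z *\<^sub>C x)"
      using helmholtz_inner[OF that, of "z *\<^sub>C x"] by (simp add: v_def helmholtz_scaleC inner_commute)
    then show ?thesis by (simp add: x_def inner_eta eta_scaleC)
  qed
  have lin: "M (A + B) = M A + M B" "M (A - B) = M A - M B" for A B
    using linear_add[OF bounded_linear.linear[OF bounded_linear_stokes_mult]]
      linear_diff[OF bounded_linear.linear[OF bounded_linear_stokes_mult]] by (auto simp: M_def)
  \<comment> \<open>One factor \<eta> of the test field is moved to the flux. It commutes with the
    pointwise operator \<open>M\<close>, so the main term depends on the cut-off gradient
    \<open>W\<close> and the commutator \<open>E\<close> only.\<close>
  have form: "inner (M (grad u)) (vscaleC z (grad v))
      = inner (M (W - E)) (vscaleC z (W + E)) - inner (M (grad u)) (vscaleC z (grad g))"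
  proof -
    have "inner (M (grad u)) (vscaleC z (veta (W + E))) = inner (M (W - E)) (vscaleC z (W + E))"
      by (simp add: veta_vscaleC[symmetric] inner_veta[symmetric] M_def stokes_mult_veta[symmetric] G)
    then show ?thesis unfolding gv vscaleC_diff by (simp add: inner_diff_right)
  qed
  \<comment> \<open>The cutoff annihilates \<open>F\<close>, so \<open>F\<close> is felt solely
    through the nonlocal part \<open>g\<close> of the test field.\<close>
  have Fterm: "inner (mat_rows F) (vscaleC z (grad v)) = - inner (mat_rows F) (vscaleC z (grad g))"
    unfolding gv vscaleC_diff
    by (simp add: inner_diff_right veta_vscaleC[symmetric] inner_veta[symmetric] F)
  have "inner (l *\<^sub>C u) (z *\<^sub>C v) + inner (M (grad u)) (vscaleC z (grad v))
      = inner f (z *\<^sub>C v) - inner (mat_rows F) (vscaleC z (grad v))"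
    using sol vs unfolding resolvent_solution_rotated[OF z0] by (simp add: M_def)
  moreover have "inner (l *\<^sub>C u) (z *\<^sub>C v) = inner (l *\<^sub>C w) (z *\<^sub>C w)"
    by (simp add: proj scaleC_L2_sigma us eta_scaleC w_def)
  ultimately have id: "inner (l *\<^sub>C w) (z *\<^sub>C w) + inner (M (W - E)) (vscaleC z (W + E))
      = inner (M (grad u)) (vscaleC z (grad g)) + inner (eta f) (z *\<^sub>C w) + inner (mat_rows F) (vscaleC z (grad g))"
    unfolding form Fterm proj[OF f] by simp
  have "c0 * (cmod l * (norm w)\<^sup>2 + (norm W)\<^sup>2) \<le> inner (l *\<^sub>C w) (z *\<^sub>C w) + inner (M W) (vscaleC z W)"
    unfolding M_def W_def by (rule energy_lower_bound[OF z lz w1])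
  also have "\<dots> = - inner (M W) (vscaleC z E) + inner (M E) (vscaleC z W) + inner (M E) (vscaleC z E)
      + inner (M (grad u)) (vscaleC z (grad g)) + inner (eta f) (z *\<^sub>C w) + inner (mat_rows F) (vscaleC z (grad g))"
    using id by (simp add: lin vscaleC_add inner_add_right inner_diff_left)
  also have "\<dots> \<le> Z * bnd * (norm W * norm E) + Z * bnd * (norm E * norm W) + Z * bnd * (norm E * norm E)
      + Z * bnd * (norm (grad u) * norm (grad g)) + Z * norm (eta f) * norm w + Z * norm (mat_rows F) * norm (grad g)"
  proof -
    have "inner (eta f) (z *\<^sub>C w) \<le> norm (eta f) * (cmod z * norm w)"
      using norm_cauchy_schwarz[of "eta f" "z *\<^sub>C w"] by simp
    also have "\<dots> \<le> norm (eta f) * (Z * norm w)" by (intro mult_left_mono mult_right_mono rotation_norm z) auto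
    finally have 1: "inner (eta f) (z *\<^sub>C w) \<le> Z * norm (eta f) * norm w" by (simp add: mult_ac)
    have "inner (mat_rows F) (vscaleC z (grad g)) \<le> norm (mat_rows F) * (cmod z * norm (grad g))"
      using norm_cauchy_schwarz[of "mat_rows F" "vscaleC z (grad g)"] by simp
    also have "\<dots> \<le> norm (mat_rows F) * (Z * norm (grad g))" by (intro mult_left_mono mult_right_mono rotation_norm z) auto
    finally have 2: "inner (mat_rows F) (vscaleC z (grad g)) \<le> Z * norm (mat_rows F) * norm (grad g)" by (simp add: mult_ac)
    show ?thesis
      using 1 2 form_rotated_bound[OF z, of W E] form_rotated_bound[OF z, of E W] form_rotated_bound[OF z, of E E]
        form_rotated_bound[OF z, of "grad u" "grad g"] unfolding M_def[symmetric] by linarith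
  qed
  also have "\<dots> = Z * bnd * (2 * (norm W * norm E) + (norm E)\<^sup>2 + norm (grad u) * norm (grad g))
      + Z * norm (eta f) * norm w + Z * norm (mat_rows F) * norm (grad g)"
    by (simp add: power2_eq_square algebra_simps)
  also have "\<dots> \<le> Z * bnd * (2 * (norm W * (D * norm u)) + (D * norm u)\<^sup>2 + norm (grad u) * (2 * D * norm w))
      + Z * norm (eta f) * norm w + Z * norm (mat_rows F) * (2 * D * norm w)"
  proof -
    have E: "norm E \<le> D * norm u" unfolding E_def by (rule norm_vdeta_le)
    \<comment> \<open>\<open>undefined\<close> is an arbitrary slot for the scalar
      divergence.\<close>
    have "(norm (grad g))\<^sup>2 = (norm (weak_div undefined x))\<^sup>2"
      using helmholtz_complement_grad[OF x1] by (simp add: norm_vec_square grad_def g_def v_def)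
    then have "norm (grad g) = norm (weak_div undefined x)"
      by (meson norm_ge_zero power2_eq_iff_nonneg)
    also have "\<dots> \<le> 2 * D * norm w"
      unfolding x_def w_def by (rule norm_weak_div_eta_eta[OF u])
    finally have g: "norm (grad g) \<le> 2 * D * norm w" .
    show ?thesis
      using E g Z_pos bnd_pos
      by (intro add_mono mult_left_mono power_mono order_refl) (auto intro: mult_left_mono)
  qed
  finally show ?thesis by (simp add: w_def W_def)
qed

text \<open>The constant of \<open>quadratic_bound\<close>, with the \<open>b\<close> of the next
  proof collecting all coefficients.\<close>

definition K2 :: real where "K2 = 2 * (4 * Z * bnd * K1 + Z * bnd * K1\<^sup>2 + 3 * Z) / c0 + 1"

text \<open>Every term not containing \<open>eta f\<close> carries at least one factor
  \<open>q = D / s\<close>, the ratio of the length scale of \<lambda> to that of the cutoff; the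
  global quantities enter through \<open>resolvent_energy\<close>. The term
  \<open>norm (eta f) / s\<close> is kept although it vanishes for data supported away from the
  cutoff: it is needed when \<open>f\<close> is itself a resolvent, as in the
  \<lambda>-derivatives.\<close>

lemma local_resolvent_estimate:
  assumes l: "sec l" and f: "f \<in> L2_sigma" and F: "veta (mat_rows F) = 0"
    and sol: "resolvent_solution \<mu> l f F u"
  defines "s \<equiv> sqrt (cmod l)"
  shows "s * norm (eta u) \<le> K2 * (D / s * (norm f / s + norm (mat_rows F)) + norm (eta f) / s)"
proof -
  obtain z where z: "z \<in> {Complex 1 \<kappa>, Complex 1 (- \<kappa>)}" and lz: "c * cmod l \<le> Re (l * cnj z)" and l0: "l \<noteq> 0"
    using l unfolding sectorial_def by blast
  have s: "s > 0" "s\<^sup>2 = cmod l" using l0 by (auto simp: s_def)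
  define A where "A = norm f / s + norm (mat_rows F)"
  have A: "A \<ge> 0" using s by (simp add: A_def)
  have en: "s * norm u \<le> K1 * A" "norm (grad u) \<le> K1 * A"
    using resolvent_energy[OF l sol] by (simp_all add: A_def s_def)
  define q where "q = D / s"
  have q: "q \<ge> 0" using s D_nonneg by (simp add: q_def)
  define N where "N = sqrt (cmod l * (norm (eta u))\<^sup>2 + (norm (grad (eta u)))\<^sup>2)"
  have N2: "N\<^sup>2 = cmod l * (norm (eta u))\<^sup>2 + (norm (grad (eta u)))\<^sup>2" by (simp add: N_def)
  have N0: "N \<ge> 0" by (simp add: N_def)
  have Nu: "s * norm (eta u) \<le> N"
    by (rule power2_le_imp_le[OF _ N0]) (simp add: N2 power_mult_distrib s)
  have Ng: "norm (grad (eta u)) \<le> N"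
    by (rule power2_le_imp_le[OF _ N0]) (simp add: N2)
  have Du: "D * norm u \<le> q * (K1 * A)"
    using mult_left_mono[OF en(1) q] s by (simp add: q_def)
  have Dw: "2 * D * norm (eta u) \<le> 2 * (q * N)"
    using mult_left_mono[OF Nu q] s by (simp add: q_def)
  have fw: "norm (eta f) * norm (eta u) \<le> norm (eta f) / s * N"
    using mult_left_mono[OF Nu, of "norm (eta f) / s"] s by simp
  define X where "X = q * A + norm (eta f) / s"
  have X: "X \<ge> 0" "q * A \<le> X" "norm (eta f) / s \<le> X" using q A s by (auto simp: X_def)
  define b where "b = 4 * Z * bnd * K1 + Z * bnd * K1\<^sup>2 + 3 * Z"
  note pos = Z_pos bnd_pos K1_pos
  have "c0 * N\<^sup>2 \<le> Z * bnd * (2 * (norm (grad (eta u)) * (D * norm u)) + (D * norm u)\<^sup>2 + norm (grad u) * (2 * D * norm (eta u)))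
      + Z * norm (eta f) * norm (eta u) + Z * norm (mat_rows F) * (2 * D * norm (eta u))"
    unfolding N2 by (rule localised_energy[OF z lz f F sol])
  also have "\<dots> \<le> Z * bnd * (2 * (N * (q * (K1 * A))) + (q * (K1 * A))\<^sup>2 + (K1 * A) * (2 * (q * N)))
      + Z * (norm (eta f) / s * N) + Z * (A * (2 * (q * N)))"
  proof -
    have 1: "norm (grad (eta u)) * (D * norm u) \<le> N * (q * (K1 * A))"
      by (rule mult_mono[OF Ng Du N0]) (use D_nonneg in simp)
    have 2: "(D * norm u)\<^sup>2 \<le> (q * (K1 * A))\<^sup>2"
      by (rule power_mono[OF Du]) (use D_nonneg in simp)
    have 3: "norm (grad u) * (2 * D * norm (eta u)) \<le> (K1 * A) * (2 * (q * N))"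
      by (rule mult_mono[OF en(2) Dw]) (use D_nonneg pos A in auto)
    have "norm (mat_rows F) \<le> A" using s by (simp add: A_def)
    from mult_mono[OF this Dw A] have 4: "norm (mat_rows F) * (2 * D * norm (eta u)) \<le> A * (2 * (q * N))"
      using D_nonneg by simp
    have "Z * bnd * (2 * (norm (grad (eta u)) * (D * norm u)) + (D * norm u)\<^sup>2 + norm (grad u) * (2 * D * norm (eta u)))
        \<le> Z * bnd * (2 * (N * (q * (K1 * A))) + (q * (K1 * A))\<^sup>2 + (K1 * A) * (2 * (q * N)))"
      by (rule mult_left_mono[OF add_mono[OF add_mono[OF mult_left_mono[OF 1] 2] 3]]) (use pos in auto)
    moreover have "Z * norm (eta f) * norm (eta u) \<le> Z * (norm (eta f) / s * N)"
      using mult_left_mono[OF fw, of Z] pos by (simp add: mult.assoc)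
    moreover have "Z * norm (mat_rows F) * (2 * D * norm (eta u)) \<le> Z * (A * (2 * (q * N)))"
      using mult_left_mono[OF 4, of Z] pos by (simp add: mult.assoc)
    ultimately show ?thesis by linarith
  qed
  also have "\<dots> = (4 * Z * bnd * K1 + 2 * Z) * (q * A) * N + Z * (norm (eta f) / s) * N + Z * bnd * K1\<^sup>2 * (q * A)\<^sup>2"
    by (simp add: power2_eq_square algebra_simps)
  also have "\<dots> \<le> (4 * Z * bnd * K1 + 2 * Z) * X * N + Z * X * N + b * X\<^sup>2"
  proof -
    have 1: "(4 * Z * bnd * K1 + 2 * Z) * (q * A) * N \<le> (4 * Z * bnd * K1 + 2 * Z) * X * N"
      using X N0 pos by (intro mult_right_mono mult_left_mono) auto
    have 2: "Z * (norm (eta f) / s) * N \<le> Z * X * N"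
      using X N0 pos by (intro mult_right_mono mult_left_mono) auto
    have 3: "Z * bnd * K1\<^sup>2 * (q * A)\<^sup>2 \<le> b * X\<^sup>2"
      using X pos q A by (intro mult_mono power_mono) (auto simp: b_def)
    show ?thesis using 1 2 3 by linarith
  qed
  also have "\<dots> \<le> b * X * N + b * X\<^sup>2"
  proof -
    have "(4 * Z * bnd * K1 + 2 * Z) * X * N + Z * X * N = (4 * Z * bnd * K1 + 3 * Z) * (X * N)"
      by (simp add: algebra_simps)
    also have "\<dots> \<le> b * (X * N)" using X N0 pos by (intro mult_right_mono) (auto simp: b_def)
    finally show ?thesis by (simp add: mult.assoc)
  qed
  finally have "c0 * N\<^sup>2 \<le> b * X * N + b * X\<^sup>2" .
  then have "N \<le> (2 * b / c0 + 1) * X"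
    using c0_pos N0 X(1) pos by (intro quadratic_bound) (auto simp: b_def)
  then show ?thesis using Nu by (simp add: K2_def b_def X_def q_def A_def)
qed

end

section \<open>Contour integrals\<close>

lemma integrable_on_ray:
  fixes f :: "real \<Rightarrow> 'a::banach"
  assumes cont: "continuous_on {a..} f" and b: "b > 0"
    and le: "\<And>s. s \<ge> a \<Longrightarrow> norm (f s) \<le> K * exp (- b * s)"
  shows "f integrable_on {a..}"
proof (rule integrable_on_all_intervals_integrable_bound)
  show "(\<lambda>s. K * exp (- b * s)) integrable_on {a..}"
    by (rule has_integral_integrable[OF has_integral_mult_right[OF has_integral_exp_minus_to_infinity[OF b]]])
  show "(\<lambda>x. if x \<in> {a..} then f x else 0) integrable_on cbox p q" for p q
  proof -
    have "{a..} \<inter> {p..q} = {max a p..q}" by auto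
    moreover have "f integrable_on {max a p..q}"
      by (rule integrable_continuous_interval) (rule continuous_on_subset[OF cont], auto)
    ultimately show ?thesis
      unfolding box_real integrable_restrict_Int by simp
  qed
qed (use le in auto)

text \<open>The rate \<open>b\<close> degenerates as the ray approaches the imaginary axis. It is
  used for integrability and for a vanishing tail only, so the bound \<open>B\<close> on finite
  pieces survives unchanged.\<close>

lemma norm_integral_ray_le:
  fixes f :: "real \<Rightarrow> 'a::banach"
  assumes cont: "continuous_on {a..} f" and b: "b > 0" and K: "K \<ge> 0"
    and le: "\<And>s. s \<ge> a \<Longrightarrow> norm (f s) \<le> K * exp (- b * s)"
    and part: "\<And>S. S \<ge> a \<Longrightarrow> norm (integral {a..S} f) \<le> B"
  shows "norm (integral {a..} f) \<le> B"
proof -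
  have tail: "norm (integral {S..} f) \<le> K * (exp (- b * S) / b)" if "S \<ge> a" for S
  proof -
    have "f integrable_on {S..}"
      by (rule integrable_on_ray[OF continuous_on_subset[OF cont] b, of _ K]) (use that le in auto)
    then have "norm (integral {S..} f) \<le> integral {S..} (\<lambda>s. K * exp (- b * s))"
      by (rule Henstock_Kurzweil_Integration.integral_norm_bound_integral)
         (rule has_integral_integrable[OF has_integral_mult_right[OF has_integral_exp_minus_to_infinity[OF b]]],
          use that le in auto)
    also have "\<dots> = K * (exp (- b * S) / b)"
      by (intro integral_unique has_integral_mult_right has_integral_exp_minus_to_infinity b)
    finally show ?thesis .
  qed
  have split: "integral {a..} f = integral {a..S} f + integral {S..} f" if "S \<ge> a" for S
  proof (rule integral_unique)
    have "f integrable_on {a..S}"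
      by (rule integrable_continuous_interval) (rule continuous_on_subset[OF cont], auto)
    moreover have "f integrable_on {S..}"
      by (rule integrable_on_ray[OF continuous_on_subset[OF cont] b, of _ K]) (use that le in auto)
    moreover have "{a..S} \<inter> {S..} \<subseteq> {S}" by auto
    then have "negligible ({a..S} \<inter> {S..})" using negligible_subset negligible_sing by blast
    ultimately have "(f has_integral integral {a..S} f + integral {S..} f) ({a..S} \<union> {S..})"
      by (intro has_integral_Un) (auto simp: integrable_integral)
    also have "{a..S} \<union> {S..} = {a..}" using that by auto
    finally show "(f has_integral integral {a..S} f + integral {S..} f) {a..}" .
  qed
  have bd: "norm (integral {a..} f) \<le> B + K * (exp (- b * S) / b)" if "S \<ge> a" for S
    using split[OF that] part[OF that] tail[OF that] norm_triangle_ineq[of "integral {a..S} f" "integral {S..} f"] by simp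
  have "((\<lambda>S. exp (- b * S)) \<longlongrightarrow> 0) at_top"
    using b by (intro filterlim_compose[OF exp_at_bot] filterlim_tendsto_neg_mult_at_bot[OF tendsto_const _ filterlim_ident]) simp
  then have "((\<lambda>S. B + K * (exp (- b * S) / b)) \<longlongrightarrow> B + K * (0 / b)) at_top"
    using b by (intro tendsto_intros) auto
  then have "((\<lambda>S. B + K * (exp (- b * S) / b)) \<longlongrightarrow> B) at_top" by simp
  then show ?thesis
    by (rule tendsto_lowerbound) (use bd in \<open>auto intro: eventually_mono[OF eventually_ge_at_top[of a]]\<close>)
qed

text \<open>Two integrations by parts give a bound which does not depend on how close \<open>e\<close> is to the
  imaginary axis.\<close>

lemma ray_estimate:
  fixes \<Phi> \<Phi>' \<Phi>'' :: "real \<Rightarrow> 'n::finite vfield"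
  assumes e: "cmod e = 1" "Re e < 0" and t: "t > 0" and K: "K \<ge> 0"
    and d0: "\<And>s. s \<ge> 1 / t \<Longrightarrow> (\<Phi> has_vector_derivative \<Phi>' s) (at s within {1 / t..})"
    and d1: "\<And>s. s \<ge> 1 / t \<Longrightarrow> (\<Phi>' has_vector_derivative \<Phi>'' s) (at s within {1 / t..})"
    and b: "\<And>s. s \<ge> 1 / t \<Longrightarrow> norm (\<Phi> s) \<le> K" "\<And>s. s \<ge> 1 / t \<Longrightarrow> norm (\<Phi>' s) \<le> K / s"
      "\<And>s. s \<ge> 1 / t \<Longrightarrow> norm (\<Phi>'' s) \<le> K / s\<^sup>2"
  defines "f \<equiv> \<lambda>s. exp (of_real t * (of_real s * e)) *\<^sub>C \<Phi> s"
  shows "f integrable_on {1 / t..}" "norm (integral {1 / t..} f) \<le> 5 * K / t"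
proof -
  define a where "a = 1 / t"
  have a: "a > 0" "a * t = 1" using t by (simp_all add: a_def)
  define E where "E s = exp (of_real t * (of_real s * e))" for s :: real
  have Enorm: "cmod (E s) = exp (- (- t * Re e) * s)" for s
    by (simp add: E_def norm_exp_eq_Re mult_ac)
  have Ele: "cmod (E s) \<le> 1" if "s \<ge> a" for s
    unfolding Enorm using that e(2) t a by (simp add: mult_nonneg_nonpos2 mult_nonpos_nonneg mult_nonneg_nonpos)
  define w where "w = of_real t * e"
  have w: "w \<noteq> 0" "cmod w = t" using e t by (auto simp: w_def norm_mult)
  have dE: "(E has_vector_derivative w * E s) (at s within S)" for s S
  proof -
    have "((\<lambda>z. exp (of_real t * (z * e))) has_field_derivative w * E s) (at (of_real s))"
      unfolding E_def w_def by (auto intro!: derivative_eq_intros)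
    from has_vector_derivative_real_field[OF this] show ?thesis by (simp add: E_def[abs_def])
  qed
  have dscale: "((\<lambda>s. g s *\<^sub>C x s) has_vector_derivative (g s *\<^sub>C x' + g' *\<^sub>C x s)) (at s within S)"
    if "(g has_vector_derivative g') (at s within S)" "(x has_vector_derivative x') (at s within S)"
    for g :: "real \<Rightarrow> complex" and g' s S and x :: "real \<Rightarrow> 'n vfield" and x'
    by (rule bounded_bilinear.has_vector_derivative[OF bounded_bilinear_scaleC that])
  have c0: "continuous_on {a..} \<Phi>" using d0 unfolding a_def[symmetric]
    by (auto simp: continuous_on_eq_continuous_within intro: has_vector_derivative_continuous)
  have cE: "continuous_on S E" for S unfolding E_def by (intro continuous_intros)
  have cf: "continuous_on {a..} f"
    unfolding f_def E_def[symmetric] using bounded_bilinear.continuous_on[OF bounded_bilinear_scaleC cE c0] .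
  have fle: "norm (f s) \<le> K * exp (- (- t * Re e) * s)" if "s \<ge> a" for s
    using b(1)[of s] that unfolding f_def E_def[symmetric] norm_scaleC Enorm[symmetric] a_def
    by (subst mult.commute) (rule mult_right_mono, auto)
  have pos: "- t * Re e > 0" using e(2) t by (simp add: mult_pos_neg)
  show "f integrable_on {1 / t..}"
    using integrable_on_ray[OF cf pos fle] by (simp add: a_def)
  \<comment> \<open>Both integrations by parts packed into one primitive: the derivative of
    \<open>F\<close> is \<open>f - g\<close>, and \<open>g\<close> decays like
    \<open>1 / s^2\<close>. Dividing by \<open>w\<close> costs powers of \<open>t\<close> only, as
    \<open>cmod w = t\<close> for every angle.\<close>
  define F where "F s = (E s / w) *\<^sub>C \<Phi> s - (E s / w\<^sup>2) *\<^sub>C \<Phi>' s" for s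
  define g where "g s = (E s / w\<^sup>2) *\<^sub>C \<Phi>'' s" for s
  have dF: "(F has_vector_derivative (f s - g s)) (at s within {a..S})" if "s \<in> {a..S}" for s S
  proof -
    have d0': "(\<Phi> has_vector_derivative \<Phi>' s) (at s within {a..S})"
      and d1': "(\<Phi>' has_vector_derivative \<Phi>'' s) (at s within {a..S})"
      using d0[of s] d1[of s] that by (auto simp: a_def intro: has_vector_derivative_within_subset)
    have dEw: "((\<lambda>s. E s / v) has_vector_derivative (w * E s / v)) (at s within {a..S})" for v
      using has_vector_derivative_divide[OF dE] by simp
    have "(F has_vector_derivative ((E s / w) *\<^sub>C \<Phi>' s + (w * E s / w) *\<^sub>C \<Phi> s)
        - ((E s / w\<^sup>2) *\<^sub>C \<Phi>'' s + (w * E s / w\<^sup>2) *\<^sub>C \<Phi>' s)) (at s within {a..S})"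
      unfolding F_def by (intro has_vector_derivative_diff dscale dEw d0' d1')
    also have "((E s / w) *\<^sub>C \<Phi>' s + (w * E s / w) *\<^sub>C \<Phi> s)
        - ((E s / w\<^sup>2) *\<^sub>C \<Phi>'' s + (w * E s / w\<^sup>2) *\<^sub>C \<Phi>' s) = f s - g s"
      using w by (simp add: f_def E_def[symmetric] g_def power2_eq_square)
    finally show ?thesis .
  qed
  have Fle: "norm (F s) \<le> 2 * K / t" if "s \<ge> a" for s
  proof -
    have s0: "s > 0" using that a by simp
    have "1 / s \<le> 1 / a" using that a by (intro divide_left_mono) auto
    then have s: "1 / s \<le> t" by (simp add: a_def)
    have "norm (F s) \<le> norm ((E s / w) *\<^sub>C \<Phi> s) + norm ((E s / w\<^sup>2) *\<^sub>C \<Phi>' s)"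
      unfolding F_def by (rule norm_triangle_ineq4)
    also have "\<dots> = cmod (E s) / t * norm (\<Phi> s) + cmod (E s) / t\<^sup>2 * norm (\<Phi>' s)"
      by (simp add: norm_divide norm_power w)
    also have "\<dots> \<le> 1 / t * K + 1 / t\<^sup>2 * (K * t)"
    proof (intro add_mono mult_mono divide_right_mono Ele that)
      show "norm (\<Phi> s) \<le> K" using b(1)[of s] that by (simp add: a_def)
      have "norm (\<Phi>' s) \<le> K * (1 / s)" using b(2)[of s] that by (simp add: a_def)
      also have "\<dots> \<le> K * t" by (intro mult_left_mono s K)
      finally show "norm (\<Phi>' s) \<le> K * t" .
    qed (use t in auto)
    also have "\<dots> = 2 * K / t" using t by (simp add: power2_eq_square field_simps)
    finally show ?thesis .
  qed
  have "norm (integral {a..S} f) \<le> 5 * K / t" if S: "S \<ge> a" for S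
  proof -
    have FTC: "((\<lambda>s. f s - g s) has_integral (F S - F a)) {a..S}"
      by (rule fundamental_theorem_of_calculus[OF S]) (rule dF)
    have fi: "f integrable_on {a..S}"
      by (rule integrable_continuous_interval) (rule continuous_on_subset[OF cf], auto)
    have "(\<lambda>s. f s - (f s - g s)) integrable_on {a..S}"
      by (rule integrable_diff[OF fi has_integral_integrable[OF FTC]])
    then have gi: "g integrable_on {a..S}" by simp
    have hi: "((\<lambda>s. K / t\<^sup>2 * (1 / s\<^sup>2)) has_integral (K / t\<^sup>2 * (- (1 / S)) - K / t\<^sup>2 * (- (1 / a)))) {a..S}"
    proof (rule fundamental_theorem_of_calculus[OF S])
      fix s assume "s \<in> {a..S}"
      then have "s \<noteq> 0" using a by auto
      then show "((\<lambda>s. K / t\<^sup>2 * (- (1 / s))) has_vector_derivative K / t\<^sup>2 * (1 / s\<^sup>2)) (at s within {a..S})"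
        using t by (auto intro!: derivative_eq_intros simp: has_real_derivative_iff_has_vector_derivative[symmetric] power2_eq_square field_simps)
    qed
    have "norm (integral {a..S} g) \<le> integral {a..S} (\<lambda>s. K / t\<^sup>2 * (1 / s\<^sup>2))"
    proof (rule Henstock_Kurzweil_Integration.integral_norm_bound_integral[OF gi])
      show "(\<lambda>s. K / t\<^sup>2 * (1 / s\<^sup>2)) integrable_on {a..S}" using hi by blast
      fix s assume s: "s \<in> {a..S}"
      have "norm (g s) = cmod (E s) / t\<^sup>2 * norm (\<Phi>'' s)" by (simp add: g_def norm_divide norm_power w)
      also have "\<dots> \<le> 1 / t\<^sup>2 * (K / s\<^sup>2)"
        using s b(3)[of s] Ele[of s] by (intro mult_mono divide_right_mono) (auto simp: a_def)
      finally show "norm (g s) \<le> K / t\<^sup>2 * (1 / s\<^sup>2)" by simp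
    qed
    also have "\<dots> = K / t\<^sup>2 * (- (1 / S)) - K / t\<^sup>2 * (- (1 / a))" using hi by (rule integral_unique)
    also have "\<dots> \<le> K / t"
    proof -
      have "K / t\<^sup>2 * (1 / S) \<ge> 0" using K S a by auto
      moreover have "K / t\<^sup>2 * (1 / a) = K / t" using t by (simp add: a_def power2_eq_square)
      ultimately show ?thesis unfolding mult_minus_right by linarith
    qed
    finally have gle: "norm (integral {a..S} g) \<le> K / t" .
    have "integral {a..S} f = (F S - F a) + integral {a..S} g"
    proof -
      have "integral {a..S} (\<lambda>s. f s - g s) = integral {a..S} f - integral {a..S} g"
        by (rule Henstock_Kurzweil_Integration.integral_diff[OF fi gi])
      then show ?thesis using integral_unique[OF FTC] by simp
    qed
    then have "norm (integral {a..S} f) \<le> norm (F S) + norm (F a) + norm (integral {a..S} g)"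
      using norm_triangle_ineq[of "F S - F a" "integral {a..S} g"] norm_triangle_ineq4[of "F S" "F a"] by simp
    \<comment> \<open>Two boundary terms and the remainder, in which \<open>1 / s^2\<close>
      integrates to at most \<open>t\<close>; hence the factor 5.\<close>
    also have "\<dots> \<le> 2 * K / t + 2 * K / t + K / t"
      by (intro add_mono Fle gle S order_refl)
    finally show ?thesis by simp
  qed
  from norm_integral_ray_le[OF cf pos K fle this]
  show "norm (integral {1 / t..} f) \<le> 5 * K / t" by (simp add: a_def)
qed

text \<open>Complex differentiability relative to \<Sigma>, which is not assumed open; along the
  contour only derivatives within \<Sigma> are needed.\<close>

definition cderiv_on :: "complex set \<Rightarrow> (complex \<Rightarrow> 'n::finite vfield) \<Rightarrow> (complex \<Rightarrow> 'n vfield) \<Rightarrow> bool" where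
  "cderiv_on \<Sigma> Y Y' \<longleftrightarrow> (\<forall>l\<in>\<Sigma>. (Y has_derivative (\<lambda>h. h *\<^sub>C Y' l)) (at l within \<Sigma>))"

lemma cderiv_on_ray:
  assumes d: "cderiv_on \<Sigma> Y Y'" and S: "\<And>s. s \<in> S \<Longrightarrow> of_real s * e \<in> \<Sigma>" and s: "s \<in> S"
  shows "((\<lambda>s. a *\<^sub>C Y (of_real s * e)) has_vector_derivative (a * e) *\<^sub>C Y' (of_real s * e)) (at s within S)"
proof -
  have g: "((\<lambda>s. complex_of_real s * e) has_derivative (\<lambda>h. of_real h * e)) (at s within S)"
    by (auto intro!: derivative_eq_intros)
  have "(Y has_derivative (\<lambda>h. h *\<^sub>C Y' (of_real s * e))) (at (of_real s * e) within (\<lambda>s. of_real s * e) ` S)"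
  proof (rule has_derivative_subset)
    show "(Y has_derivative (\<lambda>h. h *\<^sub>C Y' (of_real s * e))) (at (of_real s * e) within \<Sigma>)"
      using d S[OF s] unfolding cderiv_on_def by blast
    show "(\<lambda>s. of_real s * e) ` S \<subseteq> \<Sigma>" using S by blast
  qed
  from diff_chain_within[OF g this]
  have "((\<lambda>s. Y (of_real s * e)) has_derivative (\<lambda>h. (of_real h * e) *\<^sub>C Y' (of_real s * e))) (at s within S)"
    by (simp add: o_def)
  then have "((\<lambda>s. a *\<^sub>C Y (of_real s * e)) has_derivative (\<lambda>h. a *\<^sub>C (of_real h * e) *\<^sub>C Y' (of_real s * e))) (at s within S)"
    by (rule bounded_linear.has_derivative[OF bounded_linear_scaleC])
  moreover have "a *\<^sub>C (of_real h * e) *\<^sub>C Y' (of_real s * e) = h *\<^sub>R (a * e) *\<^sub>C Y' (of_real s * e)" for h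
    by (simp add: L2_scaleC_of_real[symmetric] mult_ac)
  ultimately show ?thesis by (simp add: has_vector_derivative_def)
qed

lemma cderiv_on_linear:
  assumes "cderiv_on \<Sigma> Y Y'" "bounded_linear T" "\<And>a x. T (a *\<^sub>C x) = a *\<^sub>C T x"
  shows "cderiv_on \<Sigma> (\<lambda>l. T (Y l)) (\<lambda>l. T (Y' l))"
  unfolding cderiv_on_def
proof
  fix l assume "l \<in> \<Sigma>"
  then have "(Y has_derivative (\<lambda>h. h *\<^sub>C Y' l)) (at l within \<Sigma>)"
    using assms(1) by (simp add: cderiv_on_def)
  from bounded_linear.has_derivative[OF assms(2) this]
  show "((\<lambda>l. T (Y l)) has_derivative (\<lambda>h. h *\<^sub>C T (Y' l))) (at l within \<Sigma>)"
    by (simp only: assms(3))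
qed

lemma cderiv_on_continuous: "cderiv_on \<Sigma> Y Y' \<Longrightarrow> continuous_on \<Sigma> Y"
  unfolding cderiv_on_def continuous_on_eq_continuous_within
  using has_derivative_continuous by blast

locale sector_contour =
  fixes \<theta> t :: real and \<Sigma> :: "complex set"
  assumes \<theta>: "pi / 2 < \<theta>" "\<theta> < pi" and t: "t > 0"
    and ray: "\<And>s. s \<ge> 1 / t \<Longrightarrow> of_real s * cis \<theta> \<in> \<Sigma>" "\<And>s. s \<ge> 1 / t \<Longrightarrow> of_real s * cis (- \<theta>) \<in> \<Sigma>"
    and arc: "\<And>\<phi>. \<phi> \<in> {- \<theta>..\<theta>} \<Longrightarrow> cis \<phi> / of_real t \<in> \<Sigma>"
begin

text \<open>Two rays contribute 5 each. On the arc the exponential has modulus at most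
  \<open>exp 1\<close>, and the angular length is at most \<open>2 * pi\<close>.\<close>

definition CC :: real where "CC = 10 + 2 * pi * exp 1"

abbreviation "ctr Y \<equiv> contour_integral_L2 \<theta> t (\<lambda>l. exp (of_real t * l) *\<^sub>C Y l)"

text \<open>Symbol-type bounds, each derivative gaining one factor \<open>1 / cmod l\<close>:
  exactly the input of \<open>ray_estimate\<close>, asked only outside the disc of radius
  \<open>1 / t\<close>.\<close>

definition family :: "(complex \<Rightarrow> 'n::finite vfield) \<Rightarrow> (complex \<Rightarrow> 'n vfield) \<Rightarrow> (complex \<Rightarrow> 'n vfield) \<Rightarrow> real \<Rightarrow> bool" where
  "family Y Y1 Y2 K \<longleftrightarrow> K \<ge> 0 \<and> cderiv_on \<Sigma> Y Y1 \<and> cderiv_on \<Sigma> Y1 Y2 \<and>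
    (\<forall>l\<in>\<Sigma>. cmod l \<ge> 1 / t \<longrightarrow> norm (Y l) \<le> K \<and> norm (Y1 l) \<le> K / cmod l \<and> norm (Y2 l) \<le> K / (cmod l)\<^sup>2)"

lemma cos_neg: "cos \<theta> < 0"
  by (rule cos_lt_zero_pi) (use \<theta> in auto)

lemma
  assumes f: "family Y Y1 Y2 K" and e: "e = cis \<theta> \<or> e = cis (- \<theta>)"
  defines "g \<equiv> \<lambda>s. e *\<^sub>C exp (of_real t * (of_real s * e)) *\<^sub>C Y (of_real s * e)"
  shows ray_integrable: "g integrable_on {1 / t..}"
    and ray_bound: "norm (integral {1 / t..} g) \<le> 5 * K / t"
proof -
  have S: "of_real s * e \<in> \<Sigma>" if "s \<in> {1 / t..}" for s using that e ray by auto
  have ne: "cmod e = 1" "Re e < 0" using e cos_neg by auto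
  have sp: "s > 0" if "s \<ge> 1 / t" for s using that t by (meson divide_pos_pos less_le_trans zero_less_one)
  have bb: "norm (Y (of_real s * e)) \<le> K" "norm (Y1 (of_real s * e)) \<le> K / s" "norm (Y2 (of_real s * e)) \<le> K / s\<^sup>2"
    if "s \<ge> 1 / t" for s
  proof -
    have "cmod (of_real s * e) = s" using ne sp[OF that] by (simp add: norm_mult)
    then show "norm (Y (of_real s * e)) \<le> K" "norm (Y1 (of_real s * e)) \<le> K / s" "norm (Y2 (of_real s * e)) \<le> K / s\<^sup>2"
      using f S[of s] that unfolding family_def by auto
  qed
  have geq: "g = (\<lambda>s. exp (of_real t * (of_real s * e)) *\<^sub>C (e *\<^sub>C Y (of_real s * e)))"
    by (simp add: g_def mult.commute)
  have K: "K \<ge> 0" and d: "cderiv_on \<Sigma> Y Y1" "cderiv_on \<Sigma> Y1 Y2" using f by (auto simp: family_def)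
  have r: "((\<lambda>s. e *\<^sub>C Y (of_real s * e)) has_vector_derivative (e * e) *\<^sub>C Y1 (of_real s * e)) (at s within {1 / t..})"
    "((\<lambda>s. (e * e) *\<^sub>C Y1 (of_real s * e)) has_vector_derivative (e * e * e) *\<^sub>C Y2 (of_real s * e)) (at s within {1 / t..})"
    if "s \<ge> 1 / t" for s
    using cderiv_on_ray[OF d(1) S, of "{1 / t..}" s e] cderiv_on_ray[OF d(2) S, of "{1 / t..}" s "e * e"] that by auto
  note re = ray_estimate[OF ne t K, where \<Phi> = "\<lambda>s. e *\<^sub>C Y (of_real s * e)" and
      \<Phi>' = "\<lambda>s. (e * e) *\<^sub>C Y1 (of_real s * e)" and \<Phi>'' = "\<lambda>s. (e * e * e) *\<^sub>C Y2 (of_real s * e)"]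
  show "g integrable_on {1 / t..}" unfolding geq
    by (rule re(1)) (use r bb ne in \<open>auto simp: norm_mult\<close>)
  show "norm (integral {1 / t..} g) \<le> 5 * K / t" unfolding geq
    by (rule re(2)) (use r bb ne in \<open>auto simp: norm_mult\<close>)
qed

lemma
  assumes f: "family Y Y1 Y2 K"
  defines "g \<equiv> \<lambda>\<phi>. (\<i> * cis \<phi> / of_real t) *\<^sub>C exp (of_real t * (cis \<phi> / of_real t)) *\<^sub>C Y (cis \<phi> / of_real t)"
  shows arc_integrable: "g integrable_on {- \<theta>..\<theta>}"
    and arc_bound: "norm (integral {- \<theta>..\<theta>} g) \<le> 2 * pi * exp 1 * K / t"
proof -
  have cY: "continuous_on {- \<theta>..\<theta>} (\<lambda>\<phi>. Y (cis \<phi> / of_real t))"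
  proof (rule continuous_on_compose2[OF cderiv_on_continuous])
    show "cderiv_on \<Sigma> Y Y1" using f by (simp add: family_def)
    show "continuous_on {- \<theta>..\<theta>} (\<lambda>\<phi>. cis \<phi> / of_real t)" using t by (intro continuous_intros) auto
  qed (use arc in auto)
  have "continuous_on {- \<theta>..\<theta>} g"
    unfolding g_def using t
    by (intro bounded_bilinear.continuous_on[OF bounded_bilinear_scaleC] cY continuous_intros) auto
  then show gi: "g integrable_on {- \<theta>..\<theta>}" by (rule integrable_continuous_interval)
  have "norm (integral {- \<theta>..\<theta>} g) \<le> integral {- \<theta>..\<theta>} (\<lambda>\<phi>. exp 1 * K / t)"
  proof (rule Henstock_Kurzweil_Integration.integral_norm_bound_integral[OF gi])
    fix \<phi> assume \<phi>: "\<phi> \<in> {- \<theta>..\<theta>}"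
    have "cmod (cis \<phi> / of_real t) = 1 / t" using t by (simp add: norm_divide)
    then have "norm (Y (cis \<phi> / of_real t)) \<le> K" using f arc[OF \<phi>] unfolding family_def by simp
    moreover have "cmod (exp (of_real t * (cis \<phi> / of_real t))) \<le> exp 1"
      using t by (simp add: norm_exp_eq_Re)
    moreover have "norm (g \<phi>) = 1 / t * (cmod (exp (of_real t * (cis \<phi> / of_real t))) * norm (Y (cis \<phi> / of_real t)))"
      using t by (simp add: g_def norm_mult norm_divide)
    ultimately show "norm (g \<phi>) \<le> exp 1 * K / t"
      using t by (auto simp: divide_simps intro!: mult_mono)
  qed (intro integrable_const_ivl)
  also have "\<dots> = 2 * \<theta> * (exp 1 * K / t)" using \<theta> pi_gt_zero by simp
  also have "\<dots> \<le> 2 * pi * (exp 1 * K / t)"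
    using \<theta> t f by (intro mult_right_mono) (auto simp: family_def)
  finally show "norm (integral {- \<theta>..\<theta>} g) \<le> 2 * pi * exp 1 * K / t" by simp
qed

lemma contour_bound:
  assumes f: "family Y Y1 Y2 K"
  shows "norm (ctr Y) \<le> CC * K / t"
proof -
  have "norm (ctr Y) \<le> 5 * K / t + 2 * pi * exp 1 * K / t + 5 * K / t"
    unfolding contour_integral_L2_def
    using ray_bound[OF f, of "cis \<theta>"] ray_bound[OF f, of "cis (- \<theta>)"] arc_bound[OF f]
    by (intro norm_triangle_le_diff norm_triangle_le add_mono) auto
  then show ?thesis by (simp add: CC_def add_divide_distrib distrib_right)
qed

text \<open>Moves cutoffs, the Helmholtz projection and a fixed resolvent under the integral. The
  family of \<open>Y\<close> is needed for integrability, not for its constant.\<close>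

lemma contour_linear:
  assumes f: "family Y Y1 Y2 K" and T: "bounded_linear T" "\<And>a x. T (a *\<^sub>C x) = a *\<^sub>C T x"
  shows "T (ctr Y) = ctr (\<lambda>l. T (Y l))"
proof -
  note lin = integral_linear[OF _ T(1), unfolded o_def, symmetric]
  show ?thesis
    unfolding contour_integral_L2_def
    using lin[OF ray_integrable[OF f, of "cis \<theta>"]] lin[OF ray_integrable[OF f, of "cis (- \<theta>)"]]
      lin[OF arc_integrable[OF f]]
    by (simp add: linear_add[OF bounded_linear.linear[OF T(1)]] linear_diff[OF bounded_linear.linear[OF T(1)]] T(2))
qed

lemma contour_add:
  assumes f: "family Y Y1 Y2 K" and g: "family W W1 W2 L"
  shows "ctr (\<lambda>l. Y l + W l) = ctr Y + ctr W"
  unfolding contour_integral_L2_def L2_scaleC_add_right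
  using ray_integrable[OF f, of "cis \<theta>"] ray_integrable[OF f, of "cis (- \<theta>)"] arc_integrable[OF f]
    ray_integrable[OF g, of "cis \<theta>"] ray_integrable[OF g, of "cis (- \<theta>)"] arc_integrable[OF g]
  by (simp add: Henstock_Kurzweil_Integration.integral_add algebra_simps)

end

section \<open>The semigroup\<close>

text \<open>\<open>Q l0\<close> is an exact complex difference quotient, which the resolvent
  identity delivers; only its limit remains to be computed.\<close>

lemma cderiv_onI:
  assumes diff: "\<And>l0 l. l0 \<in> \<Sigma> \<Longrightarrow> l \<in> \<Sigma> \<Longrightarrow> Y l - Y l0 = (l - l0) *\<^sub>C Q l0 l"
    and lim: "\<And>l0. l0 \<in> \<Sigma> \<Longrightarrow> (Q l0 \<longlongrightarrow> Y' l0) (at l0 within \<Sigma>)"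
  shows "cderiv_on \<Sigma> Y Y'"
  unfolding cderiv_on_def
proof
  fix l0 assume l0: "l0 \<in> \<Sigma>"
  show "(Y has_derivative (\<lambda>h. h *\<^sub>C Y' l0)) (at l0 within \<Sigma>)"
    unfolding has_derivative_iff_norm
  proof
    show "bounded_linear (\<lambda>h. h *\<^sub>C Y' l0)"
      by (rule bounded_bilinear.bounded_linear_left[OF bounded_bilinear_scaleC])
    have "((\<lambda>l. norm (Q l0 l - Y' l0)) \<longlongrightarrow> 0) (at l0 within \<Sigma>)"
      using lim[OF l0] by (intro tendsto_norm_zero) (simp add: LIM_zero_iff)
    then show "((\<lambda>l. norm (Y l - Y l0 - (l - l0) *\<^sub>C Y' l0) / norm (l - l0)) \<longlongrightarrow> 0) (at l0 within \<Sigma>)"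
    proof (rule Lim_transform_eventually)
      show "\<forall>\<^sub>F l in at l0 within \<Sigma>. norm (Q l0 l - Y' l0) = norm (Y l - Y l0 - (l - l0) *\<^sub>C Y' l0) / norm (l - l0)"
        unfolding eventually_at_filter
      proof (rule always_eventually, intro allI impI)
        fix l assume "l \<noteq> l0" "l \<in> \<Sigma>"
        then show "norm (Q l0 l - Y' l0) = norm (Y l - Y l0 - (l - l0) *\<^sub>C Y' l0) / norm (l - l0)"
          by (simp add: diff[OF l0] L2_scaleC_diff_right[symmetric])
      qed
    qed
  qed
qed

lemma mat_rows_zero: "mat_rows 0 = 0"
  unfolding mat_rows_def
  by (simp add: vec_eq_iff linear_0[OF bounded_linear.linear[OF bounded_linear_L2_mult[OF bounded_multiplier_nth]]])

section \<open>The resolvent identity and derivatives in the spectral parameter\<close>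

context stokes_sector
begin

abbreviation "Res l f \<equiv> stokes_resolvent \<mu> l f 0"

lemma resolvent_sol: "sec l \<Longrightarrow> resolvent_solution \<mu> l f F (stokes_resolvent \<mu> l f F)"
  unfolding stokes_resolvent_def by (rule theI'[OF resolvent_unique_solution])

lemma resolvent_eqI: "sec l \<Longrightarrow> resolvent_solution \<mu> l f F u \<Longrightarrow> stokes_resolvent \<mu> l f F = u"
  unfolding stokes_resolvent_def by (rule the1_equality[OF resolvent_unique_solution])

lemma resolvent_H1_sigma: "sec l \<Longrightarrow> stokes_resolvent \<mu> l f F \<in> H1_sigma"
  using resolvent_sol[of l f F] by (simp add: resolvent_solution_iff)

lemma resolvent_L2_sigma: "sec l \<Longrightarrow> stokes_resolvent \<mu> l f F \<in> L2_sigma"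
  by (rule H1_sigma_L2_sigma[OF resolvent_H1_sigma])

lemma norm_Res_le:
  assumes l: "sec l"
  shows "norm (Res l f) \<le> K1 / cmod l * norm f"
proof -
  have l0: "cmod l > 0" using l by (simp add: sectorial_def)
  have "sqrt (cmod l) * norm (Res l f) \<le> K1 * (norm f / sqrt (cmod l))"
    using resolvent_energy(1)[OF l resolvent_sol[OF l, of f 0]] by (simp add: mat_rows_zero)
  then have "sqrt (cmod l) * (sqrt (cmod l) * norm (Res l f)) \<le> sqrt (cmod l) * (K1 * (norm f / sqrt (cmod l)))"
    by (rule mult_left_mono) simp
  then have "cmod l * norm (Res l f) \<le> K1 * norm f" using l0 by (simp add: mult.assoc[symmetric])
  then show ?thesis using l0 by (simp add: field_simps)
qed

lemma norm_resolvent_div_le: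
  assumes l: "sec l"
  shows "norm (stokes_resolvent \<mu> l 0 F) \<le> K1 / sqrt (cmod l) * norm (mat_rows F)"
proof -
  have l0: "cmod l > 0" using l by (simp add: sectorial_def)
  have "sqrt (cmod l) * norm (stokes_resolvent \<mu> l 0 F) \<le> K1 * norm (mat_rows F)"
    using resolvent_energy(1)[OF l resolvent_sol[OF l, of 0 F]] by simp
  then show ?thesis using l0 by (simp add: field_simps)
qed

lemma Res_add:
  assumes l: "sec l"
  shows "Res l (f + g) = Res l f + Res l g"
proof (rule resolvent_eqI[OF l])
  show "resolvent_solution \<mu> l (f + g) 0 (Res l f + Res l g)"
    unfolding resolvent_solution_iff
  proof (intro conjI ballI)
    show "Res l f + Res l g \<in> H1_sigma" by (intro H1_sigma_add resolvent_H1_sigma l)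
    fix v :: "'n vfield" assume v: "v \<in> H1_sigma"
    show "inner (l *\<^sub>C (Res l f + Res l g)) v + inner (stokes_mult \<mu> (grad (Res l f + Res l g))) (grad v)
        = inner (f + g) v - inner (mat_rows 0) (grad v)"
      using resolvent_sol[OF l, of f 0, unfolded resolvent_solution_iff] v
        resolvent_sol[OF l, of g 0, unfolded resolvent_solution_iff]
      by (simp add: grad_add H1_sigma_H1 L2_scaleC_add_right inner_add_left mat_rows_zero
          linear_add[OF bounded_linear.linear[OF bounded_linear_stokes_mult]] add_ac)
  qed
qed

lemma Res_scaleC:
  assumes l: "sec l"
  shows "Res l (a *\<^sub>C f) = a *\<^sub>C Res l f"
proof (cases "a = 0")
  case True
  have "Res l 0 = 0" using norm_Res_le[OF l, of 0] by simp
  then show ?thesis using True by simp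
next
  case False
  show ?thesis
  proof (rule resolvent_eqI[OF l])
    have s: "resolvent_solution \<mu> l f 0 (Res l f)" using resolvent_sol[OF l] .
    \<comment> \<open>Rotating the equation by \<open>cnj a\<close> and moving the scalar across the
      inner product is the same as scaling solution and data by \<open>a\<close>.\<close>
    have "cnj a \<noteq> 0" using False by simp
    from s[unfolded resolvent_solution_rotated[OF this]]
    show "resolvent_solution \<mu> l (a *\<^sub>C f) 0 (a *\<^sub>C Res l f)"
      by (simp add: resolvent_solution_iff H1_sigma_scaleC grad_scaleC H1_sigma_H1 stokes_mult_scaleC
          inner_scaleC_left inner_vscaleC_left mat_rows_zero mult.commute)
  qed
qed

lemma Res_diff: "sec l \<Longrightarrow> Res l (f - g) = Res l f - Res l g"
  using Res_add[of l f "(-1) *\<^sub>C g"] Res_scaleC[of l "-1" g] by simp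

text \<open>Subtracting the two equations cancels \<open>f\<close> and \<open>F\<close> alike. What
  remains has an L2 right-hand side, so \<open>Res\<close> alone describes all
  \<lambda>-derivatives, also for data in divergence form.\<close>

lemma resolvent_difference:
  assumes l: "sec l" and l0: "sec l0"
  shows "stokes_resolvent \<mu> l f F - stokes_resolvent \<mu> l0 f F = (l0 - l) *\<^sub>C Res l (stokes_resolvent \<mu> l0 f F)"
proof -
  let ?y = "stokes_resolvent \<mu> l f F" and ?w = "stokes_resolvent \<mu> l0 f F"
  have s: "resolvent_solution \<mu> l f F ?y" "resolvent_solution \<mu> l0 f F ?w"
    using resolvent_sol[OF l] resolvent_sol[OF l0] by auto
  have "resolvent_solution \<mu> l ((l0 - l) *\<^sub>C ?w) 0 (?y - ?w)"
    unfolding resolvent_solution_iff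
  proof (intro conjI ballI)
    show "?y - ?w \<in> H1_sigma" using s by (simp add: resolvent_solution_iff H1_sigma_diff)
    fix v :: "'n vfield" assume v: "v \<in> H1_sigma"
    have 1: "inner (l *\<^sub>C ?y) v + inner (stokes_mult \<mu> (grad ?y)) (grad v) = inner f v - inner (mat_rows F) (grad v)"
      and 2: "inner (l0 *\<^sub>C ?w) v + inner (stokes_mult \<mu> (grad ?w)) (grad v) = inner f v - inner (mat_rows F) (grad v)"
      using s v by (auto simp: resolvent_solution_iff)
    have g: "grad (?y - ?w) = grad ?y - grad ?w"
      using s by (intro grad_diff H1_sigma_H1) (auto simp: resolvent_solution_iff)
    show "inner (l *\<^sub>C (?y - ?w)) v + inner (stokes_mult \<mu> (grad (?y - ?w))) (grad v)
        = inner ((l0 - l) *\<^sub>C ?w) v - inner (mat_rows 0) (grad v)"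
      unfolding g linear_diff[OF bounded_linear.linear[OF bounded_linear_stokes_mult]]
        L2_scaleC_diff_left L2_scaleC_diff_right mat_rows_zero inner_diff_left
      using 1 2 by simp
  qed
  from resolvent_eqI[OF l this] show ?thesis by (simp add: Res_scaleC[OF l])
qed

text \<open>Joint continuity in parameter and datum: the second difference quotient applies
  \<open>Res l\<close> to arguments that themselves depend on \<open>l\<close>.\<close>

lemma Res_tendsto:
  assumes l0: "sec l0" and y: "(y \<longlongrightarrow> y0) (at l0 within Collect sec)"
  shows "((\<lambda>l. Res l (y l)) \<longlongrightarrow> Res l0 y0) (at l0 within Collect sec)"
proof -
  have n0: "cmod l0 \<noteq> 0" using l0 by (simp add: sectorial_def)
  let ?b = "\<lambda>l. K1 / cmod l * norm (y l - y0) + cmod (l0 - l) * (K1 / cmod l * norm (Res l0 y0))"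
  have "(?b \<longlongrightarrow> K1 / cmod l0 * norm (y0 - y0) + cmod (l0 - l0) * (K1 / cmod l0 * norm (Res l0 y0))) (at l0 within Collect sec)"
    by (intro tendsto_intros y n0)
  then have "(?b \<longlongrightarrow> 0) (at l0 within Collect sec)" by simp
  moreover have "\<forall>\<^sub>F l in at l0 within Collect sec. norm (Res l (y l) - Res l0 y0) \<le> ?b l"
    unfolding eventually_at_filter
  proof (rule always_eventually, intro allI impI)
    fix l assume "l \<in> Collect sec"
    then have l: "sec l" by simp
    have "Res l (y l) - Res l0 y0 = Res l (y l - y0) + (l0 - l) *\<^sub>C Res l (Res l0 y0)"
      using resolvent_difference[OF l l0, of y0 0] by (simp add: Res_diff[OF l] algebra_simps)
    also have "norm \<dots> \<le> norm (Res l (y l - y0)) + cmod (l0 - l) * norm (Res l (Res l0 y0))"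
      using norm_triangle_ineq[of "Res l (y l - y0)" "(l0 - l) *\<^sub>C Res l (Res l0 y0)"] by simp
    also have "\<dots> \<le> ?b l"
      by (intro add_mono mult_left_mono norm_Res_le l) auto
    finally show "norm (Res l (y l) - Res l0 y0) \<le> ?b l" .
  qed
  ultimately have "((\<lambda>l. Res l (y l) - Res l0 y0) \<longlongrightarrow> 0) (at l0 within Collect sec)"
    by (rule Lim_null_comparison[rotated])
  then show ?thesis by (simp add: LIM_zero_iff)
qed

lemma cderiv_resolvent:
  "cderiv_on (Collect sec) (\<lambda>l. stokes_resolvent \<mu> l f F) (\<lambda>l. - Res l (stokes_resolvent \<mu> l f F))"
proof (rule cderiv_onI[where Q = "\<lambda>l0 l. - Res l (stokes_resolvent \<mu> l0 f F)"])
  fix l0 l assume "l0 \<in> Collect sec" "l \<in> Collect sec"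
  then show "stokes_resolvent \<mu> l f F - stokes_resolvent \<mu> l0 f F = (l - l0) *\<^sub>C (- Res l (stokes_resolvent \<mu> l0 f F))"
    using resolvent_difference[of l l0 f F]
    by (simp add: L2_scaleC_minus_right L2_scaleC_minus_left[symmetric])
qed (rule tendsto_minus[OF Res_tendsto[OF _ tendsto_const]], simp)

text \<open>Both the outer resolvent and its argument vary with \<open>l\<close>. The two
  contributions coincide in the limit, hence the factor 2.\<close>

lemma cderiv_resolvent2:
  "cderiv_on (Collect sec) (\<lambda>l. - Res l (stokes_resolvent \<mu> l f F))
     (\<lambda>l. 2 *\<^sub>C Res l (Res l (stokes_resolvent \<mu> l f F)))"
proof (rule cderiv_onI[where Q = "\<lambda>l0 l. Res l (Res l (stokes_resolvent \<mu> l0 f F)) + Res l (Res l0 (stokes_resolvent \<mu> l0 f F))"])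
  fix l0 l assume "l0 \<in> Collect sec" "l \<in> Collect sec"
  then have l: "sec l" and l0: "sec l0" by auto
  let ?y = "stokes_resolvent \<mu> l f F" and ?w = "stokes_resolvent \<mu> l0 f F"
  have "Res l ?y - Res l0 ?w = Res l (?y - ?w) + (Res l ?w - Res l0 ?w)"
    by (simp add: Res_diff[OF l])
  also have "\<dots> = (l0 - l) *\<^sub>C (Res l (Res l ?w) + Res l (Res l0 ?w))"
    by (simp add: resolvent_difference[OF l l0] Res_scaleC[OF l] L2_scaleC_add_right)
  finally have "- (Res l ?y - Res l0 ?w) = (l - l0) *\<^sub>C (Res l (Res l ?w) + Res l (Res l0 ?w))"
    by (simp add: L2_scaleC_minus_left[symmetric] del: L2_scaleC_add_right)
  then show "- Res l ?y - - Res l0 ?w = (l - l0) *\<^sub>C (Res l (Res l ?w) + Res l (Res l0 ?w))" by simp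
next
  fix l0 assume l0: "l0 \<in> Collect sec"
  let ?w = "stokes_resolvent \<mu> l0 f F"
  have "((\<lambda>l. Res l (Res l ?w) + Res l (Res l0 ?w)) \<longlongrightarrow> Res l0 (Res l0 ?w) + Res l0 (Res l0 ?w)) (at l0 within Collect sec)"
    using l0 by (intro tendsto_add Res_tendsto tendsto_const) auto
  also have "Res l0 (Res l0 ?w) + Res l0 (Res l0 ?w) = 2 *\<^sub>C Res l0 (Res l0 ?w)"
    using L2_scaleC_add_left[of 1 1 "Res l0 (Res l0 ?w)"] by simp
  finally show "((\<lambda>l. Res l (Res l ?w) + Res l (Res l0 ?w)) \<longlongrightarrow> 2 *\<^sub>C Res l0 (Res l0 ?w)) (at l0 within Collect sec)" .
qed

text \<open>\<open>f - l *\<^sub>C Y l\<close> stands for \<open>A\<close> applied to the resolvent.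
  In this form the unbounded operator is never applied to an integrand.\<close>

lemma cderiv_defect:
  fixes f
  defines "Y \<equiv> \<lambda>l. stokes_resolvent \<mu> l f 0"
  shows "cderiv_on (Collect sec) (\<lambda>l. f - l *\<^sub>C Y l) (\<lambda>l. l *\<^sub>C Res l (Y l) - Y l)"
    and "cderiv_on (Collect sec) (\<lambda>l. l *\<^sub>C Res l (Y l) - Y l) (\<lambda>l. 2 *\<^sub>C Res l (Y l) - (2 * l) *\<^sub>C Res l (Res l (Y l)))"
proof -
  note bb = bounded_bilinear.FDERIV[OF bounded_bilinear_scaleC]
  note sc = L2_scaleC_add_right L2_scaleC_diff_right L2_scaleC_minus_right L2_scaleC_minus_left
  have d1: "(Y has_derivative (\<lambda>h. h *\<^sub>C (- Res l (Y l)))) (at l within Collect sec)" if "l \<in> Collect sec" for l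
    using cderiv_resolvent[of f 0] that unfolding cderiv_on_def Y_def by blast
  have d2: "((\<lambda>l. - Res l (Y l)) has_derivative (\<lambda>h. h *\<^sub>C (2 *\<^sub>C Res l (Res l (Y l))))) (at l within Collect sec)"
    if "l \<in> Collect sec" for l
    using cderiv_resolvent2[of f 0] that unfolding cderiv_on_def Y_def by blast
  show "cderiv_on (Collect sec) (\<lambda>l. f - l *\<^sub>C Y l) (\<lambda>l. l *\<^sub>C Res l (Y l) - Y l)"
    unfolding cderiv_on_def
  proof
    fix l assume l: "l \<in> Collect sec"
    have "((\<lambda>l. f - l *\<^sub>C Y l) has_derivative (\<lambda>h. 0 - (l *\<^sub>C h *\<^sub>C (- Res l (Y l)) + h *\<^sub>C Y l))) (at l within Collect sec)"
      by (intro has_derivative_diff has_derivative_const bb[OF has_derivative_ident d1[OF l]])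
    then show "((\<lambda>l. f - l *\<^sub>C Y l) has_derivative (\<lambda>h. h *\<^sub>C (l *\<^sub>C Res l (Y l) - Y l))) (at l within Collect sec)"
      by (rule has_derivative_eq_rhs) (simp add: sc mult.commute fun_eq_iff)
  qed
  show "cderiv_on (Collect sec) (\<lambda>l. l *\<^sub>C Res l (Y l) - Y l) (\<lambda>l. 2 *\<^sub>C Res l (Y l) - (2 * l) *\<^sub>C Res l (Res l (Y l)))"
    unfolding cderiv_on_def
  proof
    fix l assume l: "l \<in> Collect sec"
    \<comment> \<open>The double minus brings the term into the form to which the product rule with
      \<open>d2\<close> applies.\<close>
    have "((\<lambda>l. - (l *\<^sub>C (- Res l (Y l))) - Y l) has_derivative
        (\<lambda>h. - (l *\<^sub>C h *\<^sub>C (2 *\<^sub>C Res l (Res l (Y l))) + h *\<^sub>C (- Res l (Y l))) - h *\<^sub>C (- Res l (Y l)))) (at l within Collect sec)"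
      by (intro has_derivative_diff has_derivative_minus bb[OF has_derivative_ident d2[OF l]] d1[OF l])
    then have "((\<lambda>l. l *\<^sub>C Res l (Y l) - Y l) has_derivative
        (\<lambda>h. - (l *\<^sub>C h *\<^sub>C (2 *\<^sub>C Res l (Res l (Y l))) + h *\<^sub>C (- Res l (Y l))) - h *\<^sub>C (- Res l (Y l)))) (at l within Collect sec)"
      by (simp add: L2_scaleC_minus_right)
    then show "((\<lambda>l. l *\<^sub>C Res l (Y l) - Y l) has_derivative
        (\<lambda>h. h *\<^sub>C (2 *\<^sub>C Res l (Y l) - (2 * l) *\<^sub>C Res l (Res l (Y l))))) (at l within Collect sec)"
    proof (rule has_derivative_eq_rhs)
      have two: "(h * 2) *\<^sub>C x = h *\<^sub>C x + h *\<^sub>C x" for h and x :: "'n vfield"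
        using L2_scaleC_add_left[of h h x] by (simp add: mult_2_right)
      show "(\<lambda>h. - (l *\<^sub>C h *\<^sub>C (2 *\<^sub>C Res l (Res l (Y l))) + h *\<^sub>C (- Res l (Y l))) - h *\<^sub>C (- Res l (Y l)))
          = (\<lambda>h. h *\<^sub>C (2 *\<^sub>C Res l (Y l) - (2 * l) *\<^sub>C Res l (Res l (Y l))))"
        by (simp add: fun_eq_iff sc two mult_ac)
    qed
  qed
qed

end

context sector_contour
begin

text \<open>The new constant is left unspecified because the lemma is used for integrability
  only.\<close>

lemma family_linear:
  assumes f: "family Y Y1 Y2 K" and T: "bounded_linear T" "\<And>a x. T (a *\<^sub>C x) = a *\<^sub>C T x"
  shows "\<exists>K'. family (\<lambda>l. T (Y l)) (\<lambda>l. T (Y1 l)) (\<lambda>l. T (Y2 l)) K'"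
proof -
  obtain N where N: "N > 0" "\<And>x. norm (T x) \<le> norm x * N"
    using bounded_linear.pos_bounded[OF T(1)] by blast
  have le: "norm (T x) \<le> N * b" if "norm x \<le> b" for x b
    using order_trans[OF N(2)[of x] mult_right_mono[OF that, of N]] N(1) by (simp add: mult.commute)
  have "family (\<lambda>l. T (Y l)) (\<lambda>l. T (Y1 l)) (\<lambda>l. T (Y2 l)) (N * K)"
    unfolding family_def
  proof (intro conjI ballI impI)
    show "N * K \<ge> 0" using f N by (simp add: family_def)
    have d: "cderiv_on \<Sigma> Y Y1" "cderiv_on \<Sigma> Y1 Y2" using f by (simp_all add: family_def)
    show "cderiv_on \<Sigma> (\<lambda>l. T (Y l)) (\<lambda>l. T (Y1 l))" by (rule cderiv_on_linear[OF d(1) T])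
    show "cderiv_on \<Sigma> (\<lambda>l. T (Y1 l)) (\<lambda>l. T (Y2 l))" by (rule cderiv_on_linear[OF d(2) T])
    fix l assume l: "l \<in> \<Sigma>" "1 / t \<le> cmod l"
    have "norm (Y l) \<le> K" "norm (Y1 l) \<le> K / cmod l" "norm (Y2 l) \<le> K / (cmod l)\<^sup>2"
      using f l unfolding family_def by auto
    from le[OF this(1)] le[OF this(2)] le[OF this(3)]
    show "norm (T (Y l)) \<le> N * K" "norm (T (Y1 l)) \<le> N * K / cmod l" "norm (T (Y2 l)) \<le> N * K / (cmod l)\<^sup>2"
      by simp_all
  qed
  then show ?thesis by blast
qed

lemma contour_cong:
  assumes "\<And>l. l \<in> \<Sigma> \<Longrightarrow> Y l = W l"
  shows "ctr Y = ctr W"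
proof -
  have "integral {1 / t..} (\<lambda>s. e *\<^sub>C exp (of_real t * (of_real s * e)) *\<^sub>C Y (of_real s * e))
      = integral {1 / t..} (\<lambda>s. e *\<^sub>C exp (of_real t * (of_real s * e)) *\<^sub>C W (of_real s * e))"
    if "e = cis \<theta> \<or> e = cis (- \<theta>)" for e
    by (rule Henstock_Kurzweil_Integration.integral_cong) (use that ray assms in auto)
  moreover have "integral {- \<theta>..\<theta>} (\<lambda>\<phi>. (\<i> * cis \<phi> / of_real t) *\<^sub>C exp (of_real t * (cis \<phi> / of_real t)) *\<^sub>C Y (cis \<phi> / of_real t))
      = integral {- \<theta>..\<theta>} (\<lambda>\<phi>. (\<i> * cis \<phi> / of_real t) *\<^sub>C exp (of_real t * (cis \<phi> / of_real t)) *\<^sub>C W (cis \<phi> / of_real t))"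
    by (rule Henstock_Kurzweil_Integration.integral_cong) (use arc assms in auto)
  ultimately show ?thesis unfolding contour_integral_L2_def by metis
qed

end

section \<open>Uniform bounds for localised contour integrals\<close>

locale stokes_contour = stokes_sector \<mu> mlo mhi c \<kappa> + sector_contour \<theta> t "Collect (sectorial \<kappa> c)"
  for \<mu> :: "'n::finite coeffs" and mlo mhi c \<kappa> \<theta> t :: real +
  fixes K :: real
  assumes K: "K1 \<le> K" and sec1: "sec 1"
begin

text \<open>Dominates all constants of the two families below: 1, \<open>2 * K\<close>,
  \<open>6 * K^2\<close> for the resolvent and 2, \<open>2 * K + 1\<close>,
  \<open>4 * K + 6 * K^2\<close> for the defect.\<close>

definition B :: real where "B = 2 + 4 * K + 6 * K\<^sup>2"

text \<open>\<open>loc_op T \<rho>\<close> abstracts the two cases of the estimate: \<open>T\<close> is the multiplication by a cutoff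
  function and \<open>\<rho>\<close> the decay factor, or \<open>T\<close> is the identity and \<open>\<rho> = 1\<close>.\<close>

definition loc_op :: "('n vfield \<Rightarrow> 'n vfield) \<Rightarrow> real \<Rightarrow> bool" where
  "loc_op T \<rho> \<longleftrightarrow> bounded_linear T \<and> (\<forall>a x. T (a *\<^sub>C x) = a *\<^sub>C T x) \<and> 0 \<le> \<rho> \<and>
    (\<forall>l f. sec l \<longrightarrow> 1 / t \<le> cmod l \<longrightarrow> f \<in> L2_sigma \<longrightarrow>
      norm (T (Res l f)) \<le> K / cmod l * (\<rho> * norm f + norm (T f)))"

lemma K_pos: "K > 0"
  using K K1_pos by simp

lemma B_pos: "B > 0"
  using K_pos by (simp add: B_def add_pos_pos)

lemma CC_pos: "CC > 0"
  by (simp add: CC_def add_pos_pos)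

lemma norm_Res_K: "sec l \<Longrightarrow> norm (Res l f) \<le> K / cmod l * norm f"
  by (rule order_trans[OF norm_Res_le]) (auto intro!: mult_right_mono divide_right_mono K)

lemma loc_op_id: "loc_op (\<lambda>x. x) 1"
  unfolding loc_op_def
proof (intro conjI allI impI)
  fix l and f :: "'n vfield" assume l: "sec l"
  have "norm (Res l f) \<le> K / cmod l * norm f" by (rule norm_Res_K[OF l])
  also have "\<dots> \<le> K / cmod l * (1 * norm f + norm f)" using K_pos by (intro mult_left_mono) auto
  finally show "norm (Res l f) \<le> K / cmod l * (1 * norm f + norm f)" .
qed (auto simp: bounded_linear_ident)

text \<open>The ratio \<rho> between localised and global size is inherited by each further
  resolvent, because \<open>loc_op\<close> admits data with \<open>norm (T f)\<close> nonzero. The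
  constants are \<open>K * (1 + 1)\<close> and \<open>K * (K + 2 * K)\<close>.\<close>

lemma chain:
  assumes T: "loc_op T \<rho>" and l: "sec l" "1 / t \<le> cmod l" and y: "y \<in> L2_sigma" "norm y \<le> a" "norm (T y) \<le> \<rho> * a"
  shows "norm (T (Res l y)) \<le> 2 * K * (\<rho> * a) / cmod l"
    and "norm (T (Res l (Res l y))) \<le> 3 * K\<^sup>2 * (\<rho> * a) / (cmod l)\<^sup>2"
proof -
  have m: "cmod l > 0" using l by (simp add: sectorial_def)
  have \<rho>: "\<rho> \<ge> 0" using T by (simp add: loc_op_def)
  have 1: "norm (T (Res l f)) \<le> K / cmod l * (\<rho> * norm f + norm (T f))" if "f \<in> L2_sigma" for f
    using T l that by (simp add: loc_op_def)
  have "norm (T (Res l y)) \<le> K / cmod l * (\<rho> * a + \<rho> * a)"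
    by (rule order_trans[OF 1[OF y(1)]]) (use K_pos y \<rho> in \<open>intro mult_left_mono add_mono, auto\<close>)
  then show 2: "norm (T (Res l y)) \<le> 2 * K * (\<rho> * a) / cmod l" by (simp add: algebra_simps)
  have 3: "norm (Res l y) \<le> K / cmod l * a"
    by (rule order_trans[OF norm_Res_K[OF l(1)]]) (use K_pos y in \<open>intro mult_left_mono, auto\<close>)
  have "norm (T (Res l (Res l y))) \<le> K / cmod l * (\<rho> * norm (Res l y) + norm (T (Res l y)))"
    by (rule 1[OF resolvent_L2_sigma[OF l(1)]])
  also have "\<dots> \<le> K / cmod l * (\<rho> * (K / cmod l * a) + 2 * K * (\<rho> * a) / cmod l)"
    using K_pos \<rho> by (intro mult_left_mono add_mono 2 3) auto
  also have "\<dots> = 3 * K\<^sup>2 * (\<rho> * a) / (cmod l)\<^sup>2"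
    using m by (simp add: power2_eq_square field_simps)
  finally show "norm (T (Res l (Res l y))) \<le> 3 * K\<^sup>2 * (\<rho> * a) / (cmod l)\<^sup>2" .
qed

lemma family_resolvent:
  assumes T: "loc_op T \<rho>"
    and Y: "\<And>l. sec l \<Longrightarrow> 1 / t \<le> cmod l \<Longrightarrow> norm (stokes_resolvent \<mu> l f F) \<le> a \<and> norm (T (stokes_resolvent \<mu> l f F)) \<le> \<rho> * a"
    and a: "a \<ge> 0"
  shows "family (\<lambda>l. T (stokes_resolvent \<mu> l f F)) (\<lambda>l. T (- Res l (stokes_resolvent \<mu> l f F)))
    (\<lambda>l. T (2 *\<^sub>C Res l (Res l (stokes_resolvent \<mu> l f F)))) (B * (\<rho> * a))"
  unfolding family_def
proof (intro conjI ballI impI)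
  have TL: "bounded_linear T" and TC: "\<And>a x. T (a *\<^sub>C x) = a *\<^sub>C T x" and \<rho>: "\<rho> \<ge> 0"
    using T by (auto simp: loc_op_def)
  have \<rho>a: "\<rho> * a \<ge> 0" using \<rho> a by simp
  show "B * (\<rho> * a) \<ge> 0" using B_pos \<rho>a by simp
  show "cderiv_on (Collect sec) (\<lambda>l. T (stokes_resolvent \<mu> l f F)) (\<lambda>l. T (- Res l (stokes_resolvent \<mu> l f F)))"
    by (rule cderiv_on_linear[OF cderiv_resolvent TL TC])
  show "cderiv_on (Collect sec) (\<lambda>l. T (- Res l (stokes_resolvent \<mu> l f F))) (\<lambda>l. T (2 *\<^sub>C Res l (Res l (stokes_resolvent \<mu> l f F))))"
    by (rule cderiv_on_linear[OF cderiv_resolvent2 TL TC])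
  fix l assume "l \<in> Collect sec" and l1: "1 / t \<le> cmod l"
  then have l: "sec l" by simp
  let ?y = "stokes_resolvent \<mu> l f F"
  note ch = chain[OF T l l1 resolvent_L2_sigma[OF l] conjunct1[OF Y[OF l l1]] conjunct2[OF Y[OF l l1]]]
  have kB: "1 \<le> B" "2 * K \<le> B" "6 * K\<^sup>2 \<le> B" using K_pos by (auto simp: B_def)
  have up: "b * (\<rho> * a) / d \<le> B * (\<rho> * a) / d" if "b \<le> B" "d \<ge> 0" for b d
    using that \<rho>a by (intro divide_right_mono mult_right_mono)
  show "norm (T ?y) \<le> B * (\<rho> * a)" using Y[OF l l1] up[OF kB(1), of 1] by simp
  have "T (- Res l ?y) = - T (Res l ?y)" using TC[of "-1"] by simp
  then show "norm (T (- Res l ?y)) \<le> B * (\<rho> * a) / cmod l"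
    using ch(1) up[OF kB(2), of "cmod l"] by simp
  have "norm (T (2 *\<^sub>C Res l (Res l ?y))) \<le> 2 * (3 * K\<^sup>2 * (\<rho> * a) / (cmod l)\<^sup>2)"
    using ch(2) by (simp add: TC)
  also have "\<dots> = 6 * K\<^sup>2 * (\<rho> * a) / (cmod l)\<^sup>2" by simp
  also have "\<dots> \<le> B * (\<rho> * a) / (cmod l)\<^sup>2" by (rule up[OF kB(3)]) simp
  finally show "norm (T (2 *\<^sub>C Res l (Res l ?y))) \<le> B * (\<rho> * a) / (cmod l)\<^sup>2" .
qed

text \<open>Each additional factor \<open>l\<close> is compensated by an additional resolvent, so
  the defect obeys bounds of the same type; \<open>f\<close> itself enters, which is why
  \<open>T f\<close> has to be small as well.\<close>

lemma family_defect:
  fixes f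
  assumes T: "loc_op T \<rho>"
    and Y: "\<And>l. sec l \<Longrightarrow> 1 / t \<le> cmod l \<Longrightarrow> norm (Res l f) \<le> a / cmod l \<and> norm (T (Res l f)) \<le> \<rho> * (a / cmod l)"
    and f: "norm (T f) \<le> \<rho> * a" and a: "a \<ge> 0"
  shows "family (\<lambda>l. T (f - l *\<^sub>C Res l f)) (\<lambda>l. T (l *\<^sub>C Res l (Res l f) - Res l f))
    (\<lambda>l. T (2 *\<^sub>C Res l (Res l f) - (2 * l) *\<^sub>C Res l (Res l (Res l f)))) (B * (\<rho> * a))"
  unfolding family_def
proof (intro conjI ballI impI)
  have TL: "bounded_linear T" and TC: "\<And>a x. T (a *\<^sub>C x) = a *\<^sub>C T x" and \<rho>: "\<rho> \<ge> 0"
    using T by (auto simp: loc_op_def)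
  have \<rho>a: "\<rho> * a \<ge> 0" using \<rho> a by simp
  note TD = linear_diff[OF bounded_linear.linear[OF TL]]
  show "B * (\<rho> * a) \<ge> 0" using B_pos \<rho>a by simp
  show "cderiv_on (Collect sec) (\<lambda>l. T (f - l *\<^sub>C Res l f)) (\<lambda>l. T (l *\<^sub>C Res l (Res l f) - Res l f))"
    by (rule cderiv_on_linear[OF cderiv_defect(1) TL TC])
  show "cderiv_on (Collect sec) (\<lambda>l. T (l *\<^sub>C Res l (Res l f) - Res l f))
      (\<lambda>l. T (2 *\<^sub>C Res l (Res l f) - (2 * l) *\<^sub>C Res l (Res l (Res l f))))"
    by (rule cderiv_on_linear[OF cderiv_defect(2) TL TC])
  fix l assume "l \<in> Collect sec" and l1: "1 / t \<le> cmod l"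
  then have l: "sec l" by simp
  define m where "m = cmod l"
  have m: "m > 0" using l by (simp add: sectorial_def m_def)
  let ?y = "Res l f"
  have Y': "norm ?y \<le> a / m" "norm (T ?y) \<le> \<rho> * (a / m)" using Y[OF l l1] by (auto simp: m_def)
  note ch = chain[OF T l l1 resolvent_L2_sigma[OF l] Y', folded m_def]
  have up: "b * (\<rho> * a) / d \<le> B * (\<rho> * a) / d" if "b \<le> B" "d \<ge> 0" for b d
    using that \<rho>a by (intro divide_right_mono mult_right_mono)
  have "norm (T (f - l *\<^sub>C ?y)) \<le> norm (T f) + m * norm (T ?y)"
    unfolding TD TC using norm_triangle_ineq4[of "T f" "l *\<^sub>C T ?y"] by (simp add: m_def)
  also have "\<dots> \<le> \<rho> * a + m * (\<rho> * (a / m))" using m by (intro add_mono mult_left_mono f Y') auto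
  also have "\<dots> = 2 * (\<rho> * a) / 1" using m by simp
  also have "\<dots> \<le> B * (\<rho> * a) / 1" by (rule up) (use K_pos in \<open>auto simp: B_def\<close>)
  finally show "norm (T (f - l *\<^sub>C ?y)) \<le> B * (\<rho> * a)" by simp
  have "norm (T (l *\<^sub>C Res l ?y - ?y)) \<le> m * norm (T (Res l ?y)) + norm (T ?y)"
    unfolding TD TC using norm_triangle_ineq4[of "l *\<^sub>C T (Res l ?y)" "T ?y"] by (simp add: m_def)
  also have "\<dots> \<le> m * (2 * K * (\<rho> * (a / m)) / m) + \<rho> * (a / m)"
    using m by (intro add_mono mult_left_mono ch Y') auto
  also have "\<dots> = (2 * K + 1) * (\<rho> * a) / m" using m by (simp add: field_simps)
  also have "\<dots> \<le> B * (\<rho> * a) / m" by (rule up) (use K_pos m in \<open>auto simp: B_def\<close>)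
  finally show "norm (T (l *\<^sub>C Res l ?y - ?y)) \<le> B * (\<rho> * a) / cmod l" by (simp add: m_def)
  have "norm (T (2 *\<^sub>C Res l ?y - (2 * l) *\<^sub>C Res l (Res l ?y))) \<le> 2 * norm (T (Res l ?y)) + 2 * m * norm (T (Res l (Res l ?y)))"
    unfolding TD TC using norm_triangle_ineq4[of "2 *\<^sub>C T (Res l ?y)" "(2 * l) *\<^sub>C T (Res l (Res l ?y))"]
    by (simp add: m_def norm_mult)
  also have "\<dots> \<le> 2 * (2 * K * (\<rho> * (a / m)) / m) + 2 * m * (3 * K\<^sup>2 * (\<rho> * (a / m)) / m\<^sup>2)"
    using m by (intro add_mono mult_left_mono ch) auto
  also have "\<dots> = (4 * K + 6 * K\<^sup>2) * (\<rho> * a) / m\<^sup>2" using m by (simp add: field_simps power2_eq_square)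
  also have "\<dots> \<le> B * (\<rho> * a) / m\<^sup>2" by (rule up) (use K_pos m in \<open>auto simp: B_def\<close>)
  finally show "norm (T (2 *\<^sub>C Res l ?y - (2 * l) *\<^sub>C Res l (Res l ?y))) \<le> B * (\<rho> * a) / (cmod l)\<^sup>2" by (simp add: m_def)
qed

lemma Res_bounds:
  assumes T: "loc_op T \<rho>" and f: "f \<in> L2_sigma" "norm (T f) \<le> \<rho> * norm f" and l: "sec l" "1 / t \<le> cmod l"
  shows "norm (Res l f) \<le> 2 * K * norm f / cmod l" "norm (T (Res l f)) \<le> \<rho> * (2 * K * norm f / cmod l)"
proof -
  have "K / cmod l * norm f \<le> 2 * K * norm f / cmod l" using K_pos by (simp add: divide_right_mono)
  then show "norm (Res l f) \<le> 2 * K * norm f / cmod l" using norm_Res_K[OF l(1), of f] by linarith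
  show "norm (T (Res l f)) \<le> \<rho> * (2 * K * norm f / cmod l)"
    using chain(1)[OF T l f(1) order_refl f(2)] by (simp add: mult_ac)
qed

lemma inv_le_t: "1 / t \<le> m \<Longrightarrow> 1 / m \<le> t"
  using t by (simp add: divide_simps mult.commute split: if_splits) (smt (verit) mult_less_0_iff mult_pos_neg)

lemma norm_prefactor: "norm ((1 / (2 * of_real pi * \<i>)) *\<^sub>C x) \<le> norm x"
proof -
  have "cmod (1 / (2 * of_real pi * \<i>)) = 1 / (2 * pi)" by (simp add: norm_divide norm_mult)
  also have "\<dots> \<le> 1" using pi_ge_two by simp
  finally show ?thesis unfolding norm_scaleC using mult_right_mono[of _ 1 "norm x"] by simp
qed

text \<open>Both terms are contour integrals of localised families; the point is to identify the
  integral of the defect with \<open>stokes_op\<close> of the semigroup.\<close>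

lemma semigroup_bound:
  assumes T: "loc_op T \<rho>" and f: "f \<in> L2_sigma" "norm (T f) \<le> \<rho> * norm f"
  shows "norm (T (stokes_semigroup \<mu> \<theta> t f)) + t * norm (T (stokes_op \<mu> (stokes_semigroup \<mu> \<theta> t f)))
    \<le> CC * B * (1 + 4 * K) * \<rho> * norm f"
proof -
  \<comment> \<open>\<open>b\<close> dominates the resolvents by \<open>1 / cmod l \<le> t\<close>.
    For the defect, \<open>a / cmod l\<close> dominates the resolvent and \<open>a\<close> is large
    enough to cover \<open>f\<close> itself. In the end
    \<open>b / t + a = (1 + 4 * K) * norm f\<close>.\<close>
  define a where "a = (1 + 2 * K) * norm f"
  define b where "b = t * (2 * K * norm f)"
  have ab: "a \<ge> 0" "b \<ge> 0" using K_pos t by (auto simp: a_def b_def)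
  let ?Y = "\<lambda>l. Res l f" and ?W = "\<lambda>l. f - l *\<^sub>C Res l f" and ?pre = "1 / (2 * of_real pi * \<i>) :: complex"
  have famY: "\<exists>Y1 Y2. family (\<lambda>l. T (Res l f)) Y1 Y2 (B * (\<rho> * b))"
    if T: "loc_op T \<rho>" and fT: "norm (T f) \<le> \<rho> * norm f" for T \<rho>
  proof -
    have \<rho>: "\<rho> \<ge> 0" using T by (simp add: loc_op_def)
    have "norm (Res l f) \<le> b \<and> norm (T (Res l f)) \<le> \<rho> * b" if l: "sec l" "1 / t \<le> cmod l" for l
    proof -
      have "2 * K * norm f / cmod l \<le> b"
        using mult_left_mono[OF inv_le_t[OF l(2)], of "2 * K * norm f"] K_pos by (simp add: b_def mult_ac)
      then show ?thesis
        using Res_bounds[OF T f(1) fT l] mult_left_mono[OF _ \<rho>, of "2 * K * norm f / cmod l" b] by linarith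
    qed
    from family_resolvent[OF T this ab(2)] show ?thesis by blast
  qed
  have famW: "\<exists>W1 W2. family (\<lambda>l. T (?W l)) W1 W2 (B * (\<rho> * a))"
    if T: "loc_op T \<rho>" and fT: "norm (T f) \<le> \<rho> * norm f" for T \<rho>
  proof -
    have \<rho>: "\<rho> \<ge> 0" using T by (simp add: loc_op_def)
    have "norm (Res l f) \<le> a / cmod l \<and> norm (T (Res l f)) \<le> \<rho> * (a / cmod l)" if l: "sec l" "1 / t \<le> cmod l" for l
    proof -
      have "2 * K * norm f / cmod l \<le> a / cmod l" by (intro divide_right_mono) (auto simp: a_def distrib_right)
      then show ?thesis
        using Res_bounds[OF T f(1) fT l] mult_left_mono[OF _ \<rho>, of "2 * K * norm f / cmod l" "a / cmod l"] by linarith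
    qed
    moreover have "norm (T f) \<le> \<rho> * a"
      by (rule order_trans[OF fT]) (use \<rho> K_pos in \<open>auto simp: a_def distrib_right intro!: mult_left_mono\<close>)
    ultimately show ?thesis using family_defect[OF T _ _ ab(1)] by blast
  qed
  have TL: "bounded_linear T" and TC: "\<And>a x. T (a *\<^sub>C x) = a *\<^sub>C T x" and \<rho>: "\<rho> \<ge> 0"
    using T by (auto simp: loc_op_def)
  \<comment> \<open>The identity in place of \<open>T\<close> provides the integrability needed to
    move operators under the integral; the decay comes from the localised families below.\<close>
  obtain Y1 Y2 where Y: "family ?Y Y1 Y2 (B * (1 * b))" using famY[OF loc_op_id] by auto
  obtain W1 W2 where W: "family ?W W1 W2 (B * (1 * a))" using famW[OF loc_op_id] by auto
  define S where "S = ?pre *\<^sub>C ctr ?Y"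
  \<comment> \<open>The candidate for \<open>A S\<close>, since
    \<open>A (l + A)^(-1) f = f - l (l + A)^(-1) f\<close>.\<close>
  define g where "g = ?pre *\<^sub>C ctr ?W"
  have S: "stokes_semigroup \<mu> \<theta> t f = S" by (simp add: stokes_semigroup_def S_def)
  have bS: "norm (T S) \<le> CC * (B * (\<rho> * b)) / t"
  proof -
    obtain U1 U2 where U: "family (\<lambda>l. T (Res l f)) U1 U2 (B * (\<rho> * b))" using famY[OF T f(2)] by auto
    have "T S = ?pre *\<^sub>C ctr (\<lambda>l. T (Res l f))" by (simp add: S_def TC contour_linear[OF Y TL TC])
    then show ?thesis using order_trans[OF norm_prefactor contour_bound[OF U]] by simp
  qed
  have bg: "norm (T g) \<le> CC * (B * (\<rho> * a)) / t"
  proof -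
    obtain U1 U2 where U: "family (\<lambda>l. T (?W l)) U1 U2 (B * (\<rho> * a))" using famW[OF T f(2)] by auto
    have "T g = ?pre *\<^sub>C ctr (\<lambda>l. T (?W l))" by (simp only: g_def TC contour_linear[OF W TL TC])
    then show ?thesis using order_trans[OF norm_prefactor contour_bound[OF U]] by simp
  qed
  \<comment> \<open>The projection fixes the integrand, hence the integral, so the integral is
    solenoidal.\<close>
  have hel: "helmholtz (ctr X) = ctr X" if "family X X1 X2 k" "\<And>l. sec l \<Longrightarrow> X l \<in> L2_sigma" for X X1 X2 k
    unfolding contour_linear[OF that(1) bounded_linear_helmholtz helmholtz_scaleC]
    by (rule contour_cong) (simp add: helmholtz_id that(2))
  have WL: "f - l *\<^sub>C Res l f \<in> L2_sigma" if "sec l" for l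
    by (intro subspace_diff[OF subspace_L2_sigma] f scaleC_L2_sigma resolvent_L2_sigma that)
  have SL: "S \<in> L2_sigma" unfolding S_def
    using helmholtz_in[of "ctr ?Y"] hel[OF Y resolvent_L2_sigma] by (intro scaleC_L2_sigma) simp
  have gL: "g \<in> L2_sigma" unfolding g_def
    using helmholtz_in[of "ctr ?W"] hel[OF W WL] by (intro scaleC_L2_sigma) simp
  define Q where "Q = (\<lambda>x. Res 1 (helmholtz x))"
  have Res1: "bounded_linear (Res 1)"
  proof (rule bounded_linear_intro)
    show "Res 1 (r *\<^sub>R x) = r *\<^sub>R Res 1 x" for r x
      using Res_scaleC[OF sec1, of "of_real r" x] by (simp add: L2_scaleC_of_real)
    show "norm (Res 1 x) \<le> norm x * K" for x using norm_Res_K[OF sec1, of x] by (simp add: mult.commute)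
  qed (rule Res_add[OF sec1])
  have QL: "bounded_linear Q" unfolding Q_def by (rule bounded_linear_compose[OF Res1 bounded_linear_helmholtz])
  have QC: "Q (a *\<^sub>C x) = a *\<^sub>C Q x" for a x by (simp add: Q_def helmholtz_scaleC Res_scaleC[OF sec1])
  \<comment> \<open>The resolvent identity between the reference point 1 and \<open>l\<close>:
    applying \<open>(1 + A)^(-1)\<close> to the sum of a resolvent and its image under
    \<open>A\<close> returns that resolvent. As \<open>Q\<close> is bounded, the identity can be
    integrated.\<close>
  have "ctr ?Y = ctr (\<lambda>l. Q (?Y l) + Q (?W l))"
  proof (rule contour_cong)
    fix l assume "l \<in> Collect sec"
    then have l: "sec l" by simp
    have "stokes_resolvent \<mu> 1 f 0 - stokes_resolvent \<mu> l f 0 = (l - 1) *\<^sub>C Res 1 (stokes_resolvent \<mu> l f 0)"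
      by (rule resolvent_difference[OF sec1 l])
    then have "?Y l = Res 1 (?Y l) + Res 1 (?W l)"
      by (simp add: Res_diff[OF sec1] Res_scaleC[OF sec1] L2_scaleC_diff_left algebra_simps)
    then show "?Y l = Q (?Y l) + Q (?W l)"
      by (simp add: Q_def helmholtz_id WL[OF l] resolvent_L2_sigma[OF l])
  qed
  also have "\<dots> = Q (ctr ?Y) + Q (ctr ?W)"
  proof -
    obtain k where k: "family (\<lambda>l. Q (?Y l)) (\<lambda>l. Q (Y1 l)) (\<lambda>l. Q (Y2 l)) k" using family_linear[OF Y QL QC] by blast
    obtain k' where k': "family (\<lambda>l. Q (?W l)) (\<lambda>l. Q (W1 l)) (\<lambda>l. Q (W2 l)) k'" using family_linear[OF W QL QC] by blast
    show ?thesis unfolding contour_add[OF k k'] contour_linear[OF Y QL QC] contour_linear[OF W QL QC] by (rule refl)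
  qed
  finally have "ctr ?Y = Q (ctr ?Y) + Q (ctr ?W)" .
  then have "S = Q S + Q g" unfolding S_def g_def QC L2_scaleC_add_right[symmetric] by simp
  then have SR: "S = Res 1 (S + g)" by (simp add: Q_def helmholtz_id SL gL Res_add[OF sec1])
  \<comment> \<open>In the equation at parameter 1 the two terms with \<open>S\<close> cancel, which
    leaves the weak formulation of \<open>A S = g\<close>.\<close>
  have "resolvent_solution \<mu> 1 (S + g) 0 S" using resolvent_sol[OF sec1, of "S + g" 0] SR by simp
  then have "stokes_rel \<mu> S g"
    by (simp add: resolvent_solution_iff stokes_rel_iff gL inner_add_left mat_rows_zero)
  then have op: "stokes_op \<mu> S = g" by (rule stokes_op_eq)
  have "norm (T S) + t * norm (T g) \<le> CC * (B * (\<rho> * b)) / t + t * (CC * (B * (\<rho> * a)) / t)"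
    using bS bg t by (intro add_mono mult_left_mono) auto
  also have "\<dots> = CC * B * (1 + 4 * K) * \<rho> * norm f" using t by (simp add: a_def b_def field_simps)
  finally show ?thesis unfolding S op .
qed

text \<open>The resolvent of divergence data is of order \<open>1 / sqrt (cmod l)\<close>, at most
  \<open>sqrt t\<close> on the contour, and the integral contributes \<open>1 / t\<close>; this
  explains the weight \<open>sqrt t\<close>. Only the first resolvent needs the hypothesis on
  \<open>F\<close>: its derivatives are resolvents of L2 fields, covered by
  \<open>loc_op\<close>.\<close>

lemma semigroup_div_bound:
  assumes T: "loc_op T \<rho>"
    and F: "\<And>l. sec l \<Longrightarrow> 1 / t \<le> cmod l \<Longrightarrow> sqrt (cmod l) * norm (T (stokes_resolvent \<mu> l 0 F)) \<le> \<rho> * (K * norm (mat_rows F))"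
  shows "sqrt t * norm (T (stokes_semigroup_div \<mu> \<theta> t F)) \<le> CC * B * K * \<rho> * norm (mat_rows F)"
proof -
  define a where "a = sqrt t * (K * norm (mat_rows F))"
  have a: "a \<ge> 0" using K_pos t by (simp add: a_def)
  have TL: "bounded_linear T" and TC: "\<And>a x. T (a *\<^sub>C x) = a *\<^sub>C T x" and \<rho>: "\<rho> \<ge> 0"
    using T by (auto simp: loc_op_def)
  have sq: "x \<le> sqrt t * y" if "1 / t \<le> m" "sqrt m * x \<le> y" "y \<ge> 0" for m x y
  proof -
    have m: "m > 0" using that(1) t by (meson divide_pos_pos less_le_trans zero_less_one)
    have "x \<le> y * (1 / sqrt m)" using that(2) m by (simp add: field_simps)
    also have "1 / sqrt m \<le> sqrt t" using inv_le_t[OF that(1)] by (metis real_sqrt_divide real_sqrt_le_iff real_sqrt_one)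
    then have "y * (1 / sqrt m) \<le> y * sqrt t" using that(3) by (rule mult_left_mono)
    finally show ?thesis by (simp add: mult.commute)
  qed
  have Y: "norm (stokes_resolvent \<mu> l 0 F) \<le> a" if l: "sec l" "1 / t \<le> cmod l" for l
    unfolding a_def
  proof (rule sq[OF l(2)])
    have "sqrt (cmod l) > 0" using l by (simp add: sectorial_def)
    then have "sqrt (cmod l) * norm (stokes_resolvent \<mu> l 0 F) \<le> K1 * norm (mat_rows F)"
      using norm_resolvent_div_le[OF l(1), of F] by (simp add: field_simps)
    also have "\<dots> \<le> K * norm (mat_rows F)" by (intro mult_right_mono K) simp
    finally show "sqrt (cmod l) * norm (stokes_resolvent \<mu> l 0 F) \<le> K * norm (mat_rows F)" .
  qed (use K_pos in simp)
  have TY: "norm (T (stokes_resolvent \<mu> l 0 F)) \<le> \<rho> * a" if l: "sec l" "1 / t \<le> cmod l" for l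
    using sq[OF l(2) F[OF l]] \<rho> K_pos by (simp add: a_def mult_ac)
  have fam: "\<exists>Y1 Y2. family (\<lambda>l. stokes_resolvent \<mu> l 0 F) Y1 Y2 (B * (1 * a))"
    using family_resolvent[OF loc_op_id _ a, of 0 F] Y by auto
  then obtain Y1 Y2 where f1: "family (\<lambda>l. stokes_resolvent \<mu> l 0 F) Y1 Y2 (B * (1 * a))" by blast
  have f2: "family (\<lambda>l. T (stokes_resolvent \<mu> l 0 F)) (\<lambda>l. T (- Res l (stokes_resolvent \<mu> l 0 F)))
    (\<lambda>l. T (2 *\<^sub>C Res l (Res l (stokes_resolvent \<mu> l 0 F)))) (B * (\<rho> * a))"
    by (rule family_resolvent[OF T _ a]) (use Y TY in auto)
  have "norm (T (stokes_semigroup_div \<mu> \<theta> t F)) \<le> CC * (B * (\<rho> * a)) / t"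
    unfolding stokes_semigroup_div_def TC contour_linear[OF f1 TL TC]
    by (rule order_trans[OF norm_prefactor contour_bound[OF f2]])
  then have "sqrt t * norm (T (stokes_semigroup_div \<mu> \<theta> t F)) \<le> sqrt t * (CC * (B * (\<rho> * a)) / t)"
    using t by (intro mult_left_mono) auto
  also have "\<dots> = (sqrt t * sqrt t) * (CC * B * \<rho> * K * norm (mat_rows F)) / t" by (simp add: a_def mult_ac)
  also have "\<dots> = CC * B * K * \<rho> * norm (mat_rows F)" using t by simp
  finally show ?thesis .
qed

end

locale stokes_local = stokes_contour \<mu> mlo mhi c \<kappa> \<theta> t K + stokes_cutoff \<mu> mlo mhi c \<kappa> h L
  for \<mu> :: "'n::finite coeffs" and mlo mhi c \<kappa> \<theta> t K :: real and h :: "real ^ 'n \<Rightarrow> real" and L :: real +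
  assumes K2: "K2 \<le> K"
begin

lemma D_div_sqrt_le: "1 / t \<le> m \<Longrightarrow> D / sqrt m \<le> D * sqrt t"
  using mult_left_mono[OF _ D_nonneg, of "1 / sqrt m" "sqrt t"] real_sqrt_le_mono[OF inv_le_t[of m]]
  by (simp add: real_sqrt_divide)

lemma veta_zero: "veta 0 = 0"
  by (simp add: veta_def vec_eq_iff linear_0[OF linear_eta])

text \<open>On the contour \<open>1 / sqrt (cmod l) \<le> sqrt t\<close>, which turns the gain
  \<open>D / sqrt (cmod l)\<close> into a factor independent of \<open>l\<close>.\<close>

lemma loc_op_eta: "loc_op eta (D * sqrt t)"
  unfolding loc_op_def
proof (intro conjI allI impI)
  show "bounded_linear eta" by (rule bounded_linear_eta)
  show "eta (a *\<^sub>C x) = a *\<^sub>C eta x" for a x by (rule eta_scaleC)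
  show "0 \<le> D * sqrt t" using D_nonneg t by simp
  fix l and f :: "'n vfield" assume l: "sec l" "1 / t \<le> cmod l" and f: "f \<in> L2_sigma"
  let ?s = "sqrt (cmod l)"
  have s: "?s > 0" "?s * ?s = cmod l" using l by (auto simp: sectorial_def)
  have "?s * norm (eta (Res l f)) \<le> K2 * (D / ?s * (norm f / ?s) + norm (eta f) / ?s)"
    using local_resolvent_estimate[OF l(1) f _ resolvent_sol[OF l(1)], of 0] by (simp add: mat_rows_zero veta_zero)
  also have "\<dots> \<le> K * (D * sqrt t * (norm f / ?s) + norm (eta f) / ?s)"
    using K2 K_pos s D_div_sqrt_le[OF l(2)] D_nonneg
    by (intro mult_mono add_mono mult_right_mono order_refl) auto
  also have "\<dots> = K * (D * sqrt t * norm f + norm (eta f)) / ?s" using s by (simp add: add_divide_distrib distrib_left)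
  finally have "?s * (?s * norm (eta (Res l f))) \<le> K * (D * sqrt t * norm f + norm (eta f))"
    using s by (simp add: pos_le_divide_eq mult.commute)
  then have "cmod l * norm (eta (Res l f)) \<le> K * (D * sqrt t * norm f + norm (eta f))"
    unfolding mult.assoc[symmetric] s(2) .
  moreover have "cmod l > 0" using l by (simp add: sectorial_def)
  ultimately show "norm (eta (Res l f)) \<le> K / cmod l * (D * sqrt t * norm f + norm (eta f))"
    by (simp add: field_simps)
qed

lemma eta_div_estimate:
  assumes F: "veta (mat_rows F) = 0" and l: "sec l" "1 / t \<le> cmod l"
  shows "sqrt (cmod l) * norm (eta (stokes_resolvent \<mu> l 0 F)) \<le> D * sqrt t * (K * norm (mat_rows F))"
proof -
  let ?s = "sqrt (cmod l)"
  have "?s * norm (eta (stokes_resolvent \<mu> l 0 F)) \<le> K2 * (D / ?s * norm (mat_rows F))"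
    using local_resolvent_estimate[OF l(1) _ F resolvent_sol[OF l(1)], of 0] subspace_0[OF subspace_L2_sigma]
    by (simp add: linear_0[OF linear_eta])
  also have "\<dots> \<le> K * (D * sqrt t * norm (mat_rows F))"
    using K2 K_pos D_div_sqrt_le[OF l(2)] D_nonneg by (intro mult_mono mult_right_mono) auto
  finally show ?thesis by (simp add: mult_ac)
qed

end

section \<open>Supports, cutoffs and the off-diagonal estimate\<close>

text \<open>The exceptional null set depends on the ball; Lindelof reduces the cover of
  \<open>U\<close> to countably many balls.\<close>

lemma AE_zero_off_L2_supp:
  assumes U: "open U" "U \<inter> L2_supp u = {}"
  shows "AE x in lebesgue. x \<in> U \<longrightarrow> L2_fun u x = 0"
proof -
  have "\<exists>e>0. AE y in lebesgue. y \<in> ball x e \<longrightarrow> L2_fun u y = 0" if "x \<in> U" for x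
    using U(2) that unfolding L2_supp_def by blast
  then obtain e where e: "\<And>x. x \<in> U \<Longrightarrow> e x > 0"
    "\<And>x. x \<in> U \<Longrightarrow> AE y in lebesgue. y \<in> ball x (e x) \<longrightarrow> L2_fun u y = 0"
    by metis
  obtain F where F: "F \<subseteq> (\<lambda>x. ball x (e x)) ` U" "countable F" "\<Union>F = (\<Union>x\<in>U. ball x (e x))"
    using Lindelof[of "(\<lambda>x. ball x (e x)) ` U"] by auto
  have "AE y in lebesgue. \<forall>S\<in>F. y \<in> S \<longrightarrow> L2_fun u y = 0"
    unfolding AE_ball_countable[OF F(2)] using F(1) e(2) by blast
  then show ?thesis
  proof eventually_elim
    case (elim y)
    show ?case
    proof
      assume "y \<in> U"
      then have "y \<in> \<Union>F" unfolding F(3) using e(1) by (intro UN_I[of y]) auto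
      then show "L2_fun u y = 0" using elim by blast
    qed
  qed
qed

lemma integrable_indicator_norm_L2:
  assumes "S \<in> sets lebesgue"
  shows "integrable lebesgue (\<lambda>x. indicator S x *\<^sub>R (norm (L2_fun u x))\<^sup>2)"
  by (rule integrable_mult_indicator[OF assms integrable_norm_L2])

lemma L2_norm_on_le:
  fixes v :: "('a::euclidean_space, 'c::euclidean_space) L2"
  assumes S: "S \<in> sets lebesgue" and k: "k \<ge> 0"
    and le: "AE x in lebesgue. x \<in> S \<longrightarrow> norm (L2_fun u x) \<le> k * norm (L2_fun v x)"
  shows "L2_norm_on S u \<le> k * norm v"
proof -
  have "set_lebesgue_integral lebesgue S (\<lambda>x. (norm (L2_fun u x))\<^sup>2) \<le> (\<integral>x. k\<^sup>2 * (norm (L2_fun v x))\<^sup>2 \<partial>lebesgue)"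
    unfolding set_lebesgue_integral_def
  proof (rule integral_mono_AE)
    show "AE x in lebesgue. indicator S x *\<^sub>R (norm (L2_fun u x))\<^sup>2 \<le> k\<^sup>2 * (norm (L2_fun v x))\<^sup>2"
      using le
    proof eventually_elim
      case (elim x)
      show ?case
      proof (cases "x \<in> S")
        case True
        then have "(norm (L2_fun u x))\<^sup>2 \<le> (k * norm (L2_fun v x))\<^sup>2" using elim by (intro power_mono) auto
        then show ?thesis using True by (simp add: power_mult_distrib)
      qed simp
    qed
    show "integrable lebesgue (\<lambda>x. indicator S x *\<^sub>R (norm (L2_fun u x))\<^sup>2)"
      by (rule integrable_indicator_norm_L2[OF S])
    show "integrable lebesgue (\<lambda>x. k\<^sup>2 * (norm (L2_fun v x))\<^sup>2)" using integrable_norm_L2[of v] by simp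
  qed
  also have "\<dots> = (k * norm v)\<^sup>2" by (simp add: norm_L2_square power_mult_distrib)
  finally have "L2_norm_on S u \<le> sqrt ((k * norm v)\<^sup>2)"
    unfolding L2_norm_on_def by (rule real_sqrt_le_mono)
  then show ?thesis using k by (simp add: abs_mult)
qed

lemma L2_norm_on_eq_norm:
  assumes S: "S \<in> sets lebesgue" and "AE x in lebesgue. x \<notin> S \<longrightarrow> L2_fun u x = 0"
  shows "L2_norm_on S u = norm u"
proof -
  have "set_lebesgue_integral lebesgue S (\<lambda>x. (norm (L2_fun u x))\<^sup>2) = (norm u)\<^sup>2"
    unfolding set_lebesgue_integral_def norm_L2_square
  proof (rule integral_cong_AE)
    show "(\<lambda>x. indicator S x *\<^sub>R (norm (L2_fun u x))\<^sup>2) \<in> borel_measurable lebesgue"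
      by (rule borel_measurable_integrable[OF integrable_indicator_norm_L2[OF S]])
    show "AE x in lebesgue. indicator S x *\<^sub>R (norm (L2_fun u x))\<^sup>2 = (norm (L2_fun u x))\<^sup>2"
      using assms(2) by eventually_elim (auto simp: indicator_def)
  qed measurable
  then show ?thesis by (simp add: L2_norm_on_def)
qed

text \<open>The support is confined by the closed outer ball while the norm uses the open one; the
  sphere between them is a null set.\<close>

lemma annulus_norm:
  fixes u :: "('a::euclidean_space, 'b::euclidean_space) L2"
  assumes supp: "L2_supp u \<subseteq> cball x0 R - ball x0 \<sigma>"
  shows "L2_norm_on (ball x0 R - ball x0 \<sigma>) u = norm u"
proof (rule L2_norm_on_eq_norm)
  show "ball x0 R - ball x0 \<sigma> \<in> sets lebesgue" by auto
  have "AE x in lebesgue. x \<in> - cball x0 R \<union> ball x0 \<sigma> \<longrightarrow> L2_fun u x = 0"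
    by (rule AE_zero_off_L2_supp) (use supp in auto)
  moreover have "AE x in lebesgue. x \<notin> sphere x0 R"
    using negligible_sphere[of x0 R] by (intro AE_not_in) (simp add: negligible_iff_null_sets)
  ultimately show "AE x in lebesgue. x \<notin> ball x0 R - ball x0 \<sigma> \<longrightarrow> L2_fun u x = 0"
    by eventually_elim (auto simp: not_le not_less)
qed

section \<open>The radial cutoff and the decay factor\<close>

definition bump :: "real ^ 'n::finite \<Rightarrow> real \<Rightarrow> real ^ 'n \<Rightarrow> real" where
  "bump x0 \<sigma> x = flat_exp (1 - (\<Sum>i\<in>UNIV. (x $ i - x0 $ i)\<^sup>2) / \<sigma>\<^sup>2)"

lemma dist_square_vec: "(\<Sum>i\<in>UNIV. (x $ i - x0 $ i)\<^sup>2) = (dist x0 x)\<^sup>2" for x x0 :: "real ^ 'n::finite"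
  by (simp add: dist_norm norm_minus_commute norm_vec_square[of "x - x0"])

lemma bump_off_ball:
  assumes "\<sigma> > 0" "x \<notin> ball x0 \<sigma>"
  shows "bump x0 \<sigma> x = 0"
proof -
  have "\<sigma>\<^sup>2 \<le> (dist x0 x)\<^sup>2" using assms by (intro power_mono) auto
  then show ?thesis using assms(1) by (simp add: bump_def dist_square_vec flat_exp_zero)
qed

text \<open>Within half the radius the argument of \<open>flat_exp\<close> is at least 3/4, in
  particular at least 1/2, and \<open>flat_exp (1 / 2) = exp (- 2)\<close>.\<close>

lemma bump_lower_bound:
  assumes "\<sigma> > 0" "x \<in> ball x0 r" "2 * r \<le> \<sigma>"
  shows "exp (- 2) \<le> bump x0 \<sigma> x"
proof -
  have "(dist x0 x)\<^sup>2 \<le> (\<sigma> / 2)\<^sup>2" using assms by (intro power_mono) auto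
  then have "(dist x0 x)\<^sup>2 / \<sigma>\<^sup>2 \<le> 1 / 4" using assms(1) by (simp add: power_divide divide_le_eq)
  then have "1 / 2 \<le> 1 - (dist x0 x)\<^sup>2 / \<sigma>\<^sup>2" by linarith
  then have "flat_exp (1 / 2) \<le> bump x0 \<sigma> x" unfolding bump_def dist_square_vec by (rule flat_exp_mono)
  then show ?thesis by (simp add: flat_exp_deriv_def)
qed

text \<open>The slope is the product of the bound 2 for the derivative of \<open>flat_exp\<close>
  and the bound \<open>2 / \<sigma>\<close> for a partial derivative of the quadratic inside the
  ball.\<close>

lemma cutoff_bump:
  fixes x0 :: "real ^ 'n::finite"
  assumes \<sigma>: "\<sigma> > 0"
  shows "cutoff (bump x0 \<sigma>) (4 / \<sigma>)"
proof
  define q where "q x = 1 - (\<Sum>i\<in>UNIV. (x $ i - x0 $ i)\<^sup>2) / \<sigma>\<^sup>2" for x :: "real ^ 'n"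
  have bq: "bump x0 \<sigma> = (\<lambda>x. flat_exp (q x))" by (simp add: bump_def q_def fun_eq_iff)
  have q_alt: "complex_of_real (q x) = 1 + of_real (- 1 / \<sigma>\<^sup>2) * (\<Sum>i\<in>UNIV. (of_real (x $ i) + - of_real (x0 $ i)) * (of_real (x $ i) + - of_real (x0 $ i)))" for x
    by (simp add: q_def power2_eq_square)
  have Cq: "C_k k (\<lambda>x. complex_of_real (q x))" for k
    unfolding q_alt by (intro C_k_add C_k_const C_k_mult C_k_sum finite C_k_coord)
  show test: "test_function (\<lambda>x. complex_of_real (bump x0 \<sigma> x))"
  proof (rule test_functionI[where K = "cball x0 \<sigma>"])
    show "C_k k (\<lambda>x. complex_of_real (bump x0 \<sigma> x))" for k unfolding bq by (rule C_k_flat_exp[OF Cq])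
    show "complex_of_real (bump x0 \<sigma> x) = 0" if "x \<notin> cball x0 \<sigma>" for x
      using bump_off_ball[OF \<sigma>, of x x0] that by auto
  qed simp
  show "\<bar>bump x0 \<sigma> x\<bar> \<le> 1" for x
    using flat_exp_nonneg[of "q x"] flat_exp_le_1[of "q x"] by (simp add: bq)
  show "cmod (partial_deriv i (\<lambda>x. complex_of_real (bump x0 \<sigma> x)) x) \<le> 4 / \<sigma>" for i x
  proof -
    have dq: "(q has_derivative (\<lambda>v. - (\<Sum>i\<in>UNIV. 2 * (x $ i - x0 $ i) * v $ i) / \<sigma>\<^sup>2)) (at x)"
    proof -
      have "((\<lambda>x. (x $ i - x0 $ i)\<^sup>2) has_derivative (\<lambda>v. 2 * (x $ i - x0 $ i) * v $ i)) (at x)" for i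
        by (auto intro!: derivative_eq_intros bounded_linear.has_derivative[OF bounded_linear_vec_nth])
      then have "((\<lambda>x. \<Sum>i\<in>UNIV. (x $ i - x0 $ i)\<^sup>2) has_derivative (\<lambda>v. \<Sum>i\<in>UNIV. 2 * (x $ i - x0 $ i) * v $ i)) (at x)"
        by (rule has_derivative_sum)
      from has_derivative_diff[OF has_derivative_const[of 1] bounded_linear.has_derivative[OF bounded_linear_divide[of "\<sigma>\<^sup>2"] this]]
      show ?thesis by (simp add: q_def[abs_def])
    qed
    have qd: "q differentiable at x" using dq unfolding differentiable_def by blast
    have fq: "frechet_derivative q (at x) = (\<lambda>v. - (\<Sum>i\<in>UNIV. 2 * (x $ i - x0 $ i) * v $ i) / \<sigma>\<^sup>2)"
      by (rule frechet_derivative_at[OF dq, symmetric])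
    have ax: "(\<Sum>j\<in>UNIV. 2 * (x $ j - x0 $ j) * (axis i 1 :: real ^ 'n) $ j) = 2 * (x $ i - x0 $ i)"
      by (simp add: axis_def if_distrib[of "\<lambda>z. _ * z"] sum.delta cong: if_cong)
    have "partial_deriv i (\<lambda>x. complex_of_real (bump x0 \<sigma> x)) x
        = of_real (flat_exp_deriv (Suc 0) (q x) * frechet_derivative q (at x) (axis i 1))"
      unfolding bq by (rule partial_deriv_eq[OF real_chain_has_derivative[OF flat_exp_has_derivative qd]])
    also have "frechet_derivative q (at x) (axis i 1) = - (2 * (x $ i - x0 $ i)) / \<sigma>\<^sup>2"
      unfolding fq ax by (rule refl)
    finally have "partial_deriv i (\<lambda>x. complex_of_real (bump x0 \<sigma> x)) x
        = of_real (flat_exp_deriv (Suc 0) (q x) * (- (2 * (x $ i - x0 $ i)) / \<sigma>\<^sup>2))" .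
    then have eq: "cmod (partial_deriv i (\<lambda>x. complex_of_real (bump x0 \<sigma> x)) x)
        = \<bar>flat_exp_deriv (Suc 0) (q x)\<bar> * (2 * \<bar>x $ i - x0 $ i\<bar> / \<sigma>\<^sup>2)"
      by (simp only: norm_of_real abs_mult abs_divide abs_minus_cancel abs_numeral abs_power2)
    show ?thesis
    proof (cases "x \<in> ball x0 \<sigma>")
      case True
      have "\<bar>x $ i - x0 $ i\<bar> \<le> norm (x - x0)" using component_le_norm_cart[of "x - x0" i] by simp
      also have "\<dots> \<le> \<sigma>" using True by (simp add: dist_norm norm_minus_commute)
      finally have "2 * \<bar>x $ i - x0 $ i\<bar> / \<sigma>\<^sup>2 \<le> 2 * \<sigma> / \<sigma>\<^sup>2" by (intro divide_right_mono) auto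
      also have "\<dots> = 2 / \<sigma>" using \<sigma> by (simp add: power2_eq_square)
      finally have "\<bar>flat_exp_deriv (Suc 0) (q x)\<bar> * (2 * \<bar>x $ i - x0 $ i\<bar> / \<sigma>\<^sup>2) \<le> 2 * (2 / \<sigma>)"
        by (intro mult_mono flat_exp_deriv_bound) auto
      then show ?thesis unfolding eq by simp
    next
      \<comment> \<open>The factor \<open>x - x0\<close> is unbounded here, but
        \<open>flat_exp_deriv\<close> vanishes at nonpositive arguments.\<close>
      case False
      then have "\<sigma>\<^sup>2 \<le> (dist x0 x)\<^sup>2" using \<sigma> by (intro power_mono) auto
      then have "q x \<le> 0" using \<sigma> unfolding q_def dist_square_vec by simp
      then show ?thesis unfolding eq using \<sigma> by (simp add: flat_exp_deriv_def)
    qed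
  qed
qed

text \<open>The argument yields the decay \<open>1 / sqrt X\<close>, the exponent of \<nu> = 2; as
  \<open>1 + X \<ge> 1\<close>, every smaller \<nu> gives a weaker bound. The factor 2 pays for
  replacing \<open>X\<close> by \<open>1 + X\<close>.\<close>

lemma decay_factor_le:
  fixes \<nu> X :: real
  assumes \<nu>: "0 < \<nu>" "\<nu> < 2" and X: "X > 0"
  shows "min 1 (1 / sqrt X) \<le> 2 * (1 + X) powr (- \<nu> / 4)"
proof -
  have "min 1 (1 / sqrt X) \<le> 2 / sqrt (1 + X)"
  proof (cases "X < 1")
    case True
    have "sqrt (1 + X) \<le> sqrt 4" using True by (intro real_sqrt_le_mono) simp
    then have "1 \<le> 2 / sqrt (1 + X)" using X by (simp add: pos_le_divide_eq)
    then show ?thesis by simp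
  next
    case False
    have "sqrt (1 + X) \<le> sqrt (4 * X)" using False by (intro real_sqrt_le_mono) simp
    then have "sqrt (1 + X) \<le> 2 * sqrt X" by (simp add: real_sqrt_mult)
    then have "1 / sqrt X \<le> 2 / sqrt (1 + X)" using X by (simp add: field_simps)
    then show ?thesis by simp
  qed
  also have "2 / sqrt (1 + X) = 2 * (1 + X) powr (- (1 / 2))"
  proof -
    have "(1 + X) powr (- (1 / 2)) = inverse (sqrt (1 + X))"
      unfolding powr_minus by (subst powr_half_sqrt) (use X in auto)
    then show ?thesis by (simp only: divide_inverse)
  qed
  also have "\<dots> \<le> 2 * (1 + X) powr (- \<nu> / 4)"
    using X \<nu> by (intro mult_left_mono powr_mono) auto
  finally show ?thesis .
qed

theorem corollary1p3:
  fixes mlo mhi :: real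
  assumes "CARD('n::finite) \<ge> 2" and "mlo > 0" and "mhi > 0"
  shows "\<exists>\<omega>. pi / 2 < \<omega> \<and> \<omega> < pi \<and>
    (\<forall>\<mu> :: 'n coeffs. admissible_coeffs mlo mhi \<mu> \<longrightarrow> resolvent_sector \<mu> \<omega>) \<and>
    (\<forall>\<nu>::real. 0 < \<nu> \<and> \<nu> < 2 \<longrightarrow>
      (\<exists>C>0. \<forall>\<mu> :: 'n coeffs. admissible_coeffs mlo mhi \<mu> \<longrightarrow>
        (\<forall>\<theta>. pi / 2 < \<theta> \<and> \<theta> < \<omega> \<longrightarrow>
          (\<forall>(x0 :: real ^ 'n) (r::real) (k0::nat) (t::real). r > 0 \<and> k0 \<ge> 2 \<and> t > 0 \<longrightarrow>
            (\<forall>f\<in>L2_sigma. L2_supp f \<subseteq> cball x0 (2 ^ k0 * r) - ball x0 (2 ^ (k0 - 1) * r) \<longrightarrow>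
              L2_norm_on (ball x0 r) (stokes_semigroup \<mu> \<theta> t f)
                + t * L2_norm_on (ball x0 r) (stokes_op \<mu> (stokes_semigroup \<mu> \<theta> t f))
              \<le> C * (1 + 2 ^ (2 * k0) * r\<^sup>2 / t) powr (- \<nu> / 4)
                  * L2_norm_on (ball x0 (2 ^ k0 * r) - ball x0 (2 ^ (k0 - 1) * r)) f) \<and>
            (\<forall>F :: 'n mfield. L2_supp F \<subseteq> cball x0 (2 ^ k0 * r) - ball x0 (2 ^ (k0 - 1) * r) \<longrightarrow>
              sqrt t * L2_norm_on (ball x0 r) (stokes_semigroup_div \<mu> \<theta> t F)
              \<le> C * (1 + 2 ^ (2 * k0) * r\<^sup>2 / t) powr (- \<nu> / 4)
                  * L2_norm_on (ball x0 (2 ^ k0 * r) - ball x0 (2 ^ (k0 - 1) * r)) F)))))"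
proof -
  \<comment> \<open>The constants of the locales are rebuilt from \<open>mlo\<close>,
    \<open>mhi\<close> and the dimension before any coefficient is fixed; this is what uniformity in
    \<mu> amounts to.\<close>
  define b0 where "b0 = mhi * CARD('n) ^ 4"
  define \<kappa> where "\<kappa> = mlo / (2 * b0)"
  have \<kappa>: "\<kappa> > 0" using assms by (simp add: \<kappa>_def b0_def)
  obtain \<omega> c where \<omega>: "pi / 2 < \<omega>" "\<omega> < pi" and c: "c > 0"
    and sec: "\<And>l. l \<in> open_sector \<omega> \<Longrightarrow> sectorial \<kappa> c l"
    using open_sector_sectorial[OF \<kappa>] by blast
  have SS: "stokes_sector \<mu> mlo mhi c \<kappa>" if "admissible_coeffs mlo mhi \<mu>" for \<mu> :: "'n coeffs"
  proof -
    interpret stokes_coeffs \<mu> mlo mhi using that assms by unfold_locales auto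
    show ?thesis by unfold_locales (auto simp: c \<kappa>_def b0_def stokes_coeffs.bnd_def[OF stokes_coeffs_axioms])
  qed
  have sector: "resolvent_sector \<mu> \<omega>" if "admissible_coeffs mlo mhi \<mu>" for \<mu> :: "'n coeffs"
    using stokes_sector.resolvent_unique_solution[OF SS[OF that] sec] by (auto simp: resolvent_sector_def)
  define Z c0 where "Z = 1 + \<kappa>" and "c0 = min c (mlo / 2)"
  define K1 where "K1 = Z / c0"
  \<comment> \<open>A sum, so that it majorises the global constant \<open>K1\<close> and the
    localised constant \<open>K2\<close> at once.\<close>
  define K where "K = K1 + (2 * (4 * Z * b0 * K1 + Z * b0 * K1\<^sup>2 + 3 * Z) / c0 + 1)"
  \<comment> \<open>With slope \<open>4 / \<sigma>\<close> and \<open>R = 2 * \<sigma>\<close>, the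
    factor \<open>H.D * sqrt t\<close> equals \<open>8 * CARD('n) / sqrt X\<close>.\<close>
  define N where "N = 8 * real CARD('n)"
  have pos: "Z > 0" "c0 > 0" "b0 > 0" "K1 > 0" using \<kappa> c assms by (auto simp: Z_def c0_def b0_def K1_def)
  have Kpos: "K > 0" unfolding K_def using pos by (intro add_pos_pos divide_pos_pos mult_pos_pos) auto
  define B where "B = 2 + 4 * K + 6 * K\<^sup>2"
  define C0 where "C0 = (10 + 2 * pi * exp 1) * B * (1 + 4 * K)"
  have C0: "C0 > 0" unfolding C0_def B_def using Kpos by (intro mult_pos_pos add_pos_pos) auto
  \<comment> \<open>\<open>exp 2\<close> undoes the cutoff on the small ball,
    \<open>CARD('n)\<close> comes from the rows of \<open>F\<close>, and \<open>N * 2\<close> from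
    the decay factor.\<close>
  define C where "C = exp 2 * C0 * CARD('n) * N * 2"
  have C: "C > 0" using C0 by (simp add: C_def N_def)
  have main: "(\<forall>f\<in>L2_sigma. L2_supp f \<subseteq> cball x0 (2 ^ k0 * r) - ball x0 (2 ^ (k0 - 1) * r) \<longrightarrow>
              L2_norm_on (ball x0 r) (stokes_semigroup \<mu> \<theta> t f)
                + t * L2_norm_on (ball x0 r) (stokes_op \<mu> (stokes_semigroup \<mu> \<theta> t f))
              \<le> C * (1 + 2 ^ (2 * k0) * r\<^sup>2 / t) powr (- \<nu> / 4)
                  * L2_norm_on (ball x0 (2 ^ k0 * r) - ball x0 (2 ^ (k0 - 1) * r)) f) \<and>
            (\<forall>F :: 'n mfield. L2_supp F \<subseteq> cball x0 (2 ^ k0 * r) - ball x0 (2 ^ (k0 - 1) * r) \<longrightarrow>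
              sqrt t * L2_norm_on (ball x0 r) (stokes_semigroup_div \<mu> \<theta> t F)
              \<le> C * (1 + 2 ^ (2 * k0) * r\<^sup>2 / t) powr (- \<nu> / 4)
                  * L2_norm_on (ball x0 (2 ^ k0 * r) - ball x0 (2 ^ (k0 - 1) * r)) F)"
    if \<nu>: "0 < \<nu>" "\<nu> < 2" and adm: "admissible_coeffs mlo mhi \<mu>" and \<theta>: "pi / 2 < \<theta>" "\<theta> < \<omega>"
      and r: "r > 0" and k0: "k0 \<ge> 2" and t: "t > 0"
    for \<nu> :: real and \<mu> :: "'n coeffs" and \<theta> and x0 :: "real ^ 'n" and r :: real and k0 :: nat and t :: real
  proof -
    define \<sigma> where "\<sigma> = 2 ^ (k0 - 1) * r"
    define R where "R = 2 ^ k0 * r"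
    define X where "X = 2 ^ (2 * k0) * r\<^sup>2 / t"
    have \<sigma>: "\<sigma> > 0" using r by (simp add: \<sigma>_def)
    obtain k where k: "k0 = Suc (Suc k)" using k0 by (metis add_2_eq_Suc le_Suc_ex)
    have R\<sigma>: "R = 2 * \<sigma>" by (simp add: R_def \<sigma>_def k)
    have r\<sigma>: "2 * r \<le> \<sigma>" using r by (simp add: \<sigma>_def k)
    have Xpos: "X > 0" using r t by (simp add: X_def)
    have XR: "sqrt X = R / sqrt t"
    proof -
      have "X = R\<^sup>2 / t" unfolding X_def R_def power_mult_distrib power_even_eq by (rule refl)
      moreover have "R \<ge> 0" using r by (simp add: R_def)
      ultimately show ?thesis by (simp add: real_sqrt_divide)
    qed
    \<comment> \<open>The cutoff lives inside the inner radius of the annulus, so it annihilates the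
      data, and \<open>k0 \<ge> 2\<close> gives \<open>2 * r \<le> \<sigma>\<close>, so it is
      bounded below on the small ball.\<close>
    define h where "h = bump x0 \<sigma>"
    interpret S: stokes_sector \<mu> mlo mhi c \<kappa> by (rule SS[OF adm])
    interpret H: cutoff h "4 / \<sigma>" unfolding h_def by (rule cutoff_bump[OF \<sigma>])
    interpret SC: stokes_cutoff \<mu> mlo mhi c \<kappa> h "4 / \<sigma>" by unfold_locales
    have Seq: "S.Z = Z" "S.c0 = c0" "S.K1 = K1" "S.bnd = b0"
      by (simp_all add: S.Z_def S.c0_def S.K1_def S.bnd_def Z_def c0_def K1_def b0_def)
    have K2: "SC.K2 \<le> K" "S.K1 \<le> K"
      using pos by (simp_all add: SC.K2_def Seq K_def add_nonneg_nonneg divide_nonneg_nonneg)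
    have arg: "s * cis \<phi> \<in> Collect (sectorial \<kappa> c)" if "s > 0" "\<bar>\<phi>\<bar> \<le> \<theta>" for s \<phi> :: real
    proof -
      have "- pi < \<phi>" "\<phi> \<le> pi" using that(2) \<theta> \<omega> by auto
      then have "Arg (rcis s \<phi>) = \<phi>" using that(1) by (intro Arg_rcis) auto
      then have "rcis s \<phi> \<in> open_sector \<omega>" using that \<theta> by (simp add: open_sector_def)
      then show ?thesis using sec by (simp add: rcis_def)
    qed
    have ip: "s > 0" if "1 / t \<le> s" for s using that t by (meson divide_pos_pos less_le_trans zero_less_one)
    interpret SL: stokes_local \<mu> mlo mhi c \<kappa> \<theta> t K h "4 / \<sigma>"
    proof unfold_locales
      show "pi / 2 < \<theta>" "\<theta> < pi" "0 < t" using \<theta> \<omega> t by auto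
      show "complex_of_real s * cis \<theta> \<in> Collect (sectorial \<kappa> c)" "complex_of_real s * cis (- \<theta>) \<in> Collect (sectorial \<kappa> c)"
        if "1 / t \<le> s" for s using arg[of s \<theta>] arg[of s "- \<theta>"] ip[OF that] \<theta> pi_gt_zero by auto
      show "cis \<phi> / complex_of_real t \<in> Collect (sectorial \<kappa> c)" if "\<phi> \<in> {- \<theta>..\<theta>}" for \<phi>
        using arg[of "1 / t" \<phi>] that t by auto
      show "S.K1 \<le> K" "SC.K2 \<le> K" by (rule K2)+
      show "sectorial \<kappa> c 1" using arg[of 1 0] \<theta> pi_gt_zero by auto
    qed
    have SLB: "SL.CC * SL.B * (1 + 4 * K) = C0"
      by (simp add: SL.CC_def SL.B_def C0_def B_def)
    have CBpos: "SL.CC * SL.B > 0" using SL.CC_pos SL.B_pos by simp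
    define \<rho> where "\<rho> = N * min 1 (1 / sqrt X)"
    have N1: "N \<ge> 1" "real CARD('n) \<ge> 1" using assms(1) by (auto simp: N_def)
    have \<rho>2: "\<rho> \<le> N * (2 * (1 + X) powr (- \<nu> / 4))"
      unfolding \<rho>_def using N1 by (intro mult_left_mono decay_factor_le \<nu> Xpos) auto
    \<comment> \<open>If \<open>X < 1\<close> the scale of the cutoff is shorter than
      \<open>sqrt t\<close> and localising gains nothing; the identity with factor 1 is used
      instead.\<close>
    define T where "T = (if 1 / sqrt X \<le> 1 then H.eta else (\<lambda>x. x))"
    define \<rho>' where "\<rho>' = (if 1 / sqrt X \<le> 1 then H.D * sqrt t else 1)"
    have T: "SL.loc_op T \<rho>'" using SL.loc_op_eta SL.loc_op_id by (simp add: T_def \<rho>'_def)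
    have \<rho>': "\<rho>' \<le> \<rho>" "\<rho>' \<ge> 0"
    proof -
      have "H.D * sqrt t = N * (1 / sqrt X)" unfolding XR using \<sigma> by (simp add: H.D_def N_def R\<sigma>)
      then show "\<rho>' \<le> \<rho>" using N1 by (auto simp: \<rho>'_def \<rho>_def min_def)
      show "\<rho>' \<ge> 0" using T by (simp add: SL.loc_op_def)
    qed
    have local: "L2_norm_on (ball x0 r) u \<le> exp 2 * norm (T u)" for u :: "'n vfield"
    proof (rule L2_norm_on_le)
      show "AE x in lebesgue. x \<in> ball x0 r \<longrightarrow> norm (L2_fun u x) \<le> exp 2 * norm (L2_fun (T u) x)"
      proof (cases "1 / sqrt X \<le> 1")
        case True
        then have Tu: "T u = L2_smult (\<lambda>x. of_real (h x)) u" by (simp add: T_def H.eta_def)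
        show ?thesis
          unfolding Tu using L2_fun_smult[OF H.h_props, of u]
        proof eventually_elim
          case (elim x)
          show ?case
          proof
            assume "x \<in> ball x0 r"
            then have b: "exp (- 2) \<le> h x" unfolding h_def by (rule bump_lower_bound[OF \<sigma> _ r\<sigma>])
            have "norm (L2_fun u x) = exp 2 * (exp (- 2) * norm (L2_fun u x))" by (simp add: exp_minus)
            also have "\<dots> \<le> exp 2 * (\<bar>h x\<bar> * norm (L2_fun u x))"
              using b by (intro mult_left_mono mult_right_mono) auto
            finally show "norm (L2_fun u x) \<le> exp 2 * norm (L2_fun (L2_smult (\<lambda>x. of_real (h x)) u) x)"
              unfolding elim norm_smult_vec by simp
          qed
        qed
      next
        case False
        have "norm (L2_fun u x) \<le> exp 2 * norm (L2_fun u x)" for x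
          using mult_right_mono[of 1 "exp 2" "norm (L2_fun u x)"] by simp
        then show ?thesis using False by (simp add: T_def)
      qed
    qed auto
    have T_zero: "T u = 0"
      if uz: "AE x in lebesgue. x \<in> ball x0 \<sigma> \<longrightarrow> L2_fun u x = 0" and le1: "1 / sqrt X \<le> 1" for u
    proof -
      have z: "AE x in lebesgue. L2_fun (0 :: 'n vfield) x = 0" by (rule L2_fun_zero)
      have "T u = L2_smult (\<lambda>x. of_real (h x)) u" using le1 by (simp add: T_def H.eta_def)
      also have "\<dots> = 0"
      proof (rule L2_eqI)
        show "AE x in lebesgue. L2_fun (L2_smult (\<lambda>x. of_real (h x)) u) x = L2_fun 0 x"
          using uz L2_fun_smult[OF H.h_props, of u] z
        proof eventually_elim
          case (elim x)
          then show ?case using bump_off_ball[OF \<sigma>, of x x0] by (cases "x \<in> ball x0 \<sigma>") (auto simp: h_def)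
        qed
      qed
      finally show "T u = 0" .
    qed
    have final: "exp 2 * (C0 * \<rho>' * (CARD('n) * y)) \<le> C * (1 + X) powr (- \<nu> / 4) * y" if "y \<ge> 0" for y :: real
    proof -
      have "exp 2 * (C0 * \<rho>' * (CARD('n) * y)) \<le> exp 2 * (C0 * (N * (2 * (1 + X) powr (- \<nu> / 4))) * (CARD('n) * y))"
        using order_trans[OF \<rho>'(1) \<rho>2] C0 that by (intro mult_left_mono mult_right_mono) auto
      then show ?thesis by (simp add: C_def mult_ac)
    qed
    show ?thesis
      unfolding X_def[symmetric] \<sigma>_def[symmetric] R_def[symmetric]
    proof (intro conjI ballI allI impI)
      fix f :: "'n vfield" assume f: "f \<in> L2_sigma" and supp: "L2_supp f \<subseteq> cball x0 R - ball x0 \<sigma>"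
      have "AE x in lebesgue. x \<in> ball x0 \<sigma> \<longrightarrow> L2_fun f x = 0"
        by (rule AE_zero_off_L2_supp) (use supp in auto)
      then have Tf: "norm (T f) \<le> \<rho>' * norm f"
        using T_zero[of f] \<rho>'(2) by (cases "1 / sqrt X \<le> 1") (auto simp: T_def \<rho>'_def)
      let ?u = "stokes_semigroup \<mu> \<theta> t f"
      have "L2_norm_on (ball x0 r) ?u + t * L2_norm_on (ball x0 r) (stokes_op \<mu> ?u)
          \<le> exp 2 * norm (T ?u) + t * (exp 2 * norm (T (stokes_op \<mu> ?u)))"
        using t by (intro add_mono mult_left_mono local) auto
      also have "\<dots> = exp 2 * (norm (T ?u) + t * norm (T (stokes_op \<mu> ?u)))" by (simp add: algebra_simps)
      also have "\<dots> \<le> exp 2 * (C0 * \<rho>' * norm f)"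
        using SL.semigroup_bound[OF T f Tf] unfolding SLB by (intro mult_left_mono) auto
      \<comment> \<open>The dimension factor is inserted so that both parts end in
        \<open>final\<close>.\<close>
      also have "\<dots> \<le> exp 2 * (C0 * \<rho>' * (CARD('n) * norm f))"
        using N1(2) C0 \<rho>'(2) mult_right_mono[OF N1(2), of "norm f"] by (intro mult_left_mono) auto
      also have "\<dots> \<le> C * (1 + X) powr (- \<nu> / 4) * norm f" by (rule final) simp
      finally show "L2_norm_on (ball x0 r) ?u + t * L2_norm_on (ball x0 r) (stokes_op \<mu> ?u)
          \<le> C * (1 + X) powr (- \<nu> / 4) * L2_norm_on (ball x0 R - ball x0 \<sigma>) f"
        unfolding annulus_norm[OF supp] .
    next
      fix F :: "'n mfield" assume supp: "L2_supp F \<subseteq> cball x0 R - ball x0 \<sigma>"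
      have "AE x in lebesgue. x \<in> ball x0 \<sigma> \<longrightarrow> L2_fun F x = 0"
        by (rule AE_zero_off_L2_supp) (use supp in auto)
      then have rows: "AE x in lebesgue. x \<in> ball x0 \<sigma> \<longrightarrow> L2_fun (mat_rows F $ \<alpha>) x = 0" for \<alpha>
        using L2_fun_mat_rows[of F \<alpha>] by eventually_elim simp
      have TF: "sqrt (cmod l) * norm (T (stokes_resolvent \<mu> l 0 F)) \<le> \<rho>' * (K * norm (mat_rows F))"
        if l: "sectorial \<kappa> c l" "1 / t \<le> cmod l" for l
      proof (cases "1 / sqrt X \<le> 1")
        case True
        then have "H.veta (mat_rows F) = 0"
          using T_zero[OF rows] by (simp add: H.veta_def vec_eq_iff T_def)
        from SL.eta_div_estimate[OF this l] show ?thesis using True by (simp add: T_def \<rho>'_def)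
      next
        case False
        have "sqrt (cmod l) > 0" using l by (simp add: sectorial_def)
        then have "sqrt (cmod l) * norm (stokes_resolvent \<mu> l 0 F) \<le> S.K1 * norm (mat_rows F)"
          using S.norm_resolvent_div_le[OF l(1), of F] by (simp add: field_simps)
        also have "\<dots> \<le> K * norm (mat_rows F)" by (intro mult_right_mono K2) simp
        finally show ?thesis using False by (simp add: T_def \<rho>'_def)
      qed
      let ?u = "stokes_semigroup_div \<mu> \<theta> t F"
      have "sqrt t * L2_norm_on (ball x0 r) ?u \<le> sqrt t * (exp 2 * norm (T ?u))"
        using t by (intro mult_left_mono local) auto
      also have "\<dots> = exp 2 * (sqrt t * norm (T ?u))" by simp
      also have "\<dots> \<le> exp 2 * (SL.CC * SL.B * K * \<rho>' * norm (mat_rows F))"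
        by (intro mult_left_mono SL.semigroup_div_bound[OF T TF]) auto
      also have "\<dots> \<le> exp 2 * (C0 * \<rho>' * (CARD('n) * norm F))"
      proof (intro mult_left_mono mult_mono norm_mat_rows_le)
        show "SL.CC * SL.B * K \<le> C0" unfolding SLB[symmetric] using CBpos Kpos by (intro mult_left_mono) auto
      qed (use C0 \<rho>'(2) in auto)
      also have "\<dots> \<le> C * (1 + X) powr (- \<nu> / 4) * norm F" by (rule final) simp
      finally show "sqrt t * L2_norm_on (ball x0 r) ?u
          \<le> C * (1 + X) powr (- \<nu> / 4) * L2_norm_on (ball x0 R - ball x0 \<sigma>) F"
        unfolding annulus_norm[OF supp] .
    qed
  qed
  show ?thesis
    using \<omega> sector C main by (intro exI[of _ \<omega>] conjI allI impI exI[of _ C]) auto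
qed

end
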